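(* For every polynomial $t_1$ there exists a polynomial $t_2$ such that the following holds. For all strings $a,b$ of length at most $n$ such that $C^{t_1(n),\infty}(a|b)\le k$, there exists a string $p$ of length $k+O(\log^3 n)$ such that \begin{itemize} \item $C^{t_2(n),\infty}(p|a)=O(\log^3 n)$ and \item $\mathrm{CAM}^{t_2(n)}(a|b,p)=O(\log^3 n)$. \end{itemize}
   Context: $C^{t,s}(a|b)$ is conditional Kolmogorov complexity with time bound $t$ and space bound $s$ (length of a shortest $x$ such that a fixed optimal description method produces $a$ from $x$ and $b$ in at most $t$ steps and space at most $s$; $s=\infty$ means no space bound). Arthur–Merlin complexity: let $U_n$ be a non-deterministic universal Turing machine; $\mathrm{CAM}^{t}(x|y)$ is the length of a shortest string $p$ such that (1) $\mathrm{Prob}_r[U_n(y,p,r)$ accepts, and all accepting paths return $x]>2/3$, and (2) $U_n(y,p,r)$ stops in at most time $t$ on all branches of the non-deterministic computation. *)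

theory Defs
  imports
    "HOL-Probability.Probability"
    "HOL-Computational_Algebra.Polynomial"
    "HOL-Library.Discrete_Functions"
    "HOL-Library.Landau_Symbols"
    "HOL-Library.Extended_Nat"
begin

text \<open>
  Multitape Turing machines, in general non-deterministic. Symbols and states are natural numbers;
  finiteness of the machine is finiteness of its transition table. Symbol 0 is the blank, 1 and 2
  are the bits; state 0 is initial and state 1 is accepting. A table entry \<open>(q, rs, q', as)\<close>
  means: in state \<open>q\<close>, reading \<open>rs ! j\<close> on tape \<open>j\<close>, the machine may go to \<open>q'\<close> and,
  on every tape \<open>j\<close> with \<open>as ! j = (w, d)\<close>, write \<open>w\<close> and move its head by \<open>d\<close>.
  A configuration without successor is a halting one.
\<close>

record ntm =
  work_tapes :: nat
  trans :: "(nat \<times> nat list \<times> nat \<times> (nat \<times> int) list) set"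

text \<open>Machines with \<open>m\<close> read-only input tapes, which come first; the last work tape is the
  output tape.\<close>

definition is_ntm :: "nat \<Rightarrow> ntm \<Rightarrow> bool" where
  "is_ntm m M \<longleftrightarrow> work_tapes M \<ge> 1 \<and> finite (trans M) \<and>
     (\<forall>(q, rs, q', as) \<in> trans M.
        q \<noteq> 1 \<and>
        length rs = m + work_tapes M \<and> length as = m + work_tapes M \<and>
        snd ` set as \<subseteq> {-1, 0, 1} \<and>
        (\<forall>j<m. fst (as ! j) = rs ! j))"

definition deterministic :: "ntm \<Rightarrow> bool" where
  "deterministic M \<longleftrightarrow>
     (\<forall>q rs u v. (q, rs, u) \<in> trans M \<and> (q, rs, v) \<in> trans M \<longrightarrow> u = v)"

text \<open>A tape is its contents together with the position of the head on it.\<close>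

type_synonym tape = "(int \<Rightarrow> nat) \<times> int"
type_synonym conf = "nat \<times> tape list"

definition step :: "ntm \<Rightarrow> conf \<Rightarrow> conf \<Rightarrow> bool" where
  "step M c c' \<longleftrightarrow>
     (\<exists>as. (fst c, map (\<lambda>(T, h). T h) (snd c), fst c', as) \<in> trans M \<and>
           snd c' = map2 (\<lambda>(T, h) (w, d). (T(h := w), h + d)) (snd c) as)"

definition tape_of :: "bool list \<Rightarrow> int \<Rightarrow> nat" where
  "tape_of x i =
     (if 0 \<le> i \<and> i < int (length x) then (if x ! nat i then 2 else 1) else 0)"

definition init_conf :: "ntm \<Rightarrow> bool list list \<Rightarrow> conf" where
  "init_conf M ins =
     (0, map (\<lambda>x. (tape_of x, 0)) ins @ replicate (work_tapes M) (tape_of [], 0))"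

text \<open>The output is the string of bits on the output tape, from cell 0 up to the first cell not
  containing a bit.\<close>

definition out_string :: "conf \<Rightarrow> bool list" where
  "out_string c = (let T = fst (last (snd c)) in
     map (\<lambda>i. T (int i) = 2) [0..<(LEAST i. T (int i) \<notin> {1, 2})])"

text \<open>Strings returned by the accepting paths.\<close>

definition results :: "ntm \<Rightarrow> bool list list \<Rightarrow> bool list set" where
  "results M ins =
     {out_string c | c i. (step M ^^ i) (init_conf M ins) c \<and> fst c = 1}"

definition halts_within :: "ntm \<Rightarrow> bool list list \<Rightarrow> nat \<Rightarrow> bool" where
  "halts_within M ins t \<longleftrightarrow> (\<forall>i c. (step M ^^ i) (init_conf M ins) c \<longrightarrow> i \<le> t)"

text \<open>Total number of cells scanned on all tapes. Only meant for halting computations of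
  deterministic machines, where the reachable configurations are those of the only path.\<close>

definition space_used :: "ntm \<Rightarrow> bool list list \<Rightarrow> nat" where
  "space_used M ins =
     (\<Sum>j < length ins + work_tapes M.
        card {snd (snd c ! j) | c. (step M)\<^sup>*\<^sup>* (init_conf M ins) c})"

definition produces ::
  "ntm \<Rightarrow> bool list list \<Rightarrow> bool list \<Rightarrow> nat \<Rightarrow> enat \<Rightarrow> bool" where
  "produces M ins z t s \<longleftrightarrow>
     (\<exists>i c. (step M ^^ i) (init_conf M ins) c \<and> i \<le> t \<and> fst c = 1 \<and> out_string c = z) \<and>
     enat (space_used M ins) \<le> s"

text \<open>\<open>KC \<phi> t s a b\<close> is the complexity of \<open>a\<close> given \<open>b\<close> with description method
  \<open>\<phi>\<close>, time bound \<open>t\<close> and space bound \<open>s\<close>; it is infinite if there is no description.\<close>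

definition KC :: "ntm \<Rightarrow> nat \<Rightarrow> enat \<Rightarrow> bool list \<Rightarrow> bool list \<Rightarrow> enat" where
  "KC \<phi> t s a b = Inf {enat (length x) | x. produces \<phi> [x, b] a t s}"

definition description_method :: "ntm \<Rightarrow> bool" where
  "description_method \<phi> \<longleftrightarrow> is_ntm 2 \<phi> \<and> deterministic \<phi>"

text \<open>Optimality in the sense of the invariance theorem for resource-bounded complexity (Li and
  Vitanyi): time overhead \<open>c t log t\<close> and space overhead \<open>c s\<close>. The added constants only
  matter for very small \<open>t\<close> and \<open>s\<close>.\<close>

definition optimal :: "ntm \<Rightarrow> bool" where
  "optimal \<phi> \<longleftrightarrow> description_method \<phi> \<and>
     (\<forall>\<psi>. description_method \<psi> \<longrightarrow>
        (\<exists>c. \<forall>t s a b.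
           KC \<phi> (c * t * floor_log t + c) (enat c * s + enat c) a b \<le> KC \<psi> t s a b + enat c))"

text \<open>Universality of a non-deterministic machine with inputs (condition, program, random bits):
  up to a constant increase of the program length, it simulates every other such machine, with the
  same strings returned on accepting paths and the standard time overhead.\<close>

definition universal :: "ntm \<Rightarrow> bool" where
  "universal U \<longleftrightarrow> is_ntm 3 U \<and>
     (\<forall>N. is_ntm 3 N \<longrightarrow>
        (\<exists>c. \<forall>p. \<exists>q. length q \<le> length p + c \<and>
           (\<forall>y r. results U [y, q, r] = results N [y, p, r] \<and>
              (\<forall>t. halts_within N [y, p, r] t \<longrightarrow>
                   halts_within U [y, q, r] (c * t * floor_log t + c)))))"

text \<open>Arthur-Merlin complexity of \<open>x\<close> given \<open>y\<close>. A computation of at most \<open>t\<close> steps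
  scans at most the first \<open>t\<close> random bits, so \<open>r\<close> is uniform among the strings of
  length \<open>t\<close>.\<close>

definition CAM :: "ntm \<Rightarrow> nat \<Rightarrow> bool list \<Rightarrow> bool list \<Rightarrow> enat" where
  "CAM U t x y = Inf {enat (length p) | p.
     measure_pmf.prob (pmf_of_set {r. length r = t})
       {r. results U [y, p, r] \<noteq> {} \<and> (\<forall>z \<in> results U [y, p, r]. z = x)} > 2 / 3 \<and>
     (\<forall>r. length r = t \<longrightarrow> halts_within U [y, p, r] t)}"

text \<open>Encoding of a pair of strings: the bits of the first one doubled, a delimiter, the second
  one.\<close>

definition pair :: "bool list \<Rightarrow> bool list \<Rightarrow> bool list" where
  "pair x y = concat (map (\<lambda>b. [b, b]) x) @ [False, True] @ y"

text \<open>The time bound at \<open>n\<close> given by a polynomial. Steps are whole numbers, so rounding down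
  loses nothing.\<close>

definition bound :: "real poly \<Rightarrow> nat \<Rightarrow> nat" where
  "bound t n = nat \<lfloor>poly t (real n)\<rfloor>"

end

theory Submission
  imports Defs "HOL-Number_Theory.Prime_Powers"
begin

text \<open>
  Let \<open>B\<close> be the set of all \<open>m\<close>-bit outputs of Trevisan's generator (a list-decodable code composed
  with a Nisan--Wigderson design) on \<open>d\<close>-bit seeds and strings of complexity at most \<open>k\<close> given \<open>b\<close>. For
  \<open>m\<close> slightly above \<open>k + d\<close> this set is sparse, but it contains every output on \<open>a\<close>. The hybrid
  argument yields an index and a fixing of the seed such that, given the code bits \<open>p\<close> of \<open>a\<close> queried by
  the earlier outputs, membership in \<open>B\<close> predicts the code of \<open>a\<close>. Weak designs keep the number of these
  bits below \<open>m\<close> with \<open>d = O(log\<^sup>3 n)\<close>. By the Johnson bound few strings agree with \<open>p\<close> and are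
  predicted equally well, and a short Reed--Solomon fingerprint separates \<open>a\<close> from them. Membership in
  \<open>B\<close> is certified by a description and a seed, so Merlin can send a string with certificates for random
  samples, and Arthur accepts it if many samples fall into \<open>B\<close>.

  Machines are obtained by compiling a small imperative language; its values are binary trees kept on
  stacks, and the functions computable in polynomial time are closed under bounded folds. The description
  method is simulated with every tape as a zipper, padded on the left by the number of steps.
\<close>


section \<open>Structured programs and their Turing machines\<close>

text \<open>The verifier is one-sided: Merlin can certify membership in \<open>B\<close>, never its
  absence. So the predictor is used only through lower bounds on counts: for \<open>a\<close> many
  hybrid samples lie in \<open>B\<close>, while for a string outside the short list, most likely,
  too few do, whatever is sent. As accepting paths may return nothing but \<open>a\<close>, this
  must hold for all wrong strings and the same random bits at once; hence sampling errors below
  \<open>2 ^ (- n)\<close> and a union bound. Nothing nonuniform has to be computed. The prime, the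
  columns of the design, the hybrid index, the seed, the fingerprint point and the threshold are
  only shown to exist; they are written, with O(log^3 n) bits, into an advice that is the program of
  both machines. The cube comes from the seed: O(log n) blocks, each with O(log n) coordinates
  choosing among O(log n) cells. The time bound depends on \<open>n\<close> alone although
  \<open>k\<close> is arbitrary. Therefore \<open>B\<close> contains outputs on short strings
  themselves as well as on the strings they describe: for \<open>k > n\<close> the string
  \<open>a\<close> is its own description, and \<open>p\<close> has at most \<open>min k n\<close>
  bits plus O(log^3 n).\<close>

datatype prog = Mv nat int | Wr nat nat | Gs nat | Skip | Fail
  | Sq prog prog | If nat nat prog prog | Wh nat nat prog

definition reads :: "tape list \<Rightarrow> nat list" where
  "reads ts = map (\<lambda>(T, h). T h) ts"

definition stay :: "nat list \<Rightarrow> (nat \<times> int) list" where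
  "stay rs = map (\<lambda>s. (s, 0)) rs"

definition act :: "tape list \<Rightarrow> (nat \<times> int) list \<Rightarrow> tape list" where
  "act ts as = map2 (\<lambda>(T, h) (w, d). (T(h := w), h + d)) ts as"

text \<open>One machine step of a continuation, that is, of the list of programs still to be run. The
  continuations themselves serve as machine states.\<close>

fun delta :: "prog list \<Rightarrow> nat list \<Rightarrow> (prog list \<times> (nat \<times> int) list) set" where
  "delta [] rs = {}"
| "delta (Mv j d # K) rs = {(K, (stay rs)[j := (rs ! j, d)])}"
| "delta (Wr j w # K) rs = {(K, (stay rs)[j := (w, 0)])}"
| "delta (Gs j # K) rs = {(K, (stay rs)[j := (1, 0)]), (K, (stay rs)[j := (2, 0)])}"
| "delta (Skip # K) rs = {(K, stay rs)}"
| "delta (Fail # K) rs = {}"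
| "delta (Sq a b # K) rs = {(a # b # K, stay rs)}"
| "delta (If j s a b # K) rs = {((if rs ! j = s then a else b) # K, stay rs)}"
| "delta (Wh j s a # K) rs = {(if rs ! j = s then K else a # Wh j s a # K, stay rs)}"

definition good :: "nat \<Rightarrow> tape list \<Rightarrow> bool" where
  "good W ts \<longleftrightarrow> length ts = W \<and> set (reads ts) \<subseteq> {..2}"

text \<open>The restriction \<open>good\<close> mirrors the finite transition table: only tuples of
  the symbols \<open>0\<close>, \<open>1\<close>, \<open>2\<close> on exactly \<open>W\<close> tapes
  have entries.\<close>

definition sstep :: "nat \<Rightarrow> prog list \<times> tape list \<Rightarrow> prog list \<times> tape list \<Rightarrow> bool" where
  "sstep W c c' \<longleftrightarrow> good W (snd c) \<and>
     (\<exists>as. (fst c', as) \<in> delta (fst c) (reads (snd c)) \<and> snd c' = act (snd c) as)"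

text \<open>The continuations that can arise while \<open>c\<close> runs in front of
  \<open>K\<close>. There are finitely many, since a loop puts itself back in front of the unchanged
  \<open>K\<close>. Note that \<open>Wh j s a\<close> repeats \<open>a\<close> until tape
  \<open>j\<close> reads \<open>s\<close>, and that \<open>Fail\<close> blocks in a non-accepting
  state.\<close>

fun sts :: "prog \<Rightarrow> prog list \<Rightarrow> prog list set" where
  "sts (Sq a b) K = insert (Sq a b # K) (sts a (b # K) \<union> sts b K)"
| "sts (If j s a b) K = insert (If j s a b # K) (sts a K \<union> sts b K)"
| "sts (Wh j s a) K = insert (Wh j s a # K) (sts a (Wh j s a # K))"
| "sts c K = {c # K}"

fun wf_prog :: "nat \<Rightarrow> prog \<Rightarrow> bool" where
  "wf_prog m (Mv j d) \<longleftrightarrow> d \<in> {-1, 0, 1}"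
| "wf_prog m (Wr j w) \<longleftrightarrow> m \<le> j"
| "wf_prog m (Gs j) \<longleftrightarrow> m \<le> j"
| "wf_prog m (Sq a b) \<longleftrightarrow> wf_prog m a \<and> wf_prog m b"
| "wf_prog m (If j s a b) \<longleftrightarrow> wf_prog m a \<and> wf_prog m b"
| "wf_prog m (Wh j s a) \<longleftrightarrow> wf_prog m a"
| "wf_prog m c \<longleftrightarrow> True"

fun det_prog :: "prog \<Rightarrow> bool" where
  "det_prog (Gs j) \<longleftrightarrow> False"
| "det_prog (Sq a b) \<longleftrightarrow> det_prog a \<and> det_prog b"
| "det_prog (If j s a b) \<longleftrightarrow> det_prog a \<and> det_prog b"
| "det_prog (Wh j s a) \<longleftrightarrow> det_prog a"
| "det_prog c \<longleftrightarrow> True"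

lemma finite_sts: "finite (sts c K)"
  by (induction c arbitrary: K) auto

lemma self_in_sts: "c # K \<in> sts c K"
  by (cases c) auto

lemma delta_sts_closed:
  "K1 \<in> sts c K \<Longrightarrow> (K2, as) \<in> delta K1 rs \<Longrightarrow> K2 \<in> insert K (sts c K)"
proof (induction c arbitrary: K K1)
  case (Sq a b)
  consider "K1 = Sq a b # K" | "K1 \<in> sts a (b # K)" | "K1 \<in> sts b K" using Sq.prems(1) by auto
  then show ?case
  proof cases
    case 1
    then show ?thesis using Sq.prems(2) self_in_sts[of a "b # K"] by auto
  next
    case 2
    then show ?thesis using Sq.IH(1)[OF 2 Sq.prems(2)] self_in_sts[of b K] by auto
  next
    case 3
    then show ?thesis using Sq.IH(2)[OF 3 Sq.prems(2)] by auto
  qed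
next
  case (If j s a b)
  consider "K1 = If j s a b # K" | "K1 \<in> sts a K" | "K1 \<in> sts b K" using If.prems(1) by auto
  then show ?case
  proof cases
    case 1
    then show ?thesis using If.prems(2) self_in_sts[of a K] self_in_sts[of b K] by auto
  next
    case 2
    then show ?thesis using If.IH(1)[OF 2 If.prems(2)] by auto
  next
    case 3
    then show ?thesis using If.IH(2)[OF 3 If.prems(2)] by auto
  qed
next
  case (Wh j s a)
  consider "K1 = Wh j s a # K" | "K1 \<in> sts a (Wh j s a # K)" using Wh.prems(1) by auto
  then show ?case
  proof cases
    case 1
    then show ?thesis using Wh.prems(2) self_in_sts[of a "Wh j s a # K"] by (auto split: if_splits)
  next
    case 2
    then show ?thesis using Wh.IH[OF 2 Wh.prems(2)] by auto
  qed
qed auto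

text \<open>Transfers a syntactic property of a program, such as \<open>wf_prog m\<close> or
  \<open>det_prog\<close>, to every continuation that serves as a state.\<close>

lemma sts_inherit:
  assumes "\<And>a b. Q (Sq a b) \<Longrightarrow> Q a \<and> Q b" "\<And>j s a b. Q (If j s a b) \<Longrightarrow> Q a \<and> Q b"
    "\<And>j s a. Q (Wh j s a) \<Longrightarrow> Q a"
  shows "K1 \<in> sts c K \<Longrightarrow> Q c \<Longrightarrow> \<forall>d\<in>set K. Q d \<Longrightarrow> \<forall>d\<in>set K1. Q d"
proof (induction c arbitrary: K K1)
  case (Sq a b)
  from assms(1)[OF Sq.prems(2)] have "Q a" "Q b" by auto
  with Sq.prems Sq.IH(1)[of K1 "b # K"] Sq.IH(2)[of K1 K] show ?case by auto
next
  case (If j s a b)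
  from assms(2)[OF If.prems(2)] have "Q a" "Q b" by auto
  with If.prems If.IH(1)[of K1 K] If.IH(2)[of K1 K] show ?case by auto
next
  case (Wh j s a)
  from assms(3)[OF Wh.prems(2)] have "Q a" by auto
  with Wh.prems Wh.IH[of K1 "Wh j s a # K"] show ?case by auto
qed auto

definition cont_set :: "prog \<Rightarrow> prog list set" where
  "cont_set c = insert [] (sts c [])"

text \<open>The continuations are numbered so that the whole program is the initial state
  \<open>0\<close> and the empty continuation, its end, is the accepting state
  \<open>1\<close>.\<close>

definition numb :: "prog \<Rightarrow> prog list \<Rightarrow> nat" where
  "numb c = (SOME f. inj_on f (cont_set c) \<and> f [c] = 0 \<and> f [] = 1)"

lemma numb: "inj_on (numb c) (cont_set c)" "numb c [c] = 0" "numb c [] = 1"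
proof -
  have "finite (cont_set c)" by (simp add: cont_set_def finite_sts)
  then obtain g :: "prog list \<Rightarrow> nat" where g: "inj_on g (cont_set c)"
    using finite_imp_inj_to_nat_seg by metis
  define f where "f K = (if K = [c] then 0 else if K = [] then 1 else g K + 2)" for K
  have "inj_on f (cont_set c) \<and> f [c] = 0 \<and> f [] = 1"
    using g by (auto simp: inj_on_def f_def)
  then have "\<exists>f. inj_on f (cont_set c) \<and> f [c] = 0 \<and> f [] = (1::nat)" by blast
  from someI_ex[OF this] show "inj_on (numb c) (cont_set c)" "numb c [c] = 0" "numb c [] = 1"
    unfolding numb_def by auto
qed

text \<open>The five work tapes are four stacks and the output tape.\<close>

definition machine :: "nat \<Rightarrow> prog \<Rightarrow> ntm" where
  "machine m c = \<lparr>work_tapes = 5, trans = {(numb c K, rs, numb c K', as) | K rs K' as.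
     K \<in> cont_set c \<and> length rs = m + 5 \<and> set rs \<subseteq> {..2} \<and> (K', as) \<in> delta K rs}\<rparr>"

lemma cont_set_closed: "K \<in> cont_set c \<Longrightarrow> (K', as) \<in> delta K rs \<Longrightarrow> K' \<in> cont_set c"
  using delta_sts_closed[of K c "[]"] by (auto simp: cont_set_def)

lemma finite_delta: "finite (delta K rs)"
  by (cases "(K, rs)" rule: delta.cases) auto

lemma stay_nth: "j < length rs \<Longrightarrow> stay rs ! j = (rs ! j, 0)"
  by (simp add: stay_def)

lemma length_stay [simp]: "length (stay rs) = length rs"
  by (simp add: stay_def)

lemma delta_valid:
  assumes "(K', as) \<in> delta K rs" "\<forall>d\<in>set K. wf_prog m d" "m \<le> length rs"
  shows "length as = length rs \<and> snd ` set as \<subseteq> {-1, 0, 1} \<and> (\<forall>j<m. fst (as ! j) = rs ! j)"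
proof -
  define ok where "ok as \<longleftrightarrow> length as = length rs \<and> snd ` set as \<subseteq> {-1, 0, 1} \<and>
    (\<forall>j<m. fst (as ! j) = rs ! j)" for as :: "(nat \<times> int) list"
  have st: "ok (stay rs)" using assms(3) by (auto simp: ok_def stay_def)
  have upd: "ok ((stay rs)[i := (w, d)])" if "d \<in> {-1, 0, 1}" "w = rs ! i \<or> m \<le> i" for i w d
  proof -
    have "snd ` set ((stay rs)[i := (w, d)]) \<subseteq> insert d (snd ` set (stay rs))"
      using set_update_subset_insert[of "stay rs" i "(w, d)"] by auto
    moreover have "fst ((stay rs)[i := (w, d)] ! j) = rs ! j" if "j < m" for j
      using that \<open>w = rs ! i \<or> m \<le> i\<close> assms(3) by (cases "i = j") (auto simp: stay_nth)
    ultimately show ?thesis using st that(1) by (auto simp: ok_def)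
  qed
  have "ok as"
    using assms(1,2) by (cases "(K, rs)" rule: delta.cases) (auto intro: st upd)
  then show ?thesis by (simp add: ok_def)
qed

lemma is_ntm_machine:
  assumes "wf_prog m c"
  shows "is_ntm m (machine m c)"
proof -
  let ?R = "{rs. set rs \<subseteq> {..2::nat} \<and> length rs = m + 5}"
  let ?S = "SIGMA K : cont_set c. SIGMA rs : ?R. delta K rs"
  have "trans (machine m c) = (\<lambda>(K, rs, K', as). (numb c K, rs, numb c K', as)) ` ?S"
    by (force simp: machine_def image_iff)
  moreover have "finite ?S"
    by (intro finite_SigmaI finite_delta finite_lists_length_eq) (simp_all add: cont_set_def finite_sts)
  ultimately have fin: "finite (trans (machine m c))" by simp
  have wfK: "\<forall>d\<in>set K. wf_prog m d" if "K \<in> cont_set c" for K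
  proof (cases "K = []")
    case False
    then have "K \<in> sts c []" using that by (simp add: cont_set_def)
    show ?thesis by (rule sts_inherit[of "wf_prog m", OF _ _ _ \<open>K \<in> sts c []\<close>]) (simp_all add: assms)
  qed simp
  have ne1: "numb c K \<noteq> 1" if "K \<in> cont_set c" "x \<in> delta K rs" for K x rs
  proof
    assume "numb c K = 1"
    then have "K = []" using numb(1,3)[of c] that(1)
      by (metis cont_set_def inj_on_eq_iff insertI1)
    then show False using that by simp
  qed
  show ?thesis unfolding is_ntm_def
  proof (intro conjI fin)
    show "1 \<le> work_tapes (machine m c)" by (simp add: machine_def)
    show "\<forall>(q, rs, q', as)\<in>trans (machine m c). q \<noteq> 1 \<and> length rs = m + work_tapes (machine m c) \<and>
        length as = m + work_tapes (machine m c) \<and> snd ` set as \<subseteq> {-1, 0, 1} \<and>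
        (\<forall>j<m. fst (as ! j) = rs ! j)"
    proof clarify
      fix q rs q' as
      assume "(q, rs, q', as) \<in> trans (machine m c)"
      then obtain K K' where *: "q = numb c K" "K \<in> cont_set c" "length rs = m + 5"
        "(K', as) \<in> delta K rs"
        by (auto simp: machine_def)
      show "q \<noteq> 1 \<and> length rs = m + work_tapes (machine m c) \<and>
        length as = m + work_tapes (machine m c) \<and> snd ` set as \<subseteq> {-1, 0, 1} \<and>
        (\<forall>j<m. fst (as ! j) = rs ! j)"
        using * ne1 delta_valid[OF *(4) wfK[OF *(2)]] by (auto simp: machine_def)
    qed
  qed
qed

lemma deterministic_machine:
  assumes "det_prog c"
  shows "deterministic (machine m c)"
proof -
  have dK: "\<forall>d\<in>set K. det_prog d" if "K \<in> cont_set c" for K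
  proof (cases "K = []")
    case False
    then have "K \<in> sts c []" using that by (simp add: cont_set_def)
    show ?thesis by (rule sts_inherit[of det_prog, OF _ _ _ \<open>K \<in> sts c []\<close>]) (simp_all add: assms)
  qed simp
  have un: "x = y" if "K \<in> cont_set c" "x \<in> delta K rs" "y \<in> delta K rs" for K rs x y
    using dK[OF that(1)] that(2,3) by (cases "(K, rs)" rule: delta.cases) auto
  show ?thesis unfolding deterministic_def
  proof (intro allI impI)
    fix q rs u v
    assume "(q, rs, u) \<in> trans (machine m c) \<and> (q, rs, v) \<in> trans (machine m c)"
    then have 1: "(q, rs, u) \<in> trans (machine m c)" and 2: "(q, rs, v) \<in> trans (machine m c)" by auto
    obtain K K' as where K: "q = numb c K" "K \<in> cont_set c" "(K', as) \<in> delta K rs"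
      "u = (numb c K', as)" using 1 by (auto simp: machine_def)
    obtain L L' bs where L: "q = numb c L" "L \<in> cont_set c" "(L', bs) \<in> delta L rs"
      "v = (numb c L', bs)" using 2 by (auto simp: machine_def)
    note * = K L
    then have "K = L" using numb(1)[of c] by (metis inj_on_eq_iff)
    with * un[of K "(K', as)" rs "(L', bs)"] show "u = v" by auto
  qed
qed

lemma step_machine:
  assumes "K \<in> cont_set c"
  shows "step (machine m c) (numb c K, ts) C \<longleftrightarrow>
    (\<exists>K' ts'. C = (numb c K', ts') \<and> K' \<in> cont_set c \<and> length ts = m + 5 \<and> sstep (m + 5) (K, ts) (K', ts'))"
    (is "?l \<longleftrightarrow> ?r")
proof
  assume ?l
  then obtain as where as: "(numb c K, reads ts, fst C, as) \<in> trans (machine m c)" "snd C = act ts as"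
    by (auto simp: step_def reads_def act_def)
  then obtain L K' where L: "numb c K = numb c L" "L \<in> cont_set c" "fst C = numb c K'"
    "length (reads ts) = m + 5" "set (reads ts) \<subseteq> {..2}" "(K', as) \<in> delta L (reads ts)"
    by (auto simp: machine_def)
  then have "L = K" using numb(1)[of c] assms by (metis inj_on_eq_iff)
  with L as show ?r
    by (intro exI[of _ K'] exI[of _ "act ts as"])
      (auto simp: sstep_def good_def reads_def prod_eq_iff intro: cont_set_closed)
next
  assume ?r
  then show ?l using assms
    by (force simp: step_def machine_def sstep_def good_def reads_def act_def)
qed

text \<open>Steps correspond one to one, so step counts carry over exactly to the machine.\<close>

lemma relpow_step_machine:
  "(step (machine m c) ^^ i) (0, ts) C \<longleftrightarrow>
    (\<exists>K' ts'. C = (numb c K', ts') \<and> K' \<in> cont_set c \<and> (sstep (m + 5) ^^ i) ([c], ts) (K', ts'))"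
proof (induction i arbitrary: C)
  case 0
  have "[c] \<in> cont_set c" by (simp add: cont_set_def self_in_sts)
  then show ?case using numb(2)[of c] by (auto simp: eq_OO)
next
  case (Suc i)
  have "(step (machine m c) ^^ Suc i) (0, ts) C \<longleftrightarrow>
     (\<exists>K1 ts1. K1 \<in> cont_set c \<and> (sstep (m + 5) ^^ i) ([c], ts) (K1, ts1) \<and>
        step (machine m c) (numb c K1, ts1) C)"
    using Suc.IH by (auto simp: OO_def)
  also have "\<dots> \<longleftrightarrow> (\<exists>K' ts'. C = (numb c K', ts') \<and> K' \<in> cont_set c \<and>
      (sstep (m + 5) ^^ Suc i) ([c], ts) (K', ts'))" (is "?a \<longleftrightarrow> ?b")
  proof
    assume ?a
    then show ?b by (auto simp: step_machine OO_def) blast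
  next
    assume ?b
    then obtain K' ts' K1 ts1 where *: "C = (numb c K', ts')" "K' \<in> cont_set c"
      "(sstep (m + 5) ^^ i) ([c], ts) (K1, ts1)" "sstep (m + 5) (K1, ts1) (K', ts')"
      by (auto simp: OO_def)
    have inv: "(sstep (m + 5) ^^ i) ([c], ts) (K1, ts1) \<Longrightarrow> K1 \<in> cont_set c" for i K1 ts1
    proof (induction i arbitrary: K1 ts1)
      case 0
      then show ?case by (auto simp: cont_set_def self_in_sts)
    next
      case (Suc i)
      then show ?case by (auto simp: OO_def sstep_def intro: cont_set_closed)
    qed
    have "length ts1 = m + 5" using *(4) by (simp add: sstep_def good_def)
    with * inv[OF *(3)] show ?a
      by (intro exI[of _ K1] exI[of _ ts1]) (auto simp: step_machine)
  qed
  finally show ?case .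
qed

section \<open>Deterministic runs\<close>

text \<open>Each step must be the only possible one, so a run found here describes all paths at
  once; this is what lets deterministic pieces be used inside a non-deterministic program.\<close>

inductive dr :: "nat \<Rightarrow> nat \<Rightarrow> prog list \<times> tape list \<Rightarrow> prog list \<times> tape list \<Rightarrow> bool" for W where
  dr_0: "dr W 0 c c"
| dr_Suc: "(\<And>d. sstep W c d \<longleftrightarrow> d = c1) \<Longrightarrow> dr W t c1 c' \<Longrightarrow> dr W (Suc t) c c'"

lemma dr_trans: "dr W s a b \<Longrightarrow> dr W t b c \<Longrightarrow> dr W (s + t) a c"
  by (induction rule: dr.induct) (auto intro: dr.intros)

lemma dr_relpow: "dr W t a b \<Longrightarrow> (sstep W ^^ t) a b"
proof (induction rule: dr.induct)
  case (dr_Suc c c1 t c')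
  then show ?case by (intro relpowp_Suc_I2[of _ c c1]) auto
qed simp

text \<open>The quantifier over the continuation makes the statement composable; \<open>t\<close> is
  only an upper bound on the time.\<close>

definition run :: "nat \<Rightarrow> prog \<Rightarrow> tape list \<Rightarrow> tape list \<Rightarrow> nat \<Rightarrow> bool" where
  "run W c ts ts' t \<longleftrightarrow> (\<forall>K. \<exists>i\<le>t. dr W i (c # K, ts) (K, ts'))"

lemma run_mono: "run W c a b s \<Longrightarrow> s \<le> t \<Longrightarrow> run W c a b t"
  unfolding run_def using le_trans by blast

lemma act_update:
  assumes "j < length ts"
  shows "act ts ((stay (reads ts))[j := (w, d)]) = ts[j := ((fst (ts ! j))(snd (ts ! j) := w), snd (ts ! j) + d)]"
  using assms by (intro nth_equalityI)
    (auto simp: act_def stay_def reads_def nth_list_update case_prod_beta)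

lemma act_stay: "act ts (stay (reads ts)) = ts"
  by (intro nth_equalityI) (auto simp: act_def stay_def reads_def case_prod_beta)

lemma dr_1:
  assumes "good W ts" "delta K (reads ts) = {(K', as)}" "act ts as = ts'"
  shows "dr W (Suc 0) (K, ts) (K', ts')"
  by (rule dr_Suc[OF _ dr_0]) (use assms in \<open>auto simp: sstep_def prod_eq_iff\<close>)

lemma run_Mv:
  "good W ts \<Longrightarrow> j < W \<Longrightarrow> run W (Mv j d) ts (ts[j := (fst (ts ! j), snd (ts ! j) + d)]) 1"
  unfolding run_def
  by (intro allI exI[of _ "Suc 0"] conjI dr_1)
    (auto simp: act_update good_def, auto simp: reads_def case_prod_beta)

lemma run_Wr:
  "good W ts \<Longrightarrow> j < W \<Longrightarrow> run W (Wr j w) ts (ts[j := ((fst (ts ! j))(snd (ts ! j) := w), snd (ts ! j))]) 1"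
  unfolding run_def
  by (intro allI exI[of _ "Suc 0"] conjI dr_1) (auto simp: act_update good_def)

lemma run_Skip: "good W ts \<Longrightarrow> run W Skip ts ts 1"
  unfolding run_def
  by (intro allI exI[of _ "Suc 0"] conjI dr_1) (auto simp: act_stay)

lemma run_Sq:
  assumes "good W a" "run W c1 a b t1" "run W c2 b c t2"
  shows "run W (Sq c1 c2) a c (t1 + t2 + 1)"
  unfolding run_def
proof
  fix K
  obtain i where i: "i \<le> t1" "dr W i (c1 # c2 # K, a) (c2 # K, b)" using assms(2) by (auto simp: run_def)
  obtain j where j: "j \<le> t2" "dr W j (c2 # K, b) (K, c)" using assms(3) by (auto simp: run_def)
  have "dr W (Suc 0) (Sq c1 c2 # K, a) (c1 # c2 # K, a)"
    by (rule dr_1[OF assms(1)]) (auto simp: act_stay)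
  from dr_trans[OF dr_trans[OF this i(2)] j(2)] i j
  show "\<exists>i\<le>t1 + t2 + 1. dr W i (Sq c1 c2 # K, a) (K, c)" by (intro exI conjI) auto
qed

lemma run_If:
  assumes "good W a" "run W (if reads a ! j = s then c1 else c2) a b t"
  shows "run W (If j s c1 c2) a b (t + 1)"
  unfolding run_def
proof
  fix K
  obtain i where i: "i \<le> t" "dr W i ((if reads a ! j = s then c1 else c2) # K, a) (K, b)"
    using assms(2) by (auto simp: run_def)
  have "dr W (Suc 0) (If j s c1 c2 # K, a) ((if reads a ! j = s then c1 else c2) # K, a)"
    by (rule dr_1[OF assms(1)]) (auto simp: act_stay)
  from dr_trans[OF this i(2)] i
  show "\<exists>i\<le>t + 1. dr W i (If j s c1 c2 # K, a) (K, b)" by (intro exI conjI) auto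
qed

lemma run_Wh_end: "good W a \<Longrightarrow> reads a ! j = s \<Longrightarrow> run W (Wh j s c) a a 1"
  unfolding run_def
  by (intro allI exI[of _ "Suc 0"] conjI dr_1) (auto simp: act_stay)

lemma dr_Wh_step:
  assumes "good W a" "reads a ! j \<noteq> s" "run W c a b t"
  shows "\<exists>i\<le>t + 1. dr W i (Wh j s c # K, a) (Wh j s c # K, b)"
proof -
  obtain i where i: "i \<le> t" "dr W i (c # Wh j s c # K, a) (Wh j s c # K, b)"
    using assms(3) by (auto simp: run_def)
  have "dr W (Suc 0) (Wh j s c # K, a) (c # Wh j s c # K, a)"
    by (rule dr_1[OF assms(1)]) (use assms(2) in \<open>auto simp: act_stay\<close>)
  from dr_trans[OF this i(2)] i show ?thesis by (intro exI conjI) auto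
qed

lemma run_Wh_step:
  assumes "good W a" "reads a ! j \<noteq> s" "run W c a b t" "run W (Wh j s c) b d t'"
  shows "run W (Wh j s c) a d (t + t' + 1)"
  unfolding run_def
proof
  fix K
  obtain i where i: "i \<le> t + 1" "dr W i (Wh j s c # K, a) (Wh j s c # K, b)"
    using dr_Wh_step[OF assms(1-3)] by blast
  obtain k where k: "k \<le> t'" "dr W k (Wh j s c # K, b) (K, d)"
    using assms(4) by (auto simp: run_def)
  from dr_trans[OF i(2) k(2)] i k
  show "\<exists>i\<le>t + t' + 1. dr W i (Wh j s c # K, a) (K, d)" by (intro exI conjI) auto
qed

section \<open>Stacks on tapes\<close>

definition sym :: "bool \<Rightarrow> nat" where "sym b = (if b then 2 else 1)"

text \<open>The top of the stack is the cell under the head. Cell \<open>0\<close> stays blank, so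
  reading \<open>0\<close> means that the stack is empty.\<close>

definition stk :: "bool list \<Rightarrow> tape" where
  "stk s = (\<lambda>i. if 1 \<le> i \<and> i \<le> int (length s) then sym (s ! (length s - nat i)) else 0, int (length s))"

definition otp :: "bool list \<Rightarrow> tape" where "otp x = (tape_of x, int (length x))"

definition itp :: "bool list \<times> int \<Rightarrow> tape" where "itp x = (tape_of (fst x), snd x)"

definition TP :: "(bool list \<times> int) list \<Rightarrow> bool list list \<Rightarrow> bool list \<Rightarrow> tape list" where
  "TP is ss out = map itp is @ map stk ss @ [otp out]"

definition top_sym :: "bool list \<Rightarrow> nat" where
  "top_sym s = (case s of [] \<Rightarrow> 0 | b # _ \<Rightarrow> sym b)"

lemma sym_le [simp]: "sym b \<le> 2" by (simp add: sym_def)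

lemma sym_simps [simp]: "sym b \<noteq> 0" "sym True = 2" "sym False = 1" "sym b = 2 \<longleftrightarrow> b" "sym b = 1 \<longleftrightarrow> \<not> b"
  "sym b = Suc 0 \<longleftrightarrow> \<not> b"
  by (auto simp: sym_def)

lemma top_sym_simps [simp]: "top_sym [] = 0" "top_sym (b # s) = sym b"
  by (auto simp: top_sym_def)

lemma stk_top: "fst (stk s) (snd (stk s)) = top_sym s"
  by (cases s) (auto simp: stk_def)

lemma stk_push: "((fst (stk s))(snd (stk s) + 1 := sym b), snd (stk s) + 1) = stk (b # s)"
  by (auto simp: stk_def fun_eq_iff nth_Cons Suc_diff_le split: nat.splits)

lemma stk_pop: "((fst (stk (b # s)))(snd (stk (b # s)) := 0), snd (stk (b # s)) - 1) = stk s"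
  by (auto simp: stk_def fun_eq_iff nth_Cons Suc_diff_le split: nat.splits)

lemma stk_bound: "fst (stk s) i \<le> 2" by (simp add: stk_def)

lemma tape_of_bound: "tape_of s i \<le> 2" by (simp add: tape_of_def)

lemma otp_write: "((fst (otp x))(snd (otp x) := sym b), snd (otp x) + 1) = otp (x @ [b])"
  by (auto simp: otp_def tape_of_def fun_eq_iff sym_def nth_append)

lemma good_all: "length ts = W \<Longrightarrow> (\<And>t i. t \<in> set ts \<Longrightarrow> fst t i \<le> 2) \<Longrightarrow> good W ts"
  by (auto simp: good_def reads_def) 

lemma length_TP [simp]: "length (TP is ss out) = length is + length ss + 1"
  by (simp add: TP_def)

lemma TP_bound: "t \<in> set (TP is ss out) \<Longrightarrow> fst t i \<le> 2"
  by (auto simp: TP_def itp_def otp_def stk_bound tape_of_bound)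

lemma good_TP: "length is + length ss + 1 = W \<Longrightarrow> good W (TP is ss out)"
  by (rule good_all) (auto simp: TP_bound)

lemma TP_nth_stack: "i < length ss \<Longrightarrow> TP is ss out ! (length is + i) = stk (ss ! i)"
  by (simp add: TP_def nth_append)

lemma TP_upd_stack: "i < length ss \<Longrightarrow> (TP is ss out)[length is + i := stk s] = TP is (ss[i := s]) out"
  by (simp add: TP_def list_update_append map_update)

lemma reads_TP_stack: "i < length ss \<Longrightarrow> reads (TP is ss out) ! (length is + i) = top_sym (ss ! i)"
  by (simp add: reads_def TP_nth_stack case_prod_beta stk_top)

definition psh :: "nat \<Rightarrow> nat \<Rightarrow> bool \<Rightarrow> prog" where
  "psh m i b = Sq (Mv (m + i) 1) (Wr (m + i) (sym b))"

definition pop :: "nat \<Rightarrow> nat \<Rightarrow> prog" where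
  "pop m i = Sq (Wr (m + i) 0) (Mv (m + i) (-1))"

lemma wf_det_psh_pop [simp]: "wf_prog m (psh m i b)" "wf_prog m (pop m i)" "det_prog (psh m i b)" "det_prog (pop m i)"
  by (auto simp: psh_def pop_def)

lemma good_upd:
  assumes "length ts = W" "\<And>t i. t \<in> set ts \<Longrightarrow> fst t i \<le> 2" "\<And>i. fst u i \<le> 2"
  shows "good W (ts[j := u])"
  using assms set_update_subset_insert[of ts j u] by (intro good_all) (auto dest!: subsetD)

lemma run_psh:
  assumes "length is = m" "length ss = 4" "i < 4"
  shows "run (m + 5) (psh m i b) (TP is ss out) (TP is (ss[i := b # ss ! i]) out) 3"
proof -
  let ?t = "TP is ss out" and ?j = "m + i"
  let ?t1 = "?t[?j := (fst (?t ! ?j), snd (?t ! ?j) + 1)]"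
  have len: "?j < length ?t" "length ?t = m + 5" using assms by auto
  have nth: "?t ! ?j = stk (ss ! i)" using assms TP_nth_stack[of i ss "is"] by simp
  have g1: "good (m + 5) ?t1"
    by (rule good_upd) (use assms TP_bound nth stk_bound in auto)
  have e: "?t1[?j := ((fst (?t1 ! ?j))(snd (?t1 ! ?j) := sym b), snd (?t1 ! ?j))] = TP is (ss[i := b # ss ! i]) out"
    using assms len nth stk_push[of "ss ! i" b] TP_upd_stack[of i ss "is" out "b # ss ! i"] by simp
  have "run (m + 5) (psh m i b) ?t (?t1[?j := ((fst (?t1 ! ?j))(snd (?t1 ! ?j) := sym b), snd (?t1 ! ?j))]) (1 + 1 + 1)"
    unfolding psh_def
    by (rule run_Sq[OF _ run_Mv run_Wr]) (use assms g1 len in \<open>auto intro: good_TP\<close>)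
  then show ?thesis using e by (auto elim: run_mono)
qed

lemma run_pop:
  assumes "length is = m" "length ss = 4" "i < 4" "ss ! i \<noteq> []"
  shows "run (m + 5) (pop m i) (TP is ss out) (TP is (ss[i := tl (ss ! i)]) out) 3"
proof -
  let ?t = "TP is ss out" and ?j = "m + i"
  let ?t1 = "?t[?j := ((fst (?t ! ?j))(snd (?t ! ?j) := 0), snd (?t ! ?j))]"
  have len: "?j < length ?t" "length ?t = m + 5" using assms by auto
  have nth: "?t ! ?j = stk (ss ! i)" using assms TP_nth_stack[of i ss "is"] by simp
  have g1: "good (m + 5) ?t1"
    by (rule good_upd) (use assms TP_bound nth stk_bound in auto)
  have e: "?t1[?j := (fst (?t1 ! ?j), snd (?t1 ! ?j) + (-1))] = TP is (ss[i := tl (ss ! i)]) out"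
    using assms len nth stk_pop[of "hd (ss ! i)" "tl (ss ! i)"] TP_upd_stack[of i ss "is" out "tl (ss ! i)"]
    by simp
  have "run (m + 5) (pop m i) ?t (?t1[?j := (fst (?t1 ! ?j), snd (?t1 ! ?j) + (-1))]) (1 + 1 + 1)"
    unfolding pop_def
    by (rule run_Sq[OF _ run_Wr run_Mv]) (use assms g1 len in \<open>auto intro: good_TP\<close>)
  then show ?thesis using e by (auto elim: run_mono)
qed

section \<open>Trees on the stacks\<close>

datatype tree = Lf | Nd tree tree

text \<open>Preorder, hence self-delimiting: trees can be stacked without separators, and the first
  bit tells a leaf from a node.\<close>

fun code :: "tree \<Rightarrow> bool list" where
  "code Lf = [False]"
| "code (Nd a b) = True # code a @ code b"

lemma code_len: "length (code t) \<ge> 1" by (cases t) auto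

lemma code_ne [simp]: "code t \<noteq> []" by (cases t) auto

definition grab_body :: "nat \<Rightarrow> nat \<Rightarrow> prog" where
  "grab_body m i = If (m + i) 2 (Sq (pop m i) (Sq (psh m 3 True) (psh m 2 True)))
      (Sq (pop m i) (Sq (psh m 3 False) (pop m 2)))"

definition grab :: "nat \<Rightarrow> nat \<Rightarrow> prog" where
  "grab m i = Sq (psh m 2 True) (Wh (m + 2) 0 (grab_body m i))"

text \<open>Stack \<open>3\<close> holds a code with its last bit on top, so pushing the bits back
  one by one restores their order.\<close>

definition drain :: "nat \<Rightarrow> prog \<Rightarrow> prog \<Rightarrow> prog" where
  "drain m a b = Wh (m + 3) 0 (If (m + 3) 2 (Sq (pop m 3) a) (Sq (pop m 3) b))"

lemma wf_det_grab [simp]: "wf_prog m (grab m i)" "det_prog (grab m i)"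
  by (auto simp: grab_def grab_body_def)

lemma wf_det_drain [simp]: "wf_prog m (drain m a b) \<longleftrightarrow> wf_prog m a \<and> wf_prog m b"
  "det_prog (drain m a b) \<longleftrightarrow> det_prog a \<and> det_prog b"
  by (auto simp: drain_def)

lemma run_SqTP:
  assumes "run (m + 5) c1 (TP is ss out) b t1" "run (m + 5) c2 b c t2" "length is = m" "length ss = 4"
  shows "run (m + 5) (Sq c1 c2) (TP is ss out) c (t1 + t2 + 1)"
  by (rule run_Sq) (use assms in \<open>auto intro: good_TP\<close>)

lemma run_IfTP:
  assumes "run (m + 5) (if top_sym (ss ! i) = s then c1 else c2) (TP is ss out) b t"
    "length is = m" "length ss = 4" "i < 4"
  shows "run (m + 5) (If (m + i) s c1 c2) (TP is ss out) b (t + 1)"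
  by (rule run_If) (use assms reads_TP_stack[of i ss "is" out] in \<open>auto intro: good_TP\<close>)

lemma grab_body_True:
  assumes "length is = m" "i < 2" "length ss = 4" "ss ! i = True # rest"
  shows "run (m + 5) (grab_body m i) (TP is ss out)
     (TP is (ss[i := rest, 3 := True # ss ! 3, 2 := True # ss ! 2]) out) 12"
proof -
  let ?s1 = "ss[i := rest]" let ?s2 = "?s1[3 := True # ss ! 3]"
  have 1: "run (m + 5) (pop m i) (TP is ss out) (TP is ?s1 out) 3"
    using run_pop[of "is" m ss i] assms by simp
  have 2: "run (m + 5) (psh m 3 True) (TP is ?s1 out) (TP is ?s2 out) 3"
    using run_psh[of "is" m ?s1 3 True] assms by simp
  have 3: "run (m + 5) (psh m 2 True) (TP is ?s2 out) (TP is (?s2[2 := True # ss ! 2]) out) 3"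
    using run_psh[of "is" m ?s2 2 True] assms by simp
  show ?thesis unfolding grab_body_def
    by (rule run_mono[OF run_IfTP], simp add: assms, rule run_SqTP[OF 1 run_SqTP[OF 2 3]])
      (use assms in auto)
qed

lemma grab_body_False:
  assumes "length is = m" "i < 2" "length ss = 4" "ss ! i = False # rest" "ss ! 2 \<noteq> []"
  shows "run (m + 5) (grab_body m i) (TP is ss out)
     (TP is (ss[i := rest, 3 := False # ss ! 3, 2 := tl (ss ! 2)]) out) 12"
proof -
  let ?s1 = "ss[i := rest]" let ?s2 = "?s1[3 := False # ss ! 3]"
  have 1: "run (m + 5) (pop m i) (TP is ss out) (TP is ?s1 out) 3"
    using run_pop[of "is" m ss i] assms by simp
  have 2: "run (m + 5) (psh m 3 False) (TP is ?s1 out) (TP is ?s2 out) 3"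
    using run_psh[of "is" m ?s1 3 False] assms by simp
  have 3: "run (m + 5) (pop m 2) (TP is ?s2 out) (TP is (?s2[2 := tl (ss ! 2)]) out) 3"
    using run_pop[of "is" m ?s2 2] assms by simp
  show ?thesis unfolding grab_body_def
    by (rule run_mono[OF run_IfTP], simp add: assms, rule run_SqTP[OF 1 run_SqTP[OF 2 3]])
      (use assms in auto)
qed

text \<open>Stack 2 counts the subtrees that are still to be read.\<close>

lemma grab_loop:
  assumes "length is = m" "i < 2" "length ss = 4" "ss ! i = code t @ rest" "ss ! 2 = True # cs"
  shows "\<exists>k\<le>13 * length (code t).
     dr (m + 5) k (Wh (m + 2) 0 (grab_body m i) # K, TP is ss out)
      (Wh (m + 2) 0 (grab_body m i) # K, TP is (ss[i := rest, 2 := cs, 3 := rev (code t) @ ss ! 3]) out)"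
  using assms(3-)
proof (induction t arbitrary: ss rest cs)
  case Lf
  have r: "reads (TP is ss out) ! (m + 2) \<noteq> 0"
    using reads_TP_stack[of 2 ss "is" out] assms(1) Lf by simp
  have g: "good (m + 5) (TP is ss out)" using Lf assms by (auto intro: good_TP)
  have e: "ss[i := rest, 3 := False # ss ! 3, 2 := cs] = ss[i := rest, 2 := cs, 3 := False # ss ! 3]"
    by (simp add: list_update_swap)
  from dr_Wh_step[OF g r grab_body_False[OF assms(1,2) Lf(1)], of rest K] Lf e
  show ?case by auto
next
  case (Nd a b)
  have r: "reads (TP is ss out) ! (m + 2) \<noteq> 0"
    using reads_TP_stack[of 2 ss "is" out] assms(1) Nd.prems by simp
  have g: "good (m + 5) (TP is ss out)" using Nd.prems assms by (auto intro: good_TP)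
  let ?s1 = "ss[i := code a @ code b @ rest, 3 := True # ss ! 3, 2 := True # ss ! 2]"
  let ?s2 = "?s1[i := code b @ rest, 2 := True # cs, 3 := rev (code a) @ ?s1 ! 3]"
  let ?s3 = "?s2[i := rest, 2 := cs, 3 := rev (code b) @ ?s2 ! 3]"
  let ?w = "Wh (m + 2) 0 (grab_body m i)"
  from dr_Wh_step[OF g r grab_body_True[OF assms(1,2) Nd.prems(1)], of "code a @ code b @ rest" K] Nd.prems
  obtain k1 where 1: "k1 \<le> 13" "dr (m + 5) k1 (?w # K, TP is ss out) (?w # K, TP is ?s1 out)"
    by auto
  obtain k2 where 2: "k2 \<le> 13 * length (code a)" "dr (m + 5) k2 (?w # K, TP is ?s1 out) (?w # K, TP is ?s2 out)"
    using Nd.IH(1)[of ?s1 "code b @ rest" "True # cs"] Nd.prems assms(2) by auto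
  obtain k3 where 3: "k3 \<le> 13 * length (code b)" "dr (m + 5) k3 (?w # K, TP is ?s2 out) (?w # K, TP is ?s3 out)"
    using Nd.IH(2)[of ?s2 rest cs] Nd.prems assms(2) by auto
  have e: "?s3 = ss[i := rest, 2 := cs, 3 := rev (code (Nd a b)) @ ss ! 3]"
    using Nd.prems assms(2) by (intro nth_equalityI) (auto simp: nth_list_update)
  from dr_trans[OF dr_trans[OF 1(2) 2(2)] 3(2)] 1 2 3 e show ?case
    by (intro exI[of _ "k1 + k2 + k3"]) auto
qed

lemma run_grab:
  assumes "length is = m" "i < 2" "ss = [s0, s1, [], []]" "ss ! i = code t @ rest"
  shows "run (m + 5) (grab m i) (TP is ss out) (TP is (ss[i := rest, 3 := rev (code t)]) out) (18 * length (code t))"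
proof -
  let ?w = "Wh (m + 2) 0 (grab_body m i)"
  let ?s1 = "ss[2 := [True]]" let ?s2 = "ss[i := rest, 3 := rev (code t)]"
  have 1: "run (m + 5) (psh m 2 True) (TP is ss out) (TP is ?s1 out) 3"
    using run_psh[of "is" m ss 2 True] assms by (simp add: numeral_2_eq_2)
  have e: "?s1[i := rest, 2 := [], 3 := rev (code t) @ ?s1 ! 3] = ?s2"
    using assms by (intro nth_equalityI) (auto simp: nth_list_update nth_Cons split: nat.splits)
  have h: "length ?s1 = 4" "?s1 ! i = code t @ rest" "?s1 ! 2 = True # []"
    using assms by (auto simp: less_2_cases_iff)
  have l2: "length ?s2 = 4" "?s2 ! 2 = []" using assms by (auto simp: less_2_cases_iff)
  have gr: "good (m + 5) (TP is ?s2 out)" "reads (TP is ?s2 out) ! (m + 2) = 0"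
    using reads_TP_stack[of 2 ?s2 "is" out] l2 assms(1) by (simp_all add: good_TP)
  have "run (m + 5) ?w (TP is ?s1 out) (TP is ?s2 out) (13 * length (code t) + 1)"
    unfolding run_def
  proof
    fix K
    obtain k where k: "k \<le> 13 * length (code t)"
     "dr (m + 5) k (?w # K, TP is ?s1 out) (?w # K, TP is ?s2 out)"
      using grab_loop[OF assms(1,2) h, of K out] unfolding e by blast
    have "run (m + 5) ?w (TP is ?s2 out) (TP is ?s2 out) 1"
      by (rule run_Wh_end[OF gr])
    then obtain k' where k': "k' \<le> 1" "dr (m + 5) k' (?w # K, TP is ?s2 out) (K, TP is ?s2 out)"
      by (auto simp: run_def)
    from dr_trans[OF k(2) k'(2)] k k'
    show "\<exists>i\<le>13 * length (code t) + 1. dr (m + 5) i (?w # K, TP is ?s1 out) (K, TP is ?s2 out)"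
      by (intro exI conjI) auto
  qed
  from run_SqTP[OF 1 this] assms have "run (m + 5) (grab m i) (TP is ss out) (TP is ?s2 out)
     (3 + (13 * length (code t) + 1) + 1)" by (simp add: grab_def)
  then show ?thesis by (rule run_mono) (use code_len[of t] in simp)
qed

text \<open>Stacks \<open>0\<close> and \<open>1\<close> are abstracted to the first two entries of
  a list \<open>s\<close>, on which \<open>f\<close> is the effect of the program run for one
  bit.\<close>

lemma run_drain:
  assumes "length is = m"
    "\<And>b z s. run (m + 5) (if b then ca else cb) (TP is [s ! 0, s ! 1, [], z] out) (TP is [f b s ! 0, f b s ! 1, [], z] out) t"
  shows "run (m + 5) (drain m ca cb) (TP is [s ! 0, s ! 1, [], z] out)
     (TP is [fold f z s ! 0, fold f z s ! 1, [], []] out) ((t + 6) * length z + 1)"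
proof (induction z arbitrary: s)
  case Nil
  have "run (m + 5) (drain m ca cb) (TP is [s ! 0, s ! 1, [], []] out) (TP is [s ! 0, s ! 1, [], []] out) 1"
    unfolding drain_def by (rule run_Wh_end)
      (use assms reads_TP_stack[of 3 "[s ! 0, s ! 1, [], []]" "is" out] in \<open>auto intro!: good_TP\<close>)
  then show ?case by simp
next
  case (Cons b z)
  let ?S = "TP is [s ! 0, s ! 1, [], b # z] out"
  let ?S1 = "TP is [s ! 0, s ! 1, [], z] out"
  let ?S2 = "TP is [f b s ! 0, f b s ! 1, [], z] out"
  have p: "run (m + 5) (pop m 3) ?S ?S1 3"
    using run_pop[of "is" m "[s ! 0, s ! 1, [], b # z]" 3 out] assms(1) by simp
  have bd: "run (m + 5) (Sq (pop m 3) (if b then ca else cb)) ?S ?S2 (3 + t + 1)"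
    by (rule run_SqTP[OF p assms(2)]) (use assms(1) in auto)
  have "run (m + 5) (If (m + 3) 2 (Sq (pop m 3) ca) (Sq (pop m 3) cb)) ?S ?S2 (3 + t + 1 + 1)"
    by (rule run_IfTP) (use bd assms(1) in \<open>auto split: if_splits\<close>)
  from run_Wh_step[OF _ _ this Cons.IH[of "f b s", folded drain_def, unfolded drain_def]]
  have "run (m + 5) (drain m ca cb) ?S (TP is [fold f (b # z) s ! 0, fold f (b # z) s ! 1, [], []] out)
     (3 + t + 1 + 1 + ((t + 6) * length z + 1) + 1)"
    using assms(1) reads_TP_stack[of 3 "[s ! 0, s ! 1, [], b # z]" "is" out]
    by (auto simp: drain_def good_TP sym_def)
  then show ?case by (rule run_mono) simp
qed

definition to_aux :: "nat \<Rightarrow> prog" where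
  "to_aux m = Sq (grab m 0) (drain m (psh m 1 True) (psh m 1 False))"
definition from_aux :: "nat \<Rightarrow> prog" where
  "from_aux m = Sq (grab m 1) (drain m (psh m 0 True) (psh m 0 False))"
definition drop_top :: "nat \<Rightarrow> prog" where
  "drop_top m = Sq (grab m 0) (drain m Skip Skip)"
definition dup :: "nat \<Rightarrow> prog" where
  "dup m = Sq (grab m 0) (Sq (drain m (Sq (psh m 0 True) (psh m 1 True)) (Sq (psh m 0 False) (psh m 1 False)))
     (from_aux m))"

lemma wf_det_moves [simp]: "wf_prog m (to_aux m)" "det_prog (to_aux m)" "wf_prog m (from_aux m)" "det_prog (from_aux m)"
  "wf_prog m (drop_top m)" "det_prog (drop_top m)" "wf_prog m (dup m)" "det_prog (dup m)"
  by (auto simp: to_aux_def from_aux_def drop_top_def dup_def)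

lemma fold_push2: "fold (\<lambda>b s. [b # s ! 0, b # s ! 1]) z [x, y :: bool list] = [rev z @ x, rev z @ y]"
  by (induction z arbitrary: x y) auto

lemma drain_to:
  assumes "length is = m" "i < 2"
  shows "run (m + 5) (drain m (psh m i True) (psh m i False)) (TP is [x, y, [], z] out)
     (TP is ([x, y, [], []][i := rev z @ [x, y] ! i]) out) (9 * length z + 1)"
proof -
  have st: "run (m + 5) (if b then psh m i True else psh m i False) (TP is [s ! 0, s ! 1, [], z] out)
      (TP is [(s[i := b # s ! i]) ! 0, (s[i := b # s ! i]) ! 1, [], z] out) 3" if "length s = 2" for b z s
    using run_psh[of "is" m "[s ! 0, s ! 1, [], z]" i b out] assms that
    by (auto simp: less_2_cases_iff split: if_splits)
  have "run (m + 5) (drain m (psh m i True) (psh m i False)) (TP is [[x, y] ! 0, [x, y] ! 1, [], z] out)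
     (TP is [fold (\<lambda>b s. [s ! 0, s ! 1][i := b # s ! i]) z [x, y] ! 0,
       fold (\<lambda>b s. [s ! 0, s ! 1][i := b # s ! i]) z [x, y] ! 1, [], []] out) ((3 + 6) * length z + 1)"
  proof (rule run_drain[OF assms(1)])
    fix b z s
    show "run (m + 5) (if b then psh m i True else psh m i False) (TP is [s ! 0, s ! 1, [], z] out)
      (TP is [([s ! 0, s ! 1][i := b # s ! i]) ! 0, ([s ! 0, s ! 1][i := b # s ! i]) ! 1, [], z] out) 3"
      using st[of "[s ! 0, s ! 1]" b z] assms(2) by (auto simp: less_2_cases_iff split: if_splits)
  qed
  moreover have "fold (\<lambda>b s. [s ! 0, s ! 1][i := b # s ! i]) z [x, y] = [x, y][i := rev z @ [x, y] ! i]"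
    using assms(2)
  proof (induction z arbitrary: x y)
    case (Cons b z)
    then show ?case by (auto simp: less_2_cases_iff)
  qed (auto simp: less_2_cases_iff)
  ultimately show ?thesis using assms(2) by (auto simp: less_2_cases_iff)
qed

lemma run_to_aux:
  assumes "length is = m"
  shows "run (m + 5) (to_aux m) (TP is [code t @ r, s, [], []] out) (TP is [r, code t @ s, [], []] out) (30 * length (code t))"
proof -
  have 1: "run (m + 5) (grab m 0) (TP is [code t @ r, s, [], []] out) (TP is [r, s, [], rev (code t)] out) (18 * length (code t))"
    using run_grab[OF assms, of 0 _ "code t @ r" s t r out] by (simp add: numeral_3_eq_3)
  have 2: "run (m + 5) (drain m (psh m 1 True) (psh m 1 False)) (TP is [r, s, [], rev (code t)] out)
    (TP is [r, code t @ s, [], []] out) (9 * length (code t) + 1)"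
    using drain_to[OF assms, of 1 r s "rev (code t)" out] by simp
  have "run (m + 5) (to_aux m) (TP is [code t @ r, s, [], []] out) (TP is [r, code t @ s, [], []] out)
    (18 * length (code t) + (9 * length (code t) + 1) + 1)"
    unfolding to_aux_def by (rule run_SqTP[OF 1 2]) (use assms in auto)
  then show ?thesis by (rule run_mono) (use code_len[of t] in simp)
qed

lemma run_from_aux:
  assumes "length is = m"
  shows "run (m + 5) (from_aux m) (TP is [r, code t @ s, [], []] out) (TP is [code t @ r, s, [], []] out) (30 * length (code t))"
proof -
  have 1: "run (m + 5) (grab m 1) (TP is [r, code t @ s, [], []] out) (TP is [r, s, [], rev (code t)] out) (18 * length (code t))"
    using run_grab[OF assms, of 1 _ r "code t @ s" t s out] by (simp add: numeral_3_eq_3)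
  have 2: "run (m + 5) (drain m (psh m 0 True) (psh m 0 False)) (TP is [r, s, [], rev (code t)] out)
    (TP is [code t @ r, s, [], []] out) (9 * length (code t) + 1)"
    using drain_to[OF assms, of 0 r s "rev (code t)" out] by simp
  have "run (m + 5) (from_aux m) (TP is [r, code t @ s, [], []] out) (TP is [code t @ r, s, [], []] out)
    (18 * length (code t) + (9 * length (code t) + 1) + 1)"
    unfolding from_aux_def by (rule run_SqTP[OF 1 2]) (use assms in auto)
  then show ?thesis by (rule run_mono) (use code_len[of t] in simp)
qed

lemma run_drop_top:
  assumes "length is = m"
  shows "run (m + 5) (drop_top m) (TP is [code t @ r, s, [], []] out) (TP is [r, s, [], []] out) (30 * length (code t))"
proof -
  have 1: "run (m + 5) (grab m 0) (TP is [code t @ r, s, [], []] out) (TP is [r, s, [], rev (code t)] out) (18 * length (code t))"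
    using run_grab[OF assms, of 0 _ "code t @ r" s t r out] by (simp add: numeral_3_eq_3)
  have "run (m + 5) (drain m Skip Skip) (TP is [[r, s] ! 0, [r, s] ! 1, [], rev (code t)] out)
    (TP is [fold (\<lambda>b s. s) (rev (code t)) [r, s] ! 0, fold (\<lambda>b s. s) (rev (code t)) [r, s] ! 1, [], []] out)
     ((1 + 6) * length (rev (code t)) + 1)"
    by (rule run_drain[OF assms]) (use assms in \<open>auto intro!: run_Skip[simplified] good_TP\<close>)
  moreover have "fold (\<lambda>b s. s) z x = x" for z :: "bool list" and x :: "bool list list"
    by (induction z) auto
  ultimately have 2: "run (m + 5) (drain m Skip Skip) (TP is [r, s, [], rev (code t)] out)
    (TP is [r, s, [], []] out) (7 * length (code t) + 1)" by simp
  have "run (m + 5) (drop_top m) (TP is [code t @ r, s, [], []] out) (TP is [r, s, [], []] out)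
    (18 * length (code t) + (7 * length (code t) + 1) + 1)"
    unfolding drop_top_def by (rule run_SqTP[OF 1 2]) (use assms in auto)
  then show ?thesis by (rule run_mono) (use code_len[of t] in simp)
qed

lemma run_dup:
  assumes "length is = m"
  shows "run (m + 5) (dup m) (TP is [code t @ r, s, [], []] out) (TP is [code t @ code t @ r, s, [], []] out) (80 * length (code t))"
proof -
  have 1: "run (m + 5) (grab m 0) (TP is [code t @ r, s, [], []] out) (TP is [r, s, [], rev (code t)] out) (18 * length (code t))"
    using run_grab[OF assms, of 0 _ "code t @ r" s t r out] by (simp add: numeral_3_eq_3)
  let ?c = "drain m (Sq (psh m 0 True) (psh m 1 True)) (Sq (psh m 0 False) (psh m 1 False))"
  have "run (m + 5) ?c (TP is [[r, s] ! 0, [r, s] ! 1, [], rev (code t)] out)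
    (TP is [fold (\<lambda>b s. [b # s ! 0, b # s ! 1]) (rev (code t)) [r, s] ! 0,
        fold (\<lambda>b s. [b # s ! 0, b # s ! 1]) (rev (code t)) [r, s] ! 1, [], []] out)
     ((7 + 6) * length (rev (code t)) + 1)"
  proof (rule run_drain[OF assms])
    fix b z and s :: "bool list list"
    have a: "run (m + 5) (psh m 0 b) (TP is [s ! 0, s ! 1, [], z] out) (TP is [b # s ! 0, s ! 1, [], z] out) 3"
      using run_psh[of "is" m "[s ! 0, s ! 1, [], z]" 0 b out] assms by simp
    have b: "run (m + 5) (psh m 1 b) (TP is [b # s ! 0, s ! 1, [], z] out) (TP is [b # s ! 0, b # s ! 1, [], z] out) 3"
      using run_psh[of "is" m "[b # s ! 0, s ! 1, [], z]" 1 b out] assms by simp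
    have "run (m + 5) (Sq (psh m 0 b) (psh m 1 b)) (TP is [s ! 0, s ! 1, [], z] out) (TP is [b # s ! 0, b # s ! 1, [], z] out) (3 + 3 + 1)"
      by (rule run_SqTP[OF a b]) (use assms in auto)
    then show "run (m + 5) (if b then Sq (psh m 0 True) (psh m 1 True) else Sq (psh m 0 False) (psh m 1 False))
       (TP is [s ! 0, s ! 1, [], z] out) (TP is [[b # s ! 0, b # s ! 1] ! 0, [b # s ! 0, b # s ! 1] ! 1, [], z] out) 7"
      by (cases b) auto
  qed
  then have 2: "run (m + 5) ?c (TP is [r, s, [], rev (code t)] out)
    (TP is [code t @ r, code t @ s, [], []] out) (13 * length (code t) + 1)"
    unfolding fold_push2 by simp
  have "run (m + 5) (dup m) (TP is [code t @ r, s, [], []] out) (TP is [code t @ code t @ r, s, [], []] out)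
    (18 * length (code t) + ((13 * length (code t) + 1) + 30 * length (code t) + 1) + 1)"
    unfolding dup_def by (rule run_SqTP[OF 1 run_SqTP[OF 2 run_from_aux]]) (use assms in auto)
  then show ?thesis by (rule run_mono) (use code_len[of t] in simp)
qed

section \<open>Polynomial-time functions on encoded values\<close>

class enc = fixes tr :: "'a \<Rightarrow> tree"

instantiation unit :: enc begin
definition "tr (x :: unit) = Lf"
instance ..
end

instantiation bool :: enc begin
definition "tr (x :: bool) = (if x then Nd Lf Lf else Lf)"
instance ..
end

text \<open>Numbers are unary, so polynomial time means polynomial in their values; the clock
  \<open>N\<close> is such a number.\<close>

instantiation nat :: enc begin
primrec tr_nat :: "nat \<Rightarrow> tree" where
  "tr_nat 0 = Lf" | "tr_nat (Suc n) = Nd Lf (tr_nat n)"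
instance ..
end

instantiation list :: (enc) enc begin
primrec tr_list :: "'a list \<Rightarrow> tree" where
  "tr_list [] = Lf" | "tr_list (x # xs) = Nd (tr x) (tr_list xs)"
instance ..
end

instantiation prod :: (enc, enc) enc begin
definition "tr (x :: 'a \<times> 'b) = Nd (tr (fst x)) (tr (snd x))"
instance ..
end

definition sz :: "'a::enc \<Rightarrow> nat" where "sz x = length (code (tr x))"

lemma sz_simps [simp]:
  "sz () = 1" "sz (b :: bool) = (if b then 3 else 1)" "sz (n :: nat) = 2 * n + 1"
  "sz ([] :: 'a::enc list) = 1" "sz ((x :: 'a) # xs) = 1 + sz x + sz xs"
  "sz ((x :: 'a), (y :: 'b::enc)) = 1 + sz x + sz y"
proof -
  show "sz (n :: nat) = 2 * n + 1" by (induction n) (auto simp: sz_def)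
qed (auto simp: sz_def tr_unit_def tr_bool_def tr_prod_def)

lemma sz_ge1: "sz x \<ge> 1" unfolding sz_def by (rule code_len)

lemma sz_pos [simp]: "0 < sz x" using sz_ge1[of x] by linarith

lemma sz_fst_snd: "sz z = 1 + sz (fst z) + sz (snd z)"
  by (cases z) simp

lemma sz_append: "sz (xs @ ys) + 1 = sz xs + sz ys"
  by (induction xs) auto

lemma sz_elem: "x \<in> set xs \<Longrightarrow> sz x < sz xs"
  by (induction xs) auto

lemma length_sz: "2 * length xs < sz xs"
proof (induction xs)
  case (Cons x xs)
  then show ?case using sz_ge1[of x] by simp
qed simp

text \<open>Since \<open>sz x + 1\<close> is at least \<open>2\<close>, its powers absorb constants
  and sums, so a single exponent describes every polynomial bound.\<close>

definition pbd :: "('a::enc \<Rightarrow> nat) \<Rightarrow> bool" where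
  "pbd g \<longleftrightarrow> (\<exists>C. \<forall>x. g x \<le> (sz x + 1) ^ C)"

lemma pbdI: "(\<And>x. g x \<le> (sz x + 1) ^ C) \<Longrightarrow> pbd g" by (auto simp: pbd_def)

lemma pbd_mono: "pbd g \<Longrightarrow> (\<And>x. f x \<le> g x) \<Longrightarrow> pbd f"
  unfolding pbd_def using le_trans by blast

lemma pbd_sz: "pbd sz" by (rule pbdI[of _ 1]) simp

lemma pbd_const: "pbd (\<lambda>x. k)"
proof (rule pbdI[of _ k])
  fix x :: 'a
  have "k \<le> 2 ^ k" using less_exp[of k] by linarith
  also have "\<dots> \<le> (sz x + 1) ^ k" by (intro power_mono) (use sz_ge1[of x] in auto)
  finally show "k \<le> (sz x + 1) ^ k" .
qed

lemma pbd_add: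
  assumes "pbd f" "pbd g" shows "pbd (\<lambda>x. f x + g x)"
proof -
  obtain A B where A: "\<And>x. f x \<le> (sz x + 1) ^ A" and B: "\<And>x. g x \<le> (sz x + 1) ^ B"
    using assms by (auto simp: pbd_def)
  show ?thesis
  proof (rule pbdI[of _ "Suc (A + B)"])
    fix x :: 'a
    have "f x + g x \<le> (sz x + 1) ^ A + (sz x + 1) ^ B" using A[of x] B[of x] by simp
    also have "\<dots> \<le> (sz x + 1) ^ (A + B) + (sz x + 1) ^ (A + B)"
      by (intro add_mono power_increasing) auto
    also have "\<dots> = 2 * (sz x + 1) ^ (A + B)" by simp
    also have "\<dots> \<le> (sz x + 1) * (sz x + 1) ^ (A + B)"
      using sz_ge1[of x] by (intro mult_right_mono) auto
    finally show "f x + g x \<le> (sz x + 1) ^ Suc (A + B)" by simp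
  qed
qed

lemma pbd_mult:
  assumes "pbd f" "pbd g" shows "pbd (\<lambda>x. f x * g x)"
proof -
  obtain A B where A: "\<And>x. f x \<le> (sz x + 1) ^ A" and B: "\<And>x. g x \<le> (sz x + 1) ^ B"
    using assms by (auto simp: pbd_def)
  show ?thesis
    by (rule pbdI[of _ "A + B"]) (use A B in \<open>auto simp: power_add intro: mult_mono\<close>)
qed

lemma pbd_power: "pbd f \<Longrightarrow> pbd (\<lambda>x. f x ^ k)"
  by (induction k) (auto intro: pbd_const pbd_mult)

lemma pbd_comp:
  assumes "pbd g" "pbd (\<lambda>x. sz (f x))" shows "pbd (\<lambda>x. g (f x))"
proof -
  obtain A where A: "\<And>x. g x \<le> (sz x + 1) ^ A" using assms by (auto simp: pbd_def)
  show ?thesis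
    by (rule pbd_mono[OF _ A]) (intro pbd_power pbd_add assms pbd_const)
qed

lemma pbd_fst_snd: "pbd (\<lambda>z. sz (fst z))" "pbd (\<lambda>z. sz (snd z))"
  by (rule pbd_mono[OF pbd_sz], simp add: sz_fst_snd)+

lemmas pbd_intros = pbd_const pbd_sz pbd_add pbd_mult pbd_power pbd_fst_snd

definition vrun :: "nat \<Rightarrow> prog \<Rightarrow> tree \<Rightarrow> tree \<Rightarrow> nat \<Rightarrow> bool" where
  "vrun m c x y t \<longleftrightarrow> (\<forall>is r s out. length is = m \<longrightarrow>
     run (m + 5) c (TP is [code x @ r, s, [], []] out) (TP is [code y @ r, s, [], []] out) t)"

lemma vrun_mono: "vrun m c x y s \<Longrightarrow> s \<le> t \<Longrightarrow> vrun m c x y t"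
  unfolding vrun_def using run_mono by blast

text \<open>The number \<open>m\<close> of input tapes is a parameter because the same programs are
  used in a machine with two of them and in one with three.\<close>

definition cmp :: "(nat \<Rightarrow> prog) \<Rightarrow> ('a::enc \<Rightarrow> nat) \<Rightarrow> ('a \<Rightarrow> 'b::enc) \<Rightarrow> bool" where
  "cmp c T f \<longleftrightarrow> (\<forall>m. wf_prog m (c m) \<and> det_prog (c m) \<and> (\<forall>x. vrun m (c m) (tr x) (tr (f x)) (T x)))"

lemma cmpI:
  assumes "\<And>m. wf_prog m (c m)" "\<And>m. det_prog (c m)"
    "\<And>m is r s out x. length is = m \<Longrightarrow> run (m + 5) (c m) (TP is [code (tr x) @ r, s, [], []] out)
       (TP is [code (tr (f x)) @ r, s, [], []] out) (T x)"
  shows "cmp c T f"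
  using assms unfolding cmp_def vrun_def by blast

lemma cmp_run:
  "cmp c T f \<Longrightarrow> length is = m \<Longrightarrow> run (m + 5) (c m) (TP is [code (tr x) @ r, s, [], []] out)
       (TP is [code (tr (f x)) @ r, s, [], []] out) (T x)"
  by (simp add: cmp_def vrun_def)

lemma cmp_wf_det: "cmp c T f \<Longrightarrow> wf_prog m (c m)" "cmp c T f \<Longrightarrow> det_prog (c m)"
  by (simp_all add: cmp_def)

text \<open>The size of the result is bounded separately, since composition needs it to bound the
  time of the next function.\<close>

definition PT :: "('a::enc \<Rightarrow> 'b::enc) \<Rightarrow> bool" where
  "PT f \<longleftrightarrow> pbd (\<lambda>x. sz (f x)) \<and> (\<exists>T c. pbd T \<and> cmp c T f)"

lemma PTI: "pbd (\<lambda>x. sz (f x)) \<Longrightarrow> pbd T \<Longrightarrow> cmp c T f \<Longrightarrow> PT f"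
  unfolding PT_def by blast

lemma PT_E:
  assumes "PT f"
  obtains c T where "pbd (\<lambda>x. sz (f x))" "pbd T" "cmp c T f"
  using assms unfolding PT_def by blast

lemma PTI2:
  assumes "pbd (\<lambda>x. sz (f x))" "pbd T" "\<And>m. wf_prog m (c m)" "\<And>m. det_prog (c m)"
    "\<And>m is r s out x. length is = m \<Longrightarrow> run (m + 5) (c m) (TP is [code (tr x) @ r, s, [], []] out)
       (TP is [code (tr (f x)) @ r, s, [], []] out) (T x)"
  shows "PT f"
  using PTI[OF assms(1,2) cmpI[OF assms(3-5)]] .

lemma PT_size: "PT f \<Longrightarrow> pbd (\<lambda>x. sz (f x))" by (simp add: PT_def)

text \<open>Machines see only trees, so a function may be exchanged for one of another result type
  with the same trees; this makes constructors and unary numbers free of charge.\<close>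

lemma PT_tr: "PT f \<Longrightarrow> (\<And>x. tr (g x) = tr (f x)) \<Longrightarrow> PT g"
  unfolding PT_def sz_def cmp_def by simp

lemma PT_id: "PT (\<lambda>x. x)"
  by (rule PTI[of _ "\<lambda>x. 1" "\<lambda>m. Skip"], (intro pbd_intros)+)
    (auto intro!: cmpI run_Skip[simplified] good_TP)

lemma PT_comp:
  assumes "PT f" "PT g" shows "PT (\<lambda>x. f (g x))"
proof -
  obtain c T where f: "pbd (\<lambda>x. sz (f x))" "pbd T" "cmp c T f" using PT_E[OF assms(1)] .
  obtain d S where g: "pbd (\<lambda>x. sz (g x))" "pbd S" "cmp d S g" using PT_E[OF assms(2)] .
  show ?thesis
  proof (rule PTI[of _ "\<lambda>x. S x + T (g x) + 1" "\<lambda>m. Sq (d m) (c m)"])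
    show "pbd (\<lambda>x. sz (f (g x)))" by (rule pbd_comp[OF f(1) g(1)])
    show "pbd (\<lambda>x. S x + T (g x) + 1)" by (intro pbd_intros g pbd_comp[OF f(2) g(1)])
    show "cmp (\<lambda>m. Sq (d m) (c m)) (\<lambda>x. S x + T (g x) + 1) (\<lambda>x. f (g x))"
    proof (rule cmpI)
      fix m r s out and x :: 'c and "is" :: "(bool list \<times> int) list"
      assume m: "length is = m"
      show "run (m + 5) (Sq (d m) (c m)) (TP is [code (tr x) @ r, s, [], []] out)
        (TP is [code (tr (f (g x))) @ r, s, [], []] out) (S x + T (g x) + 1)"
        by (rule run_SqTP[OF cmp_run[OF g(3) m] cmp_run[OF f(3) m]]) (use m in auto)
    qed (auto intro: cmp_wf_det f g)
  qed
qed

fun pushes :: "nat \<Rightarrow> bool list \<Rightarrow> prog" where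
  "pushes m [] = Skip"
| "pushes m (b # bs) = Sq (pushes m bs) (psh m 0 b)"

lemma wf_det_pushes [simp]: "wf_prog m (pushes m bs)" "det_prog (pushes m bs)"
  by (induction bs) auto

lemma run_pushes:
  assumes "length is = m"
  shows "run (m + 5) (pushes m bs) (TP is [r, s, [], []] out) (TP is [bs @ r, s, [], []] out) (4 * length bs + 1)"
proof (induction bs)
  case Nil
  then show ?case using assms by (auto intro!: run_Skip[simplified] good_TP)
next
  case (Cons b bs)
  have 1: "run (m + 5) (psh m 0 b) (TP is [bs @ r, s, [], []] out) (TP is [b # bs @ r, s, [], []] out) 3"
    using run_psh[of "is" m "[bs @ r, s, [], []]" 0 b out] assms by simp
  have "run (m + 5) (pushes m (b # bs)) (TP is [r, s, [], []] out) (TP is [(b # bs) @ r, s, [], []] out)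
      (4 * length bs + 1 + 3 + 1)"
    using run_SqTP[OF Cons 1] assms by simp
  then show ?case by (rule run_mono) simp
qed

lemma PT_const: "PT (\<lambda>x. k)"
proof (rule PTI2[of _ "\<lambda>x. 30 * sz x + (4 * length (code (tr k)) + 1) + 1" "\<lambda>m. Sq (drop_top m) (pushes m (code (tr k)))"])
  fix m r s out and x :: 'a and "is" :: "(bool list \<times> int) list"
  assume m: "length is = m"
  show "run (m + 5) (Sq (drop_top m) (pushes m (code (tr k)))) (TP is [code (tr x) @ r, s, [], []] out)
        (TP is [code (tr k) @ r, s, [], []] out) (30 * sz x + (4 * length (code (tr k)) + 1) + 1)"
    unfolding sz_def by (rule run_SqTP[OF run_drop_top[OF m] run_pushes[OF m]]) (use m in auto)
qed (intro pbd_intros, intro pbd_intros, simp, simp)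

lemma PT_pair:
  assumes "PT f" "PT g" shows "PT (\<lambda>x. (f x, g x))"
proof -
  obtain c T where f: "pbd (\<lambda>x. sz (f x))" "pbd T" "cmp c T f" using PT_E[OF assms(1)] .
  obtain d S where g: "pbd (\<lambda>x. sz (g x))" "pbd S" "cmp d S g" using PT_E[OF assms(2)] .
  let ?T = "\<lambda>x. 80 * sz x + (T x + (30 * sz (f x) + (S x + (30 * sz (f x) + 3 + 1) + 1) + 1) + 1) + 1"
  show ?thesis
  proof (rule PTI2[of _ ?T "\<lambda>m. Sq (dup m) (Sq (c m) (Sq (to_aux m) (Sq (d m) (Sq (from_aux m) (psh m 0 True)))))"])
    fix m r s out and x :: 'a and "is" :: "(bool list \<times> int) list"
    assume m: "length is = m"
    have p: "run (m + 5) (psh m 0 True) (TP is [code (tr (f x)) @ code (tr (g x)) @ r, s, [], []] out)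
       (TP is [code (tr (f x, g x)) @ r, s, [], []] out) 3"
      using run_psh[of "is" m "[code (tr (f x)) @ code (tr (g x)) @ r, s, [], []]" 0 True out] m
      by (simp add: tr_prod_def)
    show "run (m + 5) (Sq (dup m) (Sq (c m) (Sq (to_aux m) (Sq (d m) (Sq (from_aux m) (psh m 0 True))))))
       (TP is [code (tr x) @ r, s, [], []] out) (TP is [code (tr (f x, g x)) @ r, s, [], []] out) (?T x)"
      unfolding sz_def
      by (rule run_SqTP[OF run_dup[OF m] run_SqTP[OF cmp_run[OF f(3) m] run_SqTP[OF run_to_aux[OF m]
          run_SqTP[OF cmp_run[OF g(3) m] run_SqTP[OF run_from_aux[OF m] p]]]]]) (use m in auto)
  qed (simp only: sz_simps, intro pbd_intros f g, intro pbd_intros f g,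
      simp_all add: cmp_wf_det[OF f(3)] cmp_wf_det[OF g(3)])
qed

lemma PT_fst0: "PT (\<lambda>z. fst z)"
proof (rule PTI2[of _ "\<lambda>z. 3 + (30 * sz z + (30 * sz z + 30 * sz z + 1) + 1) + 1"
      "\<lambda>m. Sq (pop m 0) (Sq (to_aux m) (Sq (drop_top m) (from_aux m)))"])
  fix m r s out and z :: "'a \<times> 'b" and "is" :: "(bool list \<times> int) list"
  assume m: "length is = m"
  have p: "run (m + 5) (pop m 0) (TP is [code (tr z) @ r, s, [], []] out)
       (TP is [code (tr (fst z)) @ code (tr (snd z)) @ r, s, [], []] out) 3"
    using run_pop[of "is" m "[code (tr z) @ r, s, [], []]" 0 out] m by (simp add: tr_prod_def)
  have le: "length (code (tr (fst z))) \<le> sz z" "length (code (tr (snd z))) \<le> sz z"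
    by (auto simp: sz_def tr_prod_def)
  show "run (m + 5) (Sq (pop m 0) (Sq (to_aux m) (Sq (drop_top m) (from_aux m)))) (TP is [code (tr z) @ r, s, [], []] out)
       (TP is [code (tr (fst z)) @ r, s, [], []] out) (3 + (30 * sz z + (30 * sz z + 30 * sz z + 1) + 1) + 1)"
    by (rule run_SqTP[OF p run_SqTP[OF run_mono[OF run_to_aux[OF m]] run_SqTP[OF run_mono[OF run_drop_top[OF m]]
          run_mono[OF run_from_aux[OF m]]]]]) (use m le in auto)
qed (intro pbd_intros, intro pbd_intros, simp, simp)

lemma PT_snd0: "PT (\<lambda>z. snd z)"
proof (rule PTI2[of _ "\<lambda>z. 3 + 30 * sz z + 1" "\<lambda>m. Sq (pop m 0) (drop_top m)"])
  fix m r s out and z :: "'a \<times> 'b" and "is" :: "(bool list \<times> int) list"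
  assume m: "length is = m"
  have p: "run (m + 5) (pop m 0) (TP is [code (tr z) @ r, s, [], []] out)
       (TP is [code (tr (fst z)) @ code (tr (snd z)) @ r, s, [], []] out) 3"
    using run_pop[of "is" m "[code (tr z) @ r, s, [], []]" 0 out] m by (simp add: tr_prod_def)
  have le: "length (code (tr (fst z))) \<le> sz z"
    by (auto simp: sz_def tr_prod_def)
  show "run (m + 5) (Sq (pop m 0) (drop_top m)) (TP is [code (tr z) @ r, s, [], []] out)
       (TP is [code (tr (snd z)) @ r, s, [], []] out) (3 + 30 * sz z + 1)"
    by (rule run_SqTP[OF p run_mono[OF run_drop_top[OF m]]]) (use m le in auto)
qed (intro pbd_intros, intro pbd_intros, simp, simp)

text \<open>A value is a leaf iff the first bit of its code is \<open>False\<close>; otherwise the test leaves the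
  components on the stack above the saved argument.\<close>

lemma PT_case0:
  fixes l :: "'a::enc \<Rightarrow> 'l::enc list"
  assumes "PT l" "PT f" "PT g"
  shows "PT (\<lambda>x. case l x of [] \<Rightarrow> f x | y # ys \<Rightarrow> g ((y, ys), x))"
proof -
  obtain b R where l: "pbd (\<lambda>x. sz (l x))" "pbd R" "cmp b R l" using PT_E[OF assms(1)] .
  obtain c T where f: "pbd (\<lambda>x. sz (f x))" "pbd T" "cmp c T f" using PT_E[OF assms(2)] .
  obtain d S where g: "pbd (\<lambda>x. sz (g x))" "pbd S" "cmp d S g" using PT_E[OF assms(3)] .
  define sp where "sp x = (case l x of [] \<Rightarrow> undefined | y # ys \<Rightarrow> ((y, ys), x))" for x
  let ?h = "\<lambda>x. case l x of [] \<Rightarrow> f x | y # ys \<Rightarrow> g ((y, ys), x)"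
  have spsz: "sz (sp x) \<le> sz (undefined :: ('l \<times> 'l list) \<times> 'a) + sz (l x) + sz x + 1" for x
    by (auto simp: sp_def split: list.splits)
  have psp: "pbd (\<lambda>x. sz (sp x))"
    by (rule pbd_mono[OF _ spsz], intro pbd_intros l)
  have pS: "pbd (\<lambda>x. S (sp x))" by (rule pbd_comp[OF g(2) psp])
  have pg: "pbd (\<lambda>x. sz (g (sp x)))" by (rule pbd_comp[OF g(1) psp])
  have ph: "pbd (\<lambda>x. sz (?h x))"
    by (rule pbd_mono[of "\<lambda>x. sz (f x) + sz (g (sp x))"], intro pbd_intros f pg)
      (auto simp: sp_def split: list.splits)
  let ?T = "\<lambda>x. 80 * sz x + (R x + (T x + S (sp x) + 5 + 1) + 1) + 1"
  let ?c = "\<lambda>m. Sq (dup m) (Sq (b m) (If (m + 0) 2 (Sq (psh m 0 True) (d m)) (Sq (pop m 0) (c m))))"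
  show ?thesis
  proof (rule PTI2[OF ph, of ?T ?c])
    fix m r s out and x :: 'a and "is" :: "(bool list \<times> int) list"
    assume m: "length is = m"
    have "run (m + 5) (If (m + 0) 2 (Sq (psh m 0 True) (d m)) (Sq (pop m 0) (c m))) (TP is [code (tr (l x)) @ code (tr x) @ r, s, [], []] out)
       (TP is [code (tr (?h x)) @ r, s, [], []] out) (T x + S (sp x) + 5 + 1)"
    proof (rule run_IfTP, cases "l x")
      case Nil
      have p: "run (m + 5) (pop m 0) (TP is [code (tr (l x)) @ code (tr x) @ r, s, [], []] out)
       (TP is [code (tr x) @ r, s, [], []] out) 3"
        using run_pop[of "is" m "[code (tr (l x)) @ code (tr x) @ r, s, [], []]" 0 out] m Nil by simp
      have "run (m + 5) (Sq (pop m 0) (c m)) (TP is [code (tr (l x)) @ code (tr x) @ r, s, [], []] out)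
       (TP is [code (tr (?h x)) @ r, s, [], []] out) (3 + T x + 1)"
        by (rule run_SqTP[OF p]) (use m Nil cmp_run[OF f(3) m] in auto)
      then show "run (m + 5) (if top_sym ([code (tr (l x)) @ code (tr x) @ r, s, [], []] ! 0) = 2 then Sq (psh m 0 True) (d m) else Sq (pop m 0) (c m))
        (TP is [code (tr (l x)) @ code (tr x) @ r, s, [], []] out)
        (TP is [code (tr (?h x)) @ r, s, [], []] out) (T x + S (sp x) + 5)"
        using Nil by (auto elim: run_mono)
    next
      case (Cons y ys)
      have "run (m + 5) (Sq (psh m 0 True) (d m)) (TP is [code (tr (l x)) @ code (tr x) @ r, s, [], []] out)
         (TP is [code (tr (?h x)) @ r, s, [], []] out) (3 + S (sp x) + 1)"
      proof (rule run_SqTP)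
        show "run (m + 5) (psh m 0 True) (TP is [code (tr (l x)) @ code (tr x) @ r, s, [], []] out)
          (TP is [code (tr (sp x)) @ r, s, [], []] out) 3"
          using run_psh[of "is" m "[code (tr (l x)) @ code (tr x) @ r, s, [], []]" 0 True out] m Cons
          by (simp add: sp_def tr_prod_def)
        show "run (m + 5) (d m) (TP is [code (tr (sp x)) @ r, s, [], []] out)
           (TP is [code (tr (?h x)) @ r, s, [], []] out) (S (sp x))"
          using cmp_run[OF g(3) m, of "sp x"] Cons by (simp add: sp_def)
      qed (use m in auto)
      then show "run (m + 5) (if top_sym ([code (tr (l x)) @ code (tr x) @ r, s, [], []] ! 0) = 2 then Sq (psh m 0 True) (d m) else Sq (pop m 0) (c m))
        (TP is [code (tr (l x)) @ code (tr x) @ r, s, [], []] out)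
        (TP is [code (tr (?h x)) @ r, s, [], []] out) (T x + S (sp x) + 5)"
        using Cons by (auto elim: run_mono)
    qed (use m in auto)
    then show "run (m + 5) (?c m) (TP is [code (tr x) @ r, s, [], []] out)
       (TP is [code (tr (?h x)) @ r, s, [], []] out) (?T x)"
      unfolding sz_def
      by (intro run_SqTP[OF run_dup[OF m] run_SqTP[OF cmp_run[OF l(3) m]]]) (use m in auto)
  qed (intro pbd_intros f g l pS,
      simp_all add: cmp_wf_det[OF f(3)] cmp_wf_det[OF g(3)] cmp_wf_det[OF l(3)])
qed

text \<open>The list waits on stack \<open>1\<close> while the state stays on stack
  \<open>0\<close>. The leading bit of the remaining list, \<open>True\<close> before another
  element and \<open>False\<close> at the end, controls the loop; the last pop removes that
  \<open>False\<close>.\<close>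

definition fold_prog :: "(nat \<Rightarrow> prog) \<Rightarrow> nat \<Rightarrow> prog" where
  "fold_prog c m = Sq (pop m 0) (Sq (to_aux m)
     (Sq (Wh (m + 1) 1 (Sq (pop m 1) (Sq (from_aux m) (Sq (psh m 0 True) (c m))))) (pop m 1)))"

lemma run_fold_loop:
  fixes l :: "'a::enc list" and s :: "'b::enc"
  assumes "length is = m"
    "\<And>l1 x l2. l = l1 @ x # l2 \<Longrightarrow> vrun m (c m) (tr (x, fold f l1 s)) (tr (f x (fold f l1 s))) B"
  shows "run (m + 5) (Wh (m + 1) 1 (Sq (pop m 1) (Sq (from_aux m) (Sq (psh m 0 True) (c m)))))
     (TP is [code (tr s) @ r, code (tr l) @ q, [], []] out)
     (TP is [code (tr (fold f l s)) @ r, False # q, [], []] out) ((30 * sz l + B + 10) * length l + 1)"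
  using assms(2)
proof (induction l arbitrary: s)
  case Nil
  have "run (m + 5) (Wh (m + 1) 1 (Sq (pop m 1) (Sq (from_aux m) (Sq (psh m 0 True) (c m)))))
     (TP is [code (tr s) @ r, False # q, [], []] out) (TP is [code (tr s) @ r, False # q, [], []] out) 1"
    by (rule run_Wh_end)
      (use assms reads_TP_stack[of 1 "[code (tr s) @ r, False # q, [], []]" "is" out] in \<open>auto intro!: good_TP\<close>)
  then show ?case by simp
next
  case (Cons x l)
  let ?w = "Wh (m + 1) 1 (Sq (pop m 1) (Sq (from_aux m) (Sq (psh m 0 True) (c m))))"
  have v: "vrun m (c m) (tr (x, s)) (tr (f x s)) B" using Cons.prems[of "[]" x l] by simp
  have p1: "run (m + 5) (pop m 1) (TP is [code (tr s) @ r, code (tr (x # l)) @ q, [], []] out)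
     (TP is [code (tr s) @ r, code (tr x) @ code (tr l) @ q, [], []] out) 3"
    using run_pop[of "is" m "[code (tr s) @ r, code (tr (x # l)) @ q, [], []]" 1 out] assms(1) by simp
  have p2: "run (m + 5) (psh m 0 True) (TP is [code (tr x) @ code (tr s) @ r, code (tr l) @ q, [], []] out)
     (TP is [code (tr (x, s)) @ r, code (tr l) @ q, [], []] out) 3"
    using run_psh[of "is" m "[code (tr x) @ code (tr s) @ r, code (tr l) @ q, [], []]" 0 True out] assms(1)
    by (simp add: tr_prod_def)
  have p3: "run (m + 5) (c m) (TP is [code (tr (x, s)) @ r, code (tr l) @ q, [], []] out)
     (TP is [code (tr (f x s)) @ r, code (tr l) @ q, [], []] out) B"
    using v assms(1) by (simp add: vrun_def)
  have body: "run (m + 5) (Sq (pop m 1) (Sq (from_aux m) (Sq (psh m 0 True) (c m))))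
     (TP is [code (tr s) @ r, code (tr (x # l)) @ q, [], []] out)
     (TP is [code (tr (f x s)) @ r, code (tr l) @ q, [], []] out) (3 + (30 * length (code (tr x)) + (3 + B + 1) + 1) + 1)"
    by (rule run_SqTP[OF p1 run_SqTP[OF run_from_aux[OF assms(1)] run_SqTP[OF p2 p3]]]) (use assms(1) in auto)
  have IH: "run (m + 5) ?w (TP is [code (tr (f x s)) @ r, code (tr l) @ q, [], []] out)
     (TP is [code (tr (fold f l (f x s))) @ r, False # q, [], []] out) ((30 * sz l + B + 10) * length l + 1)"
    by (rule Cons.IH) (use Cons.prems[of "x # _"] in simp)
  have "run (m + 5) ?w (TP is [code (tr s) @ r, code (tr (x # l)) @ q, [], []] out)
     (TP is [code (tr (fold f l (f x s))) @ r, False # q, [], []] out)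
     ((3 + (30 * length (code (tr x)) + (3 + B + 1) + 1) + 1) + ((30 * sz l + B + 10) * length l + 1) + 1)"
    by (rule run_Wh_step[OF _ _ body IH])
      (use assms(1) reads_TP_stack[of 1 "[code (tr s) @ r, code (tr (x # l)) @ q, [], []]" "is" out]
        in \<open>auto intro!: good_TP\<close>)
  then have "run (m + 5) ?w (TP is [code (tr s) @ r, code (tr (x # l)) @ q, [], []] out)
     (TP is [code (tr (fold f (x # l) s)) @ r, False # q, [], []] out)
     ((3 + (30 * length (code (tr x)) + (3 + B + 1) + 1) + 1) + ((30 * sz l + B + 10) * length l + 1) + 1)" by simp
  then show ?case
  proof (rule run_mono)
    have "(30 * sz l + B + 10) * length l \<le> (30 * sz (x # l) + B + 10) * length l"
      by (intro mult_right_mono) auto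
    moreover have "length (code (tr x)) = sz x" by (simp add: sz_def)
    moreover have "sz x \<le> sz (x # l)" by simp
    moreover have "(30 * sz (x # l) + B + 10) * length (x # l) = (30 * sz (x # l) + B + 10) * length l + (30 * sz (x # l) + B + 10)"
      by simp
    moreover have "sz (x # l) = 1 + sz x + sz l" by simp
    ultimately show "(3 + (30 * length (code (tr x)) + (3 + B + 1) + 1) + 1) + ((30 * sz l + B + 10) * length l + 1) + 1
      \<le> (30 * sz (x # l) + B + 10) * length (x # l) + 1" by linarith
  qed
qed

lemma vrun_fold:
  fixes l :: "'a::enc list" and s :: "'b::enc"
  assumes "\<And>l1 x l2. l = l1 @ x # l2 \<Longrightarrow> vrun m (c m) (tr (x, fold f l1 s)) (tr (f x (fold f l1 s))) B"
  shows "vrun m (fold_prog c m) (tr (l, s)) (tr (fold f l s)) ((30 * sz l + B + 10) * (length l + 2))"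
  unfolding vrun_def
proof (intro allI impI)
  fix r q out and "is" :: "(bool list \<times> int) list"
  assume m: "length is = m"
  have p1: "run (m + 5) (pop m 0) (TP is [code (tr (l, s)) @ r, q, [], []] out)
     (TP is [code (tr l) @ code (tr s) @ r, q, [], []] out) 3"
    using run_pop[of "is" m "[code (tr (l, s)) @ r, q, [], []]" 0 out] m by (simp add: tr_prod_def)
  have p2: "run (m + 5) (pop m 1) (TP is [code (tr (fold f l s)) @ r, False # q, [], []] out)
     (TP is [code (tr (fold f l s)) @ r, q, [], []] out) 3"
    using run_pop[of "is" m "[code (tr (fold f l s)) @ r, False # q, [], []]" 1 out] m by simp
  have loop: "run (m + 5) (Wh (m + 1) 1 (Sq (pop m 1) (Sq (from_aux m) (Sq (psh m 0 True) (c m)))))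
     (TP is [code (tr s) @ r, code (tr l) @ q, [], []] out)
     (TP is [code (tr (fold f l s)) @ r, False # q, [], []] out) ((30 * sz l + B + 10) * length l + 1)"
    by (rule run_fold_loop[OF m]) (rule assms)
  have "run (m + 5) (fold_prog c m) (TP is [code (tr (l, s)) @ r, q, [], []] out)
     (TP is [code (tr (fold f l s)) @ r, q, [], []] out)
     (3 + (30 * length (code (tr l)) + (((30 * sz l + B + 10) * length l + 1) + 3 + 1) + 1) + 1)"
    unfolding fold_prog_def
    by (rule run_SqTP[OF p1 run_SqTP[OF run_to_aux[OF m] run_SqTP[OF loop p2]]])
      (use m in auto)
  then show "run (m + 5) (fold_prog c m) (TP is [code (tr (l, s)) @ r, q, [], []] out)
     (TP is [code (tr (fold f l s)) @ r, q, [], []] out) ((30 * sz l + B + 10) * (length l + 2))"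
    by (rule run_mono) (auto simp: sz_def algebra_simps)
qed

text \<open>Iterating a polynomial-time step may square the state each time, so a polynomial bound
  \<open>D\<close> on all intermediate states has to be assumed; given it, every step costs at most
  a fixed polynomial.\<close>

lemma PT_fold0:
  fixes f :: "'a::enc \<Rightarrow> 'b::enc \<Rightarrow> 'b"
  assumes "PT (\<lambda>z. f (fst z) (snd z))" "pbd D"
    "\<And>v l1 l2. l v = l1 @ l2 \<Longrightarrow> sz (fold f l1 (s v)) \<le> D v" "PT l" "PT s"
  shows "PT (\<lambda>v. fold f (l v) (s v))"
proof -
  obtain c T where f: "pbd (\<lambda>z. sz (f (fst z) (snd z)))" "pbd T" "cmp c T (\<lambda>z. f (fst z) (snd z))"
    using PT_E[OF assms(1)] .
  obtain C where C: "\<And>z. T z \<le> (sz z + 1) ^ C" using f(2) unfolding pbd_def by blast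
  have "PT (\<lambda>v. (l v, s v))" by (intro PT_pair assms)
  then obtain d S where g: "pbd (\<lambda>v. sz (l v, s v))" "pbd S" "cmp d S (\<lambda>v. (l v, s v))" using PT_E by blast
  let ?T = "\<lambda>v. S v + ((30 * sz (l v) + (sz (l v) + D v + 2) ^ C + 10) * (sz (l v) + 2)) + 1"
  show ?thesis
  proof (rule PTI2[of _ ?T "\<lambda>m. Sq (d m) (fold_prog c m)"])
    show "pbd (\<lambda>v. sz (fold f (l v) (s v)))"
      by (rule pbd_mono[OF assms(2)], rule assms(3)[of _ _ "[]"]) simp
    show "pbd ?T" by (intro pbd_intros g assms(2) PT_size[OF assms(4)])
    show "wf_prog m (Sq (d m) (fold_prog c m))" "det_prog (Sq (d m) (fold_prog c m))" for m
      by (simp_all add: fold_prog_def cmp_wf_det[OF f(3)] cmp_wf_det[OF g(3)])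
    fix m r q out v and "is" :: "(bool list \<times> int) list"
    assume m: "length is = m"
    have "vrun m (fold_prog c m) (tr (l v, s v)) (tr (fold f (l v) (s v))) ((30 * sz (l v) + (sz (l v) + D v + 2) ^ C + 10) * (length (l v) + 2))"
    proof (rule vrun_fold)
      fix l1 x l2 assume l: "l v = l1 @ x # l2"
      have "vrun m (c m) (tr (x, fold f l1 (s v))) (tr (f x (fold f l1 (s v)))) (T (x, fold f l1 (s v)))"
        using f(3) by (simp add: cmp_def)
      moreover have "T (x, fold f l1 (s v)) \<le> (sz (l v) + D v + 2) ^ C"
      proof (rule order.trans[OF C], rule power_mono)
        have "sz x < sz (l v)" using l by (intro sz_elem) auto
        then show "sz (x, fold f l1 (s v)) + 1 \<le> sz (l v) + D v + 2"
          using assms(3)[OF l] by simp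
      qed simp
      ultimately show "vrun m (c m) (tr (x, fold f l1 (s v))) (tr (f x (fold f l1 (s v)))) ((sz (l v) + D v + 2) ^ C)"
        by (rule vrun_mono)
    qed
    moreover have "length (l v) \<le> sz (l v)" using length_sz[of "l v"] by simp
    ultimately have "vrun m (fold_prog c m) (tr (l v, s v)) (tr (fold f (l v) (s v))) ((30 * sz (l v) + (sz (l v) + D v + 2) ^ C + 10) * (sz (l v) + 2))"
      by (auto elim!: vrun_mono intro!: mult_left_mono)
    then show "run (m + 5) (Sq (d m) (fold_prog c m)) (TP is [code (tr v) @ r, q, [], []] out)
        (TP is [code (tr (fold f (l v) (s v))) @ r, q, [], []] out) (?T v)"
      by (intro run_SqTP[OF cmp_run[OF g(3) m]]) (use m in \<open>auto simp: vrun_def\<close>)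
  qed
qed

section \<open>Closure rules: branching, bounded folds, lists and unary arithmetic\<close>

named_theorems pt

lemma pbd_Suc: "pbd f \<Longrightarrow> pbd (\<lambda>x. Suc (f x))"
  using pbd_add[OF _ pbd_const[of 1]] by simp

lemma PT_fst [pt]: "PT f \<Longrightarrow> PT (\<lambda>x. fst (f x))" by (rule PT_comp[OF PT_fst0])
lemma PT_snd [pt]: "PT f \<Longrightarrow> PT (\<lambda>x. snd (f x))" by (rule PT_comp[OF PT_snd0])

declare PT_id [pt] PT_const [pt] PT_pair [pt]

lemma PT_comp2:
  assumes "PT (\<lambda>z. F (fst z) (snd z))" "PT f" "PT g" shows "PT (\<lambda>x. F (f x) (g x))"
  using PT_comp[OF assms(1) PT_pair[OF assms(2,3)]] by simp

lemma PT_Cons [pt]: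
  assumes "PT f" "PT g" shows "PT (\<lambda>x. f x # g x)"
  by (rule PT_tr[OF PT_pair[OF assms]]) (simp add: tr_prod_def)

lemma PT_case_list [pt]:
  assumes "PT l" "PT f" "PT (\<lambda>z. g (snd z) (fst (fst z)) (snd (fst z)))"
  shows "PT (\<lambda>x. case l x of [] \<Rightarrow> f x | y # ys \<Rightarrow> g x y ys)"
  using PT_case0[OF assms] by (simp only: fst_conv snd_conv)

lemma PT_if [pt]:
  assumes "PT c" "PT f" "PT g" shows "PT (\<lambda>x. if c x then f x else g x)"
proof -
  have "PT (\<lambda>x. if c x then [()] else [])"
    by (rule PT_tr[OF assms(1)]) (simp add: tr_bool_def tr_unit_def)
  from PT_case_list[OF this assms(3) PT_comp[OF assms(2) PT_snd[OF PT_id]]]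
  show ?thesis by (rule back_subst[of PT]) (auto simp: fun_eq_iff)
qed

lemma PT_not [pt]: "PT f \<Longrightarrow> PT (\<lambda>x. \<not> f x)"
proof -
  assume "PT f"
  then have "PT (\<lambda>x. if f x then False else True)" by (intro pt)
  moreover have "(\<lambda>x. if f x then False else True) = (\<lambda>x. \<not> f x)" by auto
  ultimately show ?thesis by metis
qed

lemma PT_conj [pt]: "PT f \<Longrightarrow> PT g \<Longrightarrow> PT (\<lambda>x. f x \<and> g x)"
proof -
  assume "PT f" "PT g"
  then have "PT (\<lambda>x. if f x then g x else False)" by (intro pt)
  moreover have "(\<lambda>x. if f x then g x else False) = (\<lambda>x. f x \<and> g x)" by auto
  ultimately show ?thesis by metis
qed

lemma PT_disj [pt]: "PT f \<Longrightarrow> PT g \<Longrightarrow> PT (\<lambda>x. f x \<or> g x)"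
  using PT_not[OF PT_conj[OF PT_not PT_not], of f g] by simp

lemma PT_bool_eq [pt]:
  fixes f g :: "'a::enc \<Rightarrow> bool"
  assumes "PT f" "PT g" shows "PT (\<lambda>x. f x = g x)"
proof -
  have "PT (\<lambda>x. if f x then g x else \<not> g x)" by (intro pt assms)
  then show ?thesis by (rule back_subst[of PT]) auto
qed

lemma PT_null [pt]: "PT l \<Longrightarrow> PT (\<lambda>x. l x = [])"
proof -
  assume "PT l"
  then have "PT (\<lambda>x. case l x of [] \<Rightarrow> True | y # ys \<Rightarrow> False)" by (intro pt)
  then show ?thesis by (rule back_subst[of PT]) (auto simp: fun_eq_iff split: list.splits)
qed

lemma PT_tl [pt]: "PT l \<Longrightarrow> PT (\<lambda>x. tl (l x))"
proof -
  assume "PT l"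
  then have "PT (\<lambda>x. case l x of [] \<Rightarrow> [] | y # ys \<Rightarrow> ys)" by (intro pt)
  then show ?thesis by (rule back_subst[of PT]) (auto simp: fun_eq_iff split: list.splits)
qed

text \<open>The parameter \<open>v\<close> has to be available to every step; it is carried along
  inside the state.\<close>

lemma PT_foldD:
  fixes F :: "'v::enc \<Rightarrow> 'a::enc \<Rightarrow> 'b::enc \<Rightarrow> 'b"
  assumes "PT (\<lambda>z. F (fst (snd z)) (fst z) (snd (snd z)))" "pbd D"
    "\<And>v l1 l2. l v = l1 @ l2 \<Longrightarrow> sz (fold (F v) l1 (s v)) \<le> D v" "PT l" "PT s"
  shows "PT (\<lambda>v. fold (F v) (l v) (s v))"
proof -
  define G where "G x p = (fst p, F (fst p) x (snd p))" for x :: 'a and p :: "'v \<times> 'b"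
  have e: "fold G xs (v, t) = (v, fold (F v) xs t)" for xs v t
    by (induction xs arbitrary: t) (auto simp: G_def)
  have "PT (\<lambda>v. fold G (l v) (v, s v))"
  proof (rule PT_fold0[where D = "\<lambda>v. sz v + D v + 1"])
    show "PT (\<lambda>z. G (fst z) (snd z))" unfolding G_def by (intro pt assms)
    show "pbd (\<lambda>v. sz v + D v + 1)" by (intro pbd_intros assms)
  qed (use assms in \<open>auto intro!: pt simp: e\<close>)
  then have "PT (\<lambda>v. snd (fold G (l v) (v, s v)))" by (rule PT_snd)
  then show ?thesis by (simp add: e)
qed

text \<open>If a step adds at most an amount depending on the parameter and the element but not on
  the state, growth is additive and the intermediate states stay polynomial.\<close>

lemma PT_fold:
  fixes F :: "'v::enc \<Rightarrow> 'a::enc \<Rightarrow> 'b::enc \<Rightarrow> 'b"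
  assumes "PT (\<lambda>z. F (fst (snd z)) (fst z) (snd (snd z)))" "pbd h"
    "\<And>v x t. sz (F v x t) \<le> sz t + h (v, x)" "PT l" "PT s"
  shows "PT (\<lambda>v. fold (F v) (l v) (s v))"
proof -
  obtain C where C: "\<And>z. h z \<le> (sz z + 1) ^ C" using assms(2) unfolding pbd_def by blast
  have st: "sz (fold (F v) xs t) \<le> sz t + length xs * (sz v + sz l + 1) ^ C"
    if "set xs \<subseteq> set l" for v xs t and l :: "'a list"
    using that
  proof (induction xs arbitrary: t)
    case (Cons x xs)
    have "sz x < sz l" using Cons.prems by (auto intro: sz_elem)
    then have "h (v, x) \<le> (sz v + sz l + 1) ^ C"
      by (intro order.trans[OF C] power_mono) auto
    moreover have "sz (fold (F v) xs (F v x t)) \<le> sz (F v x t) + length xs * (sz v + sz l + 1) ^ C"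
      using Cons by auto
    ultimately show ?case using assms(3)[of v x t] by simp
  qed simp
  show ?thesis
  proof (rule PT_foldD[OF assms(1) _ _ assms(4,5), where D = "\<lambda>v. sz (s v) + sz (l v) * (sz v + sz (l v) + 1) ^ C"])
    show "pbd (\<lambda>v. sz (s v) + sz (l v) * (sz v + sz (l v) + 1) ^ C)"
      by (intro pbd_intros PT_size assms)
    fix v l1 l2 assume l: "l v = l1 @ l2"
    have "sz (fold (F v) l1 (s v)) \<le> sz (s v) + length l1 * (sz v + sz (l v) + 1) ^ C"
      by (rule st) (simp add: l)
    also have "\<dots> \<le> sz (s v) + sz (l v) * (sz v + sz (l v) + 1) ^ C"
      using length_sz[of "l v"] l by (intro add_left_mono mult_right_mono) auto
    finally show "sz (fold (F v) l1 (s v)) \<le> sz (s v) + sz (l v) * (sz v + sz (l v) + 1) ^ C" .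
  qed
qed

lemma PT_rev [pt]: "PT l \<Longrightarrow> PT (\<lambda>x. rev (l x))"
proof -
  assume l: "PT l"
  have "PT (\<lambda>v. fold (\<lambda>x s. x # s) (l v) [])"
    by (rule PT_fold[where h = "\<lambda>z. sz (snd z) + 1"]) (auto intro!: pt l pbd_intros pbd_Suc)
  then show ?thesis by (simp add: fold_Cons_rev)
qed

lemma PT_append [pt]:
  assumes "PT f" "PT g" shows "PT (\<lambda>x. f x @ g x)"
proof -
  have "PT (\<lambda>v. fold (\<lambda>x s. x # s) (rev (f v)) (g v))"
    by (rule PT_fold[where h = "\<lambda>z. sz (snd z) + 1"]) (auto intro!: pt assms pbd_intros pbd_Suc)
  then show ?thesis by (simp add: fold_Cons_rev)
qed

lemma PT_map [pt]:
  assumes "PT (\<lambda>z. F (fst z) (snd z))" "PT l" shows "PT (\<lambda>v. map (F v) (l v))"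
proof -
  have "PT (\<lambda>v. rev (fold (\<lambda>x s. F v x # s) (l v) []))"
  proof (rule PT_rev, rule PT_fold[where h = "\<lambda>z. sz (F (fst z) (snd z)) + 1"])
    show "PT (\<lambda>z. F (fst (snd z)) (fst z) # snd (snd z))"
      by (intro pt PT_comp2[OF assms(1)])
    show "pbd (\<lambda>z. sz (F (fst z) (snd z)) + 1)" by (intro pbd_intros PT_size assms)
  qed (auto intro!: pt assms)
  moreover have "rev (fold (\<lambda>x s. F v x # s) xs t) = rev t @ map (F v) xs" for v xs t
    by (induction xs arbitrary: t) auto
  ultimately show ?thesis by simp
qed

lemma PT_filter [pt]:
  assumes "PT (\<lambda>z. P (fst z) (snd z))" "PT l" shows "PT (\<lambda>v. filter (P v) (l v))"
proof -
  have "PT (\<lambda>v. rev (fold (\<lambda>x s. if P v x then x # s else s) (l v) []))"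
  proof (rule PT_rev, rule PT_fold[where h = "\<lambda>z. sz (snd z) + 1"])
    show "PT (\<lambda>z. if P (fst (snd z)) (fst z) then fst z # snd (snd z) else snd (snd z))"
      by (intro pt PT_comp2[OF assms(1)])
    show "pbd (\<lambda>z. sz (snd z) + 1)" by (intro pbd_intros)
  qed (auto intro!: pt assms)
  moreover have "rev (fold (\<lambda>x s. if P v x then x # s else s) xs t) = rev t @ filter (P v) xs" for v xs t
    by (induction xs arbitrary: t) auto
  ultimately show ?thesis by simp
qed

lemma PT_concat [pt]:
  assumes "PT l" shows "PT (\<lambda>v. concat (l v))"
proof -
  have "PT (\<lambda>v. fold (\<lambda>x s. x @ s) (rev (l v)) [])"
  proof (rule PT_fold[where h = "\<lambda>z. sz (snd z)"])
    show "sz (x @ t) \<le> sz t + sz (snd (v, x))" for v :: 'a and x t :: "'b list"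
      using sz_append[of x t] by simp
  qed (auto intro!: pt assms pbd_intros)
  moreover have "fold (\<lambda>x s. x @ s) (rev xs) t = concat xs @ t" for xs and t :: "'b list"
    by (induction xs arbitrary: t) auto
  ultimately show ?thesis by simp
qed

text \<open>A unary number and a list of units have the same tree, so counting loops are
  folds.\<close>

definition units :: "nat \<Rightarrow> unit list" where "units n = replicate n ()"

lemma tr_units: "tr (units n) = tr n" by (induction n) (auto simp: units_def tr_unit_def)

lemma PT_units [pt]: "PT f \<Longrightarrow> PT (\<lambda>x. units (f x))" by (rule PT_tr) (simp_all add: tr_units)

lemma fold_units: "fold (\<lambda>_. f) (units n) s = (f ^^ n) s"
  by (induction n arbitrary: s) (auto simp: units_def funpow_swap1)

lemma PT_Suc [pt]: "PT f \<Longrightarrow> PT (\<lambda>x. Suc (f x))"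
  by (rule PT_tr[OF PT_pair[OF PT_const[of "()"]]]) (auto simp: tr_prod_def tr_unit_def)

lemma PT_funpow:
  fixes F :: "'v::enc \<Rightarrow> 'b::enc \<Rightarrow> 'b"
  assumes "PT (\<lambda>z. F (fst z) (snd z))" "pbd h" "\<And>v t. sz (F v t) \<le> sz t + h v" "PT n" "PT s"
  shows "PT (\<lambda>v. (F v ^^ n v) (s v))"
proof -
  have "PT (\<lambda>v. fold (\<lambda>_. F v) (units (n v)) (s v))"
  proof (rule PT_fold[where h = "\<lambda>z. h (fst z)"])
    show "PT (\<lambda>z. F (fst (snd z)) (snd (snd z)))" by (intro pt PT_comp2[OF assms(1)])
    show "pbd (\<lambda>z. h (fst z))" by (rule pbd_comp[OF assms(2)]) (intro pbd_intros)
  qed (use assms in \<open>auto intro!: pt\<close>)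
  then show ?thesis by (simp add: fold_units)
qed

lemma PT_length [pt]: "PT l \<Longrightarrow> PT (\<lambda>x. length (l x))"
proof -
  assume l: "PT l"
  have "PT (\<lambda>v. fold (\<lambda>x n. Suc n) (l v) 0)"
    by (rule PT_fold[where h = "\<lambda>z. 2"]) (auto intro!: pt l pbd_intros pbd_Suc)
  moreover have "fold (\<lambda>x n. Suc n) xs k = length xs + k" for xs :: "'b list" and k
    by (induction xs arbitrary: k) auto
  ultimately show ?thesis by simp
qed

lemma PT_plus [pt]:
  fixes f g :: "'a::enc \<Rightarrow> nat"
  assumes "PT f" "PT g" shows "PT (\<lambda>x. f x + g x)"
proof -
  have "PT (\<lambda>v. (Suc ^^ f v) (g v))"
    by (rule PT_funpow[where h = "\<lambda>z. 2"]) (auto intro!: pt assms pbd_intros pbd_Suc)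
  moreover have "(Suc ^^ a) b = a + b" for a b by (induction a) auto
  ultimately show ?thesis by simp
qed

lemma PT_times [pt]:
  fixes f g :: "'a::enc \<Rightarrow> nat"
  assumes "PT f" "PT g" shows "PT (\<lambda>x. f x * g x)"
proof -
  have "PT (\<lambda>v. ((\<lambda>n. g v + n) ^^ f v) 0)"
  proof (rule PT_funpow[where h = "\<lambda>v. 2 * sz (g v)"])
    show "PT (\<lambda>z. g (fst z) + snd z)" by (intro pt PT_comp[OF assms(2)])
    show "pbd (\<lambda>v. 2 * sz (g v))" by (intro pbd_intros PT_size assms)
  qed (auto intro!: pt assms)
  moreover have "((\<lambda>n. b + n) ^^ a) 0 = a * b" for a b :: nat by (induction a) auto
  ultimately show ?thesis by simp
qed

lemma PT_pred:
  fixes f :: "'a::enc \<Rightarrow> nat"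
  assumes "PT f" shows "PT (\<lambda>x. f x - 1)"
proof (rule PT_tr[OF PT_tl[OF PT_units[OF assms]]])
  have "tl (units n) = units (n - 1)" for n by (cases n) (auto simp: units_def)
  then show "tr (f x - 1) = tr (tl (units (f x)))" for x by (simp add: tr_units)
qed

lemma PT_minus [pt]:
  fixes f g :: "'a::enc \<Rightarrow> nat"
  assumes "PT f" "PT g" shows "PT (\<lambda>x. f x - g x)"
proof -
  have "PT (\<lambda>v. ((\<lambda>n. n - 1) ^^ g v) (f v))"
    by (rule PT_funpow[where h = "\<lambda>z. 0"]) (auto intro!: pt assms PT_pred[unfolded One_nat_def] pbd_intros pbd_Suc)
  moreover have "((\<lambda>n. n - 1) ^^ a) b = b - a" for a b :: nat by (induction a) auto
  ultimately show ?thesis by simp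
qed

lemma PT_nat_tests [pt]:
  fixes f g :: "'a::enc \<Rightarrow> nat"
  assumes "PT f" "PT g"
  shows "PT (\<lambda>x. f x \<le> g x)" "PT (\<lambda>x. f x < g x)" "PT (\<lambda>x. f x = g x)"
proof -
  have "PT (\<lambda>x. units (f x - g x) = [])" by (intro pt assms)
  then show 1: "PT (\<lambda>x. f x \<le> g x)" by (simp add: units_def)
  have "PT (\<lambda>x. units (Suc (f x) - g x) = [])" by (intro pt assms)
  then show "PT (\<lambda>x. f x < g x)"
  proof -
    have "PT (\<lambda>x. units (Suc (f x) - g x) = [])" by (intro pt assms)
    moreover have "(units (Suc a - b) = []) = (a < b)" for a b by (auto simp: units_def)
    ultimately show ?thesis by simp
  qed
  have "PT (\<lambda>x. units (f x - g x) = [] \<and> units (g x - f x) = [])" by (intro pt assms)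
  moreover have "(units (a - b) = [] \<and> units (b - a) = []) = (a = b)" for a b by (auto simp: units_def)
  ultimately show "PT (\<lambda>x. f x = g x)" by simp
qed

lemma PT_min [pt]:
  fixes f g :: "'a::enc \<Rightarrow> nat"
  assumes "PT f" "PT g" shows "PT (\<lambda>x. min (f x) (g x))"
  unfolding min_def by (intro pt assms)

lemma PT_upt [pt]:
  assumes "PT f" shows "PT (\<lambda>x. [0..<f x])"
proof -
  have e: "fold (\<lambda>_ s. s @ [length s]) (us :: unit list) [] = [0..<length us]" for us
    by (induction us rule: rev_induct) auto
  have sz: "sz [0..<n] \<le> 1 + n * (2 * n + 2)" for n
  proof (induction n)
    case (Suc n)
    have "sz ([0..<n] @ [n]) + 1 = sz [0..<n] + (2 * n + 3)" using sz_append[of "[0..<n]" "[n]"] by simp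
    then show ?case using Suc by (simp add: algebra_simps)
  qed simp
  have "PT (\<lambda>v. fold (\<lambda>_ s. s @ [length s]) (units (f v)) [])"
  proof (rule PT_foldD[where D = "\<lambda>v. 1 + sz (f v) * (2 * sz (f v) + 2)"])
    fix v l1 l2 assume "units (f v) = l1 @ l2"
    then have "length l1 + length l2 = f v" by (metis length_append length_replicate units_def)
    then have "length l1 \<le> f v" by linarith
    have "sz [0..<length l1] \<le> 1 + length l1 * (2 * length l1 + 2)" by (rule sz)
    also have "\<dots> \<le> 1 + sz (f v) * (2 * sz (f v) + 2)"
      using \<open>length l1 \<le> f v\<close> by (intro add_left_mono mult_mono) auto
    finally show "sz (fold (\<lambda>_ s. s @ [length s]) l1 []) \<le> 1 + sz (f v) * (2 * sz (f v) + 2)"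
      by (simp only: e)
  next
    show "pbd (\<lambda>v. 1 + sz (f v) * (2 * sz (f v) + 2))" by (intro pbd_intros PT_size assms)
  qed (auto intro!: pt assms)
  then show ?thesis by (simp only: e) (simp add: units_def)
qed

lemma PT_drop [pt]:
  assumes "PT n" "PT l" shows "PT (\<lambda>x. drop (n x) (l x))"
proof -
  have "PT (\<lambda>v. (tl ^^ n v) (l v))"
  proof (rule PT_funpow[where h = "\<lambda>z. 0"])
    show "sz (tl t) \<le> sz t + 0" for t :: "'b list" by (cases t) auto
  qed (auto intro!: pt assms pbd_intros pbd_Suc)
  moreover have "(tl ^^ k) xs = drop k xs" for k and xs :: "'b list"
    by (induction k arbitrary: xs) (auto simp: funpow_swap1 drop_Suc tl_drop)
  ultimately show ?thesis by simp
qed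

lemma PT_take [pt]:
  assumes "PT n" "PT l" shows "PT (\<lambda>x. take (n x) (l x))"
proof -
  have "PT (\<lambda>x. rev (drop (length (l x) - n x) (rev (l x))))" by (intro pt assms)
  moreover have "rev (drop (length xs - k) (rev xs)) = take k xs" for k and xs :: "'b list"
    by (cases "k \<le> length xs") (simp_all add: rev_drop)
  ultimately show ?thesis by simp
qed

lemma PT_replicate [pt]:
  assumes "PT n" "PT f" shows "PT (\<lambda>x. replicate (n x) (f x))"
proof -
  have "PT (\<lambda>x. map (\<lambda>_. f x) (units (n x)))"
    by (intro pt assms PT_comp[OF assms(2)])
  then show ?thesis by (simp add: units_def)
qed

lemma PT_zip [pt]:
  fixes f :: "'v::enc \<Rightarrow> 'a::enc list" and g :: "'v \<Rightarrow> 'b::enc list"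
  assumes "PT f" "PT g" shows "PT (\<lambda>x. zip (f x) (g x))"
proof -
  define F where "F x s = (case fst s of [] \<Rightarrow> s | y # ys \<Rightarrow> (ys, (x, y) # snd s))"
    for x :: 'a and s :: "'b list \<times> ('a \<times> 'b) list"
  have e: "rev (snd (fold F xs (ys, t))) = rev t @ zip xs ys" for xs ys t
  proof (induction xs arbitrary: ys t)
    case IH: (Cons x xs)
    show ?case
    proof (cases ys)
      case Nil
      have "fold F xs ([], t) = ([], t)" for t by (induction xs) (auto simp: F_def)
      moreover have "F x ([], t) = ([], t)" by (simp add: F_def)
      ultimately show ?thesis using Nil by simp
    next
      case (Cons y zs)
      have "F x (y # zs, t) = (zs, (x, y) # t)" by (simp add: F_def)
      then show ?thesis using Cons IH by simp
    qed
  qed simp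
  have "PT (\<lambda>v. rev (snd (fold F (f v) (g v, []))))"
  proof (intro pt PT_fold[where h = "\<lambda>z. sz (snd z) + 1" and F = "\<lambda>_. F"])
    show "PT (\<lambda>z. F (fst z) (snd (snd z)))" unfolding F_def by (intro pt)
    show "pbd (\<lambda>z. sz (snd z) + 1)" by (intro pbd_intros)
    show "sz (F x t) \<le> sz t + (sz (snd (v, x)) + 1)" for v :: 'v and x t
      by (cases t) (auto simp: F_def split: list.splits)
  qed (intro assms)+
  then show ?thesis by (simp add: e)
qed

lemma PT_list_eq [pt]:
  fixes f g :: "'v::enc \<Rightarrow> 'a::enc list"
  assumes "PT (\<lambda>z :: 'a \<times> 'a. fst z = snd z)" "PT f" "PT g" shows "PT (\<lambda>x. f x = g x)"
proof -
  have "PT (\<lambda>x. length (f x) = length (g x) \<and> filter (\<lambda>p. \<not> fst p = snd p) (zip (f x) (g x)) = [])"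
  proof (rule PT_conj[OF PT_nat_tests(3) PT_null[OF PT_filter[OF PT_not]]])
    have "PT (\<lambda>z :: 'v \<times> 'a \<times> 'a. snd z)" by (intro pt)
    from PT_comp[OF assms(1) this] show "PT (\<lambda>z :: 'v \<times> 'a \<times> 'a. fst (snd z) = snd (snd z))" .
  qed (intro PT_length PT_zip assms)+
  moreover have "(length xs = length ys \<and> filter (\<lambda>p. \<not> fst p = snd p) (zip xs ys) = []) = (xs = ys)" for xs ys :: "'a list"
    by (induction xs arbitrary: ys) (case_tac ys; auto)+
  ultimately show ?thesis by simp
qed

section \<open>The algorithms\<close>

lemma PT_comp3:
  assumes "PT (\<lambda>z. F (fst z) (fst (snd z)) (snd (snd z)))" "PT f1" "PT f2" "PT f3"
  shows "PT (\<lambda>x. F (f1 x) (f2 x) (f3 x))"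
  using PT_comp[OF assms(1), of "\<lambda>x. (f1 x, f2 x, f3 x)"] assms(2-) by (simp add: PT_pair)

lemma PT_comp4:
  assumes "PT (\<lambda>z. F (fst z) (fst (snd z)) (fst (snd (snd z))) (snd (snd (snd z))))" "PT f1" "PT f2" "PT f3" "PT f4"
  shows "PT (\<lambda>x. F (f1 x) (f2 x) (f3 x) (f4 x))"
  using PT_comp[OF assms(1), of "\<lambda>x. (f1 x, f2 x, f3 x, f4 x)"] assms(2-) by (simp add: PT_pair)

lemma PT_foldr:
  fixes F :: "'v::enc \<Rightarrow> 'a::enc \<Rightarrow> 'b::enc \<Rightarrow> 'b"
  assumes "PT (\<lambda>z. F (fst (snd z)) (fst z) (snd (snd z)))" "pbd h"
    "\<And>v x t. sz (F v x t) \<le> sz t + h (v, x)" "PT l" "PT s"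
  shows "PT (\<lambda>v. foldr (F v) (l v) (s v))"
  using PT_fold[OF assms(1-3) PT_rev[OF assms(4)] assms(5)] by (simp add: foldr_conv_fold)

text \<open>A counter that wraps around at \<open>b\<close>. Moduli appear as successors to exclude
  \<open>0\<close>, which is why the advice stores a prime minus one.\<close>

lemma PT_mod [pt]:
  assumes "PT f" "PT g" shows "PT (\<lambda>x. f x mod Suc (g x))"
proof (rule PT_comp2[where F = "\<lambda>a b. a mod Suc b", OF _ assms])
  have e: "((\<lambda>s. if s = b then 0 else Suc s) ^^ a) 0 = a mod Suc b" for a b
    by (induction a) (auto simp: mod_Suc)
  have "PT (\<lambda>z :: nat \<times> nat. ((\<lambda>s. if s = snd z then 0 else Suc s) ^^ fst z) 0)"
    by (rule PT_funpow[where h = "\<lambda>_. 2"]) (auto intro!: pt pbd_intros)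
  then show "PT (\<lambda>z. fst z mod Suc (snd z))" by (simp add: e)
qed

lemma PT_even [pt]: "PT f \<Longrightarrow> PT (\<lambda>x. even (f x))" for f :: "'a::enc \<Rightarrow> nat"
proof -
  assume "PT f"
  then have "PT (\<lambda>x. f x mod Suc 1 = 0)" by (intro pt)
  moreover have "(n mod Suc 1 = 0) = even n" for n by presburger
  ultimately show ?thesis by simp
qed

lemma PT_half [pt]: "PT f \<Longrightarrow> PT (\<lambda>x. f x div 2)" for f :: "'a::enc \<Rightarrow> nat"
proof (rule PT_comp[where f = "\<lambda>a. a div 2"])
  let ?F = "\<lambda>s. if snd s then (Suc (fst s), False) else (fst s, True)"
  have e: "(?F ^^ a) (0, False) = (a div 2, odd a)" for a by (induction a) auto
  have "PT (\<lambda>a :: nat. fst ((?F ^^ a) (0, False)))"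
    by (rule PT_fst, rule PT_funpow[where h = "\<lambda>_. 4" and F = "\<lambda>_. ?F"])
      (auto intro!: pt pbd_intros simp: sz_fst_snd)
  then show "PT (\<lambda>a :: nat. a div 2)" by (simp add: e)
qed

text \<open>The value of a binary number, low bit first, cut off at \<open>N\<close>. Advice gives
  numbers in binary, and the cut keeps their unary values polynomial in the clock; for the advice
  constructed later it has no effect.\<close>

definition bn :: "nat \<Rightarrow> bool list \<Rightarrow> nat" where
  "bn N bs = foldr (\<lambda>b acc. min N ((if b then 1 else 0) + 2 * acc)) bs 0"

lemma PT_bn [pt]: "PT f \<Longrightarrow> PT g \<Longrightarrow> PT (\<lambda>x. bn (f x) (g x))"
proof (rule PT_comp2[where F = bn])
  show "PT (\<lambda>z. bn (fst z) (snd z))" unfolding bn_def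
  proof (rule PT_foldr[where h = "\<lambda>z. 2 * sz (fst z) + 1"])
    show "sz (min (fst v) ((if x then 1 else 0) + 2 * t)) \<le> sz t + (2 * sz (fst (v, x)) + 1)"
      for v :: "nat \<times> bool list" and x :: bool and t :: nat
    proof -
      have "min (fst v) ((if x then 1 else 0) + 2 * t) \<le> fst v" by (rule min.cobounded1)
      moreover have "fst v \<le> sz v" by (cases v) simp
      moreover have "k \<le> a \<Longrightarrow> a \<le> c \<Longrightarrow> 2 * k + 1 \<le> 2 * t + 1 + (2 * c + 1)" for k a c :: nat by simp
      ultimately show ?thesis by (simp only: sz_simps fst_conv)
    qed
  qed (intro pt pbd_intros)+
qed

definition pw :: "nat \<Rightarrow> nat \<Rightarrow> nat" where "pw N e = bn N (replicate e False @ [True])"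

lemma PT_pw [pt]: "PT f \<Longrightarrow> PT g \<Longrightarrow> PT (\<lambda>x. pw (f x) (g x))"
  unfolding pw_def by (intro pt)

definition dig :: "nat \<Rightarrow> nat \<Rightarrow> bool list" where
  "dig w c = map (\<lambda>i. odd (c div 2 ^ i)) [0..<w]"

lemma PT_dig [pt]: "PT f \<Longrightarrow> PT g \<Longrightarrow> PT (\<lambda>x. dig (f x) (g x))"
proof (rule PT_comp2[where F = dig])
  have e: "((\<lambda>c. c div 2) ^^ i) c = c div 2 ^ i" for i c :: nat
    by (induction i) (auto simp: div_mult2_eq[symmetric] mult.commute)
  have p: "PT (\<lambda>z :: nat \<times> nat. ((\<lambda>c. c div 2) ^^ fst z) (snd z))"
    by (rule PT_funpow[where h = "\<lambda>_. 0"]) (auto intro!: pt pbd_intros)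
  have "PT (\<lambda>z :: nat \<times> nat. map (\<lambda>i. odd (((\<lambda>c. c div 2) ^^ i) (snd z))) [0..<fst z])"
    by (intro pt PT_comp2[where F = "\<lambda>i c. ((\<lambda>c :: nat. c div 2) ^^ i) c", OF p])
  then show "PT (\<lambda>z. dig (fst z) (snd z))" by (simp add: e dig_def)
qed

definition lk :: "bool list \<Rightarrow> nat \<Rightarrow> bool" where
  "lk u i = (case drop i u of [] \<Rightarrow> False | b # _ \<Rightarrow> b)"

lemma PT_lk [pt]: "PT f \<Longrightarrow> PT g \<Longrightarrow> PT (\<lambda>x. lk (f x) (g x))"
  unfolding lk_def by (intro pt)

definition nthl :: "'a list list \<Rightarrow> nat \<Rightarrow> 'a list" where
  "nthl u i = (case drop i u of [] \<Rightarrow> [] | b # _ \<Rightarrow> b)"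

lemma PT_nthl [pt]: "PT f \<Longrightarrow> PT g \<Longrightarrow> PT (\<lambda>x. nthl (f x) (g x))"
  unfolding nthl_def by (intro pt)

text \<open>Horner evaluation at \<open>a\<close>, modulo \<open>Suc P\<close>, of the polynomial
  whose coefficients are the bits: a Reed--Solomon symbol. The appended \<open>True\<close> makes
  the polynomial monic, so that strings of different lengths also yield different
  polynomials.\<close>

definition rs :: "nat \<Rightarrow> bool list \<Rightarrow> nat \<Rightarrow> nat" where
  "rs P x a = foldr (\<lambda>b acc. ((if b then 1 else 0) + a * acc) mod Suc P) (x @ [True]) 0"

lemma PT_rs [pt]: "PT f \<Longrightarrow> PT g \<Longrightarrow> PT h \<Longrightarrow> PT (\<lambda>x. rs (f x) (g x) (h x))"
proof (rule PT_comp3[where F = rs])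
  show "PT (\<lambda>z. rs (fst z) (fst (snd z)) (snd (snd z)))" unfolding rs_def
  proof (rule PT_foldr[where h = "\<lambda>z. 2 * sz (fst z) + 1"])
    fix v :: "nat \<times> bool list \<times> nat" and x :: bool and t :: nat
    have "((if x then 1 else 0) + snd (snd v) * t) mod Suc (fst v) \<le> fst v"
      by (metis less_Suc_eq_le mod_less_divisor zero_less_Suc)
    moreover have "fst v \<le> sz v" by (cases v) simp
    ultimately show "sz (((if x then 1 else 0) + snd (snd v) * t) mod Suc (fst v)) \<le> sz t + (2 * sz (fst (v, x)) + 1)"
      by (simp only: sz_simps fst_conv)
  qed (intro pt pbd_intros)+
qed

text \<open>The parity of the bitwise product of \<open>c\<close>, in binary, with \<open>h\<close>:
  a bit of a Hadamard codeword.\<close>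

definition had :: "nat \<Rightarrow> bool list \<Rightarrow> bool" where
  "had c h = snd (fold (\<lambda>b s. (fst s div 2, snd s \<noteq> (b \<and> odd (fst s)))) h (c, False))"

lemma PT_had [pt]: "PT f \<Longrightarrow> PT g \<Longrightarrow> PT (\<lambda>x. had (f x) (g x))"
proof (rule PT_comp2[where F = had])
  show "PT (\<lambda>z. had (fst z) (snd z))" unfolding had_def
  proof (rule PT_snd, rule PT_fold[where h = "\<lambda>z. 2"])
    show "sz (fst t div 2, snd t \<noteq> (x \<and> odd (fst t))) \<le> sz t + 2" for t :: "nat \<times> bool" and x
    proof (cases t)
      case (Pair a b)
      have "2 * (a div 2) \<le> 2 * a" by simp
      then show ?thesis unfolding Pair sz_simps fst_conv snd_conv by (auto split: if_splits)
    qed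
  qed (intro pt pbd_intros)+
qed

text \<open>Reed--Solomon concatenated with Hadamard: the first \<open>s\<close> bits of a position
  choose the evaluation point, the others a position in the Hadamard word of that symbol.\<close>

definition cw :: "nat \<Rightarrow> nat \<Rightarrow> nat \<Rightarrow> bool list \<Rightarrow> bool list \<Rightarrow> bool" where
  "cw N s P x v = had (rs P x (bn N (take s v))) (drop s v)"

lemma PT_cw [pt]: "PT f1 \<Longrightarrow> PT f2 \<Longrightarrow> PT f3 \<Longrightarrow> PT f4 \<Longrightarrow> PT f5 \<Longrightarrow>
    PT (\<lambda>x. cw (f1 x) (f2 x) (f3 x) (f4 x) (f5 x))"
  unfolding cw_def by (intro pt)

definition xorv :: "bool list \<Rightarrow> bool list \<Rightarrow> bool list" where
  "xorv a b = map (\<lambda>p. fst p \<noteq> snd p) (zip a b)"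

text \<open>A linear combination over the two-element field: the bits of \<open>j\<close> select the
  columns in \<open>A\<close> that are added up.\<close>

definition cvec :: "nat \<Rightarrow> nat \<Rightarrow> bool list list list \<Rightarrow> bool list \<Rightarrow> bool list list" where
  "cvec l k A j = fold (\<lambda>p acc. if fst p then map (\<lambda>q. xorv (fst q) (snd q)) (zip acc (snd p)) else acc)
     (zip j A) (replicate l (replicate k False))"

text \<open>The bound involves the second list only. With the accumulator as first list, a fold then
  grows additively, as \<open>PT_fold\<close> demands.\<close>

lemma sz_map_zip:
  assumes "\<And>a b. sz (F (a, b)) \<le> 3 * sz b"
  shows "sz (map F (zip as bs)) \<le> 3 * sz bs"
proof (induction as arbitrary: bs)
  case (Cons a as)
  show ?case
  proof (cases bs)
    case (Cons b bs')
    then show ?thesis using assms[of a b] Cons.IH[of bs'] by simp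
  qed (use sz_ge1[of bs] in simp)
qed (use sz_ge1 in \<open>auto intro: order.trans[of _ "sz _"]\<close>)

lemma PT_cvec [pt]: "PT f1 \<Longrightarrow> PT f2 \<Longrightarrow> PT f3 \<Longrightarrow> PT f4 \<Longrightarrow> PT (\<lambda>x. cvec (f1 x) (f2 x) (f3 x) (f4 x))"
proof (rule PT_comp4[where F = cvec])
  have 1: "sz (xorv a b) \<le> 3 * sz b" for a b
    unfolding xorv_def by (rule sz_map_zip) auto
  have 2: "sz (map (\<lambda>q. xorv (fst q) (snd q)) (zip a b)) \<le> 3 * sz b" for a b
    by (rule sz_map_zip) (simp add: 1)
  show "PT (\<lambda>z. cvec (fst z) (fst (snd z)) (fst (snd (snd z))) (snd (snd (snd z))))"
    unfolding cvec_def
  proof (rule PT_fold[where h = "\<lambda>z. 3 * sz (snd z)"])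
    show "sz (if fst p then map (\<lambda>q. xorv (fst q) (snd q)) (zip t (snd p)) else t) \<le> sz t + 3 * sz (snd (v, p))"
      for v :: "nat \<times> nat \<times> bool list list list \<times> bool list" and p t
      using 2[of t "snd p"] by (auto simp: sz_fst_snd[of p])
  qed (unfold xorv_def, (intro pt pbd_intros)+)
qed

text \<open>The block with number \<open>fst p\<close> owns a segment of \<open>l * q\<close> seed
  cells, in which coordinate \<open>fst r\<close> chooses one among \<open>q\<close> cells of its
  own; so lists of different blocks are disjoint.\<close>

definition design :: "nat \<Rightarrow> nat \<Rightarrow> nat \<Rightarrow> nat \<Rightarrow> nat list \<Rightarrow> bool list list list \<Rightarrow> nat list list" where
  "design N l k q es A = concat (map (\<lambda>p. map (\<lambda>j.
       map (\<lambda>r. (fst p * l + fst r) * q + bn N (snd r)) (zip [0..<l] (cvec l k A (dig (snd p) j))))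
     [0..<pw N (snd p)]) (zip [0..<length es] es))"

lemma PT_design [pt]:
  assumes "PT f1" "PT f2" "PT f3" "PT f4" "PT f5" "PT f6"
  shows "PT (\<lambda>x. design (f1 x) (f2 x) (f3 x) (f4 x) (f5 x) (f6 x))"
proof -
  have "PT (\<lambda>z. design (fst z) (fst (snd z)) (fst (snd (snd z))) (fst (snd (snd (snd z))))
     (fst (snd (snd (snd (snd z))))) (snd (snd (snd (snd (snd z))))))"
    unfolding design_def by (intro pt)
  from PT_comp[OF this, of "\<lambda>x. (f1 x, f2 x, f3 x, f4 x, f5 x, f6 x)"] assms show ?thesis
    by (simp add: PT_pair)
qed

lemma PT_update [pt]:
  fixes f :: "'v::enc \<Rightarrow> 'a::enc list"
  assumes "PT f" "PT g" "PT h" shows "PT (\<lambda>x. (f x)[g x := h x])"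
proof (rule PT_comp3[where F = "\<lambda>a b c. a[b := c]", OF _ assms])
  have e: "take i u @ (case drop i u of [] \<Rightarrow> [] | _ # r \<Rightarrow> b # r) = u[i := b]" for i b and u :: "'a list"
  proof (cases "i < length u")
    case True
    then show ?thesis by (simp add: upd_conv_take_nth_drop Cons_nth_drop_Suc[symmetric])
  qed (simp add: list_update_beyond)
  have "PT (\<lambda>z :: 'a list \<times> nat \<times> 'a. take (fst (snd z)) (fst z) @
     (case drop (fst (snd z)) (fst z) of [] \<Rightarrow> [] | _ # r \<Rightarrow> snd (snd z) # r))" by (intro pt)
  then show "PT (\<lambda>z :: 'a list \<times> nat \<times> 'a. (fst z)[fst (snd z) := snd (snd z)])" by (simp add: e)
qed

definition sub :: "bool list \<Rightarrow> nat list \<Rightarrow> bool list \<Rightarrow> bool list" where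
  "sub u S v = fold (\<lambda>p u. u[fst p := snd p]) (zip S v) u"

lemma PT_sub [pt]: "PT f \<Longrightarrow> PT g \<Longrightarrow> PT h \<Longrightarrow> PT (\<lambda>x. sub (f x) (g x) (h x))"
proof (rule PT_comp3[where F = sub])
  have "sz (u[i := b]) \<le> sz u + 2" for u :: "bool list" and i b
    by (induction u arbitrary: i) (auto split: nat.splits)
  then show "PT (\<lambda>z. sub (fst z) (fst (snd z)) (snd (snd z)))" unfolding sub_def
    by (intro PT_fold[where h = "\<lambda>_. 2"]) (intro pt pbd_intros | simp)+
qed

definition rd :: "bool list \<Rightarrow> nat list \<Rightarrow> bool list" where "rd u S = map (lk u) S"

lemma PT_rd [pt]: "PT f \<Longrightarrow> PT g \<Longrightarrow> PT (\<lambda>x. rd (f x) (g x))"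
  by (rule PT_comp2[where F = rd]) (unfold rd_def, intro pt)

definition nw :: "nat \<Rightarrow> nat \<Rightarrow> nat \<Rightarrow> nat list list \<Rightarrow> bool list \<Rightarrow> bool list \<Rightarrow> bool list" where
  "nw N s P Ss x u = map (\<lambda>S. cw N s P x (rd u S)) Ss"

lemma PT_nw [pt]:
  assumes "PT f1" "PT f2" "PT f3" "PT f4" "PT f5" "PT f6"
  shows "PT (\<lambda>x. nw (f1 x) (f2 x) (f3 x) (f4 x) (f5 x) (f6 x))"
proof -
  have "PT (\<lambda>z. nw (fst z) (fst (snd z)) (fst (snd (snd z))) (fst (snd (snd (snd z))))
     (fst (snd (snd (snd (snd z))))) (snd (snd (snd (snd (snd z))))))"
    unfolding nw_def by (intro pt)
  from PT_comp[OF this, of "\<lambda>x. (f1 x, f2 x, f3 x, f4 x, f5 x, f6 x)"] assms show ?thesis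
    by (simp add: PT_pair)
qed

lemma PT_remdups [pt]:
  fixes f :: "'v::enc \<Rightarrow> bool list list"
  assumes "PT f" shows "PT (\<lambda>x. remdups (f x))"
proof (rule PT_comp[where f = remdups, OF _ assms])
  have e: "foldr (\<lambda>x acc. if filter (\<lambda>y. y = x) acc = [] then x # acc else acc) xs [] = remdups xs"
    for xs :: "bool list list"
  proof (induction xs)
    case (Cons x xs)
    have "filter (\<lambda>y. y = x) (remdups xs) = [] \<longleftrightarrow> x \<notin> set xs" by (auto simp: filter_empty_conv)
    then show ?case using Cons by simp
  qed simp
  have "PT (\<lambda>v. foldr (\<lambda>x acc. if filter (\<lambda>y. y = x) acc = [] then x # acc else acc) v ([] :: bool list list))"
    by (rule PT_foldr[where h = "\<lambda>z. sz (snd z) + 1"]) (intro pt pbd_intros | simp)+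
  then show "PT (remdups :: bool list list \<Rightarrow> _)" by (simp add: e)
qed

definition allv :: "nat \<Rightarrow> nat \<Rightarrow> bool list list" where
  "allv N l = map (dig l) [0..<pw N l]"

lemma PT_allv [pt]: "PT f \<Longrightarrow> PT g \<Longrightarrow> PT (\<lambda>x. allv (f x) (g x))"
  by (rule PT_comp2[where F = allv]) (unfold allv_def, intro pt)

text \<open>The compressed string. With the seed fixed outside the list of index \<open>I\<close>,
  an earlier output can query the code of \<open>x\<close> only at the positions enumerated here.
  Neither the enumeration nor the removal of duplicates depends on \<open>x\<close>, so equal
  results mean equal answers to all these queries.\<close>

definition pf :: "nat \<Rightarrow> nat \<Rightarrow> nat \<Rightarrow> nat \<Rightarrow> nat list list \<Rightarrow> nat \<Rightarrow> bool list \<Rightarrow> bool list \<Rightarrow> bool list" where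
  "pf N s P l Ss I u x = map (cw N s P x) (remdups (concat (map (\<lambda>S.
      map (\<lambda>v. rd (sub u (nthl Ss I) v) S) (allv N l)) (take I Ss))))"

lemma PT_pf [pt]:
  assumes "PT f1" "PT f2" "PT f3" "PT f4" "PT f5" "PT f6" "PT f7" "PT f8"
  shows "PT (\<lambda>x. pf (f1 x) (f2 x) (f3 x) (f4 x) (f5 x) (f6 x) (f7 x) (f8 x))"
proof -
  have "PT (\<lambda>z. pf (fst z) (fst (snd z)) (fst (snd (snd z))) (fst (snd (snd (snd z))))
     (fst (snd (snd (snd (snd z))))) (fst (snd (snd (snd (snd (snd z)))))) (fst (snd (snd (snd (snd (snd (snd z)))))))
     (snd (snd (snd (snd (snd (snd (snd z))))))))"
    unfolding pf_def by (intro pt)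
  from PT_comp[OF this, of "\<lambda>x. (f1 x, f2 x, f3 x, f4 x, f5 x, f6 x, f7 x, f8 x)"] assms show ?thesis
    by (simp add: PT_pair)
qed

lemma PT_takeWhile [pt]:
  assumes "PT (\<lambda>z. P (fst z) (snd z))" "PT l" shows "PT (\<lambda>v. takeWhile (P v) (l v))"
proof -
  have "PT (\<lambda>v. rev (snd (fold (\<lambda>x s. if fst s \<and> P v x then (True, x # snd s) else (False, snd s)) (l v) (True, []))))"
  proof (intro PT_rev PT_snd PT_fold[where h = "\<lambda>z. sz (snd z) + 3"])
    show "PT (\<lambda>z. if fst (snd (snd z)) \<and> P (fst (snd z)) (fst z) then (True, fst z # snd (snd (snd z)))
       else (False, snd (snd (snd z))))"
      by (intro pt PT_comp2[OF assms(1)])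
  qed (intro pt assms pbd_intros | simp add: sz_fst_snd)+
  moreover have "rev (snd (fold (\<lambda>x s. if fst s \<and> P v x then (True, x # snd s) else (False, snd s)) xs (True, t)))
    = rev t @ takeWhile (P v) xs" for v xs t
  proof (induction xs arbitrary: t)
    case (Cons x xs)
    have "fold (\<lambda>x s. if fst s \<and> P v x then (True, x # snd s) else (False, snd s)) ys (False, t) = (False, t)" for ys
      by (induction ys) auto
    then show ?case using Cons by simp
  qed simp
  ultimately show ?thesis by simp
qed

subsection \<open>Simulation of the description method\<close>

type_synonym zipper = "nat list \<times> nat \<times> nat list"
type_synonym entry = "nat \<times> nat list \<times> nat \<times> (nat \<times> nat) list"

definition hd0 :: "nat list \<Rightarrow> nat" where "hd0 l = (case l of [] \<Rightarrow> 0 | x # _ \<Rightarrow> x)"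

text \<open>Directions are shifted by one to be natural numbers: \<open>0\<close> is left and
  \<open>2\<close> is right. On the left the zipper relies on its padding, on the right blanks are
  supplied by \<open>hd0\<close>.\<close>

definition zupd :: "zipper \<Rightarrow> nat \<times> nat \<Rightarrow> zipper" where
  "zupd z a = (if snd a = 0 then (tl (fst z), hd0 (fst z), fst a # snd (snd z))
     else if snd a = 1 then (fst z, fst a, snd (snd z))
     else (fst a # fst z, hd0 (snd (snd z)), tl (snd (snd z))))"

text \<open>Without a matching entry the configuration stays as it is, so iterating beyond the
  halting time does no harm.\<close>

definition zstep :: "entry list \<Rightarrow> nat \<times> zipper list \<Rightarrow> nat \<times> zipper list" where
  "zstep tab c = fold (\<lambda>ent res. if fst ent = fst c \<and> fst (snd ent) = map (\<lambda>z. fst (snd z)) (snd c)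
     then (fst (snd (snd ent)), map (\<lambda>p. zupd (fst p) (snd p)) (zip (snd c) (snd (snd (snd ent))))) else res) tab c"

definition zinit :: "nat \<Rightarrow> bool list \<Rightarrow> zipper" where
  "zinit Z x = (replicate Z 0, hd0 (map (\<lambda>b. if b then 2 else 1) x), tl (map (\<lambda>b. if b then 2 else 1) x))"

definition zout :: "nat \<Rightarrow> zipper list \<Rightarrow> bool list" where
  "zout Z ts = (case rev ts of [] \<Rightarrow> [] | z # _ \<Rightarrow>
     map (\<lambda>s. s = 2) (takeWhile (\<lambda>s. s = 1 \<or> s = 2) (drop Z (rev (fst z) @ fst (snd z) # snd (snd z)))))"

text \<open>One number \<open>N\<close> serves as padding, as number of steps and as offset of cell
  \<open>0\<close>: in \<open>N\<close> steps the head cannot pass the left end of the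
  padding.\<close>

definition zrun :: "entry list \<Rightarrow> nat \<Rightarrow> nat \<Rightarrow> bool list \<Rightarrow> bool list \<Rightarrow> bool list" where
  "zrun tab w N x y = zout N (snd ((zstep tab ^^ N)
     (0, zinit N x # zinit N y # replicate w (replicate N 0, 0, []))))"

lemma PT_hd0 [pt]: "PT f \<Longrightarrow> PT (\<lambda>x. hd0 (f x))" unfolding hd0_def by (intro pt)

lemma PT_zupd [pt]: "PT f \<Longrightarrow> PT g \<Longrightarrow> PT (\<lambda>x. zupd (f x) (g x))"
  unfolding zupd_def by (intro pt)

lemma PT_zinit [pt]: "PT f \<Longrightarrow> PT g \<Longrightarrow> PT (\<lambda>x. zinit (f x) (g x))"
  unfolding zinit_def by (intro pt)

lemma PT_zout [pt]: "PT f \<Longrightarrow> PT g \<Longrightarrow> PT (\<lambda>x. zout (f x) (g x))"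
  by (rule PT_comp2[where F = zout]) (unfold zout_def, intro pt)

lemma PT_zstep: "PT (\<lambda>c. zstep tab c)"
  unfolding zstep_def
proof (rule PT_fold[where h = "\<lambda>z. sz (fst (snd (snd (snd z))), map (\<lambda>p. zupd (fst p) (snd p)) (zip (snd (fst z)) (snd (snd (snd (snd z))))))"])
  show "pbd (\<lambda>z. sz (fst (snd (snd (snd z))), map (\<lambda>p. zupd (fst p) (snd p)) (zip (snd (fst z)) (snd (snd (snd (snd z)))))))"
    by (rule PT_size) (intro pt)
qed (intro pt | simp)+

lemma sz_zupd: "sz (zupd z a) \<le> sz z + 3 * sz a"
proof -
  have h: "sz (tl l) + sz (hd0 l) \<le> sz l + 1" for l by (cases l) (auto simp: hd0_def)
  obtain l c r where z: "z = (l, c, r)" by (cases z)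
  obtain w d where a: "a = (w, d)" by (cases a)
  show ?thesis using h[of l] h[of r] by (auto simp: z a zupd_def)
qed

text \<open>New data come from an entry of the fixed table, so a step adds at most a constant and
  \<open>N\<close> steps stay polynomial.\<close>

lemma sz_zstep: "sz (zstep tab c) \<le> sz c + 3 * sz tab"
proof -
  have 1: "sz (map (\<lambda>p. zupd (fst p) (snd p)) (zip ts as)) \<le> sz ts + 3 * sz as" for ts as
  proof (induction ts arbitrary: as)
    case (Cons z ts)
    then show ?case
    proof (cases as)
      case (Cons a as')
      then show ?thesis using Cons.IH[of as'] \<open>\<And>as. sz (map (\<lambda>p. zupd (fst p) (snd p)) (zip ts as)) \<le> sz ts + 3 * sz as\<close>[of as'] sz_zupd[of z a] by simp
    qed simp
  qed simp
  define G where "G ent = (fst (snd (snd ent)), map (\<lambda>p. zupd (fst p) (snd p)) (zip (snd c) (snd (snd (snd ent)))))" for ent :: entry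
  have "sz (G ent) \<le> sz c + 3 * sz ent" for ent
    using 1[of "snd c" "snd (snd (snd ent))"] by (cases ent; cases c) (auto simp: G_def)
  then have 2: "sz (G ent) \<le> sz c + 3 * sz tab" if "ent \<in> set tab" for ent
    using sz_elem[OF that] by (meson add_left_mono le_trans less_imp_le mult_le_mono2)
  have "zstep tab c = c \<or> (\<exists>ent\<in>set tab. zstep tab c = G ent)"
  proof -
    have "fold (\<lambda>ent res. if Q ent then G ent else res) xs t = t \<or>
      (\<exists>ent\<in>set xs. fold (\<lambda>ent res. if Q ent then G ent else res) xs t = G ent)" for Q xs t
    proof (induction xs arbitrary: t)
      case (Cons x xs)
      show ?case using Cons[of "if Q x then G x else t"] by (auto split: if_splits)
    qed simp
    from this[of "\<lambda>ent. fst ent = fst c \<and> fst (snd ent) = map (\<lambda>z. fst (snd z)) (snd c)" tab c]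
    show ?thesis unfolding zstep_def G_def[symmetric] .
  qed
  then show ?thesis using 2 by auto
qed

lemma PT_zrun [pt]: "PT f \<Longrightarrow> PT g \<Longrightarrow> PT h \<Longrightarrow> PT (\<lambda>x. zrun tab w (f x) (g x) (h x))"
proof (rule PT_comp3[where F = "zrun tab w"])
  show "PT (\<lambda>z. zrun tab w (fst z) (fst (snd z)) (snd (snd z)))" unfolding zrun_def
  proof (intro pt PT_funpow[where h = "\<lambda>_. 3 * sz tab" and F = "\<lambda>_. zstep tab"])
    show "PT (\<lambda>z. zstep tab (snd z))" by (rule PT_comp[OF PT_zstep]) (intro pt)
  qed (auto intro!: pbd_intros sz_zstep)
qed

subsection \<open>Compression and verification\<close>

text \<open>The state consists of a flag for the delimiter, the pending half of a doubled bit, and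
  the two parts in reverse; the first unequal couple is the delimiter.\<close>

definition unp :: "bool list \<Rightarrow> bool list \<times> bool list" where
  "unp y = (let st = fold (\<lambda>c st. if fst st then (True, [], fst (snd (snd st)), c # snd (snd (snd st)))
       else (case fst (snd st) of [] \<Rightarrow> (False, [c], snd (snd st))
         | d # _ \<Rightarrow> if d = c then (False, [], c # fst (snd (snd st)), snd (snd (snd st)))
            else (True, [], snd (snd st)))) y (False, [], [], [])
     in (rev (fst (snd (snd st))), rev (snd (snd (snd st)))))"

lemma PT_unp [pt]: "PT f \<Longrightarrow> PT (\<lambda>x. unp (f x))"
proof (rule PT_comp[where f = unp])
  show "PT unp" unfolding unp_def Let_def
    by (intro pt PT_fold[where h = "\<lambda>_. 10"])
      ((intro pt pbd_intros)+ | auto simp: sz_fst_snd split: list.splits)+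
qed

type_synonym advice = "nat \<times> nat \<times> nat \<times> nat \<times> nat \<times> nat list \<times> bool list list list \<times>
  bool list \<times> bool list \<times> bool list \<times> bool list \<times> bool list \<times> bool list \<times> bool list \<times> nat \<times> nat"

text \<open>What is read or guessed at one tick of the clock: a random bit, a cell of the
  certificates and a cell of the candidate string. A guessed cell has a flag that can mark its bit
  as absent, so strings of any length up to the clock can be guessed.\<close>

type_synonym tick = "bool \<times> (bool \<times> bool) \<times> (bool \<times> bool)"

abbreviation ad_rest :: "advice \<Rightarrow> bool list list list \<times>
  bool list \<times> bool list \<times> bool list \<times> bool list \<times> bool list \<times> bool list \<times> bool list \<times> nat \<times> nat"
  where "ad_rest ad \<equiv> snd (snd (snd (snd (snd (snd ad)))))"

text \<open>The components of an advice are, in this order: the logarithm of the clock, the number of bits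
  of an evaluation point, the length of a code position, the width and number of the design values,
  the block exponents, the columns of the design, the hybrid index, the seed, the modulus minus one,
  the length, evaluation point and value of the fingerprint, the threshold, and the logarithms of the
  number and of the length of the samples.\<close>

abbreviation "ad_s ad \<equiv> fst (snd (ad :: advice))"
abbreviation "ad_l ad \<equiv> fst (snd (snd (ad :: advice)))"
abbreviation "ad_k ad \<equiv> fst (snd (snd (snd (ad :: advice))))"
abbreviation "ad_q ad \<equiv> fst (snd (snd (snd (snd (ad :: advice)))))"
abbreviation "ad_es ad \<equiv> fst (snd (snd (snd (snd (snd (ad :: advice))))))"
abbreviation "ad_A ad \<equiv> fst (ad_rest ad)"
abbreviation "ad_I ad \<equiv> fst (snd (ad_rest ad))"
abbreviation "ad_u ad \<equiv> fst (snd (snd (ad_rest ad)))"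
abbreviation "ad_P ad \<equiv> fst (snd (snd (snd (ad_rest ad))))"
abbreviation "ad_len ad \<equiv> fst (snd (snd (snd (snd (ad_rest ad)))))"
abbreviation "ad_pt ad \<equiv> fst (snd (snd (snd (snd (snd (ad_rest ad))))))"
abbreviation "ad_fp ad \<equiv> fst (snd (snd (snd (snd (snd (snd (ad_rest ad)))))))"
abbreviation "ad_th ad \<equiv> fst (snd (snd (snd (snd (snd (snd (snd (ad_rest ad))))))))"
abbreviation "ad_t ad \<equiv> fst (snd (snd (snd (snd (snd (snd (snd (snd (ad_rest ad)))))))))"
abbreviation "ad_c ad \<equiv> snd (snd (snd (snd (snd (snd (snd (snd (snd (ad_rest ad)))))))))"

definition ad_Ss :: "nat \<Rightarrow> advice \<Rightarrow> nat list list" where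
  "ad_Ss N ad = design N (ad_l ad) (ad_k ad) (ad_q ad) (ad_es ad) (ad_A ad)"

definition compr :: "nat \<Rightarrow> advice \<Rightarrow> bool list \<Rightarrow> bool list" where
  "compr N ad x = pf N (ad_s ad) (bn N (ad_P ad)) (ad_l ad) (ad_Ss N ad) (bn N (ad_I ad)) (ad_u ad) x"

text \<open>The hybrid string of one sample: \<open>l\<close> random bits enter the seed at the list
  of index \<open>I\<close>, the outputs up to and including that index come from \<open>x\<close>,
  and the others are replaced by random bits.\<close>

definition target :: "nat \<Rightarrow> nat \<Rightarrow> nat \<Rightarrow> nat \<Rightarrow> nat list list \<Rightarrow> nat \<Rightarrow> bool list \<Rightarrow> bool list \<Rightarrow> bool list \<Rightarrow> bool list" where
  "target N s P l Ss I u x rc = take (Suc I) (nw N s P Ss x (sub u (nthl Ss I) (take l rc))) @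
     drop (Suc I) (take (length Ss) (drop l rc))"

definition cert_z :: "nat \<Rightarrow> (bool \<times> bool) list \<Rightarrow> bool list" where
  "cert_z d gc = map snd (filter fst (drop d gc))"

text \<open>The slack \<open>4\<close> pays for descriptions of all smaller lengths, for the two
  readings of each, and for a density of at most one quarter.\<close>

definition sample_ok :: "entry list \<Rightarrow> nat \<Rightarrow> nat \<Rightarrow> advice \<Rightarrow> bool list \<Rightarrow> bool list \<Rightarrow> bool list \<Rightarrow> (bool \<times> bool) list \<Rightarrow> bool" where
  "sample_ok tab w N ad b x rc gc \<longleftrightarrow>
     length (cert_z (length (ad_u ad)) gc) + length (ad_u ad) + 4 \<le> length (ad_Ss N ad) \<and>
     (nw N (ad_s ad) (bn N (ad_P ad)) (ad_Ss N ad) (cert_z (length (ad_u ad)) gc) (map snd (take (length (ad_u ad)) gc)) =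
        target N (ad_s ad) (bn N (ad_P ad)) (ad_l ad) (ad_Ss N ad) (bn N (ad_I ad)) (ad_u ad) x rc \<or>
      nw N (ad_s ad) (bn N (ad_P ad)) (ad_Ss N ad) (zrun tab w N (cert_z (length (ad_u ad)) gc) b) (map snd (take (length (ad_u ad)) gc)) =
        target N (ad_s ad) (bn N (ad_P ad)) (ad_l ad) (ad_Ss N ad) (bn N (ad_I ad)) (ad_u ad) x rc)"

definition chunk :: "nat \<Rightarrow> nat \<Rightarrow> 'a list \<Rightarrow> 'a list" where
  "chunk C i xs = take C (drop (i * C) xs)"

definition accepts :: "entry list \<Rightarrow> nat \<Rightarrow> nat \<Rightarrow> advice \<Rightarrow> bool list \<Rightarrow> bool list \<Rightarrow> bool list \<Rightarrow> bool list \<Rightarrow> (bool \<times> bool) list \<Rightarrow> bool" where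
  "accepts tab w N ad b p x R G \<longleftrightarrow>
     length x = bn N (ad_len ad) \<and> compr N ad x = p \<and>
     dig (length (ad_fp ad)) (rs (bn N (ad_P ad)) x (bn N (ad_pt ad))) = ad_fp ad \<and>
     bn N (ad_th ad) \<le> length (filter (\<lambda>i. sample_ok tab w N ad b x (chunk (pw N (ad_c ad)) i R) (chunk (pw N (ad_c ad)) i G))
        [0..<pw N (ad_t ad)])"

definition guess_x :: "tick list \<Rightarrow> bool list" where
  "guess_x t = map snd (filter fst (map (\<lambda>q. snd (snd q)) t))"

definition verify :: "entry list \<Rightarrow> nat \<Rightarrow> nat \<Rightarrow> advice \<Rightarrow> bool list \<Rightarrow> tick list \<Rightarrow> bool list list" where
  "verify tab w N ad y t = (if accepts tab w N ad (fst (unp y)) (snd (unp y)) (guess_x t) (map fst t) (map (\<lambda>q. fst (snd q)) t)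
     then [guess_x t] else [])"

lemma PT_ad_Ss [pt]: "PT f \<Longrightarrow> PT g \<Longrightarrow> PT (\<lambda>x. ad_Ss (f x) (g x))"
  unfolding ad_Ss_def by (intro pt)

lemma PT_compr [pt]: "PT f \<Longrightarrow> PT g \<Longrightarrow> PT h \<Longrightarrow> PT (\<lambda>x. compr (f x) (g x) (h x))"
  unfolding compr_def by (intro pt)

lemma PT_target [pt]:
  assumes "PT f1" "PT f2" "PT f3" "PT f4" "PT f5" "PT f6" "PT f7" "PT f8" "PT f9"
  shows "PT (\<lambda>x. target (f1 x) (f2 x) (f3 x) (f4 x) (f5 x) (f6 x) (f7 x) (f8 x) (f9 x))"
  unfolding target_def by (intro pt assms)

lemma PT_cert_z [pt]: "PT f \<Longrightarrow> PT g \<Longrightarrow> PT (\<lambda>x. cert_z (f x) (g x))"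
  by (rule PT_comp2[where F = cert_z]) (unfold cert_z_def, intro pt)

lemma PT_sample_ok [pt]:
  assumes "PT f1" "PT f2" "PT f3" "PT f4" "PT f5" "PT f6"
  shows "PT (\<lambda>x. sample_ok tab w (f1 x) (f2 x) (f3 x) (f4 x) (f5 x) (f6 x))"
  unfolding sample_ok_def by (intro pt assms)

lemma PT_chunk [pt]: "PT f \<Longrightarrow> PT g \<Longrightarrow> PT h \<Longrightarrow> PT (\<lambda>x. chunk (f x) (g x) (h x))"
  unfolding chunk_def by (intro pt)

lemma PT_accepts [pt]:
  assumes "PT f1" "PT f2" "PT f3" "PT f4" "PT f5" "PT f6" "PT f7"
  shows "PT (\<lambda>x. accepts tab w (f1 x) (f2 x) (f3 x) (f4 x) (f5 x) (f6 x) (f7 x))"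
proof -
  have "PT (\<lambda>z. accepts tab w (fst z) (fst (snd z)) (fst (snd (snd z))) (fst (snd (snd (snd z))))
     (fst (snd (snd (snd (snd z))))) (fst (snd (snd (snd (snd (snd z)))))) (snd (snd (snd (snd (snd (snd z)))))))"
    unfolding accepts_def by (intro pt)
  from PT_comp[OF this, of "\<lambda>x. (f1 x, f2 x, f3 x, f4 x, f5 x, f6 x, f7 x)"] assms show ?thesis
    by (simp add: PT_pair)
qed

lemma PT_guess_x [pt]: "PT f \<Longrightarrow> PT (\<lambda>x. guess_x (f x))"
  by (rule PT_comp[where f = guess_x]) (unfold guess_x_def, intro pt)

lemma PT_verify: "PT (\<lambda>z. verify tab w (fst (snd z)) (fst (snd (snd z))) (snd (snd (snd z))) (rev (fst z)))"
  unfolding verify_def by (intro pt)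

lemma PT_compr': "PT (\<lambda>z. compr (fst z) (fst (snd z)) (snd (snd z)))"
  by (intro pt)

section \<open>Input, output and nondeterminism\<close>

lemma reads_TP_in: "i < length is \<Longrightarrow> reads (TP is ss out) ! i = tape_of (fst (is ! i)) (snd (is ! i))"
  by (simp add: reads_def TP_def nth_append itp_def)

lemma TP_upd_in: "i < length is \<Longrightarrow> (TP is ss out)[i := itp x] = TP (is[i := x]) ss out"
  by (simp add: TP_def list_update_append map_update)

lemma run_Mv_in:
  assumes "i < length is" "length is = m" "length ss = 4"
  shows "run (m + 5) (Mv i d) (TP is ss out) (TP (is[i := (fst (is ! i), snd (is ! i) + d)]) ss out) 1"
proof -
  have n: "TP is ss out ! i = itp (is ! i)" using assms by (simp add: TP_def nth_append)
  have "run (m + 5) (Mv i d) (TP is ss out) ((TP is ss out)[i := (fst (TP is ss out ! i), snd (TP is ss out ! i) + d)]) 1"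
    by (rule run_Mv) (use assms in \<open>auto intro: good_TP\<close>)
  moreover have "(fst (TP is ss out ! i), snd (TP is ss out ! i) + d) = itp (fst (is ! i), snd (is ! i) + d)"
    unfolding n by (simp add: itp_def)
  ultimately show ?thesis using TP_upd_in[OF assms(1)] by simp
qed

lemma run_seek:
  assumes "i < length is" "length is = m" "length ss = 4" "fst (is ! i) = x" "snd (is ! i) = int p" "p \<le> length x"
  shows "run (m + 5) (Wh i 0 (Mv i 1)) (TP is ss out) (TP (is[i := (x, int (length x))]) ss out) (2 * (length x - p) + 1)"
  using assms(1,2,4-)
proof (induction "length x - p" arbitrary: p "is")
  case 0
  have eq: "is[i := (x, int (length x))] = is" using 0 by (simp add: list_update_same_conv prod_eq_iff)
  have "run (m + 5) (Wh i 0 (Mv i 1)) (TP is ss out) (TP is ss out) 1"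
    by (rule run_Wh_end) (use 0 assms(3) in \<open>auto simp: good_TP reads_TP_in tape_of_def\<close>)
  then show ?case using 0 eq by simp
next
  case (Suc k)
  let ?is = "is[i := (x, int (Suc p))]"
  have 1: "run (m + 5) (Mv i 1) (TP is ss out) (TP ?is ss out) 1"
    using run_Mv_in[OF Suc.prems(1,2) assms(3), of 1 out] Suc.prems by (simp add: add.commute)
  have 2: "run (m + 5) (Wh i 0 (Mv i 1)) (TP ?is ss out) (TP (?is[i := (x, int (length x))]) ss out) (2 * (length x - Suc p) + 1)"
    by (rule Suc.hyps(1)) (use Suc in auto)
  have "run (m + 5) (Wh i 0 (Mv i 1)) (TP is ss out) (TP (?is[i := (x, int (length x))]) ss out) (1 + (2 * (length x - Suc p) + 1) + 1)"
    by (rule run_Wh_step[OF _ _ 1 2]) (use Suc assms(3) in \<open>auto simp: good_TP reads_TP_in tape_of_def\<close>)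
  then show ?case by (rule back_subst) (use Suc in \<open>auto elim: run_mono\<close>)
qed

text \<open>Reading an input tape from right to left, so that its first bit ends on top of the stack.\<close>

definition load :: "nat \<Rightarrow> nat \<Rightarrow> bool list \<Rightarrow> bool list \<Rightarrow> prog" where
  "load m i t f = Sq (Wh i 0 (Mv i 1)) (Sq (Mv i (-1))
     (Wh i 0 (Sq (If i 2 (pushes m t) (pushes m f)) (Mv i (-1)))))"

lemma wf_det_load [simp]: "wf_prog m (load m i t f)" "det_prog (load m i t f)"
  by (simp_all add: load_def)

lemma run_load_loop:
  assumes "i < length is" "length is = m" "fst (is ! i) = x" "snd (is ! i) = int p - 1" "p \<le> length x"
  shows "run (m + 5) (Wh i 0 (Sq (If i 2 (pushes m t) (pushes m f)) (Mv i (-1)))) (TP is [s, s1, [], []] out)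
     (TP (is[i := (x, -1)]) [concat (map (\<lambda>b. if b then t else f) (take p x)) @ s, s1, [], []] out)
     ((4 * (length t + length f) + 6) * p + 1)"
  using assms
proof (induction p arbitrary: "is" s)
  case 0
  have eq: "is[i := (x, -1)] = is" using 0 by (simp add: list_update_same_conv prod_eq_iff)
  have "run (m + 5) (Wh i 0 (Sq (If i 2 (pushes m t) (pushes m f)) (Mv i (-1)))) (TP is [s, s1, [], []] out) (TP is [s, s1, [], []] out) 1"
    by (rule run_Wh_end) (use 0 in \<open>auto simp: good_TP reads_TP_in tape_of_def\<close>)
  then show ?case using eq by simp
next
  case (Suc p)
  let ?w = "if x ! p then t else f"
  let ?is = "is[i := (x, int p - 1)]"
  have sym: "reads (TP is [s, s1, [], []] out) ! i = (if x ! p then 2 else 1)"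
    using Suc.prems by (simp add: reads_TP_in tape_of_def)
  have "run (m + 5) (pushes m ?w) (TP is [s, s1, [], []] out) (TP is [?w @ s, s1, [], []] out) (4 * (length t + length f) + 1)"
    by (rule run_mono[OF run_pushes]) (use Suc.prems in auto)
  then have 1: "run (m + 5) (If i 2 (pushes m t) (pushes m f)) (TP is [s, s1, [], []] out) (TP is [?w @ s, s1, [], []] out) (4 * (length t + length f) + 1 + 1)"
    by (intro run_If) (use Suc.prems sym in \<open>auto simp: good_TP\<close>)
  have 2: "run (m + 5) (Mv i (-1)) (TP is [?w @ s, s1, [], []] out) (TP ?is [?w @ s, s1, [], []] out) 1"
    using run_Mv_in[OF Suc.prems(1,2), of "[?w @ s, s1, [], []]" "-1" out] Suc.prems by simp
  have 3: "run (m + 5) (Sq (If i 2 (pushes m t) (pushes m f)) (Mv i (-1))) (TP is [s, s1, [], []] out)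
     (TP ?is [?w @ s, s1, [], []] out) (4 * (length t + length f) + 1 + 1 + 1 + 1)"
    by (rule run_SqTP[OF 1 2]) (use Suc.prems in auto)
  have 4: "run (m + 5) (Wh i 0 (Sq (If i 2 (pushes m t) (pushes m f)) (Mv i (-1)))) (TP ?is [?w @ s, s1, [], []] out)
    (TP (?is[i := (x, -1)]) [concat (map (\<lambda>b. if b then t else f) (take p x)) @ ?w @ s, s1, [], []] out)
     ((4 * (length t + length f) + 6) * p + 1)"
    by (rule Suc.IH) (use Suc.prems in auto)
  have "run (m + 5) (Wh i 0 (Sq (If i 2 (pushes m t) (pushes m f)) (Mv i (-1)))) (TP is [s, s1, [], []] out)
    (TP (?is[i := (x, -1)]) [concat (map (\<lambda>b. if b then t else f) (take p x)) @ ?w @ s, s1, [], []] out)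
     (4 * (length t + length f) + 1 + 1 + 1 + 1 + ((4 * (length t + length f) + 6) * p + 1) + 1)"
    by (rule run_Wh_step[OF _ _ 3 4]) (use Suc.prems sym in \<open>auto simp: good_TP\<close>)
  moreover have "take (Suc p) x = take p x @ [x ! p]" using Suc.prems by (simp add: take_Suc_conv_app_nth)
  ultimately show ?case by (auto elim!: run_mono)
qed

lemma run_load:
  assumes "i < length is" "length is = m" "is ! i = (x, 0)"
  shows "run (m + 5) (load m i t f) (TP is [s, s1, [], []] out)
     (TP (is[i := (x, -1)]) [concat (map (\<lambda>b. if b then t else f) x) @ s, s1, [], []] out)
     ((4 * (length t + length f) + 8) * length x + 5)"
proof -
  let ?i1 = "is[i := (x, int (length x))]" let ?i2 = "is[i := (x, int (length x) - 1)]"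
  have 1: "run (m + 5) (Wh i 0 (Mv i 1)) (TP is [s, s1, [], []] out) (TP ?i1 [s, s1, [], []] out) (2 * (length x - 0) + 1)"
    by (rule run_seek) (use assms in auto)
  have 2: "run (m + 5) (Mv i (-1)) (TP ?i1 [s, s1, [], []] out) (TP ?i2 [s, s1, [], []] out) 1"
    using run_Mv_in[of i ?i1 m "[s, s1, [], []]" "-1" out] assms by simp
  have 3: "run (m + 5) (Wh i 0 (Sq (If i 2 (pushes m t) (pushes m f)) (Mv i (-1)))) (TP ?i2 [s, s1, [], []] out)
     (TP (?i2[i := (x, -1)]) [concat (map (\<lambda>b. if b then t else f) (take (length x) x)) @ s, s1, [], []] out)
     ((4 * (length t + length f) + 6) * length x + 1)"
    by (rule run_load_loop) (use assms in auto)
  have "run (m + 5) (load m i t f) (TP is [s, s1, [], []] out)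
     (TP (?i2[i := (x, -1)]) [concat (map (\<lambda>b. if b then t else f) (take (length x) x)) @ s, s1, [], []] out)
     ((2 * (length x - 0) + 1) + (1 + ((4 * (length t + length f) + 6) * length x + 1) + 1) + 1)"
    unfolding load_def by (rule run_SqTP[OF 1 run_SqTP[OF 2 3]]) (use assms in auto)
  then show ?thesis by (auto elim!: run_mono simp: algebra_simps)
qed

lemma run_load_code:
  assumes "i < length is" "length is = m" "is ! i = (code t, 0)"
  shows "run (m + 5) (load m i [True] [False]) (TP is [s, s1, [], []] out)
     (TP (is[i := (code t, -1)]) [code t @ s, s1, [], []] out) (21 * length (code t))"
proof -
  have "concat (map (\<lambda>b. if b then [True] else [False]) x) = x" for x by (induction x) auto
  with run_load[OF assms, of "[True]" "[False]" s s1 out] show ?thesis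
    using code_len[of t] by (auto elim!: run_mono)
qed

text \<open>Read from the right, a bit is put in front of the list as a node marker followed by the
  code of the bit; the \<open>False\<close> pushed at the start is the empty list.\<close>

definition load_list :: "nat \<Rightarrow> nat \<Rightarrow> prog" where
  "load_list m i = Sq (psh m 0 False) (load m i [True, True, False, False] [True, False])"

lemma wf_det_load_list [simp]: "wf_prog m (load_list m i)" "det_prog (load_list m i)"
  by (simp_all add: load_list_def)

lemma run_load_list:
  assumes "i < length is" "length is = m" "is ! i = (x, 0)"
  shows "run (m + 5) (load_list m i) (TP is [s, s1, [], []] out)
     (TP (is[i := (x, -1)]) [code (tr x) @ s, s1, [], []] out) (32 * length x + 9)"
proof -
  have e: "concat (map (\<lambda>b. if b then [True, True, False, False] else [True, False]) x) @ [False] = code (tr x)" for x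
    by (induction x) (auto simp: tr_bool_def)
  have 1: "run (m + 5) (psh m 0 False) (TP is [s, s1, [], []] out) (TP is [False # s, s1, [], []] out) 3"
    using run_psh[of "is" m "[s, s1, [], []]" 0 False out] assms by simp
  have 2: "run (m + 5) (load m i [True, True, False, False] [True, False]) (TP is [False # s, s1, [], []] out)
    (TP (is[i := (x, -1)]) [code (tr x) @ s, s1, [], []] out) (32 * length x + 5)"
    using run_load[OF assms, of "[True, True, False, False]" "[True, False]" "False # s" s1 out]
    by (simp flip: e)
  show ?thesis unfolding load_list_def
    by (rule run_mono[OF run_SqTP[OF 1 2]]) (use assms in auto)
qed

definition wout :: "nat \<Rightarrow> bool \<Rightarrow> prog" where
  "wout m b = Sq (Wr (m + 4) (sym b)) (Mv (m + 4) 1)"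

lemma run_wout:
  assumes "length is = m" "length ss = 4"
  shows "run (m + 5) (wout m b) (TP is ss out) (TP is ss (out @ [b])) 3"
proof -
  let ?t = "TP is ss out" and ?j = "m + 4"
  let ?t1 = "?t[?j := ((fst (?t ! ?j))(snd (?t ! ?j) := sym b), snd (?t ! ?j))]"
  have len: "?j < length ?t" "length ?t = m + 5" using assms by auto
  have nth: "?t ! ?j = otp out" using assms by (simp add: TP_def nth_append)
  have g1: "good (m + 5) ?t1"
    by (rule good_upd) (use assms TP_bound nth tape_of_bound in \<open>auto simp: otp_def\<close>)
  have e: "?t1[?j := (fst (?t1 ! ?j), snd (?t1 ! ?j) + 1)] = TP is ss (out @ [b])"
  proof -
    have n1: "?t1 ! ?j = ((fst (otp out))(snd (otp out) := sym b), snd (otp out))" using len nth by simp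
    have "?t1[?j := (fst (?t1 ! ?j), snd (?t1 ! ?j) + 1)] = ?t[?j := otp (out @ [b])]"
      unfolding n1 by (simp flip: otp_write)
    also have "\<dots> = TP is ss (out @ [b])" using assms by (simp add: TP_def list_update_append)
    finally show ?thesis .
  qed
  have "run (m + 5) (wout m b) ?t (?t1[?j := (fst (?t1 ! ?j), snd (?t1 ! ?j) + 1)]) (1 + 1 + 1)"
    unfolding wout_def
    by (rule run_Sq[OF _ run_Wr run_Mv]) (use assms g1 len in \<open>auto intro: good_TP\<close>)
  then show ?thesis using e by (auto elim: run_mono)
qed

definition emit :: "nat \<Rightarrow> prog" where
  "emit m = Wh (m + 0) 1 (Sq (pop m 0) (If (m + 0) 2 (Sq (pop m 0) (Sq (pop m 0) (Sq (pop m 0) (wout m True))))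
      (Sq (pop m 0) (wout m False))))"

lemma wf_det_emit [simp]: "wf_prog m (emit m)" "det_prog (emit m)"
  by (simp_all add: emit_def wout_def)

lemma run_emit:
  assumes "length is = m"
  shows "run (m + 5) (emit m) (TP is [code (tr (x :: bool list)) @ r, s, [], []] out)
    (TP is [False # r, s, [], []] (out @ x)) (22 * length x + 1)"
proof (induction x arbitrary: out)
  case Nil
  have "run (m + 5) (emit m) (TP is [False # r, s, [], []] out) (TP is [False # r, s, [], []] out) 1"
    unfolding emit_def
    by (rule run_Wh_end) (use assms reads_TP_stack[of 0 "[False # r, s, [], []]" "is" out] in \<open>auto simp: good_TP\<close>)
  then show ?case by simp
next
  case (Cons b x)
  let ?q = "code (tr x) @ r"
  let ?b = "If (m + 0) 2 (Sq (pop m 0) (Sq (pop m 0) (Sq (pop m 0) (wout m True)))) (Sq (pop m 0) (wout m False))"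
  have pp: "run (m + 5) (pop m 0) (TP is [c # q, s, [], []] out) (TP is [q, s, [], []] out) 3" for c q
    using run_pop[of "is" m "[c # q, s, [], []]" 0 out] assms by simp
  have w: "run (m + 5) (wout m b) (TP is [?q, s, [], []] out) (TP is [?q, s, [], []] (out @ [b])) 3" for b
    by (rule run_wout) (use assms in auto)
  have T: "run (m + 5) (Sq (pop m 0) (Sq (pop m 0) (Sq (pop m 0) (wout m True))))
     (TP is [True # False # False # ?q, s, [], []] out) (TP is [?q, s, [], []] (out @ [True])) (3 + (3 + (3 + 3 + 1) + 1) + 1)"
    by (rule run_SqTP[OF pp run_SqTP[OF pp run_SqTP[OF pp w]]]) (use assms in auto)
  have F: "run (m + 5) (Sq (pop m 0) (wout m False))
     (TP is [False # ?q, s, [], []] out) (TP is [?q, s, [], []] (out @ [False])) (3 + 3 + 1)"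
    by (rule run_SqTP[OF pp w]) (use assms in auto)
  have "run (m + 5) ?b (TP is [code (tr b) @ ?q, s, [], []] out) (TP is [?q, s, [], []] (out @ [b])) (15 + 1)"
    by (rule run_IfTP) (use assms T F in \<open>auto simp: tr_bool_def elim!: run_mono\<close>)
  then have body: "run (m + 5) (Sq (pop m 0) ?b) (TP is [code (tr (b # x)) @ r, s, [], []] out) (TP is [?q, s, [], []] (out @ [b])) (3 + (15 + 1) + 1)"
    using pp[of True "code (tr b) @ ?q"] assms by (intro run_SqTP) auto
  have "run (m + 5) (emit m) (TP is [code (tr (b # x)) @ r, s, [], []] out)
    (TP is [False # r, s, [], []] ((out @ [b]) @ x)) (3 + (15 + 1) + 1 + (22 * length x + 1) + 1)"
    unfolding emit_def
    by (rule run_Wh_step[OF _ _ body Cons.IH[unfolded emit_def]])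
      (use assms reads_TP_stack[of 0 "[code (tr (b # x)) @ r, s, [], []]" "is" out] in \<open>auto simp: good_TP\<close>)
  then show ?case by (auto elim!: run_mono)
qed

subsection \<open>All paths of a nondeterministic program\<close>

text \<open>\<open>nr W t c X\<close>: within \<open>t\<close> steps every path from \<open>c\<close> gets stuck without accepting or reaches
  a configuration in \<open>X\<close>, and all of \<open>X\<close> is reached.\<close>

inductive nr :: "nat \<Rightarrow> nat \<Rightarrow> prog list \<times> tape list \<Rightarrow> (prog list \<times> tape list) set \<Rightarrow> bool" for W where
  nr_0: "nr W t c {c}"
| nr_Suc: "fst c \<noteq> [] \<Longrightarrow> (\<And>d. sstep W c d \<Longrightarrow> nr W t d (X d)) \<Longrightarrow> nr W (Suc t) c (\<Union>d\<in>{d. sstep W c d}. X d)"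

lemma nr_mono: "nr W s c X \<Longrightarrow> s \<le> t \<Longrightarrow> nr W t c X"
proof (induction arbitrary: t rule: nr.induct)
  case (nr_Suc c t' X)
  then obtain t1 where "t = Suc t1" by (cases t) auto
  with nr_Suc show ?case by (auto intro: nr.nr_Suc)
qed (auto intro: nr.nr_0)

lemma nr_trans:
  "nr W s c X \<Longrightarrow> (\<And>d. d \<in> X \<Longrightarrow> nr W t d (Y d)) \<Longrightarrow> nr W (s + t) c (\<Union>d\<in>X. Y d)"
proof (induction rule: nr.induct)
  case (nr_0 s c)
  then show ?case by (auto intro: nr_mono)
next
  case (nr_Suc c s X)
  have "nr W (Suc (s + t)) c (\<Union>d\<in>{d. sstep W c d}. \<Union>e\<in>X d. Y e)"
  proof (rule nr.nr_Suc[OF nr_Suc.hyps(1)])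
    fix d assume "sstep W c d"
    then show "nr W (s + t) d (\<Union>e\<in>X d. Y e)" by (intro nr_Suc.IH nr_Suc.prems) blast+
  qed
  then show ?case by simp
qed

lemma nr_reach: "nr W t c X \<Longrightarrow> d \<in> X \<Longrightarrow> \<exists>i. (sstep W ^^ i) c d"
proof (induction rule: nr.induct)
  case (nr_0 t c)
  then show ?case by (auto intro: exI[of _ 0])
next
  case (nr_Suc c t X)
  then obtain e i where "sstep W c e" "(sstep W ^^ i) e d" by blast
  then show ?case using relpowp_Suc_I2[of "sstep W" c e i d] by blast
qed

lemma nr_path:
  "nr W t c X \<Longrightarrow> (sstep W ^^ i) c e \<Longrightarrow>
    (i \<le> t \<and> fst e \<noteq> []) \<or> (\<exists>d\<in>X. \<exists>j k. i = j + k \<and> j \<le> t \<and> (sstep W ^^ k) d e)"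
proof (induction arbitrary: i rule: nr.induct)
  case (nr_0 t c)
  then show ?case by force
next
  case (nr_Suc c t X)
  show ?case
  proof (cases i)
    case 0
    then show ?thesis using nr_Suc by auto
  next
    case (Suc i')
    then obtain d where d: "sstep W c d" "(sstep W ^^ i') d e"
      using nr_Suc.prems relpowp_Suc_D2 by metis
    from nr_Suc.IH[OF this] show ?thesis
    proof
      assume "\<exists>d'\<in>X d. \<exists>j k. i' = j + k \<and> j \<le> t \<and> (sstep W ^^ k) d' e"
      then obtain d' j k where "d' \<in> X d" "i' = j + k" "j \<le> t" "(sstep W ^^ k) d' e" by blast
      moreover have "d' \<in> (\<Union>d\<in>{d. sstep W c d}. X d)" using d(1) \<open>d' \<in> X d\<close> by blast
      moreover have "i = Suc j + k" "Suc j \<le> Suc t" using Suc \<open>i' = j + k\<close> \<open>j \<le> t\<close> by auto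
      ultimately show ?thesis by blast
    qed (use Suc in auto)
  qed
qed

lemma sstep_nonempty: "sstep W c d \<Longrightarrow> fst c \<noteq> []"
  by (auto simp: sstep_def)

lemma dr_nr: "dr W t c d \<Longrightarrow> nr W t c {d}"
proof (induction rule: dr.induct)
  case (dr_Suc c c1 t d)
  have "nr W (Suc t) c (\<Union>e\<in>{e. sstep W c e}. {d})"
    by (rule nr_Suc) (use dr_Suc sstep_nonempty[of W c c1] in auto)
  then show ?case using dr_Suc(1) by simp
qed (rule nr_0)

lemma run_nr: "run W c a b t \<Longrightarrow> nr W t (c # K, a) {(K, b)}"
  unfolding run_def using dr_nr nr_mono by blast

section \<open>The machines\<close>

lemma tape_of_Nil: "(tape_of [], 0) = stk []" "(tape_of [], 0) = otp []"
  by (auto simp: stk_def otp_def tape_of_def)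

lemma init_conf_machine: "init_conf (machine m c) ins = (0, TP (map (\<lambda>x. (x, 0)) ins) [[], [], [], []] [])"
proof -
  have "replicate 5 (tape_of [], 0 :: int) = [stk [], stk [], stk [], stk [], otp []]"
    by (simp add: numeral_eq_Suc tape_of_Nil(1)) (simp add: tape_of_Nil(1)[symmetric] tape_of_Nil(2))
  then show ?thesis by (simp add: init_conf_def machine_def TP_def itp_def comp_def)
qed

lemma out_string_TP: "out_string (q, TP is ss out) = out"
proof -
  have "(LEAST i. tape_of out (int i) \<notin> {1, 2}) = length out"
    by (rule Least_equality) (auto simp: tape_of_def not_less[symmetric] split: if_splits)
  then show ?thesis
    by (auto simp: out_string_def TP_def otp_def tape_of_def intro!: nth_equalityI)
qed

lemma vrun_run: "vrun m c x y t \<Longrightarrow> length is = m \<Longrightarrow>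
    run (m + 5) c (TP is [code x @ r, s, [], []] out) (TP is [code y @ r, s, [], []] out) t"
  by (simp add: vrun_def)

text \<open>Turns \<open>(sz n + 1) ^ D\<close> into the pure power \<open>n ^ (3 * D)\<close>, so
  that the running times below have a single exponent.\<close>

lemma cube_ge: "2 * n + 2 \<le> n ^ 3" if "2 \<le> n" for n :: nat
proof -
  have "4 * n \<le> n ^ 3" using mult_le_mono[OF that that] by (simp add: power3_eq_cube)
  with that show ?thesis by linarith
qed

text \<open>Doubling is the only computation that is not polynomial in its input.\<close>

lemma expand_prog:
  obtains c C where "\<And>m. wf_prog m (c m)" "\<And>m. det_prog (c m)"
    "\<And>m (ad :: advice) (y :: bool list). vrun m (c m) (tr (ad, y)) (tr ((2 :: nat) ^ fst ad, ad, y))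
       ((2 ^ fst ad + sz (ad, y)) ^ C)"
proof -
  have "PT (\<lambda>z :: advice \<times> bool list. (units (fst (fst z)), 1 :: nat))" by (intro pt)
  then obtain g S where g: "pbd (\<lambda>z :: advice \<times> bool list. sz (units (fst (fst z)), 1 :: nat))" "pbd S"
    "cmp g S (\<lambda>z :: advice \<times> bool list. (units (fst (fst z)), 1 :: nat))"
    using PT_E by blast
  have "PT (\<lambda>z :: unit \<times> nat. snd z + snd z)" by (intro pt)
  then obtain h T where h: "pbd (\<lambda>z :: unit \<times> nat. sz (snd z + snd z))" "pbd T" "cmp h T (\<lambda>z :: unit \<times> nat. snd z + snd z)"
    using PT_E by blast
  obtain A where A: "\<And>z. S z \<le> (sz z + 1) ^ A" using g(2) unfolding pbd_def by blast
  obtain B where B: "\<And>z. T z \<le> (sz z + 1) ^ B" using h(2) unfolding pbd_def by blast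
  let ?c = "\<lambda>m. Sq (dup m) (Sq (g m) (Sq (fold_prog h m) (psh m 0 True)))"
  let ?t = "\<lambda>N z. 80 * z + ((z + 1) ^ A + ((30 * z + (2 * N + 4) ^ B + 10) * (z + 2) + 3 + 1) + 1) + 1"
  have run: "vrun m (?c m) (tr (ad, y)) (tr ((2 :: nat) ^ fst ad, ad, y)) (?t (2 ^ fst ad) (sz (ad, y)))"
    for m and ad :: advice and y :: "bool list"
    unfolding vrun_def
  proof (intro allI impI)
    fix r s out and "is" :: "(bool list \<times> int) list"
    assume m: "length is = m"
    let ?x = "code (tr (ad, y)) @ r" and ?N = "(2::nat) ^ fst ad" and ?z = "sz (ad, y)"
    have f: "fold (\<lambda>(_ :: unit) s. s + s) us (k :: nat) = 2 ^ length us * k" for us k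
      by (induction us arbitrary: k) auto
    have 1: "run (m + 5) (dup m) (TP is [?x, s, [], []] out) (TP is [code (tr (ad, y)) @ ?x, s, [], []] out) (80 * ?z)"
      unfolding sz_def by (rule run_dup[OF m])
    have 2: "run (m + 5) (g m) (TP is [code (tr (ad, y)) @ ?x, s, [], []] out)
      (TP is [code (tr (units (fst ad), 1 :: nat)) @ ?x, s, [], []] out) ((?z + 1) ^ A)"
      using run_mono[OF cmp_run[OF g(3) m, of "(ad, y)" ?x s out] A] by simp
    have v: "vrun m (fold_prog h m) (tr (units (fst ad), 1 :: nat)) (tr (fold (\<lambda>_ s. s + s) (units (fst ad)) (1 :: nat)))
       ((30 * sz (units (fst ad)) + (2 * ?N + 4) ^ B + 10) * (length (units (fst ad)) + 2))"
    proof (rule vrun_fold)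
      fix l1 x l2 assume l: "units (fst ad) = l1 @ x # l2"
      define k where "k = fold (\<lambda>_ s. s + s) l1 (1 :: nat)"
      have "length l1 < fst ad" using arg_cong[OF l, of length] by (simp add: units_def)
      then have k: "k \<le> ?N" unfolding k_def f by simp
      have "vrun m (h m) (tr (x, k)) (tr (k + k)) (T (x, k))" using h(3) by (simp add: cmp_def)
      moreover have "T (x, k) \<le> (2 * ?N + 4) ^ B"
        by (rule order.trans[OF B], rule power_mono) (use k in auto)
      ultimately show "vrun m (h m) (tr (x, fold (\<lambda>_ s. s + s) l1 (1 :: nat)))
          (tr (fold (\<lambda>_ s. s + s) l1 (1 :: nat) + fold (\<lambda>_ s. s + s) l1 (1 :: nat))) ((2 * ?N + 4) ^ B)"
        unfolding k_def[symmetric] by (rule vrun_mono)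
    qed
    have e: "fold (\<lambda>_ s. s + s) (units (fst ad)) (1 :: nat) = ?N" unfolding f by (simp add: units_def)
    have "sz (units (fst ad)) \<le> ?z" and "length (units (fst ad)) \<le> ?z"
      by (cases ad; simp add: sz_def[of "units _"] tr_units, simp add: sz_def[symmetric] units_def)+
    then have le: "(30 * sz (units (fst ad)) + (2 * ?N + 4) ^ B + 10) * (length (units (fst ad)) + 2)
        \<le> (30 * ?z + (2 * ?N + 4) ^ B + 10) * (?z + 2)"
      by (intro mult_mono add_mono) simp_all
    have "vrun m (fold_prog h m) (tr (units (fst ad), 1 :: nat)) (tr ?N) ((30 * ?z + (2 * ?N + 4) ^ B + 10) * (?z + 2))"
      by (rule vrun_mono[OF v[unfolded e] le])
    then have 3: "run (m + 5) (fold_prog h m) (TP is [code (tr (units (fst ad), 1 :: nat)) @ ?x, s, [], []] out)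
      (TP is [code (tr ?N) @ ?x, s, [], []] out) ((30 * ?z + (2 * ?N + 4) ^ B + 10) * (?z + 2))"
      using m by (simp add: vrun_def)
    have 4: "run (m + 5) (psh m 0 True) (TP is [code (tr ?N) @ ?x, s, [], []] out)
      (TP is [code (tr (?N, ad, y)) @ r, s, [], []] out) 3"
      using run_psh[of "is" m "[code (tr ?N) @ ?x, s, [], []]" 0 True out] m by (simp add: tr_prod_def)
    show "run (m + 5) (?c m) (TP is [?x, s, [], []] out) (TP is [code (tr (?N, ad, y)) @ r, s, [], []] out) (?t ?N ?z)"
      by (rule run_SqTP[OF 1 run_SqTP[OF 2 run_SqTP[OF 3 4]]]) (use m in auto)
  qed
  have "pbd (\<lambda>n :: nat. ?t n n)" by (rule pbd_mono[of "\<lambda>n. ?t (sz n) (sz n)"], intro pbd_intros)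
    (intro add_mono mult_mono power_mono; simp)
  then obtain D where D: "\<And>n :: nat. ?t n n \<le> (sz n + 1) ^ D" unfolding pbd_def by blast
  show ?thesis
  proof (rule that[of ?c "3 * D"])
    show "wf_prog m (?c m)" "det_prog (?c m)" for m
      by (simp_all add: fold_prog_def cmp_wf_det[OF g(3)] cmp_wf_det[OF h(3)])
    fix m and ad :: advice and y :: "bool list"
    let ?n = "2 ^ fst ad + sz (ad, y)"
    have "?t (2 ^ fst ad) (sz (ad, y)) \<le> ?t ?n ?n" by (intro add_mono mult_mono power_mono) auto
    also have "\<dots> \<le> (sz ?n + 1) ^ D" by (rule D)
    also have "\<dots> \<le> (?n ^ 3) ^ D"
    proof (rule power_mono)
      have "1 \<le> (2 :: nat) ^ fst ad" by simp
      then have "2 \<le> ?n" using sz_ge1[of "(ad, y)"] by linarith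
      from cube_ge[OF this] show "sz ?n + 1 \<le> ?n ^ 3" by simp
    qed simp
    finally show "vrun m (?c m) (tr (ad, y)) (tr ((2 :: nat) ^ fst ad, ad, y)) (?n ^ (3 * D))"
      using run[of m ad y] by (auto simp: power_mult elim!: vrun_mono)
  qed
qed

text \<open>The program is the code of the advice. Its first component is only the logarithm of the
  clock, so the time is polynomial in the clock and the input sizes, not in the length of the
  program.\<close>

lemma compression_machine:
  "\<exists>\<psi> C. description_method \<psi> \<and> (\<forall>ad a. produces \<psi> [code (tr ad), a] (compr (2 ^ fst ad) ad a)
      ((2 ^ fst ad + sz (ad, a)) ^ C) \<infinity>)"
proof -
  obtain ex E where ex: "\<And>m. wf_prog m (ex m)" "\<And>m. det_prog (ex m)"
    "\<And>m (ad :: advice) (y :: bool list). vrun m (ex m) (tr (ad, y)) (tr ((2 :: nat) ^ fst ad, ad, y))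
       ((2 ^ fst ad + sz (ad, y)) ^ E)" using expand_prog by metis
  obtain c T where c: "pbd (\<lambda>z :: nat \<times> advice \<times> bool list. sz (compr (fst z) (fst (snd z)) (snd (snd z))))" "pbd T"
    "cmp c T (\<lambda>z. compr (fst z) (fst (snd z)) (snd (snd z)))"
    using PT_E[OF PT_compr'] by blast
  obtain A where A: "\<And>z. sz (compr (fst z) (fst (snd z)) (snd (snd z))) \<le> (sz z + 1) ^ A" using c(1) unfolding pbd_def by blast
  obtain B where B: "\<And>z. T z \<le> (sz z + 1) ^ B" using c(2) unfolding pbd_def by blast
  define prg where "prg = Sq (load_list 2 1) (Sq (load 2 0 [True] [False]) (Sq (psh 2 0 True) (Sq (ex 2) (Sq (c 2) (emit 2)))))"
  let ?t = "\<lambda>n. (32 * n + 9) + (21 * n + (3 + (n ^ E + ((3 * n + 3) ^ B + (22 * (3 * n + 3) ^ A + 1) + 1) + 1) + 1) + 1) + 1"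
  have prod: "produces (machine 2 prg) [code (tr ad), a] (compr (2 ^ fst ad) ad a) (?t (2 ^ fst ad + sz (ad, a))) \<infinity>" for ad a
  proof -
    let ?N = "(2::nat) ^ fst ad" and ?p = "compr (2 ^ fst ad) ad a"
    let ?n = "?N + sz (ad, a)"
    let ?i0 = "[(code (tr ad), 0), (a, 0)] :: (bool list \<times> int) list"
    let ?i1 = "[(code (tr ad), 0), (a, -1)] :: (bool list \<times> int) list"
    let ?i2 = "[(code (tr ad), -1), (a, -1)] :: (bool list \<times> int) list"
    have la: "length a \<le> sz (ad, a)" using length_sz[of a] by simp
    have lad: "length (code (tr ad)) \<le> sz (ad, a)" by (simp add: sz_def[of ad, symmetric])
    have szN: "sz (?N, ad, a) + 1 \<le> 3 * ?n + 3" by simp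
    have 1: "run (2 + 5) (load_list 2 1) (TP ?i0 [[], [], [], []] []) (TP ?i1 [code (tr a) @ [], [], [], []] []) (32 * ?n + 9)"
      using run_mono[OF run_load_list[of 1 ?i0 2 a "[]" "[]" "[]"], of "32 * ?n + 9"] la by simp
    have 2: "run (2 + 5) (load 2 0 [True] [False]) (TP ?i1 [code (tr a) @ [], [], [], []] []) (TP ?i2 [code (tr ad) @ code (tr a) @ [], [], [], []] []) (21 * ?n)"
      using run_mono[OF run_load_code[of 0 ?i1 2 "tr ad" "code (tr a) @ []" "[]" "[]"], of "21 * ?n"] lad by simp
    have 3: "run (2 + 5) (psh 2 0 True) (TP ?i2 [code (tr ad) @ code (tr a) @ [], [], [], []] []) (TP ?i2 [code (tr (ad, a)) @ [], [], [], []] []) 3"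
      using run_psh[of ?i2 2 "[code (tr ad) @ code (tr a) @ [], [], [], []]" 0 True "[]"] by (simp add: tr_prod_def)
    have 4: "run (2 + 5) (ex 2) (TP ?i2 [code (tr (ad, a)) @ [], [], [], []] []) (TP ?i2 [code (tr (?N, ad, a)) @ [], [], [], []] []) (?n ^ E)"
      by (rule vrun_run[OF ex(3)]) simp
    have 5: "run (2 + 5) (c 2) (TP ?i2 [code (tr (?N, ad, a)) @ [], [], [], []] []) (TP ?i2 [code (tr ?p) @ [], [], [], []] []) ((3 * ?n + 3) ^ B)"
      using run_mono[OF cmp_run[OF c(3), of ?i2 2 "(?N, ad, a)" "[]" "[]" "[]"] order.trans[OF B power_mono[OF szN]]] by simp
    have "length ?p \<le> (3 * ?n + 3) ^ A"
      using length_sz[of ?p] A[of "(?N, ad, a)"] power_mono[OF szN, of A] by simp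
    then have 6: "run (2 + 5) (emit 2) (TP ?i2 [code (tr ?p) @ [], [], [], []] []) (TP ?i2 [False # [], [], [], []] ([] @ ?p)) (22 * (3 * ?n + 3) ^ A + 1)"
      by (intro run_mono[OF run_emit]) auto
    have "run (2 + 5) prg (TP ?i0 [[], [], [], []] []) (TP ?i2 [False # [], [], [], []] ([] @ ?p)) (?t ?n)"
      unfolding prg_def
      by (rule run_SqTP[OF 1 run_SqTP[OF 2 run_SqTP[OF 3 run_SqTP[OF 4 run_SqTP[OF 5 6]]]]]) auto
    then obtain i where i: "i \<le> ?t ?n" "dr (2 + 5) i ([prg], TP ?i0 [[], [], [], []] []) ([], TP ?i2 [False # [], [], [], []] ([] @ ?p))"
      by (auto simp: run_def)
    from dr_relpow[OF i(2)] have "(step (machine 2 prg) ^^ i) (init_conf (machine 2 prg) [code (tr ad), a]) (numb prg [], TP ?i2 [False # [], [], [], []] ([] @ ?p))"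
      unfolding init_conf_machine relpow_step_machine by (auto simp: cont_set_def)
    then show ?thesis unfolding produces_def
      using i(1) numb(3)[of prg] out_string_TP[of 1 ?i2 "[[False], [], [], []]" ?p]
      by (intro conjI exI[of _ i] exI[of _ "(numb prg [], TP ?i2 [False # [], [], [], []] ([] @ ?p))"]) auto
  qed
  have "pbd (\<lambda>n :: nat. ?t n)" by (rule pbd_mono[of "\<lambda>n. ?t (sz n)"], intro pbd_intros)
    (intro add_mono mult_mono power_mono; simp)
  then obtain D where D: "\<And>n :: nat. ?t n \<le> (sz n + 1) ^ D" unfolding pbd_def by blast
  have "produces (machine 2 prg) [code (tr ad), a] (compr (2 ^ fst ad) ad a) ((2 ^ fst ad + sz (ad, a)) ^ (3 * D)) \<infinity>" for ad a
  proof -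
    let ?n = "2 ^ fst ad + sz (ad, a)"
    have "?t ?n \<le> (sz ?n + 1) ^ D" by (rule D)
    also have "\<dots> \<le> (?n ^ 3) ^ D"
    proof (rule power_mono)
      have "1 \<le> (2 :: nat) ^ fst ad" by simp
      then have "2 \<le> ?n" using sz_ge1[of "(ad, a)"] by linarith
      from cube_ge[OF this] show "sz ?n + 1 \<le> ?n ^ 3" by simp
    qed simp
    finally show ?thesis using prod[of ad a] unfolding produces_def power_mult by (meson le_trans)
  qed
  moreover have "description_method (machine 2 prg)" unfolding description_method_def
    by (intro conjI is_ntm_machine deterministic_machine) (simp_all add: prg_def ex cmp_wf_det[OF c(3)])
  ultimately show ?thesis by blast
qed

section \<open>Non-deterministic pieces: guessing bits, ticks and the loop over the clock\<close>

lemma nr_Sq: "good W ts \<Longrightarrow> nr W t (a # b # K, ts) X \<Longrightarrow> nr W (Suc t) (Sq a b # K, ts) X"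
  using nr_trans[OF dr_nr[OF dr_1, of W ts "Sq a b # K" "a # b # K" "stay (reads ts)" ts], of t "\<lambda>_. X"]
  by (simp add: act_stay)

lemma nr_run:
  assumes "run W c a b s" "nr W t (K, b) X"
  shows "nr W (s + t) (c # K, a) X"
  using nr_trans[OF run_nr[OF assms(1), of K], of t "\<lambda>_. X"] assms(2) by simp

lemma nr_two:
  assumes "fst c \<noteq> []" "\<And>d. sstep W c d \<longleftrightarrow> d = c1 \<or> d = c2" "nr W t c1 X1" "nr W t c2 X2" "c1 \<noteq> c2"
  shows "nr W (Suc t) c (X1 \<union> X2)"
proof -
  have "nr W (Suc t) c (\<Union>d\<in>{d. sstep W c d}. if d = c1 then X1 else X2)"
    by (rule nr_Suc) (use assms in auto)
  moreover have "{d. sstep W c d} = {c1, c2}" using assms(2) by auto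
  ultimately show ?thesis using assms(5) by (simp add: Un_commute)
qed

text \<open>Used to recover a guess from the configuration it leads to.\<close>

lemma stk_inj: "stk x = stk y \<Longrightarrow> x = y"
proof (induction x arbitrary: y)
  case Nil
  then show ?case by (auto simp: stk_def)
next
  case (Cons b x)
  then have "snd (stk (b # x)) = snd (stk y)" by simp
  then obtain c z where y: "y = c # z" by (cases y) (auto simp: stk_def)
  have "sym b = sym c" using Cons.prems stk_top[of "b # x"] stk_top[of y] y by simp
  then have "b = c" by (auto simp: sym_def split: if_splits)
  moreover have "stk x = stk z" using Cons.prems stk_pop[of b x] stk_pop[of c z] y by simp
  ultimately show ?case using Cons.IH y by simp
qed

lemma sstep_Gs: "good W ts \<Longrightarrow> sstep W (Gs j # K, ts) d \<longleftrightarrow>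
    d = (K, act ts ((stay (reads ts))[j := (1, 0)])) \<or> d = (K, act ts ((stay (reads ts))[j := (2, 0)]))"
  by (cases d) (auto simp: sstep_def)

definition guess_bit :: "nat \<Rightarrow> prog" where
  "guess_bit m = Sq (Mv (m + 0) 1) (Sq (Gs (m + 0))
     (If (m + 0) 2 (Sq (pop m 0) (pushes m [True, False, False])) Skip))"

lemma nr_guess_bit:
  assumes "length is = m"
  shows "nr (m + 5) 30 (guess_bit m # K, TP is [s, s1, [], []] out)
     ((\<lambda>b :: bool. (K, TP is [code (tr b) @ s, s1, [], []] out)) ` UNIV)"
proof -
  let ?t = "TP is [s, s1, [], []] out"
  let ?t1 = "?t[m + 0 := (fst (?t ! (m + 0)), snd (?t ! (m + 0)) + 1)]"
  let ?I = "If (m + 0) 2 (Sq (pop m 0) (pushes m [True, False, False])) Skip"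
  have nth: "?t ! (m + 0) = stk s" using assms TP_nth_stack[of 0 "[s, s1, [], []]" "is" out] by simp
  have len: "m + 0 < length ?t" "length ?t = m + 5" using assms by auto
  have g: "good (m + 5) ?t" using assms by (simp add: good_TP)
  have g1: "good (m + 5) ?t1" by (rule good_upd) (use assms TP_bound nth stk_bound in auto)
  have mv: "run (m + 5) (Mv (m + 0) 1) ?t ?t1 1" by (rule run_Mv) (use g in auto)
  have up: "act ?t1 ((stay (reads ?t1))[m + 0 := (sym b, 0)]) = TP is [b # s, s1, [], []] out" for b
    using act_update[of "m + 0" ?t1 "sym b" 0] len nth stk_push[of s b] TP_upd_stack[of 0 "[s, s1, [], []]" "is" out "b # s"] assms
    by simp
  have succ: "sstep (m + 5) (Gs (m + 0) # ?I # K, ?t1) d \<longleftrightarrow>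
      d = (?I # K, TP is [False # s, s1, [], []] out) \<or> d = (?I # K, TP is [True # s, s1, [], []] out)" for d
    unfolding sstep_Gs[OF g1] using up[of True] up[of False] by (simp only: sym_simps)
  have br: "nr (m + 5) 22 (?I # K, TP is [b # s, s1, [], []] out) {(K, TP is [code (tr b) @ s, s1, [], []] out)}" for b
  proof (rule run_nr)
    have p: "run (m + 5) (pop m 0) (TP is [True # s, s1, [], []] out) (TP is [s, s1, [], []] out) 3"
      using run_pop[of "is" m "[True # s, s1, [], []]" 0 out] assms by simp
    have "run (m + 5) (Sq (pop m 0) (pushes m [True, False, False])) (TP is [True # s, s1, [], []] out)
      (TP is [[True, False, False] @ s, s1, [], []] out) (3 + (4 * length [True, False, False] + 1) + 1)"
      by (rule run_SqTP[OF p run_pushes]) (use assms in auto)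
    moreover have "run (m + 5) Skip (TP is [False # s, s1, [], []] out) (TP is [False # s, s1, [], []] out) 1"
      by (rule run_Skip) (use assms in \<open>simp add: good_TP\<close>)
    ultimately have "run (m + 5) ?I (TP is [b # s, s1, [], []] out) (TP is [code (tr b) @ s, s1, [], []] out) (21 + 1)"
      by (intro run_IfTP) (use assms in \<open>auto simp: tr_bool_def elim!: run_mono\<close>)
    then show "run (m + 5) ?I (TP is [b # s, s1, [], []] out) (TP is [code (tr b) @ s, s1, [], []] out) 22" by simp
  qed
  have ne: "TP is [False # s, s1, [], []] out \<noteq> TP is [True # s, s1, [], []] out"
    using reads_TP_stack[of 0 "[False # s, s1, [], []]" "is" out] reads_TP_stack[of 0 "[True # s, s1, [], []]" "is" out]
    by auto
  have "nr (m + 5) (Suc 22) (Gs (m + 0) # ?I # K, ?t1)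
     ({(K, TP is [code (tr False) @ s, s1, [], []] out)} \<union> {(K, TP is [code (tr True) @ s, s1, [], []] out)})"
  proof (rule nr_two)
    show "sstep (m + 5) (Gs (m + 0) # ?I # K, ?t1) d \<longleftrightarrow>
      d = (?I # K, TP is [False # s, s1, [], []] out) \<or> d = (?I # K, TP is [True # s, s1, [], []] out)" for d
      by (rule succ)
  qed (simp, rule br, rule br, use ne in simp)
  then have "nr (m + 5) (Suc 22) (Gs (m + 0) # ?I # K, ?t1) ((\<lambda>b :: bool. (K, TP is [code (tr b) @ s, s1, [], []] out)) ` UNIV)"
    by (simp add: UNIV_bool insert_commute)
  from nr_Sq[OF g nr_run[OF mv nr_Sq[OF g1 this]]] show ?thesis
    unfolding guess_bit_def by (rule nr_mono) simp
qed

text \<open>A preorder code has to be pushed back to front: first the four guesses from last to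
  first with the node markers between them, then the bit on the random tape, then the markers of the
  tick and of the list cell.\<close>

definition tick_prog :: prog where
  "tick_prog = Sq (guess_bit 3) (Sq (guess_bit 3) (Sq (psh 3 0 True) (Sq (guess_bit 3) (Sq (guess_bit 3)
     (Sq (pushes 3 [True, True]) (Sq (Sq (If 2 2 (pushes 3 [True, False, False]) (pushes 3 [False])) (Mv 2 1))
       (pushes 3 [True, True])))))))"

text \<open>In \<open>nr_trans\<close> the continuation is a function of the configuration reached,
  here it is given as a function of the guessed bit. The code of the bit is on top of the stack, so
  the inverse exists.\<close>

lemma nr_guess_cont:
  assumes "length is = m" "\<And>b :: bool. nr (m + 5) t (K, TP is [code (tr b) @ s, s1, [], []] out) (X b)"
  shows "nr (m + 5) (30 + t) (guess_bit m # K, TP is [s, s1, [], []] out) (\<Union>b. X b)"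
proof -
  have inj: "inj (\<lambda>b :: bool. TP is [code (tr b) @ s, s1, [], []] out)"
  proof (rule injI)
    fix b c :: bool assume "TP is [code (tr b) @ s, s1, [], []] out = TP is [code (tr c) @ s, s1, [], []] out"
    then have "top_sym (code (tr b) @ s) = top_sym (code (tr c) @ s)"
      using reads_TP_stack[of 0 "[code (tr b) @ s, s1, [], []]" "is" out] reads_TP_stack[of 0 "[code (tr c) @ s, s1, [], []]" "is" out]
      by simp
    then show "b = c" by (cases b; cases c) (auto simp: tr_bool_def)
  qed
  let ?f = "\<lambda>b :: bool. (K, TP is [code (tr b) @ s, s1, [], []] out)"
  have injf: "inj ?f" using inj by (auto simp: inj_def)
  have "nr (m + 5) (30 + t) (guess_bit m # K, TP is [s, s1, [], []] out) (\<Union>d\<in>range ?f. X (inv ?f d))"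
    by (rule nr_trans[OF nr_guess_bit[OF assms(1)]]) (use assms(2) inv_f_f[OF injf] in auto)
  moreover have "(\<Union>d\<in>range ?f. X (inv ?f d)) = (\<Union>b. X b)" by (simp add: inv_f_f[OF injf])
  ultimately show ?thesis by simp
qed

lemma nr_tick:
  assumes "p < length r"
  shows "nr (3 + 5) 200 (tick_prog # K, TP [a, b, (r, int p)] [code (tr (acc :: tick list)) @ s, s1, [], []] out)
    ((\<lambda>tk. (K, TP [a, b, (r, int (Suc p))] [code (tr (tk # acc)) @ s, s1, [], []] out)) ` {tk. fst tk = r ! p})"
proof -
  let ?is = "[a, b, (r, int p)]" and ?is' = "[a, b, (r, int (Suc p))]"
  let ?R = "Sq (If 2 2 (pushes 3 [True, False, False]) (pushes 3 [False])) (Mv 2 1)"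
  let ?P = "pushes 3 [True, True]"
  let ?s0 = "code (tr acc) @ s"
  have g: "good (3 + 5) (TP ?is [x, s1, [], []] out)" for x by (simp add: good_TP)
  have ps: "run (3 + 5) (pushes 3 bs) (TP is [x, s1, [], []] out) (TP is [bs @ x, s1, [], []] out) (4 * length bs + 1)"
    if "length is = 3" for bs x "is" using run_pushes[OF that, of bs x s1 out] by simp
  have R: "run (3 + 5) ?R (TP ?is [x, s1, [], []] out) (TP ?is' [code (tr (r ! p)) @ x, s1, [], []] out) 20" for x
  proof -
    have rd: "reads (TP ?is [x, s1, [], []] out) ! 2 = (if r ! p then 2 else 1)"
      using reads_TP_in[of 2 ?is "[x, s1, [], []]" out] assms by (simp add: tape_of_def)
    have "run (3 + 5) (if r ! p then pushes 3 [True, False, False] else pushes 3 [False]) (TP ?is [x, s1, [], []] out)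
        (TP ?is [code (tr (r ! p)) @ x, s1, [], []] out) 13"
      using ps[of ?is "[True, False, False]" x] ps[of ?is "[False]" x] by (auto simp: tr_bool_def elim!: run_mono)
    then have 1: "run (3 + 5) (If 2 2 (pushes 3 [True, False, False]) (pushes 3 [False])) (TP ?is [x, s1, [], []] out)
        (TP ?is [code (tr (r ! p)) @ x, s1, [], []] out) (13 + 1)"
      by (intro run_If) (use rd in \<open>auto simp: good_TP split: if_splits\<close>)
    have 2: "run (3 + 5) (Mv 2 1) (TP ?is [code (tr (r ! p)) @ x, s1, [], []] out) (TP ?is' [code (tr (r ! p)) @ x, s1, [], []] out) 1"
      using run_Mv_in[of 2 ?is 3 "[code (tr (r ! p)) @ x, s1, [], []]" 1 out] by (simp add: add.commute)
    have "run (3 + 5) ?R (TP ?is [x, s1, [], []] out) (TP ?is' [code (tr (r ! p)) @ x, s1, [], []] out) (13 + 1 + 1 + 1)"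
      by (rule run_SqTP[OF 1 2]) auto
    then show ?thesis by (auto elim: run_mono)
  qed
  have gc: "nr (3 + 5) (Suc (30 + t)) (Sq (guess_bit 3) c # K, TP ?is [x, s1, [], []] out) (\<Union>b. X b)"
    if "\<And>b :: bool. nr (3 + 5) t (c # K, TP ?is [code (tr b) @ x, s1, [], []] out) (X b)" for t c K x X
    by (rule nr_Sq[OF g], rule nr_guess_cont[OF _ that]) simp
  have pc: "nr (3 + 5) t (c # K, TP ?is [bs @ x, s1, [], []] out) X \<Longrightarrow> length bs \<le> 3 \<Longrightarrow>
      nr (3 + 5) (Suc (13 + t)) (Sq (pushes 3 bs) c # K, TP ?is [x, s1, [], []] out) X" for t bs x c K X
    by (rule nr_Sq[OF g nr_run[OF run_mono[OF ps]]]) auto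
  have pT: "nr (3 + 5) t (c # K, TP ?is [True # x, s1, [], []] out) X \<Longrightarrow>
      nr (3 + 5) (Suc (3 + t)) (Sq (psh 3 0 True) c # K, TP ?is [x, s1, [], []] out) X" for t x c K X
    using nr_Sq[OF g nr_run[of "3 + 5" "psh 3 0 True" "TP ?is [x, s1, [], []] out" "TP ?is [True # x, s1, [], []] out" 3 t "c # K" X]]
      run_psh[of ?is 3 "[x, s1, [], []]" 0 True out] by simp
  have last: "nr (3 + 5) (Suc (20 + (13 + 0))) (Sq ?R ?P # K, TP ?is [x, s1, [], []] out)
     {(K, TP ?is' [True # True # code (tr (r ! p)) @ x, s1, [], []] out)}" for x
    by (rule nr_Sq[OF g nr_run[OF R nr_run[OF run_mono[OF ps]]]]) (use nr_0 in auto)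
  let ?X = "\<lambda>(g4 :: bool) (g3 :: bool) (g2 :: bool) (g1 :: bool). {(K, TP ?is' [True # True # code (tr (r ! p)) @ [True, True] @ code (tr g1) @ code (tr g2) @
       True # code (tr g3) @ code (tr g4) @ ?s0, s1, [], []] out)}"
  have all: "nr (3 + 5) 200 (tick_prog # K, TP ?is [?s0, s1, [], []] out) (\<Union>g4. \<Union>g3. \<Union>g2. \<Union>g1. ?X g4 g3 g2 g1)"
    unfolding tick_prog_def
    by (rule nr_mono, rule gc, rule gc, rule pT, rule gc, rule gc, rule pc, rule last) auto
  have "(\<Union>g4. \<Union>g3. \<Union>g2. \<Union>g1. ?X g4 g3 g2 g1) =
    (\<lambda>tk. (K, TP ?is' [code (tr (tk # acc)) @ s, s1, [], []] out)) ` {tk. fst tk = r ! p}"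
    by (auto simp: tr_prod_def image_iff) blast+
  with all show ?thesis by simp
qed

definition tick_loop :: prog where
  "tick_loop = Wh (3 + 1) 1 (Sq (pop 3 1) (Sq (pop 3 1) tick_prog))"

lemma nr_tick_loop:
  "p + n \<le> length r \<Longrightarrow>
   nr (3 + 5) (210 * n + 1) (tick_loop # K, TP [a, b, (r, int p)] [code (tr (acc :: tick list)) @ s, code (tr n) @ s1, [], []] out)
    ((\<lambda>t. (K, TP [a, b, (r, int (p + n))] [code (tr (rev t @ acc)) @ s, False # s1, [], []] out)) `
       {t. length t = n \<and> map fst t = take n (drop p r)})"
proof (induction n arbitrary: p acc)
  case 0
  have "run (3 + 5) tick_loop (TP [a, b, (r, int p)] [code (tr acc) @ s, False # s1, [], []] out)
     (TP [a, b, (r, int p)] [code (tr acc) @ s, False # s1, [], []] out) 1"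
    unfolding tick_loop_def
    by (rule run_Wh_end) (use reads_TP_stack[of 1 "[code (tr acc) @ s, False # s1, [], []]" "[a, b, (r, int p)]" out] in \<open>auto simp: good_TP numeral_eq_Suc\<close>)
  from run_nr[OF this] have "nr (3 + 5) 1 (tick_loop # K, TP [a, b, (r, int p)] [code (tr acc) @ s, False # s1, [], []] out)
    {(K, TP [a, b, (r, int p)] [code (tr acc) @ s, False # s1, [], []] out)}" by simp
  moreover have "{t :: tick list. length t = 0 \<and> map fst t = take 0 (drop p r)} = {[]}" by auto
  ultimately show ?case by simp
next
  case (Suc n)
  let ?is = "[a, b, (r, int p)]" and ?is1 = "[a, b, (r, int (Suc p))]"
  let ?f = "\<lambda>tk. (tick_loop # K, TP ?is1 [code (tr (tk # acc)) @ s, code (tr n) @ s1, [], []] out)"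
  let ?Y = "\<lambda>tk. (\<lambda>t. (K, TP [a, b, (r, int (Suc p + n))] [code (tr (rev t @ tk # acc)) @ s, False # s1, [], []] out)) `
       {t. length t = n \<and> map fst t = take n (drop (Suc p) r)}"
  have g: "good (3 + 5) (TP ?is [x, y, [], []] out)" for x y by (simp add: good_TP)
  have pp: "run (3 + 5) (pop 3 1) (TP ?is [x, c # y, [], []] out) (TP ?is [x, y, [], []] out) 3" for x y c
    using run_pop[of ?is 3 "[x, c # y, [], []]" 1 out] by simp
  have st: "dr (3 + 5) (Suc 0) (tick_loop # K, TP ?is [code (tr acc) @ s, code (tr (Suc n)) @ s1, [], []] out)
     (Sq (pop 3 1) (Sq (pop 3 1) tick_prog) # tick_loop # K, TP ?is [code (tr acc) @ s, code (tr (Suc n)) @ s1, [], []] out)"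
    by (rule dr_1[OF g]) (use reads_TP_stack[of 1 "[code (tr acc) @ s, code (tr (Suc n)) @ s1, [], []]" ?is out]
        in \<open>auto simp: tick_loop_def act_stay numeral_eq_Suc\<close>)
  have tk: "nr (3 + 5) 200 (tick_prog # tick_loop # K, TP ?is [code (tr acc) @ s, code (tr n) @ s1, [], []] out)
     (?f ` {tk. fst tk = r ! p})"
    by (rule nr_tick) (use Suc.prems in simp)
  have bd: "nr (3 + 5) (Suc (3 + Suc (3 + 200))) (Sq (pop 3 1) (Sq (pop 3 1) tick_prog) # tick_loop # K,
      TP ?is [code (tr acc) @ s, code (tr (Suc n)) @ s1, [], []] out) (?f ` {tk. fst tk = r ! p})"
    using nr_Sq[OF g nr_run[OF pp nr_Sq[OF g nr_run[OF pp tk]]]] by simp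
  have one: "nr (3 + 5) (Suc 0 + Suc (3 + Suc (3 + 200))) (tick_loop # K,
      TP ?is [code (tr acc) @ s, code (tr (Suc n)) @ s1, [], []] out) (?f ` {tk. fst tk = r ! p})"
    using nr_trans[OF dr_nr[OF st], of "Suc (3 + Suc (3 + 200))" "\<lambda>_. ?f ` {tk. fst tk = r ! p}"] bd by simp
  have IH: "nr (3 + 5) (210 * n + 1) (?f tk) (?Y tk)" for tk
    using Suc.IH[of "Suc p" "tk # acc"] Suc.prems by simp
  \<comment> \<open>The continuations of all ticks that lead to \<open>d\<close>; by
    \<open>injf\<close> there is at most one such tick.\<close>
  define F where "F d = (\<Union>tk\<in>{tk. fst tk = r ! p \<and> ?f tk = d}. ?Y tk)" for d
  have injf: "tk = tk'" if "?f tk = ?f tk'" for tk tk'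
  proof -
    have "stk (code (tr (tk # acc)) @ s) = stk (code (tr (tk' # acc)) @ s)"
      using that TP_nth_stack[of 0 "[code (tr (tk # acc)) @ s, code (tr n) @ s1, [], []]" ?is1 out]
        TP_nth_stack[of 0 "[code (tr (tk' # acc)) @ s, code (tr n) @ s1, [], []]" ?is1 out] by simp
    then have "code (tr (tk # acc)) @ s = code (tr (tk' # acc)) @ s" by (rule stk_inj)
    then show ?thesis by (cases tk; cases tk') (auto simp: tr_prod_def tr_bool_def split: if_splits)
  qed
  have "F (?f tk) = ?Y tk" if "fst tk = r ! p" for tk
    using that injf[of _ tk] unfolding F_def by blast
  then have "nr (3 + 5) (Suc 0 + Suc (3 + Suc (3 + 200)) + (210 * n + 1)) (tick_loop # K,
      TP ?is [code (tr acc) @ s, code (tr (Suc n)) @ s1, [], []] out) (\<Union>d\<in>?f ` {tk. fst tk = r ! p}. F d)"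
    by (intro nr_trans[OF one]) (use IH in auto)
  moreover have "(\<Union>d\<in>?f ` {tk. fst tk = r ! p}. F d) =
      (\<lambda>t. (K, TP [a, b, (r, int (p + Suc n))] [code (tr (rev t @ acc)) @ s, False # s1, [], []] out)) `
       {t. length t = Suc n \<and> map fst t = take (Suc n) (drop p r)}"
  proof -
    have d: "drop p r = r ! p # drop (Suc p) r" using Suc.prems by (simp add: Cons_nth_drop_Suc)
    have "{t :: tick list. length t = Suc n \<and> map fst t = take (Suc n) (drop p r)} =
      (\<Union>tk\<in>{tk. fst tk = r ! p}. (\<lambda>t. tk # t) ` {t. length t = n \<and> map fst t = take n (drop (Suc p) r)})"
      unfolding d by (auto simp: length_Suc_conv image_iff)
    then have "(\<lambda>t. (K, TP [a, b, (r, int (p + Suc n))] [code (tr (rev t @ acc)) @ s, False # s1, [], []] out)) `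
       {t. length t = Suc n \<and> map fst t = take (Suc n) (drop p r)} = (\<Union>tk\<in>{tk. fst tk = r ! p}. ?Y tk)"
      by (simp add: image_UN image_image)
    then show ?thesis using \<open>\<And>tk. fst tk = r ! p \<Longrightarrow> F (?f tk) = ?Y tk\<close> by auto
  qed
  ultimately show ?case by (auto elim!: nr_mono)
qed

lemma nr_Fail: "nr W 1 (Fail # K, ts) {}"
proof -
  have "nr W (Suc 0) (Fail # K, ts) (\<Union>d\<in>{d. sstep W (Fail # K, ts) d}. {})"
    by (rule nr_Suc) (auto simp: sstep_def)
  then show ?thesis by simp
qed

lemma nr_If:
  "good W a \<Longrightarrow> nr W t ((if reads a ! j = s then c1 else c2) # K, a) X \<Longrightarrow> nr W (Suc t) (If j s c1 c2 # K, a) X"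
  using nr_trans[OF dr_nr[OF dr_1, of W a "If j s c1 c2 # K" "(if reads a ! j = s then c1 else c2) # K" "stay (reads a)" a], of t "\<lambda>_. X"]
  by (simp add: act_stay)

text \<open>A configuration with empty continuation cannot move, so a path ends as soon as it
  reaches \<open>X\<close>, and the accepting paths are exactly those that do.\<close>

lemma nr_machine:
  assumes nr: "nr (m + 5) T ([c], TP (map (\<lambda>x. (x, 0)) ins) [[], [], [], []] []) X"
    and X: "\<And>d. d \<in> X \<Longrightarrow> fst d = []"
  shows "results (machine m c) ins = {out_string (1, snd d) | d. d \<in> X}"
    "halts_within (machine m c) ins T"
proof -
  have stuck: "k = 0 \<and> e = d" if dX: "d \<in> X" and de: "(sstep (m + 5) ^^ k) d e" for d k e
  proof (cases k)
    case (Suc k')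
    then obtain e' where "sstep (m + 5) d e'" using de relpowp_Suc_D2 by metis
    then show ?thesis using sstep_nonempty X[OF dX] by blast
  qed (use de in auto)
  show "halts_within (machine m c) ins T" unfolding halts_within_def init_conf_machine
  proof (intro allI impI)
    fix i C assume "(step (machine m c) ^^ i) (0, TP (map (\<lambda>x. (x, 0)) ins) [[], [], [], []] []) C"
    then obtain e where "(sstep (m + 5) ^^ i) ([c], TP (map (\<lambda>x. (x, 0)) ins) [[], [], [], []] []) e"
      unfolding relpow_step_machine by auto
    from nr_path[OF nr this] show "i \<le> T" using stuck by fastforce
  qed
  show "results (machine m c) ins = {out_string (1, snd d) | d. d \<in> X}"
  proof (intro equalityI subsetI)
    fix z assume "z \<in> results (machine m c) ins"
    then obtain i C where C: "(step (machine m c) ^^ i) (0, TP (map (\<lambda>x. (x, 0)) ins) [[], [], [], []] []) C"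
      "fst C = 1" "z = out_string C"
      unfolding results_def init_conf_machine by auto
    then obtain K ts where K: "C = (numb c K, ts)" "K \<in> cont_set c"
      "(sstep (m + 5) ^^ i) ([c], TP (map (\<lambda>x. (x, 0)) ins) [[], [], [], []] []) (K, ts)"
      unfolding relpow_step_machine by auto
    have "K = []" using K(1,2) C(2) numb(1,3)[of c] by (metis cont_set_def fst_conv inj_on_eq_iff insertI1)
    with nr_path[OF nr K(3)] obtain d k where "d \<in> X" "(sstep (m + 5) ^^ k) d (K, ts)" by auto
    with stuck have "(K, ts) \<in> X" by blast
    then show "z \<in> {out_string (1, snd d) | d. d \<in> X}" using C K by force
  next
    fix z assume "z \<in> {out_string (1, snd d) | d. d \<in> X}"
    then obtain d where d: "d \<in> X" "z = out_string (1, snd d)" by blast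
    obtain i where "(sstep (m + 5) ^^ i) ([c], TP (map (\<lambda>x. (x, 0)) ins) [[], [], [], []] []) d"
      using nr_reach[OF nr d(1)] by blast
    moreover have "d = ([], snd d)" using X[OF d(1)] by (simp add: prod_eq_iff)
    ultimately have "(step (machine m c) ^^ i) (0, TP (map (\<lambda>x. (x, 0)) ins) [[], [], [], []] []) (numb c [], snd d)"
      unfolding relpow_step_machine cont_set_def by (intro exI[of _ "[]"] exI[of _ "snd d"]) auto
    then show "z \<in> results (machine m c) ins" unfolding results_def init_conf_machine d(2) numb(3) by force
  qed
qed

lemma ticks_code_inj: "code (tr (t :: tick list)) = code (tr t') \<Longrightarrow> t = t'"
proof (induction t arbitrary: t')
  case Nil
  then show ?case by (cases t') auto
next
  case (Cons a t)
  then obtain b u where t': "t' = b # u" by (cases t') auto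
  have "a = b \<and> code (tr t) = code (tr u)" using Cons.prems unfolding t'
    by (cases a; cases b) (auto simp: tr_prod_def tr_bool_def split: if_splits)
  then show ?case using Cons.IH t' by simp
qed

lemma sz_ticks: "sz (t :: tick list) \<le> 20 * length t + 1"
proof (induction t)
  case (Cons a t)
  have "sz a \<le> 19" by (cases a) auto
  then show ?case using Cons by simp
qed simp

text \<open>The paths for one \<open>r\<close> correspond to the guesses of Merlin. The machine
  reads one random bit per tick, hence the lower bound on the length of \<open>r\<close>; the
  surplus is ignored.\<close>

lemma verification_machine:
  "\<exists>M C. is_ntm 3 M \<and> (\<forall>ad y r. 2 ^ fst ad \<le> length r \<longrightarrow>
    results M [y, code (tr ad), r] = {x. \<exists>t. length t = 2 ^ fst ad \<and> map fst t = take (2 ^ fst ad) r \<and>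
       verify tab w (2 ^ fst ad) ad y t = [x]} \<and>
    halts_within M [y, code (tr ad), r] ((2 ^ fst ad + sz (ad, y)) ^ C))"
proof -
  obtain ex E where ex: "\<And>m. wf_prog m (ex m)" "\<And>m. det_prog (ex m)"
    "\<And>m (ad :: advice) (y :: bool list). vrun m (ex m) (tr (ad, y)) (tr ((2 :: nat) ^ fst ad, ad, y))
       ((2 ^ fst ad + sz (ad, y)) ^ E)" using expand_prog by metis
  let ?v = "\<lambda>z :: tick list \<times> nat \<times> advice \<times> bool list. verify tab w (fst (snd z)) (fst (snd (snd z))) (snd (snd (snd z))) (rev (fst z))"
  obtain c T where c: "pbd (\<lambda>z. sz (?v z))" "pbd T" "cmp c T ?v"
    using PT_E[OF PT_verify] by blast
  have "PT (\<lambda>z :: nat \<times> advice \<times> bool list. fst z)" by (intro pt)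
  then obtain f S where f: "pbd S" "cmp f S (\<lambda>z :: nat \<times> advice \<times> bool list. fst z)" using PT_E by blast
  obtain B where B: "\<And>z. T z \<le> (sz z + 1) ^ B" using c(2) unfolding pbd_def by blast
  obtain A where A: "\<And>z. S z \<le> (sz z + 1) ^ A" using f(1) unfolding pbd_def by blast
  define pre where "pre = Sq (load_list 3 0) (Sq (load 3 1 [True] [False]) (Sq (psh 3 0 True) (Sq (ex 3)
     (Sq (dup 3) (Sq (f 3) (Sq (to_aux 3) (psh 3 0 False)))))))"
  define post where "post = Sq (pop 3 1) (Sq (psh 3 0 True) (Sq (c 3) (If (3 + 0) 1 Fail (Sq (pop 3 0) (emit 3)))))"
  define prg where "prg = Sq pre (Sq tick_loop post)"
  let ?t1 = "\<lambda>n. (32 * n + 9) + (21 * n + (3 + (n ^ E + (80 * (3 * n + 3) + ((3 * n + 3) ^ A + (30 * (3 * n + 3) + 3 + 1) + 1) + 1) + 1) + 1) + 1) + 1"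
  let ?t3 = "\<lambda>n. Suc (3 + Suc (3 + Suc ((30 * n + 30) ^ B + Suc (3 + (22 * n + 1) + 1))))"
  let ?t = "\<lambda>n. Suc (?t1 n + Suc ((210 * n + 1) + ?t3 n))"
  have wf: "wf_prog 3 prg"
    by (simp add: prg_def pre_def post_def tick_loop_def tick_prog_def guess_bit_def ex cmp_wf_det[OF c(3)] cmp_wf_det[OF f(2)])
  have main: "results (machine 3 prg) [y, code (tr ad), r] = {x. \<exists>t. length t = 2 ^ fst ad \<and> map fst t = take (2 ^ fst ad) r \<and>
       verify tab w (2 ^ fst ad) ad y t = [x]} \<and>
    halts_within (machine 3 prg) [y, code (tr ad), r] (?t (2 ^ fst ad + sz (ad, y)))"
    if r: "2 ^ fst ad \<le> length r" for ad y r
  proof -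
    let ?N = "(2::nat) ^ fst ad"
    let ?n = "?N + sz (ad, y)"
    let ?i0 = "[(y, 0), (code (tr ad), 0), (r, 0)] :: (bool list \<times> int) list"
    let ?i1 = "[(y, -1), (code (tr ad), 0), (r, 0)] :: (bool list \<times> int) list"
    let ?i2 = "[(y, -1), (code (tr ad), -1), (r, int 0)] :: (bool list \<times> int) list"
    let ?i3 = "[(y, -1), (code (tr ad), -1), (r, int (0 + ?N))] :: (bool list \<times> int) list"
    let ?z = "code (tr (?N, ad, y)) @ []"
    have ly: "length y \<le> sz (ad, y)" using length_sz[of y] by simp
    have lad: "length (code (tr ad)) \<le> sz (ad, y)" by (simp add: sz_def[of ad, symmetric])
    have szN: "sz (?N, ad, y) \<le> 3 * ?n + 3" "sz (?N, ad, y) + 1 \<le> 3 * ?n + 3" by simp_all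
    have 1: "run (3 + 5) (load_list 3 0) (TP ?i0 [[], [], [], []] []) (TP ?i1 [code (tr y) @ [], [], [], []] []) (32 * ?n + 9)"
      using run_mono[OF run_load_list[of 0 ?i0 3 y "[]" "[]" "[]"], of "32 * ?n + 9"] ly by simp
    have 2: "run (3 + 5) (load 3 1 [True] [False]) (TP ?i1 [code (tr y) @ [], [], [], []] []) (TP ?i2 [code (tr ad) @ code (tr y) @ [], [], [], []] []) (21 * ?n)"
      using run_mono[OF run_load_code[of 1 ?i1 3 "tr ad" "code (tr y) @ []" "[]" "[]"], of "21 * ?n"] lad by simp
    have 3: "run (3 + 5) (psh 3 0 True) (TP ?i2 [code (tr ad) @ code (tr y) @ [], [], [], []] []) (TP ?i2 [code (tr (ad, y)) @ [], [], [], []] []) 3"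
      using run_psh[of ?i2 3 "[code (tr ad) @ code (tr y) @ [], [], [], []]" 0 True "[]"] by (simp add: tr_prod_def)
    have 4: "run (3 + 5) (ex 3) (TP ?i2 [code (tr (ad, y)) @ [], [], [], []] []) (TP ?i2 [?z, [], [], []] []) (?n ^ E)"
      by (rule vrun_run[OF ex(3)]) simp
    have 5: "run (3 + 5) (dup 3) (TP ?i2 [?z, [], [], []] []) (TP ?i2 [code (tr (?N, ad, y)) @ ?z, [], [], []] []) (80 * (3 * ?n + 3))"
      by (rule run_mono[OF run_dup]) (use szN in \<open>simp_all add: sz_def[symmetric]\<close>)
    have 6: "run (3 + 5) (f 3) (TP ?i2 [code (tr (?N, ad, y)) @ ?z, [], [], []] []) (TP ?i2 [code (tr ?N) @ ?z, [], [], []] []) ((3 * ?n + 3) ^ A)"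
      using run_mono[OF cmp_run[OF f(2), of ?i2 3 "(?N, ad, y)" ?z "[]" "[]"] order.trans[OF A power_mono[OF szN(2)]]] by simp
    have 7: "run (3 + 5) (to_aux 3) (TP ?i2 [code (tr ?N) @ ?z, [], [], []] []) (TP ?i2 [?z, code (tr ?N) @ [], [], []] []) (30 * (3 * ?n + 3))"
      by (rule run_mono[OF run_to_aux]) (simp_all add: sz_def[symmetric])
    have 8: "run (3 + 5) (psh 3 0 False) (TP ?i2 [?z, code (tr ?N) @ [], [], []] []) (TP ?i2 [code (tr ([] :: tick list)) @ ?z, code (tr ?N) @ [], [], []] []) 3"
      using run_psh[of ?i2 3 "[?z, code (tr ?N) @ [], [], []]" 0 False "[]"] by simp
    have PRE: "run (3 + 5) pre (TP ?i0 [[], [], [], []] []) (TP ?i2 [code (tr ([] :: tick list)) @ ?z, code (tr ?N) @ [], [], []] []) (?t1 ?n)"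
      unfolding pre_def
      by (rule run_SqTP[OF 1 run_SqTP[OF 2 run_SqTP[OF 3 run_SqTP[OF 4 run_SqTP[OF 5 run_SqTP[OF 6 run_SqTP[OF 7 8]]]]]]]) auto
    let ?f = "\<lambda>t :: tick list. ([post], TP ?i3 [code (tr (rev t @ [])) @ ?z, False # [], [], []] [])"
    let ?TK = "{t :: tick list. length t = ?N \<and> map fst t = take ?N (drop 0 r)}"
    have LOOP: "nr (3 + 5) (210 * ?N + 1) (tick_loop # [post], TP ?i2 [code (tr ([] :: tick list)) @ ?z, code (tr ?N) @ [], [], []] []) (?f ` ?TK)"
      by (rule nr_tick_loop) (use r in simp)
    define F where "F t = {([] :: prog list, TP ?i3 [False # [False], [], [], []] ([] @ x)) | x. verify tab w ?N ad y t = [x]}" for t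
    have POST: "nr (3 + 5) (?t3 ?n) (?f t) (F t)" if t: "t \<in> ?TK" for t
    proof -
      let ?q = "(rev t, ?N, ad, y)"
      let ?r = "verify tab w ?N ad y t"
      have g: "good (3 + 5) (TP ?i3 [x, x', [], []] [])" for x x' by (simp add: good_TP)
      have p1: "run (3 + 5) (pop 3 1) (TP ?i3 [code (tr (rev t @ [])) @ ?z, False # [], [], []] []) (TP ?i3 [code (tr (rev t @ [])) @ ?z, [], [], []] []) 3"
        using run_pop[of ?i3 3 "[code (tr (rev t @ [])) @ ?z, False # [], [], []]" 1 "[]"] by simp
      have p2: "run (3 + 5) (psh 3 0 True) (TP ?i3 [code (tr (rev t @ [])) @ ?z, [], [], []] []) (TP ?i3 [code (tr ?q) @ [], [], [], []] []) 3"
        using run_psh[of ?i3 3 "[code (tr (rev t @ [])) @ ?z, [], [], []]" 0 True "[]"] by (simp add: tr_prod_def)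
      have "sz ?q + 1 \<le> 30 * ?n + 30" using sz_ticks[of "rev t"] t by simp
      then have p3: "run (3 + 5) (c 3) (TP ?i3 [code (tr ?q) @ [], [], [], []] []) (TP ?i3 [code (tr ?r) @ [], [], [], []] []) ((30 * ?n + 30) ^ B)"
        using run_mono[OF cmp_run[OF c(3), of ?i3 3 ?q "[]" "[]" "[]"] order.trans[OF B power_mono]] by simp
      have "nr (3 + 5) (3 + (22 * ?n + 1) + 1) ((if reads (TP ?i3 [code (tr ?r) @ [], [], [], []] []) ! (3 + 0) = 1 then Fail else Sq (pop 3 0) (emit 3)) # [],
          TP ?i3 [code (tr ?r) @ [], [], [], []] []) (F t)"
      proof (cases "accepts tab w ?N ad (fst (unp y)) (snd (unp y)) (guess_x t) (map fst t) (map (\<lambda>q. fst (snd q)) t)")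
        case True
        let ?x = "guess_x t"
        have v: "?r = [?x]" using True by (simp add: verify_def)
        have rd: "reads (TP ?i3 [code (tr ?r) @ [], [], [], []] []) ! (3 + 0) = 2"
          using reads_TP_stack[of 0 "[code (tr ?r) @ [], [], [], []]" ?i3 "[]"] v by (simp add: numeral_eq_Suc)
        have "length ?x \<le> length t" unfolding guess_x_def using length_filter_le[of fst "map (\<lambda>q. snd (snd q)) t"] by simp
        then have lx: "22 * length ?x + 1 \<le> 22 * ?n + 1" using t by simp
        have q1: "run (3 + 5) (pop 3 0) (TP ?i3 [code (tr ?r) @ [], [], [], []] []) (TP ?i3 [code (tr ?x) @ [False], [], [], []] []) 3"
          using run_pop[of ?i3 3 "[code (tr ?r) @ [], [], [], []]" 0 "[]"] v by simp
        have "run (3 + 5) (Sq (pop 3 0) (emit 3)) (TP ?i3 [code (tr ?r) @ [], [], [], []] []) (TP ?i3 [False # [False], [], [], []] ([] @ ?x)) (3 + (22 * ?n + 1) + 1)"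
          by (rule run_SqTP[OF q1 run_mono[OF run_emit lx]]) auto
        moreover have "F t = {([], TP ?i3 [False # [False], [], [], []] ([] @ ?x))}" unfolding F_def v by auto
        ultimately show ?thesis using rd by (simp only: if_False) (simp add: run_nr)
      next
        case False
        then have v: "?r = []" by (simp add: verify_def)
        have rd: "reads (TP ?i3 [code (tr ?r) @ [], [], [], []] []) ! (3 + 0) = 1"
          using reads_TP_stack[of 0 "[code (tr ?r) @ [], [], [], []]" ?i3 "[]"] v by (simp add: numeral_eq_Suc)
        have "F t = {}" unfolding F_def v by auto
        then show ?thesis unfolding rd using nr_mono[OF nr_Fail] by simp
      qed
      from nr_Sq[OF g nr_run[OF p1 nr_Sq[OF g nr_run[OF p2 nr_Sq[OF g nr_run[OF p3 nr_If[OF g this]]]]]]]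
      show ?thesis unfolding post_def .
    qed
    have g0: "good (3 + 5) (TP ?i0 [[], [], [], []] [])" "good (3 + 5) (TP ?i2 [code (tr ([] :: tick list)) @ ?z, code (tr ?N) @ [], [], []] [])"
      by (simp_all add: good_TP)
    define G where "G d = (\<Union>t\<in>{t \<in> ?TK. ?f t = d}. F t)" for d
    have fin: "nr (3 + 5) (?t3 ?n) d (G d)" if "d \<in> ?f ` ?TK" for d
    proof -
      from that obtain t where t: "t \<in> ?TK" "d = ?f t" by blast
      have "G d = F t"
      proof -
        have "t' = t" if "t' \<in> ?TK" "?f t' = ?f t" for t'
        proof -
          have "stk (code (tr (rev t' @ [])) @ ?z) = stk (code (tr (rev t @ [])) @ ?z)"
            using that(2) TP_nth_stack[of 0 "[code (tr (rev t' @ [])) @ ?z, False # [], [], []]" ?i3 "[]"]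
              TP_nth_stack[of 0 "[code (tr (rev t @ [])) @ ?z, False # [], [], []]" ?i3 "[]"] by simp
          then have "code (tr (rev t')) @ ?z = code (tr (rev t)) @ ?z" using stk_inj by fastforce
          then have "code (tr (rev t')) = code (tr (rev t))" by simp
          then show ?thesis using ticks_code_inj by fastforce
        qed
        then show ?thesis unfolding G_def using t by blast
      qed
      then show ?thesis using POST[OF t(1)] t(2) by simp
    qed
    have ALL: "nr (3 + 5) (?t ?n) ([prg], TP (map (\<lambda>x. (x, 0)) [y, code (tr ad), r]) [[], [], [], []] []) (\<Union>d\<in>?f ` ?TK. G d)"
    proof -
      have "nr (3 + 5) (210 * ?N + 1 + ?t3 ?n) (tick_loop # [post], TP ?i2 [code (tr ([] :: tick list)) @ ?z, code (tr ?N) @ [], [], []] []) (\<Union>d\<in>?f ` ?TK. G d)"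
        by (rule nr_trans[OF LOOP fin])
      then have "nr (3 + 5) (210 * ?n + 1 + ?t3 ?n) (tick_loop # [post], TP ?i2 [code (tr ([] :: tick list)) @ ?z, code (tr ?N) @ [], [], []] []) (\<Union>d\<in>?f ` ?TK. G d)"
        by (rule nr_mono) simp
      from nr_Sq[OF g0(1) nr_run[OF PRE nr_Sq[OF g0(2) this]]]
      show ?thesis unfolding prg_def by simp
    qed
    have X: "(\<Union>d\<in>?f ` ?TK. G d) = (\<Union>t\<in>?TK. F t)" unfolding G_def by blast
    have st: "fst d = []" if "d \<in> (\<Union>d\<in>?f ` ?TK. G d)" for d using that unfolding X F_def by auto
    have "{out_string (1, snd d) | d. d \<in> (\<Union>t\<in>?TK. F t)} = {x. \<exists>t. length t = ?N \<and> map fst t = take ?N r \<and> verify tab w ?N ad y t = [x]}"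
      unfolding F_def by (force simp: out_string_TP)
    then show ?thesis using nr_machine[OF ALL st] unfolding X by simp
  qed
  have "pbd (\<lambda>n :: nat. ?t n)" by (rule pbd_mono[of "\<lambda>n. ?t (sz n)"], intro pbd_intros pbd_Suc)
    (intro Suc_le_mono[THEN iffD2] add_mono mult_mono power_mono; simp)
  then obtain D where D: "\<And>n :: nat. ?t n \<le> (sz n + 1) ^ D" unfolding pbd_def by blast
  have bound: "?t (2 ^ fst ad + sz (ad, y)) \<le> (2 ^ fst ad + sz (ad, y)) ^ (3 * D)" for ad :: advice and y :: "bool list"
  proof -
    let ?n = "2 ^ fst ad + sz (ad, y)"
    have "?t ?n \<le> (sz ?n + 1) ^ D" by (rule D)
    also have "\<dots> \<le> (?n ^ 3) ^ D"
    proof (rule power_mono)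
      have "1 \<le> (2 :: nat) ^ fst ad" by simp
      then have "2 \<le> ?n" using sz_ge1[of "(ad, y)"] by linarith
      from cube_ge[OF this] show "sz ?n + 1 \<le> ?n ^ 3" by simp
    qed simp
    finally show ?thesis by (simp only: power_mult)
  qed
  show ?thesis
  proof (intro exI[of _ "machine 3 prg"] exI[of _ "3 * D"] conjI allI impI is_ntm_machine wf)
    fix ad :: advice and y r assume "2 ^ fst ad \<le> length (r :: bool list)"
    note m = main[OF this, of y]
    show "results (machine 3 prg) [y, code (tr ad), r] = {x. \<exists>t. length t = 2 ^ fst ad \<and> map fst t = take (2 ^ fst ad) r \<and>
       verify tab w (2 ^ fst ad) ad y t = [x]}" using m by blast
    show "halts_within (machine 3 prg) [y, code (tr ad), r] ((2 ^ fst ad + sz (ad, y)) ^ (3 * D))"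
      using m bound[of ad y] unfolding halts_within_def by (meson le_trans)
  qed
qed

section \<open>Averages over bit strings\<close>

definition BL :: "nat \<Rightarrow> bool list set" where "BL n = {x. length x = n}"

lemma finite_BL [simp]: "finite (BL n)"
  using finite_lists_length_eq[of "UNIV :: bool set" n] by (simp add: BL_def)

lemma card_BL [simp]: "card (BL n) = 2 ^ n"
  using card_lists_length_eq[of "UNIV :: bool set" n] by (simp add: BL_def)

lemma BL_0: "BL 0 = {[]}" by (auto simp: BL_def)

lemma sum_BL_add: "(\<Sum>x\<in>BL (m + n). f x) = (\<Sum>x\<in>BL m. \<Sum>y\<in>BL n. f (x @ y))"
proof -
  have "(\<Sum>x\<in>BL m. \<Sum>y\<in>BL n. f (x @ y)) = (\<Sum>(x, y)\<in>BL m \<times> BL n. f (x @ y))"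
    by (simp add: sum.cartesian_product)
  also have "\<dots> = (\<Sum>x\<in>BL (m + n). f x)"
    by (rule sum.reindex_bij_witness[of _ "\<lambda>x. (take m x, drop m x)" "\<lambda>(x, y). x @ y"])
      (auto simp: BL_def)
  finally show ?thesis ..
qed

lemma sum_BL_1: "(\<Sum>x\<in>BL 1. f x) = f [False] + f [True]"
proof -
  have "BL 1 = {[False], [True]}" by (auto simp: BL_def length_Suc_conv)
  then show ?thesis by simp
qed

lemma sum_BL_Suc: "(\<Sum>x\<in>BL (Suc n). f x) = (\<Sum>x\<in>BL n. f (False # x)) + (\<Sum>x\<in>BL n. f (True # x))"
  using sum_BL_add[of f 1 n] sum_BL_1[of "\<lambda>x. \<Sum>y\<in>BL n. f (x @ y)"] by simp

definition av :: "nat \<Rightarrow> (bool list \<Rightarrow> real) \<Rightarrow> real" where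
  "av n f = (\<Sum>x\<in>BL n. f x) / 2 ^ n"

lemma av_add: "av (m + n) f = av m (\<lambda>x. av n (\<lambda>y. f (x @ y)))"
  by (simp add: av_def sum_BL_add power_add sum_divide_distrib[symmetric] mult.commute)

lemma av_cong: "(\<And>x. length x = n \<Longrightarrow> f x = g x) \<Longrightarrow> av n f = av n g"
  unfolding av_def by (metis (mono_tags, lifting) BL_def mem_Collect_eq sum.cong)

lemma av_const [simp]: "av n (\<lambda>_. c) = c" by (simp add: av_def)

lemma av_mono: "(\<And>x. length x = n \<Longrightarrow> f x \<le> g x) \<Longrightarrow> av n f \<le> av n g"
  unfolding av_def by (intro divide_right_mono sum_mono) (auto simp: BL_def)

lemma av_diff: "av n (\<lambda>x. f x - g x) = av n f - av n g"
  by (simp add: av_def sum_subtractf diff_divide_distrib)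

lemma av_divide: "av n (\<lambda>x. f x / c) = av n f / c"
  by (simp add: av_def sum_divide_distrib[symmetric])

lemma av_ge_ex:
  assumes "c \<le> av n f" shows "\<exists>x. length x = n \<and> c \<le> f x"
proof (rule ccontr)
  assume "\<not> ?thesis"
  then have *: "f x < c" if "x \<in> BL n" for x using that by (force simp: BL_def not_le)
  have "BL n \<noteq> {}" by (auto simp: BL_def intro: exI[of _ "replicate n True"])
  then have "(\<Sum>x\<in>BL n. f x) < (\<Sum>x\<in>BL n. c)"
    by (intro sum_strict_mono) (use * in auto)
  then have "av n f < c" by (simp add: av_def field_simps)
  with assms show False by simp
qed

lemma av_Suc: "av (Suc n) f = (av n (\<lambda>x. f (False # x)) + av n (\<lambda>x. f (True # x))) / 2"
  by (simp add: av_def sum_BL_Suc add_divide_distrib)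

section \<open>A prime in a polynomial range\<close>

text \<open>Passing from \<open>n\<close> to \<open>Suc n\<close> adds the sum of
  \<open>mangoldt\<close> over the divisors of \<open>Suc n\<close>, and these are the
  \<open>d\<close> for which \<open>n div d\<close> increases. The fixed range up to
  \<open>M\<close> allows sums for different \<open>n\<close> to be subtracted.\<close>

lemma ln_fact_mangoldt:
  assumes "n \<le> M"
  shows "ln (fact n) = (\<Sum>d\<in>{1..M}. mangoldt d * real (n div d))"
  using assms
proof (induction n)
  case (Suc n)
  have "ln (fact (Suc n) :: real) = ln (real (Suc n)) + ln (fact n)"
    by (simp add: ln_mult)
  also have "ln (real (Suc n)) = (\<Sum>d | d dvd Suc n. mangoldt d)"
    using mangoldt_sum[of "Suc n", where 'a = real] by simp
  also have "\<dots> = (\<Sum>d\<in>{1..M}. if d dvd Suc n then mangoldt d else 0)"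
  proof (rule sum.mono_neutral_cong_left)
    show "{d. d dvd Suc n} \<subseteq> {1..M}"
    proof
      fix d assume "d \<in> {d. d dvd Suc n}"
      then have "d dvd Suc n" by simp
      then have "d \<le> Suc n" "d \<noteq> 0" by (auto dest: dvd_imp_le intro: Nat.gr0I)
      then show "d \<in> {1..M}" using Suc.prems by simp
    qed
  qed auto
  also have "\<dots> + ln (fact n) = (\<Sum>d\<in>{1..M}. (if d dvd Suc n then mangoldt d else 0) + mangoldt d * real (n div d))"
    using Suc by (simp add: sum.distrib)
  also have "\<dots> = (\<Sum>d\<in>{1..M}. mangoldt d * real (Suc n div d))"
  proof (rule sum.cong[OF refl])
    fix d assume "d \<in> {1..M}"
    then have "Suc n div d = n div d + (if d dvd Suc n then 1 else 0)"
      by (auto simp: div_Suc dvd_eq_mod_eq_0)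
    then show "(if d dvd Suc n then mangoldt d else 0) + mangoldt d * real (n div d) = mangoldt d * real (Suc n div d)"
      by (simp add: algebra_simps)
  qed
  finally show ?case .
qed simp

lemma central_binomial_ge: "2 ^ t \<le> (2 * t) choose t"
proof (induction t)
  case (Suc t)
  have "2 * ((2 * t) choose t) \<le> (2 * Suc t) choose Suc t"
  proof -
    have "(2 * Suc t) choose Suc t = (Suc (2 * t) choose t) + (Suc (2 * t) choose Suc t)" by simp
    moreover have "Suc (2 * t) choose t = Suc (2 * t) choose Suc t"
      using binomial_symmetric[of t "Suc (2 * t)"] by simp
    moreover have "(2 * t) choose t \<le> Suc (2 * t) choose Suc t" by simp
    ultimately show ?thesis by linarith
  qed
  then show ?case using Suc by simp
qed simp

text \<open>Chebyshev's argument with a wide margin. Without such a prime every prime power up to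
  \<open>2 ^ (2 * s + 4)\<close> has a base of at most \<open>2 ^ s\<close>, and there are too few
  of these for the sum of \<open>mangoldt\<close> to reach the logarithm of a central binomial
  coefficient.\<close>

lemma ex_prime_between: "\<exists>p :: nat. prime p \<and> 2 ^ s < p \<and> p \<le> 2 ^ (2 * s + 4)"
proof (rule ccontr)
  assume no: "\<not> ?thesis"
  \<comment> \<open>That is \<open>8 * 4 ^ s\<close>, just large enough to exceed the bound
    \<open>2 ^ s * (2 * s + 4) * s\<close> obtained at the end.\<close>
  define t :: nat where "t = 2 ^ (2 * s + 3)"
  define M where "M = 2 * t"
  have M: "M = 2 ^ (2 * s + 4)" by (simp add: M_def t_def power_add)
  have sub: "{d\<in>{1..M}. primepow d} \<subseteq> (\<lambda>(p, k). p ^ k) ` ({1..2 ^ s} \<times> {1..2 * s + 4})" (is "?A \<subseteq> ?f ` ?B")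
  proof
    fix d assume d: "d \<in> ?A"
    then obtain p k where pk: "prime p" "k > 0" "d = p ^ k" by (auto simp: primepow_def prime_elem_nat_iff)
    have "p \<le> d" using pk by (metis Suc_leI dvd_imp_le dvd_power prime_gt_0_nat zero_less_power)
    then have "p \<le> 2 ^ s" using no pk(1) d M by (metis (no_types, lifting) atLeastAtMost_iff le_trans mem_Collect_eq not_le)
    moreover have "2 ^ k \<le> (2::nat) ^ (2 * s + 4)"
    proof -
      have "2 ^ k \<le> p ^ k" using prime_ge_2_nat[OF pk(1)] by (intro power_mono) auto
      also have "\<dots> \<le> 2 ^ (2 * s + 4)" using d pk M by auto
      finally show ?thesis .
    qed
    then have "k \<le> 2 * s + 4" by (rule power_le_imp_le_exp[rotated]) simp
    ultimately have "(p, k) \<in> ?B" using pk(2) prime_gt_0_nat[OF pk(1)] by auto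
    then show "d \<in> ?f ` ?B" by (rule image_eqI[rotated]) (simp add: pk(3))
  qed
  have "real t * ln 2 = ln (2 ^ t)" by (simp add: ln_realpow)
  also have "\<dots> \<le> ln (real ((2 * t) choose t))"
  proof -
    have c: "(2 :: real) ^ t \<le> real ((2 * t) choose t)"
      using of_nat_mono[OF central_binomial_ge[of t], where 'a = real] by simp
    then have "0 < real ((2 * t) choose t)" by (rule order.strict_trans2[rotated]) simp
    with c show ?thesis by (subst ln_le_cancel_iff) auto
  qed
  also have "real ((2 * t) choose t) = fact (2 * t) / (fact t * fact t)"
    using binomial_fact[of t "2 * t", where 'a = real] by simp
  also have "ln \<dots> = ln (fact (2 * t)) - 2 * ln (fact t)"
    by (simp add: ln_div ln_mult)
  also have "\<dots> = (\<Sum>d\<in>{1..M}. mangoldt d * (real (2 * t div d) - 2 * real (t div d)))"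
  proof -
    have 1: "ln (fact (2 * t)) = (\<Sum>d\<in>{1..M}. mangoldt d * real (2 * t div d))"
      by (rule ln_fact_mangoldt) (simp add: M_def)
    have 2: "ln (fact t) = (\<Sum>d\<in>{1..M}. mangoldt d * real (t div d))"
      by (rule ln_fact_mangoldt) (simp add: M_def)
    show ?thesis unfolding 1 2 sum_distrib_left sum_subtractf[symmetric]
      by (rule sum.cong) (simp_all only: right_diff_distrib mult.left_commute)
  qed
  \<comment> \<open>Each coefficient \<open>2 * t div d - 2 * (t div d)\<close> is \<open>0\<close>
    or \<open>1\<close>.\<close>
  also have "\<dots> \<le> (\<Sum>d\<in>{1..M}. mangoldt d * 1)"
  proof (intro sum_mono mult_left_mono)
    fix d assume "d \<in> {1..M}"
    then have "t < (t div d + 1) * d"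
      using dividend_less_div_times[of d t] by (simp add: algebra_simps)
    then have "2 * t < (2 * (t div d) + 2) * d" by (simp add: algebra_simps)
    then have "2 * t div d < 2 * (t div d) + 2" by (rule less_mult_imp_div_less)
    then show "real (2 * t div d) - 2 * real (t div d) \<le> 1" by linarith
  qed (simp add: mangoldt_nonneg)
  also have "\<dots> = (\<Sum>d\<in>{1..M}. if primepow d then ln (real (aprimedivisor d)) else 0)"
    by (intro sum.cong) (auto simp: mangoldt_def)
  also have "\<dots> = (\<Sum>d\<in>{d\<in>{1..M}. primepow d}. ln (real (aprimedivisor d)))"
    by (rule sum.inter_filter[symmetric]) simp
  also have "\<dots> \<le> (\<Sum>d\<in>?A. real s * ln 2)"
  proof (intro sum_mono)
    fix d assume d: "d \<in> ?A"
    then obtain p k where pk: "prime p" "k > 0" "d = p ^ k" by (auto simp: primepow_def prime_elem_nat_iff)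
    have "p \<le> d" using pk by (metis Suc_leI dvd_imp_le dvd_power prime_gt_0_nat zero_less_power)
    then have "p \<le> 2 ^ s" using no pk(1) d M by (metis (no_types, lifting) atLeastAtMost_iff le_trans mem_Collect_eq not_le)
    then have "ln (real p) \<le> ln (2 ^ s)"
      using prime_gt_0_nat[OF pk(1)] of_nat_mono[OF \<open>p \<le> 2 ^ s\<close>, where 'a = real]
      by (subst ln_le_cancel_iff) auto
    then show "ln (real (aprimedivisor d)) \<le> real s * ln 2"
      using pk by (simp add: aprimedivisor_prime_power ln_realpow)
  qed
  also have "\<dots> = real (card ?A) * (real s * ln 2)" by simp
  also have "\<dots> \<le> real (2 ^ s * (2 * s + 4)) * (real s * ln 2)"
  proof (intro mult_right_mono)
    have "card ?A \<le> card (?f ` ?B)" by (rule card_mono) (use sub in auto)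
    also have "\<dots> \<le> card ?B" by (rule card_image_le) auto
    finally have "card ?A \<le> 2 ^ s * (2 * s + 4)" by (simp add: add.commute)
    then show "real (card ?A) \<le> real (2 ^ s * (2 * s + 4))" by linarith
  qed simp
  finally have "real t * ln 2 \<le> real (2 ^ s * (2 * s + 4)) * real s * ln 2" by simp
  then have "real t \<le> real (2 ^ s * (2 * s + 4) * s)" by simp
  then have le: "t \<le> 2 ^ s * (2 * s + 4) * s" by linarith
  have "(2 * s + 4) * s < 8 * 2 ^ s"
  proof (induction s)
    case (Suc s)
    show ?case
    proof (cases "s \<le> 1")
      case True
      then have "s = 0 \<or> s = 1" by linarith
      then show ?thesis by auto
    next
      case False
      then obtain k where "s = k + 2" by (metis add.commute le_Suc_ex not_less_eq_eq numeral_2_eq_2 One_nat_def)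
      then have "(2 * Suc s + 4) * Suc s \<le> 2 * ((2 * s + 4) * s)" by (simp add: algebra_simps)
      then show ?thesis using Suc by simp
    qed
  qed simp
  then have "2 ^ s * ((2 * s + 4) * s) < 2 ^ s * (8 * 2 ^ s)" by simp
  also have "\<dots> = t" by (simp add: t_def power_add power_mult power2_eq_square)
       (simp add: power_mult_distrib[symmetric] flip: power_add)
  finally show False using le by (simp add: mult.assoc)
qed

section \<open>The code\<close>

definition bval :: "bool list \<Rightarrow> nat" where
  "bval bs = foldr (\<lambda>b acc. (if b then 1 else 0) + 2 * acc) bs 0"

lemma bval_simps [simp]: "bval [] = 0" "bval (b # bs) = (if b then 1 else 0) + 2 * bval bs"
  by (simp_all add: bval_def)

lemma bval_less: "bval bs < 2 ^ length bs"
  by (induction bs) auto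

lemma bn_eq: "bval bs \<le> N \<Longrightarrow> bn N bs = bval bs"
  by (induction bs) (auto simp: bn_def)

lemma dig_Suc: "dig (Suc w) c = odd c # dig w (c div 2)"
proof -
  have "c div 2 ^ Suc i = c div 2 div 2 ^ i" for i by (simp add: div_mult2_eq)
  then show ?thesis unfolding dig_def by (simp add: upt_conv_Cons map_Suc_upt[symmetric] del: upt_Suc)
qed

lemma length_dig [simp]: "length (dig w c) = w" by (simp add: dig_def)

lemma bval_dig: "c < 2 ^ w \<Longrightarrow> bval (dig w c) = c"
proof (induction w arbitrary: c)
  case (Suc w)
  then have "c div 2 < 2 ^ w" by auto
  from Suc.IH[OF this] show ?case by (simp add: dig_Suc)
qed (simp add: dig_def)

lemma dig_bval: "dig (length bs) (bval bs) = bs"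
  by (induction bs) (simp add: dig_def, auto simp: dig_Suc)

lemma bval_inj: "length a = length b \<Longrightarrow> bval a = bval b \<Longrightarrow> a = b"
  by (metis dig_bval)

lemma pw_eq: "2 ^ e \<le> N \<Longrightarrow> pw N e = 2 ^ e"
proof -
  have "bval (replicate e False @ [True]) = 2 ^ e" by (induction e) auto
  then show "2 ^ e \<le> N \<Longrightarrow> pw N e = 2 ^ e" unfolding pw_def by (simp add: bn_eq)
qed

lemma set_allv: "2 ^ l \<le> N \<Longrightarrow> set (allv N l) = BL l"
proof -
  assume "2 ^ l \<le> N"
  then have "set (allv N l) = dig l ` {..<2 ^ l}" by (auto simp: allv_def pw_eq)
  also have "\<dots> = BL l"
  proof (intro equalityI subsetI)
    fix x assume "x \<in> BL l"
    then have "x = dig l (bval x)" "bval x < 2 ^ l" using dig_bval[of x] bval_less[of x] by (auto simp: BL_def)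
    then show "x \<in> dig l ` {..<2 ^ l}" by auto
  qed (auto simp: BL_def)
  finally show ?thesis .
qed

definition sg :: "bool \<Rightarrow> real" where "sg b = (if b then 1 else -1)"

lemma sg_sq [simp]: "sg b * sg b = 1" by (simp add: sg_def)

lemma sg_not: "sg (\<not> b) = - sg b" by (simp add: sg_def)

lemma had_Cons: "had c (b # h) = ((b \<and> odd c) \<noteq> had (c div 2) h)"
proof -
  have "snd (fold (\<lambda>b s. (fst s div 2, snd s \<noteq> (b \<and> odd (fst s)))) h (c, e)) =
    (e \<noteq> snd (fold (\<lambda>b s. (fst s div 2, snd s \<noteq> (b \<and> odd (fst s)))) h (c, False)))" for c e
  proof (induction h arbitrary: c e)
    case (Cons x h)
    show ?case using Cons.IH[of "c div 2" "e \<noteq> (x \<and> odd c)"] Cons.IH[of "c div 2" "False \<noteq> (x \<and> odd c)"] by auto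
  qed simp
  from this[of "c div 2" "b \<and> odd c"] show ?thesis by (simp add: had_def)
qed

text \<open>Splitting off the first bit of \<open>h\<close> gives two equal halves if the low bits
  of \<open>c\<close> and \<open>c'\<close> agree, and then the higher bits differ; otherwise the
  halves cancel.\<close>

lemma had_orth:
  assumes "c < 2 ^ w" "c' < 2 ^ w" "c \<noteq> c'"
  shows "(\<Sum>h\<in>BL w. sg (had c h) * sg (had c' h)) = 0"
  using assms
proof (induction w arbitrary: c c')
  case (Suc w)
  let ?S = "\<Sum>h\<in>BL w. sg (had (c div 2) h) * sg (had (c' div 2) h)"
  have T: "(\<Sum>h\<in>BL w. sg (had c (True # h)) * sg (had c' (True # h))) = (if odd c = odd c' then ?S else - ?S)"
    by (cases "odd c"; cases "odd c'") (simp_all add: had_Cons sg_not sum_negf)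
  have F: "(\<Sum>h\<in>BL w. sg (had c (False # h)) * sg (had c' (False # h))) = ?S"
    by (simp add: had_Cons)
  show ?case
  proof (cases "odd c = odd c'")
    case True
    then have "c div 2 \<noteq> c' div 2" using Suc.prems(3) by presburger
    moreover have "c div 2 < 2 ^ w" "c' div 2 < 2 ^ w" using Suc.prems by auto
    ultimately have "?S = 0" by (intro Suc.IH)
    then show ?thesis using T F by (simp add: sum_BL_Suc)
  next
    case False
    then show ?thesis using T F by (simp add: sum_BL_Suc)
  qed
qed simp

text \<open>Lagrange's bound, by dividing off one root at a time. Synthetic division over the
  integers keeps the leading coefficient, so its being prime to \<open>p\<close> passes on to the
  quotient.\<close>

lemma roots_mod_prime:
  fixes f :: "int poly"
  assumes "prime p" "\<not> int p dvd lead_coeff f" "finite R"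
    "\<And>a b. a \<in> R \<Longrightarrow> b \<in> R \<Longrightarrow> a \<noteq> b \<Longrightarrow> \<not> int p dvd a - b"
    "\<And>a. a \<in> R \<Longrightarrow> int p dvd poly f a"
  shows "card R \<le> degree f"
  using assms(2-)
proof (induction "degree f" arbitrary: f R)
  case 0
  then obtain c where f: "f = [:c:]" by (metis degree_eq_zeroE)
  have "R = {}"
  proof (rule ccontr)
    assume "R \<noteq> {}"
    then obtain a where "a \<in> R" by blast
    then show False using 0 f by auto
  qed
  then show ?case by simp
next
  case (Suc n)
  show ?case
  proof (cases "R = {}")
    case False
    then obtain a where a: "a \<in> R" by blast
    define g where "g = synthetic_div f a"
    have fg: "poly f x = (x - a) * poly g x + poly f a" for x
      using synthetic_div_correct'[of a f] unfolding g_def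
      by (metis (no_types, lifting) diff_add_eq_diff_diff_swap poly_add poly_mult poly_pCons mult_zero_right add.right_neutral poly_0 mult_1_right uminus_add_conv_diff add.commute)
    have deg: "degree g = n" using Suc.hyps(2) by (simp add: g_def degree_synthetic_div)
    have lc: "lead_coeff g = lead_coeff f"
    proof -
      have "f = [:-a, 1:] * g + [:poly f a:]" using synthetic_div_correct'[of a f] by (simp add: g_def)
      then have "coeff f (Suc n) = coeff ([:-a, 1:] * g + [:poly f a:]) (Suc n)" by simp
      also have "\<dots> = coeff g n" using deg coeff_eq_0[of g "Suc n"] by simp
      finally show ?thesis using deg Suc.hyps(2) by simp
    qed
    have "card (R - {a}) \<le> degree g"
    proof (rule Suc.hyps(1))
      show "n = degree g" using deg by simp
      show "\<not> int p dvd lead_coeff g" using lc Suc.prems(1) by simp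
      fix b assume b: "b \<in> R - {a}"
      then have "int p dvd (b - a) * poly g b" using Suc.prems(4)[of b] Suc.prems(4)[OF a] fg[of b]
        by (metis DiffD1 dvd_add_left_iff)
      moreover have "\<not> int p dvd b - a" using b Suc.prems(3)[of b a] a by auto
      ultimately show "int p dvd poly g b" using assms(1) by (metis prime_dvd_mult_iff prime_nat_int_transfer)
    qed (use Suc.prems in auto)
    then show ?thesis using a Suc.prems(2) deg Suc.hyps(2) by (simp add: card_Diff_singleton)
  qed simp
qed

definition msg_poly :: "bool list \<Rightarrow> int poly" where
  "msg_poly x = Poly (map of_bool (x @ [True]))"

lemma rs_poly: "int (rs P x a) = poly (msg_poly x) (int a) mod int (Suc P)"
proof -
  have "int (foldr (\<lambda>b acc. ((if b then 1 else 0) + a * acc) mod Suc P) y 0) =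
     poly (Poly (map of_bool y)) (int a) mod int (Suc P)" for y
  proof (induction y)
    case (Cons b y)
    have "int (foldr (\<lambda>b acc. ((if b then 1 else 0) + a * acc) mod Suc P) (b # y) 0) =
      ((if b then 1 else 0) + int a * (int (foldr (\<lambda>b acc. ((if b then 1 else 0) + a * acc) mod Suc P) y 0))) mod int (Suc P)"
      by (simp add: zmod_int)
    also have "\<dots> = ((if b then 1 else 0) + int a * (poly (Poly (map of_bool y)) (int a) mod int (Suc P))) mod int (Suc P)"
      unfolding Cons ..
    also have "\<dots> = ((if b then 1 else 0) + int a * poly (Poly (map of_bool y)) (int a)) mod int (Suc P)"
      by (metis mod_add_right_eq mod_mult_right_eq)
    also have "\<dots> = poly (Poly (map of_bool (b # y))) (int a) mod int (Suc P)" by simp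
    finally show ?case .
  qed simp
  then show ?thesis unfolding rs_def msg_poly_def by blast
qed

lemma coeffs_msg_poly: "coeffs (msg_poly x) = map of_bool (x @ [True])"
  unfolding msg_poly_def coeffs_Poly by (simp add: strip_while_def)

text \<open>The difference of two message polynomials has coefficients \<open>-1\<close>,
  \<open>0\<close>, \<open>1\<close>, hence a leading coefficient prime to \<open>Suc P\<close>, and
  its degree is at most \<open>n\<close>. The evaluation points are below the modulus and so
  incongruent.\<close>

lemma rs_collisions:
  assumes "prime (Suc P)" "2 ^ s \<le> Suc P" "x \<noteq> y" "length x \<le> n" "length y \<le> n"
  shows "card {a. a < 2 ^ s \<and> rs P x a = rs P y a} \<le> n"
proof -
  define f where "f = msg_poly x - msg_poly y"
  have inj: "map of_bool a = map (of_bool :: bool \<Rightarrow> int) b \<Longrightarrow> a = b" for a b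
    by (rule map_injective) (auto simp: inj_def)
  have "msg_poly x \<noteq> msg_poly y"
    using coeffs_msg_poly[of x] coeffs_msg_poly[of y] inj[of "x @ [True]" "y @ [True]"] assms(3) by auto
  then have f0: "f \<noteq> 0" by (simp add: f_def)
  have c01: "coeff (msg_poly z) i \<in> {0, 1}" for z i
    unfolding msg_poly_def coeff_Poly_eq nth_default_def by (auto simp: nth_append of_bool_def)
  have "lead_coeff f \<in> {-1, 1}"
  proof -
    have "lead_coeff f \<noteq> 0" using f0 by simp
    moreover have "lead_coeff f = coeff (msg_poly x) (degree f) - coeff (msg_poly y) (degree f)" by (simp add: f_def)
    ultimately show ?thesis using c01[of x "degree f"] c01[of y "degree f"] by auto
  qed
  then have lc: "\<not> int (Suc P) dvd lead_coeff f" using prime_gt_1_nat[OF assms(1)] by auto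
  have dg: "degree (msg_poly z) \<le> length z" for z
    by (simp add: degree_eq_length_coeffs coeffs_msg_poly)
  have "degree f \<le> n" unfolding f_def
    by (rule order.trans[OF degree_diff_le_max]) (use dg[of x] dg[of y] assms in auto)
  moreover have "card (int ` {a. a < 2 ^ s \<and> rs P x a = rs P y a}) \<le> degree f"
  proof (rule roots_mod_prime[OF assms(1) lc])
    fix a b assume ab: "a \<in> int ` {a. a < 2 ^ s \<and> rs P x a = rs P y a}" "b \<in> int ` {a. a < 2 ^ s \<and> rs P x a = rs P y a}" "a \<noteq> b"
    show "\<not> int (Suc P) dvd a - b"
    proof
      assume "int (Suc P) dvd a - b"
      moreover have "\<bar>a - b\<bar> < int (Suc P)" using ab assms(2) by auto
      ultimately have "a - b = 0" using dvd_imp_le_int[of "a - b" "int (Suc P)"] by linarith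
      then show False using ab(3) by simp
    qed
  next
    fix a assume "a \<in> int ` {a. a < 2 ^ s \<and> rs P x a = rs P y a}"
    then obtain a' where a': "a = int a'" "rs P x a' = rs P y a'" by auto
    have "poly (msg_poly x) a mod int (Suc P) = poly (msg_poly y) a mod int (Suc P)"
      using rs_poly[of P x a'] rs_poly[of P y a'] a' by simp
    then show "int (Suc P) dvd poly f a" by (simp add: f_def mod_eq_dvd_iff)
  qed simp
  moreover have "card (int ` {a. a < 2 ^ s \<and> rs P x a = rs P y a}) = card {a. a < 2 ^ s \<and> rs P x a = rs P y a}"
    by (rule card_image) simp
  ultimately show ?thesis by linarith
qed

lemma rs_less: "rs P x a < Suc P"
  unfolding rs_def by (cases x) auto

text \<open>By orthogonality of the Hadamard words, only evaluation points at which the two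
  Reed--Solomon words collide contribute, each with \<open>2 ^ s'\<close>.\<close>

lemma cw_inner:
  assumes "prime (Suc P)" "2 ^ s \<le> Suc P" "Suc P \<le> 2 ^ s'" "2 ^ s \<le> N" "x \<noteq> y" "length x \<le> n" "length y \<le> n"
  shows "(\<Sum>v\<in>BL (s + s'). sg (cw N s P x v) * sg (cw N s P y v)) \<le> real n * 2 ^ s'"
proof -
  have bn: "bn N t = bval t" if "t \<in> BL s" for t
    using that bval_less[of t] assms(4) by (intro bn_eq) (auto simp: BL_def)
  have "(\<Sum>v\<in>BL (s + s'). sg (cw N s P x v) * sg (cw N s P y v)) =
     (\<Sum>t\<in>BL s. \<Sum>h\<in>BL s'. sg (had (rs P x (bval t)) h) * sg (had (rs P y (bval t)) h))"
    unfolding sum_BL_add by (intro sum.cong refl) (auto simp: cw_def bn BL_def)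
  also have "\<dots> = (\<Sum>t\<in>BL s. if rs P x (bval t) = rs P y (bval t) then 2 ^ s' else 0)"
  proof (rule sum.cong[OF refl])
    fix t
    have "rs P x (bval t) < 2 ^ s'" "rs P y (bval t) < 2 ^ s'"
      using rs_less[of P x "bval t"] rs_less[of P y "bval t"] assms(3) by linarith+
    then show "(\<Sum>h\<in>BL s'. sg (had (rs P x (bval t)) h) * sg (had (rs P y (bval t)) h)) =
       (if rs P x (bval t) = rs P y (bval t) then 2 ^ s' else 0)"
      by (auto intro!: had_orth)
  qed
  also have "\<dots> = real (card {t\<in>BL s. rs P x (bval t) = rs P y (bval t)}) * 2 ^ s'"
    by (simp add: sum.If_cases Int_def)
  also have "\<dots> \<le> real n * 2 ^ s'"
  proof (intro mult_right_mono)
    have "card {t\<in>BL s. rs P x (bval t) = rs P y (bval t)} = card (bval ` {t\<in>BL s. rs P x (bval t) = rs P y (bval t)})"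
      by (rule card_image[symmetric]) (auto simp: inj_on_def BL_def intro: bval_inj)
    also have "\<dots> \<le> card {a. a < 2 ^ s \<and> rs P x a = rs P y a}"
      by (rule card_mono) (use bval_less in \<open>auto simp: BL_def\<close>)
    also have "\<dots> \<le> n" by (rule rs_collisions) (use assms in auto)
    finally show "real (card {t\<in>BL s. rs P x (bval t) = rs P y (bval t)}) \<le> real n" by simp
  qed simp
  finally show ?thesis .
qed

text \<open>The Johnson bound, by Cauchy--Schwarz applied to the sum of the candidate codewords.\<close>

lemma johnson:
  fixes c :: "'a \<Rightarrow> bool list \<Rightarrow> bool"
  assumes fin: "finite X" and eps: "0 < \<epsilon>" and F: "\<And>v. \<bar>F v\<bar> \<le> 1"
    and inner: "\<And>x y. x \<in> X \<Longrightarrow> y \<in> X \<Longrightarrow> x \<noteq> y \<Longrightarrow> (\<Sum>v\<in>BL l. sg (c x v) * sg (c y v)) \<le> \<epsilon>\<^sup>2 / 2 * 2 ^ l"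
    and corr: "\<And>x. x \<in> X \<Longrightarrow> \<epsilon> \<le> av l (\<lambda>v. sg (c x v) * F v)"
  shows "real (card X) \<le> 2 / \<epsilon>\<^sup>2"
proof -
  define M where "M = real (card X)"
  define G where "G v = (\<Sum>x\<in>X. sg (c x v))" for v
  define L where "L = (2 :: real) ^ l"
  have L: "L > 0" by (simp add: L_def)
  have corr': "\<epsilon> * L \<le> (\<Sum>v\<in>BL l. sg (c x v) * F v)" if "x \<in> X" for x
    using corr[OF that] L by (simp add: av_def L_def field_simps)
  have "M * (\<epsilon> * L) = (\<Sum>x\<in>X. \<epsilon> * L)" by (simp add: M_def)
  also have "\<dots> \<le> (\<Sum>x\<in>X. \<Sum>v\<in>BL l. sg (c x v) * F v)" by (intro sum_mono corr')
  also have "\<dots> = (\<Sum>v\<in>BL l. G v * F v)"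
    by (subst sum.swap) (simp add: G_def sum_distrib_right)
  finally have 1: "M * (\<epsilon> * L) \<le> (\<Sum>v\<in>BL l. G v * F v)" .
  have 2: "(\<Sum>v\<in>BL l. G v * F v)\<^sup>2 \<le> (\<Sum>v\<in>BL l. (G v)\<^sup>2) * (\<Sum>v\<in>BL l. (F v)\<^sup>2)"
    by (rule Cauchy_Schwarz_ineq_sum)
  have "(F v)\<^sup>2 \<le> 1" for v using F[of v] by (simp add: abs_le_square_iff[symmetric] power2_le_iff_abs_le abs_square_le_1)
  then have "(\<Sum>v\<in>BL l. (F v)\<^sup>2) \<le> (\<Sum>v\<in>BL l. 1)" by (intro sum_mono)
  then have 3: "(\<Sum>v\<in>BL l. (F v)\<^sup>2) \<le> L" by (simp add: L_def)
  have "(\<Sum>v\<in>BL l. (G v)\<^sup>2) = (\<Sum>x\<in>X. \<Sum>y\<in>X. \<Sum>v\<in>BL l. sg (c x v) * sg (c y v))"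
  proof -
    have "(\<Sum>v\<in>BL l. (G v)\<^sup>2) = (\<Sum>v\<in>BL l. \<Sum>x\<in>X. \<Sum>y\<in>X. sg (c x v) * sg (c y v))"
      by (simp add: G_def power2_eq_square sum_product)
    also have "\<dots> = (\<Sum>x\<in>X. \<Sum>v\<in>BL l. \<Sum>y\<in>X. sg (c x v) * sg (c y v))" by (rule sum.swap)
    also have "\<dots> = (\<Sum>x\<in>X. \<Sum>y\<in>X. \<Sum>v\<in>BL l. sg (c x v) * sg (c y v))"
      by (intro sum.cong refl sum.swap)
    finally show ?thesis .
  qed
  \<comment> \<open>Diagonal pairs contribute \<open>L\<close>, all others at most half of
    \<open>\<epsilon>\<close> squared times \<open>L\<close>. The lower bound has the full quadratic
    term in \<open>M\<close>, so half of it survives against a linear term.\<close>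
  also have "\<dots> \<le> (\<Sum>x\<in>X. \<Sum>y\<in>X. (if x = y then L else 0) + \<epsilon>\<^sup>2 / 2 * L)"
  proof (intro sum_mono)
    fix x y assume xy: "x \<in> X" "y \<in> X"
    show "(\<Sum>v\<in>BL l. sg (c x v) * sg (c y v)) \<le> (if x = y then L else 0) + \<epsilon>\<^sup>2 / 2 * L"
      using inner[OF xy] L by (cases "x = y") (auto simp: L_def)
  qed
  also have "\<dots> = M * L + M * M * (\<epsilon>\<^sup>2 / 2 * L)"
    using fin by (simp add: sum.distrib sum.delta M_def algebra_simps)
  finally have 4: "(\<Sum>v\<in>BL l. (G v)\<^sup>2) \<le> M * L + M * M * (\<epsilon>\<^sup>2 / 2 * L)" .
  have M0: "M \<ge> 0" by (simp add: M_def)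
  have "(M * (\<epsilon> * L))\<^sup>2 \<le> (\<Sum>v\<in>BL l. G v * F v)\<^sup>2"
    using 1 M0 eps L by (intro power_mono) auto
  also have "\<dots> \<le> (M * L + M * M * (\<epsilon>\<^sup>2 / 2 * L)) * L"
    using 2 mult_mono[OF 4 3] M0 L eps by (smt (verit) mult_nonneg_nonneg sum_nonneg zero_le_power2 divide_nonneg_nonneg)
  finally have "M * (M * \<epsilon>\<^sup>2) * (L * L) \<le> (M + M * M * (\<epsilon>\<^sup>2 / 2)) * (L * L)"
    by (simp add: power2_eq_square algebra_simps)
  then have 5: "M * (M * \<epsilon>\<^sup>2) \<le> M + M * M * (\<epsilon>\<^sup>2 / 2)" using L by (simp add: mult_le_cancel_right)
  show ?thesis
  proof (cases "M = 0")
    case True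
    then show ?thesis using eps by (simp add: M_def[symmetric])
  next
    case False
    then have "M > 0" using M0 by simp
    moreover have "M * (M * \<epsilon>\<^sup>2 / 2) \<le> M * 1" using 5 by (simp add: algebra_simps)
    ultimately have "M * \<epsilon>\<^sup>2 / 2 \<le> 1" by (simp only: mult_le_cancel_left_pos)
    then show ?thesis using eps by (simp add: M_def[symmetric] field_simps)
  qed
qed

section \<open>Sampling\<close>

definition cnt :: "nat \<Rightarrow> nat \<Rightarrow> ('a list \<Rightarrow> bool) \<Rightarrow> 'a list \<Rightarrow> nat" where
  "cnt T C G r = length (filter (\<lambda>i. G (chunk C i r)) [0..<T])"

lemma cnt_0 [simp]: "cnt 0 C G r = 0" by (simp add: cnt_def)

lemma chunk_append: "length w = C \<Longrightarrow> chunk C (Suc i) (w @ r) = chunk C i r" "length w = C \<Longrightarrow> chunk C 0 (w @ r) = w"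
  by (auto simp: chunk_def)

lemma cnt_Suc: "length w = C \<Longrightarrow> cnt (Suc T) C G (w @ r) = of_bool (G w) + cnt T C G r"
  unfolding cnt_def
  by (simp add: upt_conv_Cons map_Suc_upt[symmetric] filter_map o_def chunk_append del: upt_Suc)

lemma cnt_compl: "cnt T C G r + cnt T C (\<lambda>w. \<not> G w) r = T"
  using sum_length_filter_compl[of "\<lambda>i. G (chunk C i r)" "[0..<T]"] by (simp add: cnt_def)

text \<open>The chunks are disjoint, hence independent, and the exponential moment is a product. The
  \<open>R\<close> surplus bits only contribute a factor \<open>2 ^ R\<close>.\<close>

lemma sum_exp_cnt:
  "(\<Sum>r\<in>BL (T * C + R). exp (\<eta> * real (cnt T C G r))) = (\<Sum>w\<in>BL C. exp (\<eta> * of_bool (G w))) ^ T * 2 ^ R"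
proof (induction T)
  case (Suc T)
  have "(\<Sum>r\<in>BL (Suc T * C + R). exp (\<eta> * real (cnt (Suc T) C G r))) =
    (\<Sum>w\<in>BL C. \<Sum>r\<in>BL (T * C + R). exp (\<eta> * real (cnt (Suc T) C G (w @ r))))"
    using sum_BL_add[of _ C "T * C + R"] by (simp add: add.assoc)
  also have "\<dots> = (\<Sum>w\<in>BL C. \<Sum>r\<in>BL (T * C + R). exp (\<eta> * of_bool (G w)) * exp (\<eta> * real (cnt T C G r)))"
    by (intro sum.cong refl) (auto simp: BL_def cnt_Suc exp_add[symmetric] distrib_left)
  also have "\<dots> = (\<Sum>w\<in>BL C. exp (\<eta> * of_bool (G w))) * (\<Sum>r\<in>BL (T * C + R). exp (\<eta> * real (cnt T C G r)))"
    by (simp add: sum_product)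
  finally show ?case using Suc by simp
qed simp

text \<open>Exponential moments with parameter \<open>g / 2\<close>, for which
  \<open>exp \<eta> - 1\<close> is at most \<open>\<eta>\<close> plus its square; the constant in
  the exponent is not optimised.\<close>

lemma chernoff:
  assumes g: "0 < g" "g \<le> 1" and th: "real T * (av C (\<lambda>w. of_bool (G w)) + g) \<le> \<theta>"
  shows "real (card {r \<in> BL (T * C + R). \<theta> \<le> real (cnt T C G r)}) \<le> 2 ^ (T * C + R) * exp (- real T * g\<^sup>2 / 4)"
proof -
  define \<eta> where "\<eta> = g / 2"
  define \<mu> where "\<mu> = av C (\<lambda>w. of_bool (G w))"
  have \<eta>: "0 < \<eta>" "\<eta> \<le> 1" using g by (auto simp: \<eta>_def)
  have \<mu>: "0 \<le> \<mu>" "\<mu> \<le> 1"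
    using av_mono[of C "\<lambda>_. 0" "\<lambda>w. of_bool (G w)"] av_mono[of C "\<lambda>w. of_bool (G w)" "\<lambda>_. 1"] by (auto simp: \<mu>_def)
  let ?A = "{r \<in> BL (T * C + R). \<theta> \<le> real (cnt T C G r)}"
  have "(\<Sum>w\<in>BL C. exp (\<eta> * of_bool (G w))) = (\<Sum>w\<in>BL C. 1 + (exp \<eta> - 1) * of_bool (G w))"
    by (intro sum.cong) auto
  also have "\<dots> = 2 ^ C * (1 + (exp \<eta> - 1) * \<mu>)"
  proof -
    have "(\<Sum>w\<in>BL C. of_bool (G w)) = 2 ^ C * \<mu>" by (simp add: \<mu>_def av_def)
    then have "(\<Sum>w\<in>BL C. 1 + (exp \<eta> - 1) * of_bool (G w)) = 2 ^ C + (exp \<eta> - 1) * (2 ^ C * \<mu>)"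
      unfolding sum.distrib sum_distrib_left[symmetric] by simp
    then show ?thesis by (simp only: distrib_left mult_1_right mult.left_commute)
  qed
  also have "\<dots> \<le> 2 ^ C * exp ((\<eta> + \<eta>\<^sup>2) * \<mu>)"
  proof (rule mult_left_mono)
    have "exp \<eta> - 1 \<le> \<eta> + \<eta>\<^sup>2" using exp_bound[of \<eta>] \<eta> by simp
    then have "(exp \<eta> - 1) * \<mu> \<le> (\<eta> + \<eta>\<^sup>2) * \<mu>" using \<mu> by (intro mult_right_mono)
    then show "1 + (exp \<eta> - 1) * \<mu> \<le> exp ((\<eta> + \<eta>\<^sup>2) * \<mu>)"
      by (rule order.trans[OF add_left_mono exp_ge_add_one_self])
  qed simp
  finally have w: "(\<Sum>w\<in>BL C. exp (\<eta> * of_bool (G w))) \<le> 2 ^ C * exp ((\<eta> + \<eta>\<^sup>2) * \<mu>)" .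
  have "real (card ?A) * exp (\<eta> * \<theta>) = (\<Sum>r\<in>?A. exp (\<eta> * \<theta>))" by simp
  also have "\<dots> \<le> (\<Sum>r\<in>?A. exp (\<eta> * real (cnt T C G r)))"
    by (intro sum_mono) (use \<eta> in auto)
  also have "\<dots> \<le> (\<Sum>r\<in>BL (T * C + R). exp (\<eta> * real (cnt T C G r)))"
    by (intro sum_mono2) auto
  also have "\<dots> \<le> (2 ^ C * exp ((\<eta> + \<eta>\<^sup>2) * \<mu>)) ^ T * 2 ^ R"
    unfolding sum_exp_cnt by (intro mult_right_mono power_mono w sum_nonneg) auto
  also have "\<dots> = 2 ^ (T * C + R) * exp (real T * ((\<eta> + \<eta>\<^sup>2) * \<mu>))"
  proof -
    have 1: "((2::real) ^ C) ^ T = 2 ^ (T * C)" by (metis mult.commute power_mult)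
    have 2: "exp ((\<eta> + \<eta>\<^sup>2) * \<mu>) ^ T = exp (real T * ((\<eta> + \<eta>\<^sup>2) * \<mu>))" by (rule exp_of_nat_mult[symmetric])
    show ?thesis unfolding power_mult_distrib 1 2 power_add by simp
  qed
  finally have "real (card ?A) \<le> 2 ^ (T * C + R) * exp (real T * ((\<eta> + \<eta>\<^sup>2) * \<mu>)) / exp (\<eta> * \<theta>)"
    by (subst pos_le_divide_eq) simp_all
  also have "\<dots> = 2 ^ (T * C + R) * exp (real T * ((\<eta> + \<eta>\<^sup>2) * \<mu>) - \<eta> * \<theta>)"
    by (simp add: exp_diff)
  also have "\<dots> \<le> 2 ^ (T * C + R) * exp (- real T * g\<^sup>2 / 4)"
  proof (intro mult_left_mono)
    have "\<eta> * (real T * (\<mu> + g)) \<le> \<eta> * \<theta>" using th \<eta> unfolding \<mu>_def by (intro mult_left_mono) auto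
    then have "real T * ((\<eta> + \<eta>\<^sup>2) * \<mu>) - \<eta> * \<theta> \<le> real T * ((\<eta> + \<eta>\<^sup>2) * \<mu>) - \<eta> * (real T * (\<mu> + g))"
      by (rule diff_left_mono)
    also have "\<dots> = real T * (\<eta>\<^sup>2 * \<mu>) - real T * (\<eta> * g)" by (simp add: algebra_simps)
    also have "\<dots> \<le> real T * (\<eta>\<^sup>2 * 1) - real T * (\<eta> * g)"
      using \<mu> by (intro diff_right_mono mult_left_mono) auto
    also have "\<dots> = - real T * g\<^sup>2 / 4"
      by (simp add: \<eta>_def power2_eq_square field_simps)
    finally have "real T * ((\<eta> + \<eta>\<^sup>2) * \<mu>) - \<eta> * \<theta> \<le> - real T * g\<^sup>2 / 4" .
    then show "exp (real T * ((\<eta> + \<eta>\<^sup>2) * \<mu>) - \<eta> * \<theta>) \<le> exp (- real T * g\<^sup>2 / 4)" by simp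
  qed simp
  finally show ?thesis .
qed

text \<open>The upper tail of the complementary event.\<close>

lemma chernoff_lower:
  assumes g: "0 < g" "g \<le> 1" and th: "\<theta> \<le> real T * (av C (\<lambda>w. of_bool (G w)) - g)"
  shows "real (card {r \<in> BL (T * C + R). real (cnt T C G r) < \<theta>}) \<le> 2 ^ (T * C + R) * exp (- real T * g\<^sup>2 / 4)"
proof -
  have "av C (\<lambda>w. of_bool (\<not> G w)) = av C (\<lambda>w. 1 - of_bool (G w))" by (rule av_cong) auto
  also have "\<dots> = 1 - av C (\<lambda>w. of_bool (G w))" by (simp add: av_diff)
  finally have m: "av C (\<lambda>w. of_bool (\<not> G w)) = 1 - av C (\<lambda>w. of_bool (G w))" .
  have c: "real (cnt T C G r) = real T - real (cnt T C (\<lambda>w. \<not> G w) r)" for r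
    using cnt_compl[of T C G r] by linarith
  have "card {r \<in> BL (T * C + R). real (cnt T C G r) < \<theta>} \<le> card {r \<in> BL (T * C + R). real T - \<theta> \<le> real (cnt T C (\<lambda>w. \<not> G w) r)}"
    by (rule card_mono) (auto simp: c)
  moreover have "real (card {r \<in> BL (T * C + R). real T - \<theta> \<le> real (cnt T C (\<lambda>w. \<not> G w) r)}) \<le> 2 ^ (T * C + R) * exp (- real T * g\<^sup>2 / 4)"
    by (rule chernoff[OF g]) (use th in \<open>simp add: m algebra_simps\<close>)
  ultimately show ?thesis by linarith
qed

section \<open>The hybrid argument\<close>

lemma length_sub [simp]: "length (sub u S v) = length u"
proof -
  have "length (fold (\<lambda>p u. u[fst p := snd p]) ps u) = length u" for ps and u :: "'b list"
    by (induction ps arbitrary: u) auto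
  then show ?thesis by (simp add: sub_def)
qed

lemma sub_Nil [simp]: "sub u [] v = u" by (simp add: sub_def)

lemma sub_Cons [simp]: "sub u (i # S) (b # v) = sub (u[i := b]) S v" by (simp add: sub_def)

lemma lk_nth: "i < length u \<Longrightarrow> lk u i = u ! i"
  by (simp add: lk_def Cons_nth_drop_Suc[symmetric])

lemma sub_other: "length v = length S \<Longrightarrow> i \<notin> set S \<Longrightarrow> sub u S v ! i = u ! i"
proof (induction S arbitrary: u v)
  case (Cons j S)
  then obtain b v' where "v = b # v'" by (cases v) auto
  with Cons show ?case by simp
qed simp

lemma sub_same: "length v = length S \<Longrightarrow> distinct S \<Longrightarrow> set S \<subseteq> {..<length u} \<Longrightarrow> rd (sub u S v) S = v"
proof -
  assume *: "length v = length S" "distinct S" "set S \<subseteq> {..<length u}"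
  have "map (nth (sub u S v)) S = v" using *
  proof (induction S arbitrary: u v)
    case (Cons j S)
    then obtain b v' where v: "v = b # v'" by (cases v) auto
    have "sub (u[j := b]) S v' ! j = b" using Cons.prems v by (subst sub_other) auto
    then show ?case using Cons v by simp
  qed simp
  moreover have "map (lk (sub u S v)) S = map (nth (sub u S v)) S"
    by (intro map_cong refl lk_nth) (use *(3) in auto)
  ultimately show ?thesis by (simp add: rd_def)
qed

text \<open>Replacing bit \<open>i\<close> by a fresh fair bit does not change the uniform
  distribution; beyond the length the update is void.\<close>

lemma av_flip: "av d h = av d (\<lambda>u. (h (u[i := False]) + h (u[i := True])) / 2)"
proof (cases "i < d")
  case True
  have "(\<Sum>u\<in>BL d. h (u[i := False]) + h (u[i := True])) = (\<Sum>u\<in>BL d. h u + h (u[i := \<not> u ! i]))"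
  proof (rule sum.cong[OF refl])
    fix u show "h (u[i := False]) + h (u[i := True]) = h u + h (u[i := \<not> u ! i])"
      using list_update_id[of u i] by (cases "u ! i") simp_all
  qed
  also have "\<dots> = (\<Sum>u\<in>BL d. h u) + (\<Sum>u\<in>BL d. h (u[i := \<not> u ! i]))" by (simp add: sum.distrib)
  also have "(\<Sum>u\<in>BL d. h (u[i := \<not> u ! i])) = (\<Sum>u\<in>BL d. h u)"
    by (rule sum.reindex_bij_witness[of _ "\<lambda>u. u[i := \<not> u ! i]" "\<lambda>u. u[i := \<not> u ! i]"]) (use True in \<open>auto simp: BL_def\<close>)
  finally show ?thesis by (simp add: av_def sum_divide_distrib[symmetric])
next
  case False
  have "u[i := b] = u" if "length u = d" for u :: "bool list" and b using that False by (intro list_update_beyond) simp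
  then show ?thesis by (intro av_cong) auto
qed

text \<open>Overwriting the cells of \<open>S\<close> by fresh random bits leaves a uniform seed
  uniform; repetitions in \<open>S\<close> and cells beyond \<open>d\<close> do no harm.\<close>

lemma av_sub: "av d f = av d (\<lambda>u. av (length S) (\<lambda>v. f (sub u S v)))"
proof (induction S)
  case Nil
  show ?case by (simp add: av_def BL_0)
next
  case (Cons i S)
  have "av d f = av d (\<lambda>u. (av (length S) (\<lambda>v. f (sub (u[i := False]) S v)) + av (length S) (\<lambda>v. f (sub (u[i := True]) S v))) / 2)"
    by (subst Cons, rule av_flip)
  then show ?case by (simp add: av_Suc)
qed

lemma av_split_bit:
  assumes "I < m"
  shows "av m (\<lambda>w. f (drop I w)) = (av m (\<lambda>w. f (False # drop (Suc I) w)) + av m (\<lambda>w. f (True # drop (Suc I) w))) / 2"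
proof -
  obtain k where m: "m = I + Suc k" using assms less_imp_Suc_add by auto
  have "av m (\<lambda>w. f (drop I w)) = av (Suc k) f"
    unfolding m av_add by (subst av_cong[of I _ "\<lambda>_. av (Suc k) f"]) auto
  moreover have "av m (\<lambda>w. f (b # drop (Suc I) w)) = av k (\<lambda>w. f (b # w))" for b
  proof -
    have "av m (\<lambda>w. f (b # drop (Suc I) w)) = av I (\<lambda>x. av (Suc k) (\<lambda>y. f (b # drop 1 y)))"
      unfolding m av_add by (intro av_cong) auto
    also have "\<dots> = av k (\<lambda>w. f (b # w))" by (simp add: av_Suc)
    finally show ?thesis .
  qed
  ultimately show ?thesis by (simp add: av_Suc)
qed

text \<open>Let \<open>H i\<close> be the probability of hitting \<open>B\<close> when the first
  \<open>i\<close> bits come from the generator and the others are random. It climbs from at most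
  \<open>1 / 4\<close> to \<open>1\<close> in \<open>m\<close> steps, so some step gains
  \<open>3 / (4 * m)\<close>. After resampling the cells of the list of index \<open>I\<close>,
  averaging fixes the rest of the seed.\<close>

lemma hybrid:
  fixes g :: "bool list \<Rightarrow> bool list"
  assumes g: "\<And>u. length u = d \<Longrightarrow> g u \<in> B \<and> length (g u) = m"
    and B: "real (card (B \<inter> BL m)) \<le> 2 ^ m / 4" and m: "0 < m"
    and S: "\<And>i. i < m \<Longrightarrow> length (Ss ! i) = l"
  shows "\<exists>I u. I < m \<and> length u = d \<and>
    3 / (4 * real m) \<le> av l (\<lambda>v. av m (\<lambda>w. of_bool (take (Suc I) (g (sub u (Ss ! I) v)) @ drop (Suc I) w \<in> B))) -
      av l (\<lambda>v. av m (\<lambda>w. of_bool (take I (g (sub u (Ss ! I) v)) @ drop I w \<in> B)))"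
proof -
  define H where "H i = av d (\<lambda>u. av m (\<lambda>w. of_bool (take i (g u) @ drop i w \<in> B)))" for i
  have "H m = av d (\<lambda>u. av m (\<lambda>w. 1))" unfolding H_def by (intro av_cong) (use g in auto)
  then have Hm: "H m = 1" by simp
  have "H 0 = real (card (B \<inter> BL m)) / 2 ^ m"
    unfolding H_def by (simp add: av_def sum.If_cases Int_commute of_bool_def)
  then have H0: "H 0 \<le> 1 / 4" using divide_right_mono[OF B, of "2 ^ m"] by simp
  have "\<exists>I<m. 3 / (4 * real m) \<le> H (Suc I) - H I"
  proof (rule ccontr)
    assume "\<not> ?thesis"
    then have *: "H (Suc I) - H I < 3 / (4 * real m)" if "I < m" for I using that by force
    have "H m - H 0 = (\<Sum>I<m. H (Suc I) - H I)" by (simp add: sum_lessThan_telescope)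
    also have "\<dots> < (\<Sum>I<m. 3 / (4 * real m))" by (rule sum_strict_mono) (use * m in auto)
    also have "\<dots> = 3 / 4" using m by simp
    finally show False using Hm H0 by simp
  qed
  then obtain I where I: "I < m" "3 / (4 * real m) \<le> H (Suc I) - H I" by blast
  let ?f = "\<lambda>i u. av m (\<lambda>w. of_bool (take i (g u) @ drop i w \<in> B))"
  have "H (Suc I) - H I = av d (\<lambda>u. ?f (Suc I) u - ?f I u)" by (simp add: H_def av_diff)
  also have "\<dots> = av d (\<lambda>u. av l (\<lambda>v. ?f (Suc I) (sub u (Ss ! I) v) - ?f I (sub u (Ss ! I) v)))"
    using av_sub[of d "\<lambda>u. ?f (Suc I) u - ?f I u" "Ss ! I"] S[OF I(1)] by simp
  finally have "3 / (4 * real m) \<le> av d (\<lambda>u. av l (\<lambda>v. ?f (Suc I) (sub u (Ss ! I) v) - ?f I (sub u (Ss ! I) v)))"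
    using I(2) by simp
  from av_ge_ex[OF this] obtain u where u: "length u = d"
    "3 / (4 * real m) \<le> av l (\<lambda>v. ?f (Suc I) (sub u (Ss ! I) v) - ?f I (sub u (Ss ! I) v))" by blast
  show ?thesis by (intro exI[of _ I] exI[of _ u] conjI I(1) u(1)) (rule u(2)[unfolded av_diff])
qed

section \<open>The design\<close>

definition LL :: "nat \<Rightarrow> nat \<Rightarrow> bool list list set" where
  "LL l k = {a. length a = l \<and> set a \<subseteq> BL k}"

definition agr :: "bool list list \<Rightarrow> bool list list \<Rightarrow> nat" where
  "agr a b = length (filter (\<lambda>p. fst p = snd p) (zip a b))"

lemma finite_LL [simp]: "finite (LL l k)"
  unfolding LL_def using finite_lists_length_eq[OF finite_BL, of k l] by (simp add: conj_commute)

lemma card_LL: "card (LL l k) = (2 ^ k) ^ l"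
  unfolding LL_def using card_lists_length_eq[OF finite_BL, of k l] by (simp add: conj_commute)

lemma LL_Suc: "LL (Suc l) k = (\<lambda>(x, a). x # a) ` (BL k \<times> LL l k)"
  by (auto simp: LL_def length_Suc_conv image_iff)

text \<open>The sum factors over the coordinates: each has one agreeing value, of weight
  \<open>2\<close>, and \<open>2 ^ k - 1\<close> others of weight \<open>1\<close>.\<close>

lemma sum_agr:
  assumes "c \<in> LL l k"
  shows "(\<Sum>a\<in>LL l k. 2 ^ agr c a) = (2 ^ k + 1 :: nat) ^ l"
  using assms
proof (induction l arbitrary: c)
  case 0
  have "LL 0 k = {[]}" by (auto simp: LL_def)
  then show ?case by (simp add: agr_def)
next
  case (Suc l)
  then obtain x c' where c: "c = x # c'" "x \<in> BL k" "c' \<in> LL l k" by (auto simp: LL_def length_Suc_conv)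
  have "(\<Sum>a\<in>LL (Suc l) k. 2 ^ agr c a :: nat) = (\<Sum>(y, a)\<in>BL k \<times> LL l k. 2 ^ agr c (y # a) :: nat)"
    unfolding LL_Suc by (subst sum.reindex) (auto simp: inj_on_def case_prod_beta)
  also have "\<dots> = (\<Sum>y\<in>BL k. \<Sum>a\<in>LL l k. (if x = y then 2 else 1) * 2 ^ agr c' a)"
    unfolding sum.cartesian_product[symmetric] by (intro sum.cong refl) (simp add: c agr_def)
  also have "\<dots> = (\<Sum>y\<in>BL k. if x = y then 2 else 1) * (\<Sum>a\<in>LL l k. 2 ^ agr c' a)"
    by (simp add: sum_product)
  also have "(\<Sum>y\<in>BL k. if x = y then 2 else (1 :: nat)) = (\<Sum>y\<in>BL k. 1 + (if x = y then 1 else 0))"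
    by (intro sum.cong) auto
  also have "\<dots> = 2 ^ k + 1" using c(2) unfolding sum.distrib by (simp add: sum.delta)
  finally show ?case using Suc.IH[OF c(3)] by simp
qed

definition xorm :: "bool list list \<Rightarrow> bool list list \<Rightarrow> bool list list" where
  "xorm a b = map (\<lambda>q. xorv (fst q) (snd q)) (zip a b)"

lemma length_xorv [simp]: "length (xorv a b) = min (length a) (length b)" by (simp add: xorv_def)

lemma nth_xorv: "i < length a \<Longrightarrow> i < length b \<Longrightarrow> xorv a b ! i = (a ! i \<noteq> b ! i)" by (simp add: xorv_def)

lemma xorm_LL: "a \<in> LL l k \<Longrightarrow> b \<in> LL l k \<Longrightarrow> xorm a b \<in> LL l k"
proof -
  assume a: "a \<in> LL l k" and b: "b \<in> LL l k"
  have "length (xorv (fst q) (snd q)) = k" if "q \<in> set (zip a b)" for q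
  proof -
    have "fst q \<in> set a" "snd q \<in> set b"
      using that set_zip_leftD[of "fst q" "snd q" a b] set_zip_rightD[of "fst q" "snd q" a b] by simp_all
    then have "length (fst q) = k" "length (snd q) = k" using a b by (auto simp: LL_def BL_def)
    then show ?thesis by simp
  qed
  then show "xorm a b \<in> LL l k" using a b by (auto simp: LL_def xorm_def BL_def)
qed

lemma nth_xorm: "a \<in> LL l k \<Longrightarrow> b \<in> LL l k \<Longrightarrow> i < l \<Longrightarrow> xorm a b ! i = xorv (a ! i) (b ! i)"
  by (simp add: LL_def xorm_def)

lemma LL_nth: "a \<in> LL l k \<Longrightarrow> i < l \<Longrightarrow> length (a ! i) = k"
proof -
  assume a: "a \<in> LL l k" and i: "i < l"
  then have "a ! i \<in> set a" by (simp add: LL_def)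
  then show ?thesis using a by (auto simp: LL_def BL_def)
qed

definition zero_vec :: "nat \<Rightarrow> nat \<Rightarrow> bool list list" where
  "zero_vec l k = replicate l (replicate k False)"

lemma zero_vec_LL: "zero_vec l k \<in> LL l k" by (auto simp: LL_def zero_vec_def BL_def)

lemma cvec_Nil [simp]: "cvec l k A [] = zero_vec l k" by (simp add: cvec_def zero_vec_def)

lemma cvec_snoc:
  assumes "length j < length A"
  shows "cvec l k A (j @ [b]) = (if b then xorm (cvec l k A j) (A ! length j) else cvec l k A j)"
proof -
  have *: "zip (j @ [b]) (B @ x # C) = zip j (B @ x # C) @ [(b, x)]" if "length j = length B"
    for j B C and x :: "bool list list"
    using that by (induction j B rule: list_induct2) auto
  have A: "A = take (length j) A @ A ! length j # drop (Suc (length j)) A"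
    by (rule id_take_nth_drop[OF assms])
  have "zip (j @ [b]) A = zip j A @ [(b, A ! length j)]"
    using *[of j "take (length j) A" "A ! length j" "drop (Suc (length j)) A"] assms unfolding A[symmetric] by simp
  then show ?thesis by (simp add: cvec_def xorm_def)
qed

lemma cvec_LL: "set A \<subseteq> LL l k \<Longrightarrow> length j \<le> length A \<Longrightarrow> cvec l k A j \<in> LL l k"
proof (induction j rule: rev_induct)
  case Nil
  then show ?case by (simp add: zero_vec_LL)
next
  case (snoc b j)
  then have "A ! length j \<in> LL l k" by (metis length_append_singleton less_eq_Suc_le nth_mem subsetD)
  then show ?case using snoc by (auto simp: cvec_snoc intro: xorm_LL)
qed

lemma cvec_take: "cvec l k (A @ A') j = cvec l k A j" if "length j \<le> length A"
  using that by (simp add: cvec_def zip_append2)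

lemma xorv_append: "length a = length a' \<Longrightarrow> xorv (a @ b) (a' @ b') = xorv a a' @ xorv b b'"
  by (simp add: xorv_def)

lemma cvec_linear:
  assumes "set A \<subseteq> LL l k" "length j = length j'" "length j \<le> length A" "p < l" "i < k"
  shows "cvec l k A (xorv j j') ! p ! i = (cvec l k A j ! p ! i \<noteq> cvec l k A j' ! p ! i)"
  using assms(2,3)
proof (induction j arbitrary: j' rule: rev_induct)
  case Nil
  then show ?case using assms by (simp add: xorv_def zero_vec_def)
next
  case (snoc b j)
  then obtain c h where j': "j' = h @ [c]" "length h = length j"
    by (metis length_append_singleton length_Suc_conv_rev)
  have lt: "length j < length A" using snoc.prems by simp
  then have A: "A ! length j \<in> LL l k" using assms(1) by auto
  have x: "xorv (j @ [b]) (h @ [c]) = xorv j h @ [b \<noteq> c]" using j' by (simp add: xorv_append) (simp add: xorv_def)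
  have LLs: "cvec l k A j \<in> LL l k" "cvec l k A h \<in> LL l k" "cvec l k A (xorv j h) \<in> LL l k"
    using lt j' assms(1) by (auto intro!: cvec_LL)
  have nth: "xorm a (A ! length j) ! p ! i = (a ! p ! i \<noteq> A ! length j ! p ! i)" if "a \<in> LL l k" for a
    using that A assms(4,5) LL_nth by (simp add: nth_xorm nth_xorv)
  have IH: "cvec l k A (xorv j h) ! p ! i = (cvec l k A j ! p ! i \<noteq> cvec l k A h ! p ! i)"
    using snoc.IH[of h] lt j' by simp
  have lx: "length (xorv j h) = length j" using j' by simp
  show ?case unfolding j'(1) x using lt j'(2) lx nth LLs IH
    by (cases b; cases c; cases "cvec l k A j ! p ! i"; cases "cvec l k A h ! p ! i"; cases "A ! length j ! p ! i")
      (simp_all add: cvec_snoc)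
qed

lemma agr_card:
  assumes "a \<in> LL l k" "b \<in> LL l k" shows "agr a b = card {p. p < l \<and> a ! p = b ! p}"
proof -
  have "agr a b = card {p. p < length (zip a b) \<and> fst (zip a b ! p) = snd (zip a b ! p)}"
    unfolding agr_def by (rule length_filter_conv_card)
  also have "{p. p < length (zip a b) \<and> fst (zip a b ! p) = snd (zip a b ! p)} = {p. p < l \<and> a ! p = b ! p}"
    using assms by (auto simp: LL_def)
  finally show ?thesis .
qed

text \<open>Agreements of two combinations are zeros of their sum, so it suffices to control the
  zeros of single nonzero combinations instead of all pairs.\<close>

lemma agr_linear:
  assumes "set A \<subseteq> LL l k" "length j = length j'" "length j \<le> length A"
  shows "agr (cvec l k A j) (cvec l k A j') = agr (cvec l k A (xorv j j')) (zero_vec l k)"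
proof -
  have LLs: "cvec l k A j \<in> LL l k" "cvec l k A j' \<in> LL l k" "cvec l k A (xorv j j') \<in> LL l k"
    using assms by (auto intro!: cvec_LL)
  have "cvec l k A j ! p = cvec l k A j' ! p \<longleftrightarrow> cvec l k A (xorv j j') ! p = zero_vec l k ! p" if "p < l" for p
  proof -
    have "cvec l k A j ! p = cvec l k A j' ! p \<longleftrightarrow> (\<forall>i<k. cvec l k A j ! p ! i = cvec l k A j' ! p ! i)"
      using LLs that by (simp add: list_eq_iff_nth_eq LL_nth)
    also have "\<dots> \<longleftrightarrow> (\<forall>i<k. \<not> cvec l k A (xorv j j') ! p ! i)"
      using cvec_linear[OF assms that] by blast
    also have "\<dots> \<longleftrightarrow> cvec l k A (xorv j j') ! p = zero_vec l k ! p"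
      using LLs that by (simp add: list_eq_iff_nth_eq LL_nth zero_vec_def)
    finally show ?thesis .
  qed
  then have "{p. p < l \<and> cvec l k A j ! p = cvec l k A j' ! p} = {p. p < l \<and> cvec l k A (xorv j j') ! p = zero_vec l k ! p}" by blast
  then show ?thesis using LLs zero_vec_LL by (simp add: agr_card)
qed

text \<open>The left side is \<open>q ^ l\<close> times \<open>(1 + 1 / q) ^ l\<close>, and the
  latter is at most \<open>exp 1\<close>. This is the origin of the factor \<open>3\<close> in the
  design and of the demand for at least as many cells as coordinates.\<close>

lemma power_Suc_le_3: "(q + 1 :: nat) ^ l \<le> 3 * q ^ l" if "l \<le> q" "0 < q"
proof -
  have "(1 + 1 / real q) ^ l \<le> exp (1 / real q) ^ l"
    by (intro power_mono) (auto intro: exp_ge_add_one_self)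
  also have "\<dots> = exp (real l / real q)" by (simp add: exp_of_nat_mult[symmetric])
  also have "\<dots> \<le> exp 1" using that by simp
  also have "\<dots> \<le> 3" by (rule exp_le)
  finally have "(1 + 1 / real q) ^ l * real q ^ l \<le> 3 * real q ^ l" by (intro mult_right_mono) auto
  moreover have "(1 + 1 / real q) ^ l * real q ^ l = (real q + 1) ^ l"
    using that by (simp add: power_mult_distrib[symmetric] distrib_right)
  ultimately have "real ((q + 1) ^ l) \<le> real (3 * q ^ l)" by (simp add: add.commute)
  then show ?thesis by (simp only: of_nat_le_iff)
qed

text \<open>The columns are chosen one after the other, each not worse than the average over all columns.\<close>

lemma design_columns:
  assumes "l \<le> 2 ^ k"
  shows "\<exists>A. length A = E \<and> set A \<subseteq> LL l k \<and> (\<forall>e\<le>E.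
    (\<Sum>j\<in>BL e - {replicate e False}. 2 ^ agr (cvec l k A j) (zero_vec l k)) \<le> 3 * (2 ^ e - 1 :: nat))"
proof (induction E)
  case 0
  then show ?case by (auto simp: BL_0)
next
  case (Suc E)
  then obtain A where A: "length A = E" "set A \<subseteq> LL l k"
    "\<And>e. e \<le> E \<Longrightarrow> (\<Sum>j\<in>BL e - {replicate e False}. 2 ^ agr (cvec l k A j) (zero_vec l k)) \<le> 3 * (2 ^ e - 1 :: nat)"
    by blast
  have cj: "cvec l k A j \<in> LL l k" if "j \<in> BL E" for j using that A by (intro cvec_LL) (auto simp: BL_def)
  have "(\<Sum>a\<in>LL l k. \<Sum>j\<in>BL E. 2 ^ agr (cvec l k A j) a :: nat) = (\<Sum>j\<in>BL E. \<Sum>a\<in>LL l k. 2 ^ agr (cvec l k A j) a)"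
    by (rule sum.swap)
  also have "\<dots> = (\<Sum>j\<in>BL E. (2 ^ k + 1 :: nat) ^ l)" by (intro sum.cong refl sum_agr cj)
  also have "\<dots> \<le> 2 ^ E * (3 * (2 ^ k) ^ l)" using power_Suc_le_3[OF assms] by simp
  also have "\<dots> = (\<Sum>a\<in>LL l k. 3 * 2 ^ E)" by (simp add: card_LL)
  finally have le: "(\<Sum>a\<in>LL l k. \<Sum>j\<in>BL E. 2 ^ agr (cvec l k A j) a :: nat) \<le> (\<Sum>a\<in>LL l k. 3 * 2 ^ E)" .
  have "\<exists>a\<in>LL l k. (\<Sum>j\<in>BL E. 2 ^ agr (cvec l k A j) a) \<le> (3 * 2 ^ E :: nat)"
  proof (rule ccontr)
    assume "\<not> ?thesis"
    then have "(\<Sum>a\<in>LL l k. 3 * 2 ^ E :: nat) < (\<Sum>a\<in>LL l k. \<Sum>j\<in>BL E. 2 ^ agr (cvec l k A j) a)"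
      using zero_vec_LL[of l k] by (intro sum_strict_mono) (auto simp: not_le)
    with le show False by simp
  qed
  then obtain a where a: "a \<in> LL l k" "(\<Sum>j\<in>BL E. 2 ^ agr (cvec l k A j) a) \<le> (3 * 2 ^ E :: nat)" by blast
  let ?A = "A @ [a]"
  have old: "cvec l k ?A j = cvec l k A j" if "length j \<le> E" for j using that A(1) by (simp add: cvec_take)
  have "(\<Sum>j\<in>BL e - {replicate e False}. 2 ^ agr (cvec l k ?A j) (zero_vec l k)) \<le> 3 * (2 ^ e - 1 :: nat)" if e: "e \<le> Suc E" for e
  proof (cases "e = Suc E")
    case False
    then have "(\<Sum>j\<in>BL e - {replicate e False}. 2 ^ agr (cvec l k ?A j) (zero_vec l k) :: nat) =
       (\<Sum>j\<in>BL e - {replicate e False}. 2 ^ agr (cvec l k A j) (zero_vec l k))"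
      using e by (intro sum.cong) (auto simp: old BL_def)
    also have "\<dots> \<le> 3 * (2 ^ e - 1)" using A(3)[of e] False e by simp
    finally show ?thesis .
  next
    case True
    let ?f = "\<lambda>j. 2 ^ agr (cvec l k ?A j) (zero_vec l k) :: nat"
    let ?X = "(\<lambda>j. j @ [False]) ` (BL E - {replicate E False})" and ?Y = "(\<lambda>j. j @ [True]) ` BL E"
    have r: "replicate (Suc E) False = replicate E False @ [False]" by (simp add: replicate_append_same)
    \<comment> \<open>Combinations with last bit \<open>False\<close> are those of the previous
      stage; one with last bit \<open>True\<close> vanishes exactly where the old combination agrees
      with the new column \<open>a\<close>.\<close>
    have BLs: "BL (Suc E) - {replicate (Suc E) False} = ?X \<union> ?Y"
    proof (intro equalityI subsetI)
      fix j assume j: "j \<in> BL (Suc E) - {replicate (Suc E) False}"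
      then obtain h b where "j = h @ [b]" "h \<in> BL E" unfolding BL_def by (auto simp: length_Suc_conv_rev)
      with j show "j \<in> ?X \<union> ?Y" unfolding r by (cases b) auto
    next
      fix j assume "j \<in> ?X \<union> ?Y"
      then show "j \<in> BL (Suc E) - {replicate (Suc E) False}" unfolding r by (auto simp: BL_def)
    qed
    have "sum ?f (BL (Suc E) - {replicate (Suc E) False}) = sum ?f ?X + sum ?f ?Y"
      unfolding BLs by (rule sum.union_disjoint) auto
    also have "sum ?f ?X + sum ?f ?Y \<le> 3 * (2 ^ E - 1) + 3 * 2 ^ E"
    proof (rule add_mono)
    have "sum ?f ?X = (\<Sum>j\<in>BL E - {replicate E False}. 2 ^ agr (cvec l k A j) (zero_vec l k))"
    proof (subst sum.reindex)
      show "sum (?f \<circ> (\<lambda>j. j @ [False])) (BL E - {replicate E False}) = (\<Sum>j\<in>BL E - {replicate E False}. 2 ^ agr (cvec l k A j) (zero_vec l k))"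
        by (rule sum.cong) (auto simp: BL_def A(1) cvec_snoc old)
    qed (auto simp: inj_on_def)
    also have "\<dots> \<le> 3 * (2 ^ E - 1)" using A(3)[of E] by simp
    finally show "sum ?f ?X \<le> 3 * (2 ^ E - 1)" .
    have "sum ?f ?Y = (\<Sum>j\<in>BL E. 2 ^ agr (cvec l k A j) a)"
    proof (subst sum.reindex)
      show "sum (?f \<circ> (\<lambda>j. j @ [True])) (BL E) = (\<Sum>j\<in>BL E. 2 ^ agr (cvec l k A j) a)"
      proof (rule sum.cong[OF refl])
        fix j assume j: "j \<in> BL E"
        have "cvec l k ?A (j @ [True]) = xorm (cvec l k A j) a"
          using j A(1) by (simp add: cvec_snoc BL_def old nth_append)
        moreover have "agr (xorm (cvec l k A j) a) (zero_vec l k) = agr (cvec l k A j) a"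
        proof -
          have "xorm c a ! p = zero_vec l k ! p \<longleftrightarrow> c ! p = a ! p" if "c \<in> LL l k" "p < l" for c p
            using that a(1) LL_nth[of _ l k p] by (auto simp: nth_xorm zero_vec_def list_eq_iff_nth_eq nth_xorv)
          then have "{p. p < l \<and> xorm (cvec l k A j) a ! p = zero_vec l k ! p} = {p. p < l \<and> cvec l k A j ! p = a ! p}"
            using cj[OF j] by blast
          then show ?thesis using cj[OF j] a(1) zero_vec_LL xorm_LL by (simp add: agr_card[of _ l k])
        qed
        ultimately show "(?f \<circ> (\<lambda>j. j @ [True])) j = 2 ^ agr (cvec l k A j) a" by simp
      qed
    qed (auto simp: inj_on_def)
    also have "\<dots> \<le> 3 * 2 ^ E" by (rule a(2))
    finally show "sum ?f ?Y \<le> 3 * 2 ^ E" .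
    qed
    also have "3 * (2 ^ E - 1) + 3 * 2 ^ E = 3 * (2 ^ Suc E - 1 :: nat)"
      using one_le_power[of "2::nat" E] by simp
    finally show ?thesis unfolding True .
  qed
  then show ?case using A(1,2) a(1) by (intro exI[of _ ?A]) auto
qed

text \<open>A block of \<open>2 ^ e\<close> index lists costs at most \<open>3 * (2 ^ e - 1)\<close> repeated queries per list; this has to be
  covered by the number of lists from this block on, since the earlier blocks use disjoint parts of the
  seed and contribute one query per list.\<close>

fun okb :: "nat list \<Rightarrow> bool" where
  "okb [] \<longleftrightarrow> True"
| "okb (e # es) \<longleftrightarrow> 3 * (2 ^ e - 1) \<le> (sum_list (map (\<lambda>e. 2 ^ e) (e # es)) :: nat) \<and> okb es"

lemma okb_append_zeros: "okb es \<Longrightarrow> okb (es @ replicate n 0)"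
  by (induction es) (auto, induction n, auto)

lemma sum_list_map_Suc: "sum_list (map (\<lambda>e. 2 ^ e) (map Suc es)) = 2 * sum_list (map (\<lambda>e. 2 ^ e) es :: nat list)"
  by (induction es) auto

text \<open>Doubling a block raises its cost \<open>3 * (2 ^ e - 1)\<close> to twice as much plus
  \<open>3\<close>. The lists that have to cover it double as well, and three new singleton blocks
  pay the rest.\<close>

lemma okb_Suc: "okb es \<Longrightarrow> 3 \<le> n \<Longrightarrow> okb (map Suc es @ replicate n 0)"
proof (induction es)
  case Nil
  then show ?case using okb_append_zeros[of "[]" n] by simp
next
  case (Cons e es)
  have "3 * (2 ^ Suc e - 1) = 2 * (3 * (2 ^ e - 1)) + (3 :: nat)" by (cases "(2::nat) ^ e") (auto simp: algebra_simps)
  then show ?case using Cons sum_list_map_Suc[of "e # es"] by (auto simp: sum_list_replicate)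
qed

text \<open>By halving \<open>m - 3\<close>: the blocks for the half are doubled and three or four
  singletons appended, which makes at most four blocks for each binary digit of
  \<open>m\<close>.\<close>

lemma ex_blocks: "(m :: nat) < 2 ^ \<mu> \<Longrightarrow> \<exists>es. okb es \<and> sum_list (map (\<lambda>e. 2 ^ e) es) = m \<and> length es \<le> 4 * \<mu> \<and> (\<forall>e\<in>set es. e < \<mu>)"
proof (induction \<mu> arbitrary: m)
  case (Suc \<mu>)
  show ?case
  proof (cases "m < 3")
    case True
    then show ?thesis
      using okb_append_zeros[of "[]" m] by (intro exI[of _ "replicate m 0"]) (auto simp: sum_list_replicate)
  next
    case False
    define m' where "m' = (m - 3) div 2"
    have "m' < 2 ^ \<mu>" using Suc.prems False by (simp add: m'_def)
    then obtain es where es: "okb es" "sum_list (map (\<lambda>e. 2 ^ e) es) = m'" "length es \<le> 4 * \<mu>" "\<forall>e\<in>set es. e < \<mu>"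
      using Suc.IH by blast
    have n: "3 \<le> m - 2 * m'" "m - 2 * m' \<le> 4" "2 * m' \<le> m" using False unfolding m'_def by presburger+
    show ?thesis
    proof (intro exI[of _ "map Suc es @ replicate (m - 2 * m') 0"] conjI)
      show "okb (map Suc es @ replicate (m - 2 * m') 0)" by (rule okb_Suc[OF es(1) n(1)])
      show "sum_list (map (\<lambda>e. 2 ^ e) (map Suc es @ replicate (m - 2 * m') 0)) = m"
        using sum_list_map_Suc[of es] es(2) n by (simp add: sum_list_replicate)
    qed (use es n in auto)
  qed
qed simp

lemma sum_lessThan_add: "(\<Sum>i<a + b. f i) = (\<Sum>i<a. f i) + (\<Sum>i<b. f (a + i))" for f :: "nat \<Rightarrow> nat"
  by (induction b) (auto simp: add.assoc)

text \<open>A list of \<open>design\<close> without the cut at \<open>N\<close>, in the form used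
  for reasoning.\<close>

definition Sf :: "nat \<Rightarrow> nat \<Rightarrow> bool list list list \<Rightarrow> nat \<Rightarrow> nat \<Rightarrow> nat \<Rightarrow> nat list" where
  "Sf l k A \<beta> e j = map (\<lambda>r. (\<beta> * l + fst r) * 2 ^ k + bval (snd r)) (zip [0..<l] (cvec l k A (dig e j)))"

fun dsg :: "nat \<Rightarrow> nat \<Rightarrow> bool list list list \<Rightarrow> nat \<Rightarrow> nat list \<Rightarrow> nat list list" where
  "dsg l k A \<beta> [] = []"
| "dsg l k A \<beta> (e # es) = map (Sf l k A \<beta> e) [0..<2 ^ e] @ dsg l k A (Suc \<beta>) es"

lemma design_eq:
  assumes "\<forall>e\<in>set es. 2 ^ e \<le> N \<and> e \<le> length A" "set A \<subseteq> LL l k" "2 ^ k \<le> N"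
  shows "design N l k (2 ^ k) es A = dsg l k A 0 es"
proof -
  have S: "map (\<lambda>r. (\<beta> * l + fst r) * 2 ^ k + bn N (snd r)) (zip [0..<l] (cvec l k A (dig e j))) = Sf l k A \<beta> e j"
    if "e \<in> set es" for \<beta> e j
    unfolding Sf_def
  proof (rule map_cong[OF refl])
    fix r assume r: "r \<in> set (zip [0..<l] (cvec l k A (dig e j)))"
    have "cvec l k A (dig e j) \<in> LL l k" using assms that by (intro cvec_LL) auto
    moreover have "snd r \<in> set (cvec l k A (dig e j))" using r by (metis prod.collapse set_zip_rightD)
    ultimately have "length (snd r) = k" by (auto simp: LL_def BL_def)
    then have "bn N (snd r) = bval (snd r)" using bval_less[of "snd r"] assms(3) by (intro bn_eq) simp
    then show "(\<beta> * l + fst r) * 2 ^ k + bn N (snd r) = (\<beta> * l + fst r) * 2 ^ k + bval (snd r)" by simp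
  qed
  have "concat (map (\<lambda>p. map (\<lambda>j. map (\<lambda>r. (fst p * l + fst r) * 2 ^ k + bn N (snd r)) (zip [0..<l] (cvec l k A (dig (snd p) j))))
     [0..<pw N (snd p)]) (zip [b..<b + length fs] fs)) = dsg l k A b fs" if "set fs \<subseteq> set es" for b fs
    using that
  proof (induction fs arbitrary: b)
    case (Cons e fs)
    have "pw N e = 2 ^ e" using Cons.prems assms(1) by (simp add: pw_eq)
    moreover have "[b..<b + length (e # fs)] = b # [Suc b..<Suc b + length fs]" by (simp add: upt_conv_Cons del: upt_Suc)
    ultimately show ?case using Cons.IH[of "Suc b"] Cons.prems by (simp add: S)
  qed simp
  from this[of es 0] show ?thesis by (simp add: design_def)
qed

lemma length_dsg: "length (dsg l k A \<beta> es) = sum_list (map (\<lambda>e. 2 ^ e) es)"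
  by (induction es arbitrary: \<beta>) auto

lemma dsg_mem: "S \<in> set (dsg l k A \<beta> es) \<Longrightarrow> \<exists>\<gamma> e j. S = Sf l k A \<gamma> e j \<and> \<beta> \<le> \<gamma> \<and> \<gamma> < \<beta> + length es \<and> e \<in> set es \<and> j < 2 ^ e"
proof (induction es arbitrary: \<beta>)
  case (Cons e es)
  then consider "S \<in> set (map (Sf l k A \<beta> e) [0..<2 ^ e])" | "S \<in> set (dsg l k A (Suc \<beta>) es)" by auto
  then show ?case
  proof cases
    case 1
    then obtain j where "S = Sf l k A \<beta> e j" "j < 2 ^ e" by auto
    then show ?thesis by (intro exI[of _ \<beta>] exI[of _ e] exI[of _ j]) auto
  next
    case 2
    from Cons.IH[OF this] obtain \<gamma> e' j where "S = Sf l k A \<gamma> e' j" "Suc \<beta> \<le> \<gamma>" "\<gamma> < Suc \<beta> + length es" "e' \<in> set es" "j < 2 ^ e'" by blast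
    then show ?thesis by (intro exI[of _ \<gamma>] exI[of _ e'] exI[of _ j]) auto
  qed
qed simp

definition ov :: "nat \<Rightarrow> nat list \<Rightarrow> nat list \<Rightarrow> nat" where
  "ov l S S' = card {p. p < l \<and> S ! p \<in> set S'}"

context
  fixes l k :: nat and A :: "bool list list list"
  assumes A: "set A \<subseteq> LL l k"
begin

lemma Sf_len: "e \<le> length A \<Longrightarrow> length (Sf l k A \<beta> e j) = l"
  using cvec_LL[OF A, of "dig e j"] by (simp add: Sf_def LL_def)

lemma Sf_nth: "e \<le> length A \<Longrightarrow> p < l \<Longrightarrow> Sf l k A \<beta> e j ! p = (\<beta> * l + p) * 2 ^ k + bval (cvec l k A (dig e j) ! p)"
  using cvec_LL[OF A, of "dig e j"] by (simp add: Sf_def LL_def)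

lemma cvec_bval_less: "e \<le> length A \<Longrightarrow> p < l \<Longrightarrow> bval (cvec l k A (dig e j) ! p) < 2 ^ k"
  using cvec_LL[OF A, of "dig e j"] bval_less[of "cvec l k A (dig e j) ! p"] LL_nth[of "cvec l k A (dig e j)" l k p] by simp

text \<open>Mixed radix: a cell determines its block, its coordinate and its value.\<close>

lemma index_unique:
  assumes "(\<beta> * l + p) * 2 ^ k + c = (\<beta>' * l + p') * 2 ^ k + c'" "p < l" "p' < l" "c < 2 ^ k" "c' < 2 ^ k"
  shows "\<beta> = \<beta>' \<and> p = p' \<and> c = c'"
proof -
  have d: "(x * 2 ^ k + y) div 2 ^ k = x \<and> (x * 2 ^ k + y) mod 2 ^ k = y" if "y < 2 ^ k" for x y :: nat
    using that by simp
  have 1: "\<beta> * l + p = \<beta>' * l + p'" and c: "c = c'"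
    using d[OF assms(4), of "\<beta> * l + p"] d[OF assms(5), of "\<beta>' * l + p'"] unfolding assms(1) by auto
  have e: "(x * l + y) div l = x \<and> (x * l + y) mod l = y" if "y < l" for x y :: nat
    using that by simp
  show ?thesis using e[OF assms(2), of \<beta>] e[OF assms(3), of \<beta>'] c unfolding 1 by auto
qed

lemma Sf_range:
  assumes "e \<le> length A" "x \<in> set (Sf l k A \<beta> e j)"
  shows "\<beta> * (l * 2 ^ k) \<le> x" "x < Suc \<beta> * (l * 2 ^ k)"
proof -
  obtain p where p: "p < l" "x = (\<beta> * l + p) * 2 ^ k + bval (cvec l k A (dig e j) ! p)"
    using assms Sf_len[OF assms(1)] Sf_nth[OF assms(1)] by (auto simp: in_set_conv_nth)
  have c: "bval (cvec l k A (dig e j) ! p) < 2 ^ k" by (rule cvec_bval_less[OF assms(1) p(1)])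
  show "\<beta> * (l * 2 ^ k) \<le> x" unfolding p(2) by (simp add: algebra_simps)
  have "x < (\<beta> * l + p + 1) * 2 ^ k" unfolding p(2) using c by (simp add: algebra_simps)
  also have "\<dots> \<le> (\<beta> * l + l) * 2 ^ k" using p(1) by (intro mult_right_mono) auto
  finally show "x < Suc \<beta> * (l * 2 ^ k)" by (simp add: algebra_simps)
qed

lemma Sf_distinct: "e \<le> length A \<Longrightarrow> distinct (Sf l k A \<beta> e j)"
  unfolding distinct_conv_nth using Sf_len Sf_nth cvec_bval_less index_unique by metis

text \<open>Coordinates own disjoint groups of cells, so two lists of one block can share a cell
  only at the same coordinate and with the same value there.\<close>

lemma ov_same:
  assumes "e \<le> length A" shows "ov l (Sf l k A \<beta> e j) (Sf l k A \<beta> e j') = agr (cvec l k A (dig e j)) (cvec l k A (dig e j'))"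
proof -
  have LLs: "cvec l k A (dig e j) \<in> LL l k" for j using assms by (intro cvec_LL A) simp
  have "Sf l k A \<beta> e j ! p \<in> set (Sf l k A \<beta> e j') \<longleftrightarrow> cvec l k A (dig e j) ! p = cvec l k A (dig e j') ! p" if p: "p < l" for p
  proof
    assume "Sf l k A \<beta> e j ! p \<in> set (Sf l k A \<beta> e j')"
    then obtain p' where p': "p' < l" "Sf l k A \<beta> e j ! p = Sf l k A \<beta> e j' ! p'"
      using Sf_len[OF assms] by (auto simp: in_set_conv_nth)
    then have "p = p' \<and> bval (cvec l k A (dig e j) ! p) = bval (cvec l k A (dig e j') ! p')"
      using index_unique[of \<beta> p "bval (cvec l k A (dig e j) ! p)" \<beta> p' "bval (cvec l k A (dig e j') ! p')"] p cvec_bval_less[OF assms]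
      by (simp add: Sf_nth[OF assms])
    then show "cvec l k A (dig e j) ! p = cvec l k A (dig e j') ! p"
      using LL_nth[OF LLs p] by (intro bval_inj) auto
  next
    assume "cvec l k A (dig e j) ! p = cvec l k A (dig e j') ! p"
    then have "Sf l k A \<beta> e j ! p = Sf l k A \<beta> e j' ! p" using p by (simp add: Sf_nth[OF assms])
    then show "Sf l k A \<beta> e j ! p \<in> set (Sf l k A \<beta> e j')" using p Sf_len[OF assms] by simp
  qed
  then have "{p. p < l \<and> Sf l k A \<beta> e j ! p \<in> set (Sf l k A \<beta> e j')} = {p. p < l \<and> cvec l k A (dig e j) ! p = cvec l k A (dig e j') ! p}" by blast
  then show ?thesis unfolding ov_def agr_card[OF LLs LLs] by simp
qed

lemma xorv_self: "xorv j j = replicate (length j) False" by (induction j) (auto simp: xorv_def)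

lemma xorv_cancel: "length i = length j \<Longrightarrow> xorv j (xorv j i) = i"
  by (rule nth_equalityI) (auto simp: nth_xorv)

text \<open>Adding the digits of \<open>I\<close> maps the numbers of the earlier lists injectively
  to nonzero selections of columns, so the bound \<open>W\<close> covers all of them at
  once.\<close>

lemma block_sum:
  assumes e: "e \<le> length A" and I: "I < 2 ^ e"
    and W: "(\<Sum>j\<in>BL e - {replicate e False}. 2 ^ agr (cvec l k A j) (zero_vec l k)) \<le> 3 * (2 ^ e - 1 :: nat)"
  shows "(\<Sum>i<I. 2 ^ ov l (Sf l k A \<beta> e i) (Sf l k A \<beta> e I)) \<le> 3 * (2 ^ e - 1 :: nat)"
proof -
  let ?h = "\<lambda>i. xorv (dig e I) (dig e i)"
  have le: "(dig e i = dig e i') = (i = i')" if "i < 2 ^ e" "i' < 2 ^ e" for i i'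
    by (metis bval_dig that)
  have "(\<Sum>i<I. 2 ^ ov l (Sf l k A \<beta> e i) (Sf l k A \<beta> e I)) = (\<Sum>i<I. 2 ^ agr (cvec l k A (?h i)) (zero_vec l k) :: nat)"
  proof (rule sum.cong[OF refl])
    fix i
    have "agr (cvec l k A (dig e i)) (cvec l k A (dig e I)) = agr (cvec l k A (xorv (dig e i) (dig e I))) (zero_vec l k)"
      by (rule agr_linear[OF A]) (simp_all add: e)
    moreover have "xorv (dig e i) (dig e I) = ?h i" by (rule nth_equalityI) (auto simp: nth_xorv)
    ultimately have "ov l (Sf l k A \<beta> e i) (Sf l k A \<beta> e I) = agr (cvec l k A (?h i)) (zero_vec l k)"
      by (simp only: ov_same[OF e])
    then show "2 ^ ov l (Sf l k A \<beta> e i) (Sf l k A \<beta> e I) = (2 ^ agr (cvec l k A (?h i)) (zero_vec l k) :: nat)"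
      by (simp only:)
  qed
  also have "\<dots> = sum (\<lambda>j. 2 ^ agr (cvec l k A j) (zero_vec l k)) (?h ` {..<I})"
  proof (rule sum.reindex[symmetric, unfolded o_def])
    show "inj_on ?h {..<I}"
    proof (rule inj_onI)
      fix i i' assume h: "i \<in> {..<I}" "i' \<in> {..<I}" "?h i = ?h i'"
      have "dig e i = xorv (dig e I) (?h i)" by (simp add: xorv_cancel)
      also have "\<dots> = dig e i'" unfolding h(3) by (simp add: xorv_cancel)
      finally show "i = i'" using le[of i i'] h(1,2) I by (meson lessThan_iff less_trans)
    qed
  qed
  also have "\<dots> \<le> (\<Sum>j\<in>BL e - {replicate e False}. 2 ^ agr (cvec l k A j) (zero_vec l k))"
  proof (rule sum_mono2)
    show "?h ` {..<I} \<subseteq> BL e - {replicate e False}"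
    proof
      fix j assume "j \<in> ?h ` {..<I}"
      then obtain i where i: "i < I" "j = ?h i" by auto
      have "?h i \<noteq> replicate e False"
      proof
        assume "?h i = replicate e False"
        then have h: "?h i = ?h I" by (simp only: xorv_self length_dig)
        have "dig e i = xorv (dig e I) (?h i)" by (simp add: xorv_cancel)
        also have "\<dots> = dig e I" unfolding h by (simp add: xorv_cancel)
        finally have "i = I" using le[of i I] less_trans[OF i(1) I] I by blast
        then show False using i(1) by simp
      qed
      then show "j \<in> BL e - {replicate e False}" using i by (simp add: BL_def)
    qed
  qed auto
  also note W
  finally show ?thesis .
qed

text \<open>The weak-design condition: not the overlaps but the sum of their powers of two is
  bounded. This is what the length of \<open>pf\<close> needs, as an overlap of \<open>o\<close>
  cells causes up to \<open>2 ^ o\<close> queries.\<close>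

lemma design_sum:
  assumes W: "\<And>e. e \<le> length A \<Longrightarrow> (\<Sum>j\<in>BL e - {replicate e False}. 2 ^ agr (cvec l k A j) (zero_vec l k)) \<le> 3 * (2 ^ e - 1 :: nat)"
  shows "okb es \<Longrightarrow> \<forall>e\<in>set es. e \<le> length A \<Longrightarrow> I < length (dsg l k A \<beta> es) \<Longrightarrow>
    (\<Sum>i<I. 2 ^ ov l (dsg l k A \<beta> es ! i) (dsg l k A \<beta> es ! I)) \<le> length (dsg l k A \<beta> es)"
proof (induction es arbitrary: \<beta> I)
  case (Cons e es)
  let ?X = "map (Sf l k A \<beta> e) [0..<2 ^ e]" and ?Y = "dsg l k A (Suc \<beta>) es"
  have e: "e \<le> length A" using Cons.prems by simp
  show ?case
  proof (cases "I < 2 ^ e")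
    case True
    have "(\<Sum>i<I. 2 ^ ov l ((?X @ ?Y) ! i) ((?X @ ?Y) ! I)) = (\<Sum>i<I. 2 ^ ov l (Sf l k A \<beta> e i) (Sf l k A \<beta> e I) :: nat)"
      using True by (intro sum.cong) (auto simp: nth_append)
    also have "\<dots> \<le> 3 * (2 ^ e - 1)" by (rule block_sum[OF e True W[OF e]])
    also have "\<dots> \<le> length (?X @ ?Y)" using Cons.prems(1) by (simp add: length_dsg)
    finally show ?thesis by simp
  next
    case False
    define I' where "I' = I - 2 ^ e"
    have I: "I = 2 ^ e + I'" "I' < length ?Y" using False Cons.prems(3) by (auto simp: I'_def)
    have nI: "(?X @ ?Y) ! I = ?Y ! I'" using I by (simp add: nth_append)
    obtain \<gamma> f j where g: "?Y ! I' = Sf l k A \<gamma> f j" "Suc \<beta> \<le> \<gamma>" "f \<in> set es"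
      using dsg_mem[OF nth_mem[OF I(2)]] by blast
    have f: "f \<le> length A" using g(3) Cons.prems by simp
    have z: "ov l (Sf l k A \<beta> e i) (?Y ! I') = 0" for i
    proof -
      have "Sf l k A \<beta> e i ! p \<notin> set (Sf l k A \<gamma> f j)" if p: "p < l" for p
      proof
        assume "Sf l k A \<beta> e i ! p \<in> set (Sf l k A \<gamma> f j)"
        from Sf_range(1)[OF f this] have 1: "\<gamma> * (l * 2 ^ k) \<le> Sf l k A \<beta> e i ! p" .
        have "Sf l k A \<beta> e i ! p \<in> set (Sf l k A \<beta> e i)" using p Sf_len[OF e] by simp
        from Sf_range(2)[OF e this] have "Sf l k A \<beta> e i ! p < Suc \<beta> * (l * 2 ^ k)" .
        also have "\<dots> \<le> \<gamma> * (l * 2 ^ k)" using g(2) by (intro mult_right_mono) auto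
        finally show False using 1 by simp
      qed
      then have "{p. p < l \<and> Sf l k A \<beta> e i ! p \<in> set (Sf l k A \<gamma> f j)} = {}" by blast
      then show ?thesis unfolding g(1) ov_def by simp
    qed
    have "(\<Sum>i<I. 2 ^ ov l ((?X @ ?Y) ! i) ((?X @ ?Y) ! I)) =
       (\<Sum>i<2 ^ e. 2 ^ ov l ((?X @ ?Y) ! i) ((?X @ ?Y) ! I)) + (\<Sum>i<I'. 2 ^ ov l ((?X @ ?Y) ! (2 ^ e + i)) ((?X @ ?Y) ! I) :: nat)"
      unfolding I(1) by (rule sum_lessThan_add)
    also have "(\<Sum>i<2 ^ e. 2 ^ ov l ((?X @ ?Y) ! i) ((?X @ ?Y) ! I)) = (\<Sum>i<(2 :: nat) ^ e. 1 :: nat)"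
      using z unfolding nI by (intro sum.cong) (auto simp: nth_append)
    also have "(\<Sum>i<I'. 2 ^ ov l ((?X @ ?Y) ! (2 ^ e + i)) ((?X @ ?Y) ! I)) = (\<Sum>i<I'. 2 ^ ov l (?Y ! i) (?Y ! I') :: nat)"
      unfolding nI by (intro sum.cong) (auto simp: nth_append)
    also have "\<dots> \<le> length ?Y" by (rule Cons.IH) (use Cons.prems I in auto)
    finally show ?thesis by simp
  qed
qed simp

end

lemma card_vary:
  assumes "Z \<subseteq> BL l" "P \<subseteq> {..<l}" "\<And>z z' p. z \<in> Z \<Longrightarrow> z' \<in> Z \<Longrightarrow> p < l \<Longrightarrow> p \<notin> P \<Longrightarrow> z ! p = z' ! p"
  shows "card Z \<le> 2 ^ card P"
proof -
  have fP: "finite P" using assms(2) finite_subset by blast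
  have "inj_on (\<lambda>z. {p \<in> P. z ! p}) Z"
  proof (rule inj_onI)
    fix z z' assume z: "z \<in> Z" "z' \<in> Z" "{p \<in> P. z ! p} = {p \<in> P. z' ! p}"
    show "z = z'"
    proof (rule nth_equalityI)
      show "length z = length z'" using z assms(1) by (auto simp: BL_def)
      fix p assume "p < length z"
      then have "p < l" using z assms(1) by (auto simp: BL_def)
      then show "z ! p = z' ! p" using assms(3)[OF z(1,2)] z(3) by (cases "p \<in> P") blast+
    qed
  qed
  then have "card Z \<le> card (Pow P)" by (rule card_inj_on_le) (use fP in auto)
  then show ?thesis using fP by (simp add: card_Pow)
qed

text \<open>A query by list \<open>i\<close> depends on \<open>v\<close> only at the cells shared
  with list \<open>I\<close>; all others read the fixed seed \<open>u\<close>. So the overlap bounds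
  the number of different queries.\<close>

lemma length_pf:
  assumes l: "2 ^ l \<le> N" and I: "I < length Ss"
    and S: "\<And>S. S \<in> set Ss \<Longrightarrow> length S = l \<and> set S \<subseteq> {..<length u}"
    and ov: "(\<Sum>i<I. 2 ^ ov l (Ss ! i) (Ss ! I)) \<le> m"
  shows "length (pf N s P l Ss I u x) \<le> m"
proof -
  have SI: "nthl Ss I = Ss ! I" using I by (simp add: nthl_def Cons_nth_drop_Suc[symmetric])
  let ?Z = "\<lambda>i. (\<lambda>v. rd (sub u (Ss ! I) v) (Ss ! i)) ` BL l"
  have set: "set (concat (map (\<lambda>S. map (\<lambda>v. rd (sub u (nthl Ss I) v) S) (allv N l)) (take I Ss))) = (\<Union>i<I. ?Z i)"
  proof -
    have "set (take I Ss) = (\<lambda>i. Ss ! i) ` {..<I}" using nth_image[of I Ss] I by (simp add: lessThan_atLeast0)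
    then show ?thesis by (auto simp: set_allv[OF l] SI)
  qed
  have "length (pf N s P l Ss I u x) = card (\<Union>i<I. ?Z i)"
    unfolding pf_def length_map length_remdups_card_conv set ..
  also have "\<dots> \<le> (\<Sum>i<I. card (?Z i))" by (rule card_UN_le) simp
  also have "\<dots> \<le> (\<Sum>i<I. 2 ^ ov l (Ss ! i) (Ss ! I))"
  proof (rule sum_mono)
    fix i assume "i \<in> {..<I}"
    then have i: "Ss ! i \<in> set Ss" "Ss ! I \<in> set Ss" using I by auto
    show "card (?Z i) \<le> 2 ^ ov l (Ss ! i) (Ss ! I)" unfolding ov_def
    proof (rule card_vary)
      show "?Z i \<subseteq> BL l" using S[OF i(1)] by (auto simp: BL_def rd_def)
      fix z z' p assume z: "z \<in> ?Z i" "z' \<in> ?Z i" and p: "p < l" "p \<notin> {p. p < l \<and> Ss ! i ! p \<in> set (Ss ! I)}"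
      have "rd (sub u (Ss ! I) v) (Ss ! i) ! p = u ! (Ss ! i ! p)" if "v \<in> BL l" for v
      proof -
        have "Ss ! i ! p < length u" using S[OF i(1)] p(1) nth_mem[of p "Ss ! i"] by (metis lessThan_iff subsetD)
        then have "rd (sub u (Ss ! I) v) (Ss ! i) ! p = sub u (Ss ! I) v ! (Ss ! i ! p)"
          using S[OF i(1)] p(1) by (simp add: rd_def lk_nth)
        also have "\<dots> = u ! (Ss ! i ! p)"
          by (rule sub_other) (use that S[OF i(2)] p in \<open>auto simp: BL_def\<close>)
        finally show ?thesis .
      qed
      then show "z ! p = z' ! p" using z by auto
    qed auto
  qed
  also note ov
  finally show ?thesis .
qed

section \<open>Isolating the compressed string\<close>

text \<open>A sample of \<open>C\<close> random bits is cut into \<open>l\<close> bits for the list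
  of index \<open>I\<close>, one bit for each output, and padding.\<close>

lemma target_av:
  assumes "C = l + length Ss + c"
  shows "av C (\<lambda>rc. f (target N s P l Ss I u x rc)) =
     av l (\<lambda>v. av (length Ss) (\<lambda>w. f (take (Suc I) (nw N s P Ss x (sub u (nthl Ss I) v)) @ drop (Suc I) w)))"
proof -
  have "av C (\<lambda>rc. f (target N s P l Ss I u x rc)) = av l (\<lambda>v. av (length Ss) (\<lambda>w. av c (\<lambda>z. f (target N s P l Ss I u x (v @ w @ z)))))"
    unfolding assms by (simp add: av_add add.assoc)
  also have "\<dots> = av l (\<lambda>v. av (length Ss) (\<lambda>w. av c (\<lambda>z. f (take (Suc I) (nw N s P Ss x (sub u (nthl Ss I) v)) @ drop (Suc I) w))))"
    by (intro av_cong) (simp add: target_def)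
  finally show ?thesis by simp
qed

text \<open>Equal compressed strings fix all code bits that the earlier outputs can query, whatever
  \<open>v\<close> is.\<close>

lemma nw_prefix:
  assumes l: "2 ^ l \<le> N" and v: "length v = l" and pf: "pf N s P l Ss I u x = pf N s P l Ss I u a"
  shows "take I (nw N s P Ss x (sub u (nthl Ss I) v)) = take I (nw N s P Ss a (sub u (nthl Ss I) v))"
proof -
  have "cw N s P x (rd (sub u (nthl Ss I) v) S) = cw N s P a (rd (sub u (nthl Ss I) v) S)" if "S \<in> set (take I Ss)" for S
  proof -
    have "v \<in> set (allv N l)" using v by (simp add: set_allv[OF l] BL_def)
    then have "rd (sub u (nthl Ss I) v) S \<in> set (remdups (concat (map (\<lambda>S. map (\<lambda>v. rd (sub u (nthl Ss I) v) S) (allv N l)) (take I Ss))))"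
      using that by auto
    then show ?thesis using pf unfolding pf_def by (auto simp: map_eq_conv)
  qed
  then show ?thesis unfolding nw_def take_map by (auto simp: map_eq_conv)
qed

text \<open>The parameters enter as follows. \<open>2 ^ s\<close> must exceed \<open>n\<close> times
  the size of the candidate list, which also makes the inner products small enough for
  \<open>johnson\<close>; the prime must fit into \<open>s'\<close> bits for the Hadamard words; and
  \<open>T\<close> must beat a union bound over all strings of the length of
  \<open>a\<close>.\<close>

lemma isolate:
  fixes N s P l n m d T C c R :: nat and Ss :: "nat list list" and a :: "bool list" and B :: "bool list set"
  defines "W \<equiv> \<lambda>x u. nw N s P Ss x u"
  assumes prime: "prime (Suc P)" "2 ^ s \<le> Suc P" "Suc P \<le> 2 ^ s'" and l: "l = s + s'" and N: "2 ^ l \<le> N"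
    and m: "length Ss = m" "0 < m" and C: "C = l + m + c"
    and S: "\<And>S. S \<in> set Ss \<Longrightarrow> length S = l \<and> distinct S \<and> set S \<subseteq> {..<d}"
    and B: "real (card (B \<inter> BL m)) \<le> 2 ^ m / 4" "\<And>u. length u = d \<Longrightarrow> W a u \<in> B"
    and n: "length a \<le> n" "8 * real n * (4 * real m / 3)\<^sup>2 < 2 ^ s"
    and T: "64 * (real n + 3) * (4 * real m / 3)\<^sup>2 \<le> real T"
  shows "\<exists>I u th e. I < m \<and> length u = d \<and> th \<le> T \<and> e < 2 ^ s \<and>
    3 * real (card {r \<in> BL (T * C + R). \<not> ((\<forall>x. length x = length a \<and> pf N s P l Ss I u x = pf N s P l Ss I u a \<and>
        rs P x e = rs P a e \<and> th \<le> cnt T C (\<lambda>rc. target N s P l Ss I u x rc \<in> B) r \<longrightarrow> x = a) \<and>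
        th \<le> cnt T C (\<lambda>rc. target N s P l Ss I u a rc \<in> B) r)}) < 2 ^ (T * C + R)"
proof -
  \<comment> \<open>The gain of the hybrid step.\<close>
  define \<epsilon> where "\<epsilon> = 3 / (4 * real m)"
  have eps: "0 < \<epsilon>" "\<epsilon> \<le> 1" using m by (auto simp: \<epsilon>_def)
  have eps2: "(4 * real m / 3)\<^sup>2 = 1 / \<epsilon>\<^sup>2" using m by (simp add: \<epsilon>_def power2_eq_square field_simps)
  have "\<exists>I u. I < m \<and> length u = d \<and>
    3 / (4 * real m) \<le> av l (\<lambda>v. av m (\<lambda>w. of_bool (take (Suc I) (W a (sub u (Ss ! I) v)) @ drop (Suc I) w \<in> B))) -
      av l (\<lambda>v. av m (\<lambda>w. of_bool (take I (W a (sub u (Ss ! I) v)) @ drop I w \<in> B)))"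
  proof (rule hybrid)
    show "W a u \<in> B \<and> length (W a u) = m" if "length u = d" for u using B(2)[OF that] m by (simp add: W_def nw_def)
    show "length (Ss ! i) = l" if "i < m" for i using S[of "Ss ! i"] that m by simp
  qed (use B m in auto)
  then obtain I u where I: "I < m" and u: "length u = d" and
    gap: "\<epsilon> \<le> av l (\<lambda>v. av m (\<lambda>w. of_bool (take (Suc I) (W a (sub u (Ss ! I) v)) @ drop (Suc I) w \<in> B))) -
      av l (\<lambda>v. av m (\<lambda>w. of_bool (take I (W a (sub u (Ss ! I) v)) @ drop I w \<in> B)))"
    unfolding \<epsilon>_def by blast
  have SI: "nthl Ss I = Ss ! I" using I m by (simp add: nthl_def Cons_nth_drop_Suc[symmetric])
  have SI': "length (Ss ! I) = l" "distinct (Ss ! I)" "set (Ss ! I) \<subseteq> {..<d}" using S[of "Ss ! I"] I m by auto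
  \<comment> \<open>The probability with a random bit at index \<open>I\<close>. It involves only
    earlier outputs and is therefore common to all strings with the same compressed string.\<close>
  define D where "D = av l (\<lambda>v. av m (\<lambda>w. of_bool (take I (W a (sub u (Ss ! I) v)) @ drop I w \<in> B)))"
  define \<mu> where "\<mu> x = av C (\<lambda>rc. of_bool (target N s P l Ss I u x rc \<in> B))" for x
  have \<mu>: "\<mu> x = av l (\<lambda>v. av m (\<lambda>w. of_bool (take (Suc I) (W x (sub u (Ss ! I) v)) @ drop (Suc I) w \<in> B)))" for x
    unfolding \<mu>_def W_def using target_av[of C l Ss c "\<lambda>t. of_bool (t \<in> B)" N s P I u x] C m SI by simp
  have \<mu>a: "D + \<epsilon> \<le> \<mu> a" using gap by (simp add: \<mu> D_def)
  define G where "G v b = av m (\<lambda>w. of_bool (take I (W a (sub u (Ss ! I) v)) @ b # drop (Suc I) w \<in> B))" for v b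
  define F where "F v = G v True - G v False" for v
  have D: "D = av l (\<lambda>v. (G v False + G v True) / 2)"
    unfolding D_def G_def by (intro av_cong, subst av_split_bit[OF I]) simp
  have G01: "0 \<le> G v b" "G v b \<le> 1" for v b
    using av_mono[of m "\<lambda>_. 0" "\<lambda>w. of_bool (take I (W a (sub u (Ss ! I) v)) @ b # drop (Suc I) w \<in> B)"]
      av_mono[of m "\<lambda>w. of_bool (take I (W a (sub u (Ss ! I) v)) @ b # drop (Suc I) w \<in> B)" "\<lambda>_. 1"] by (auto simp: G_def)
  have F1: "\<bar>F v\<bar> \<le> 1" for v using G01[of v True] G01[of v False] by (auto simp: F_def abs_le_iff)
  \<comment> \<open>With bit \<open>b\<close> at index \<open>I\<close> the sample hits
    \<open>B\<close> with probability \<open>G v b\<close>. Compared with a random bit there, the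
    gain of \<open>x\<close> is half the correlation of its code with the signed preference
    \<open>F\<close>.\<close>
  have \<mu>F: "\<mu> x - D = av l (\<lambda>v. sg (cw N s P x v) * F v) / 2"
    if "pf N s P l Ss I u x = pf N s P l Ss I u a" for x
  proof -
    have "take (Suc I) (W x (sub u (Ss ! I) v)) = take I (W a (sub u (Ss ! I) v)) @ [cw N s P x v]" if v: "length v = l" for v
    proof -
      have "take (Suc I) (W x (sub u (Ss ! I) v)) = take I (W x (sub u (Ss ! I) v)) @ [W x (sub u (Ss ! I) v) ! I]"
        by (rule take_Suc_conv_app_nth) (use I m in \<open>simp add: W_def nw_def\<close>)
      moreover have "W x (sub u (Ss ! I) v) ! I = cw N s P x v"
        using I m v SI' u sub_same[of v "Ss ! I" u] by (simp add: W_def nw_def)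
      moreover have "take I (W x (sub u (Ss ! I) v)) = take I (W a (sub u (Ss ! I) v))"
        using nw_prefix[OF N v \<open>pf N s P l Ss I u x = pf N s P l Ss I u a\<close>] SI by (simp add: W_def)
      ultimately show ?thesis by simp
    qed
    then have "\<mu> x = av l (\<lambda>v. G v (cw N s P x v))" unfolding \<mu> G_def by (intro av_cong) simp
    then have "\<mu> x - D = av l (\<lambda>v. G v (cw N s P x v) - (G v False + G v True) / 2)" by (simp add: D av_diff)
    also have "\<dots> = av l (\<lambda>v. (sg (cw N s P x v) * F v) / 2)"
      by (rule av_cong) (auto simp: sg_def F_def field_simps)
    finally show ?thesis by (simp add: av_divide)
  qed
  \<comment> \<open>The candidates: a quarter of the gain already means a correlation of
    \<open>\<epsilon> / 2\<close>, so \<open>johnson\<close> leaves at most \<open>8\<close> divided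
    by \<open>\<epsilon>\<close> squared of them.\<close>
  define L where "L = {x. length x = length a \<and> pf N s P l Ss I u x = pf N s P l Ss I u a \<and> D + \<epsilon> / 4 \<le> \<mu> x}"
  have finL: "finite L" by (rule finite_subset[OF _ finite_BL[of "length a"]]) (auto simp: L_def BL_def)
  have N2: "2 ^ s \<le> N" using N l order.trans[OF power_increasing[of s l "2::nat"]] by simp
  have cardL: "real (card L) \<le> 2 / (\<epsilon> / 2)\<^sup>2"
  proof (rule johnson[OF finL _ F1])
    show "0 < \<epsilon> / 2" using eps by simp
    fix x y assume xy: "x \<in> L" "y \<in> L" "x \<noteq> y"
    have "(\<Sum>v\<in>BL l. sg (cw N s P x v) * sg (cw N s P y v)) \<le> real n * 2 ^ s'"
      unfolding l by (rule cw_inner[OF prime N2 xy(3)]) (use xy n in \<open>auto simp: L_def\<close>)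
    also have "\<dots> \<le> (\<epsilon> / 2)\<^sup>2 / 2 * 2 ^ l"
    proof -
      have "real n \<le> \<epsilon>\<^sup>2 / 8 * 2 ^ s" using n(2) eps unfolding eps2 by (simp add: field_simps)
      then have "real n * 2 ^ s' \<le> \<epsilon>\<^sup>2 / 8 * 2 ^ s * 2 ^ s'" by (intro mult_right_mono) auto
      then show ?thesis by (simp add: l power_add power_divide)
    qed
    finally show "(\<Sum>v\<in>BL l. sg (cw N s P x v) * sg (cw N s P y v)) \<le> (\<epsilon> / 2)\<^sup>2 / 2 * 2 ^ l" .
  next
    fix x assume x: "x \<in> L"
    then have "\<epsilon> / 4 \<le> av l (\<lambda>v. sg (cw N s P x v) * F v) / 2" using \<mu>F[of x] by (auto simp: L_def)
    then show "\<epsilon> / 2 \<le> av l (\<lambda>v. sg (cw N s P x v) * F v)" by simp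
  qed
  \<comment> \<open>Every other candidate collides with \<open>a\<close> at no more than
    \<open>n\<close> points, and \<open>2 ^ s\<close> exceeds \<open>n\<close> times the number of
    candidates.\<close>
  have "\<exists>e<2 ^ s. \<forall>x\<in>L - {a}. rs P x e \<noteq> rs P a e"
  proof (rule ccontr)
    assume "\<not> ?thesis"
    then have "{..<2 ^ s} \<subseteq> (\<Union>x\<in>L - {a}. {e. e < 2 ^ s \<and> rs P x e = rs P a e})" by auto
    then have "card {..<(2::nat) ^ s} \<le> card (\<Union>x\<in>L - {a}. {e. e < 2 ^ s \<and> rs P x e = rs P a e})"
      by (intro card_mono finite_UN_I) (use finL in auto)
    also have "\<dots> \<le> (\<Sum>x\<in>L - {a}. card {e. e < 2 ^ s \<and> rs P x e = rs P a e})"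
      by (rule card_UN_le) (use finL in simp)
    also have "\<dots> \<le> (\<Sum>x\<in>L - {a}. n)"
      by (intro sum_mono rs_collisions[OF prime(1,2)]) (use n in \<open>auto simp: L_def\<close>)
    also have "\<dots> \<le> card L * n" using finL by (simp add: card_Diff1_le)
    finally have "2 ^ s \<le> card L * n" by simp
    then have "real (2 ^ s) \<le> real (card L * n)" by (simp only: of_nat_le_iff)
    also have "\<dots> \<le> 2 / (\<epsilon> / 2)\<^sup>2 * real n" using mult_right_mono[OF cardL, of "real n"] by simp
    also have "\<dots> = 8 * real n * (4 * real m / 3)\<^sup>2" unfolding eps2 by (simp add: power_divide)
    finally show False using n(2) by simp
  qed
  then obtain e where e: "e < 2 ^ s" "\<And>x. x \<in> L \<Longrightarrow> rs P x e = rs P a e \<Longrightarrow> x = a" by blast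
  \<comment> \<open>The middle of the gap: the frequency of \<open>a\<close> is at least
    \<open>\<epsilon> / 2\<close> above \<open>D + \<epsilon> / 2\<close>, that of the strings to be
    rejected more than \<open>\<epsilon> / 4\<close> below it. Rounding up costs at most
    \<open>1\<close>, which \<open>4 \<le> T * \<epsilon>\<close> turns into a quarter of the
    gain.\<close>
  define th where "th = nat \<lceil>real T * (D + \<epsilon> / 2)\<rceil>"
  have av0: "0 \<le> av k f" if "\<And>x. 0 \<le> f x" for k and f :: "bool list \<Rightarrow> real"
    using av_mono[of k "\<lambda>_. 0" f] that by simp
  have D0: "0 \<le> D" unfolding D_def by (intro av0) simp
  have Teps: "64 * (real n + 3) \<le> real T * \<epsilon>\<^sup>2"
  proof -
    have "64 * (real n + 3) / \<epsilon>\<^sup>2 \<le> real T" using T unfolding eps2 by simp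
    then show ?thesis using eps by (simp add: pos_divide_le_eq)
  qed
  have T1: "4 \<le> real T * \<epsilon>"
  proof -
    have "real T * \<epsilon>\<^sup>2 \<le> real T * (\<epsilon> * 1)" unfolding power2_eq_square using eps by (intro mult_left_mono) auto
    then show ?thesis using Teps by simp
  qed
  have th1: "real T * (D + \<epsilon> / 2) \<le> real th" "real th \<le> real T * (D + \<epsilon> / 2) + 1"
  proof -
    have "0 \<le> real T * (D + \<epsilon> / 2)" using D0 eps by simp
    then show "real T * (D + \<epsilon> / 2) \<le> real th" "real th \<le> real T * (D + \<epsilon> / 2) + 1"
      unfolding th_def by linarith+
  qed
  have \<mu>1: "\<mu> a \<le> 1" unfolding \<mu>_def using av_mono[of C "\<lambda>rc. of_bool (target N s P l Ss I u a rc \<in> B)" "\<lambda>_. 1"] by simp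
  have thT: "th \<le> T"
  proof -
    have "real th \<le> real T * (D + \<epsilon> / 2) + 1" by (rule th1)
    also have "\<dots> \<le> real T * (D + \<epsilon> / 2) + real T * \<epsilon> / 2" using T1 by simp
    also have "\<dots> = real T * (D + \<epsilon>)" by (simp add: algebra_simps)
    also have "\<dots> \<le> real T * 1" using \<mu>a \<mu>1 by (intro mult_left_mono) auto
    finally show ?thesis by simp
  qed
  have ex: "exp (- real T * (\<epsilon> / 4)\<^sup>2 / 4) \<le> exp (- (real n + 3))"
  proof -
    have eq: "- real T * (\<epsilon> / 4)\<^sup>2 / 4 = - (real T * \<epsilon>\<^sup>2 / 64)" by (simp add: power_divide)
    have "real n + 3 \<le> real T * \<epsilon>\<^sup>2 / 64" unfolding le_divide_eq using Teps by (simp add: mult.commute)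
    then show ?thesis unfolding eq exp_le_cancel_iff by (rule le_imp_neg_le)
  qed
  let ?Bd = "2 ^ (T * C + R) * exp (- (real n + 3)) :: real"
  have up: "real (card {r \<in> BL (T * C + R). th \<le> cnt T C (\<lambda>rc. target N s P l Ss I u x rc \<in> B) r}) \<le> ?Bd" if x: "\<mu> x < D + \<epsilon> / 4" for x
  proof -
    have "real T * (\<mu> x + \<epsilon> / 4) \<le> real th"
    proof -
      have "real T * (\<mu> x + \<epsilon> / 4) \<le> real T * (D + \<epsilon> / 2)" using x by (intro mult_left_mono) auto
      then show ?thesis using th1 by simp
    qed
    then have "real (card {r \<in> BL (T * C + R). real th \<le> real (cnt T C (\<lambda>rc. target N s P l Ss I u x rc \<in> B) r)})
       \<le> 2 ^ (T * C + R) * exp (- real T * (\<epsilon> / 4)\<^sup>2 / 4)"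
      using chernoff[of "\<epsilon> / 4" T C "\<lambda>rc. target N s P l Ss I u x rc \<in> B" "real th" R] eps by (simp add: \<mu>_def)
    also have "\<dots> \<le> ?Bd" by (intro mult_left_mono ex) simp
    finally show ?thesis by simp
  qed
  have low: "real (card {r \<in> BL (T * C + R). \<not> th \<le> cnt T C (\<lambda>rc. target N s P l Ss I u a rc \<in> B) r}) \<le> ?Bd"
  proof -
    have "real th \<le> real T * (D + \<epsilon> / 2) + real T * \<epsilon> / 4" using th1 T1 by simp
    also have "\<dots> = real T * ((D + \<epsilon>) - \<epsilon> / 4)" by (simp add: algebra_simps)
    also have "\<dots> \<le> real T * (\<mu> a - \<epsilon> / 4)" using \<mu>a by (intro mult_left_mono) auto
    finally have "real (card {r \<in> BL (T * C + R). real (cnt T C (\<lambda>rc. target N s P l Ss I u a rc \<in> B) r) < real th})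
       \<le> 2 ^ (T * C + R) * exp (- real T * (\<epsilon> / 4)\<^sup>2 / 4)"
      using chernoff_lower[of "\<epsilon> / 4" "real th" T C "\<lambda>rc. target N s P l Ss I u a rc \<in> B" R] eps by (simp add: \<mu>_def)
    also have "\<dots> \<le> ?Bd" by (intro mult_left_mono ex) simp
    finally show ?thesis by (simp add: not_le)
  qed
  \<comment> \<open>The strings that have to fail by sampling; there are at most
    \<open>2 ^ n\<close> of them for the union bound.\<close>
  define X where "X = {x \<in> BL (length a). \<mu> x < D + \<epsilon> / 4}"
  let ?bad = "{r \<in> BL (T * C + R). \<not> ((\<forall>x. length x = length a \<and> pf N s P l Ss I u x = pf N s P l Ss I u a \<and>
        rs P x e = rs P a e \<and> th \<le> cnt T C (\<lambda>rc. target N s P l Ss I u x rc \<in> B) r \<longrightarrow> x = a) \<and>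
        th \<le> cnt T C (\<lambda>rc. target N s P l Ss I u a rc \<in> B) r)}"
  let ?U = "\<lambda>x. {r \<in> BL (T * C + R). th \<le> cnt T C (\<lambda>rc. target N s P l Ss I u x rc \<in> B) r}"
  let ?V = "{r \<in> BL (T * C + R). \<not> th \<le> cnt T C (\<lambda>rc. target N s P l Ss I u a rc \<in> B) r}"
  have "?bad \<subseteq> (\<Union>x\<in>X. ?U x) \<union> ?V"
  proof
    fix r assume r: "r \<in> ?bad"
    show "r \<in> (\<Union>x\<in>X. ?U x) \<union> ?V"
    proof (cases "r \<in> ?V")
      case False
      then obtain x where x: "length x = length a" "pf N s P l Ss I u x = pf N s P l Ss I u a"
        "rs P x e = rs P a e" "th \<le> cnt T C (\<lambda>rc. target N s P l Ss I u x rc \<in> B) r" "x \<noteq> a"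
        using r by blast
      have "x \<notin> L" using e(2)[of x] x by blast
      then have "x \<in> X" using x by (auto simp: L_def X_def BL_def)
      then show ?thesis using x r by blast
    qed simp
  qed
  then have "card ?bad \<le> card ((\<Union>x\<in>X. ?U x) \<union> ?V)"
    by (rule card_mono[rotated]) (auto simp: X_def)
  also have "\<dots> \<le> (\<Sum>x\<in>X. card (?U x)) + card ?V"
    by (rule order.trans[OF card_Un_le]) (intro add_mono card_UN_le, simp_all add: X_def)
  finally have "real (card ?bad) \<le> real ((\<Sum>x\<in>X. card (?U x)) + card ?V)" by (simp only: of_nat_le_iff)
  also have "\<dots> = (\<Sum>x\<in>X. real (card (?U x))) + real (card ?V)" by simp
  also have "\<dots> \<le> (\<Sum>x\<in>X. ?Bd) + ?Bd"
    by (intro add_mono sum_mono up low) (auto simp: X_def)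
  also have "\<dots> = (real (card X) + 1) * ?Bd" by (simp add: algebra_simps)
  also have "\<dots> \<le> (2 * 2 ^ n) * ?Bd"
  proof (intro mult_right_mono)
    have "card X \<le> card (BL (length a))" by (rule card_mono) (auto simp: X_def)
    also have "\<dots> \<le> 2 ^ n" using n(1) by simp
    finally have "real (card X) \<le> 2 ^ n" by simp
    moreover have "(1 :: real) \<le> 2 ^ n" by simp
    ultimately show "real (card X) + 1 \<le> 2 * 2 ^ n" by linarith
  qed simp
  finally have b1: "real (card ?bad) \<le> (2 * 2 ^ n) * ?Bd" .
  have ar: "x \<le> 2 * a * (b * e) \<Longrightarrow> 3 * x \<le> 6 * (a * e) * b" for x a b e :: real by (simp add: algebra_simps)
  have bad: "3 * real (card ?bad) \<le> 6 * (2 ^ n * exp (- (real n + 3))) * 2 ^ (T * C + R)" by (rule ar[OF b1])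
  \<comment> \<open>As \<open>2 ^ (n + 3)\<close> is at most \<open>exp (n + 3)\<close>, the product
    is at most \<open>6 / 8\<close>.\<close>
  have small: "6 * (2 ^ n * exp (- (real n + 3))) < (1 :: real)"
  proof -
    have e2: "2 \<le> exp (1::real)" using exp_ge_add_one_self[of "1::real"] by simp
    have "(2 :: real) ^ (n + 3) \<le> exp 1 ^ (n + 3)" by (intro power_mono e2) simp
    also have "\<dots> = exp (real n + 3)" by (simp add: exp_of_nat_mult[symmetric] add.commute)
    finally have "2 ^ n * 8 \<le> exp (real n + 3)" by (simp add: power_add)
    then have "2 ^ n / exp (real n + 3) \<le> 1 / 8" by (simp add: pos_divide_le_eq)
    then have "2 ^ n * exp (- (real n + 3)) \<le> 1 / 8" by (simp only: exp_minus divide_inverse)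
    then show ?thesis by linarith
  qed
  have "6 * (2 ^ n * exp (- (real n + 3))) * 2 ^ (T * C + R) < (1 :: real) * 2 ^ (T * C + R)"
    by (rule mult_strict_right_mono[OF small]) simp
  with bad have "3 * real (card ?bad) < 2 ^ (T * C + R)" by linarith
  then show ?thesis using I u thT e(1) by blast
qed

section \<open>Correctness of the simulation\<close>

definition nth0 :: "nat list \<Rightarrow> nat \<Rightarrow> nat" where
  "nth0 xs j = (if j < length xs then xs ! j else 0)"

definition enc_entry :: "nat \<times> nat list \<times> nat \<times> (nat \<times> int) list \<Rightarrow> entry" where
  "enc_entry e = (fst e, fst (snd e), fst (snd (snd e)), map (\<lambda>a. (fst a, nat (snd a + 1))) (snd (snd (snd e))))"

text \<open>Index \<open>Z\<close> of the zipper is cell \<open>0\<close> of the tape, and cells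
  beyond the stored ones are blank. After \<open>i\<close> steps at least \<open>Z - i\<close> cells
  remain on the left, so the padding lasts for \<open>Z\<close> steps.\<close>

definition zrep :: "nat \<Rightarrow> nat \<Rightarrow> zipper \<Rightarrow> tape \<Rightarrow> bool" where
  "zrep Z i z t \<longleftrightarrow> Z \<le> length (fst z) + i \<and> snd t = int (length (fst z)) - int Z \<and>
     (\<forall>j. fst t (int j - int Z) = nth0 (rev (fst z) @ fst (snd z) # snd (snd z)) j)"

lemma nth0_replace: "nth0 (xs @ w # ys) j = (if j = length xs then w else nth0 (xs @ c # ys) j)"
  by (auto simp: nth0_def nth_append nth_Cons')

lemma nth0_hd0: "nth0 (xs @ hd0 ys # tl ys) j = nth0 (xs @ ys) j"
  by (cases ys) (auto simp: nth0_def hd0_def nth_append nth_Cons')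

lemma nth0_drop: "nth0 (drop N xs) i = nth0 xs (N + i)"
  by (auto simp: nth0_def)

lemma zrep_head: "zrep Z i z t \<Longrightarrow> fst t (snd t) = fst (snd z)"
proof -
  assume "zrep Z i z t"
  then have "fst t (snd t) = nth0 (rev (fst z) @ fst (snd z) # snd (snd z)) (length (fst z))" by (simp add: zrep_def)
  then show ?thesis by (simp add: nth0_def nth_append)
qed

lemma zrep_upd:
  assumes r: "zrep Z i z (T, h)" and i: "i < Z" and d: "d \<in> {-1, 0, 1}"
  shows "zrep Z (Suc i) (zupd z (w, nat (d + 1))) (T(h := w), h + d)"
proof -
  obtain l c t where z: "z = (l, c, t)" by (cases z)
  have len: "Z \<le> length l + i" and h: "h = int (length l) - int Z"
    and T: "\<And>j. T (int j - int Z) = nth0 (rev l @ c # t) j" using r by (auto simp: zrep_def z)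
  have U: "(T(h := w)) (int j - int Z) = nth0 (rev l @ w # t) j" for j
    unfolding nth0_replace[of "rev l" w t j c] using T[of j] h by auto
  consider "d = -1" | "d = 0" | "d = 1" using d by blast
  then show ?thesis
  proof cases
    case 1
    from len i have "l \<noteq> []" by auto
    then obtain x l' where l: "l = x # l'" by (cases l) auto
    show ?thesis using U len h 1 by (simp add: zrep_def z zupd_def l hd0_def)
  next
    case 2
    then show ?thesis using U len h by (simp add: zrep_def z zupd_def)
  next
    case 3
    have "nth0 (rev l @ w # hd0 t # tl t) j = nth0 (rev l @ w # t) j" for j
      using nth0_hd0[of "rev l @ [w]" t j] by simp
    then show ?thesis using U len h 3 by (simp add: zrep_def z zupd_def)
  qed
qed

text \<open>In \<open>zstep\<close> later entries overwrite earlier ones; for a deterministic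
  machine all matching entries give the same result.\<close>

lemma fold_overwrite:
  assumes "\<And>e. e \<in> set xs \<Longrightarrow> Q e \<Longrightarrow> G e = g"
  shows "fold (\<lambda>e res. if Q e then G e else res) xs c = (if \<exists>e\<in>set xs. Q e then g else c)"
  using assms by (induction xs arbitrary: c) auto

lemma ntm_entry:
  assumes "is_ntm m M" "(q, sy, q', as) \<in> trans M"
  shows "length sy = length as" "snd ` set as \<subseteq> {-1, 0, 1}" "q \<noteq> 1"
proof -
  have "\<forall>x\<in>trans M. case x of (q, sy, q', as) \<Rightarrow> q \<noteq> 1 \<and> length sy = m + work_tapes M \<and>
     length as = m + work_tapes M \<and> snd ` set as \<subseteq> {-1, 0, 1} \<and> (\<forall>j<m. fst (as ! j) = sy ! j)"
    using assms(1) unfolding is_ntm_def by simp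
  from bspec[OF this assms(2)]
  show "length sy = length as" "snd ` set as \<subseteq> {-1, 0, 1}" "q \<noteq> 1" by simp_all
qed

lemma zstep_step:
  assumes M: "is_ntm m M" "deterministic M" and tab: "set tab = enc_entry ` trans M"
    and st: "step M (q, ts) (q', ts')" and rep: "list_all2 (zrep Z i) zs ts" and i: "i < Z"
  shows "\<exists>zs'. zstep tab (q, zs) = (q', zs') \<and> list_all2 (zrep Z (Suc i)) zs' ts'"
proof -
  obtain as where as: "(q, map (\<lambda>(T, h). T h) ts, q', as) \<in> trans M"
    "ts' = map2 (\<lambda>(T, h) (w, d). (T(h := w), h + d)) ts as" using st by (auto simp: step_def)
  have len: "length ts = length as" "snd ` set as \<subseteq> {-1, 0, 1}" using ntm_entry[OF M(1) as(1)] by auto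
  have hd: "map (\<lambda>z. fst (snd z)) zs = map (\<lambda>(T, h). T h) ts"
    using rep by (induction rule: list_all2_induct) (auto dest: zrep_head)
  let ?Q = "\<lambda>e :: entry. fst e = q \<and> fst (snd e) = map (\<lambda>z. fst (snd z)) zs"
  let ?G = "\<lambda>e :: entry. (fst (snd (snd e)), map (\<lambda>p. zupd (fst p) (snd p)) (zip zs (snd (snd (snd e)))))"
  let ?e = "enc_entry (q, map (\<lambda>(T, h). T h) ts, q', as)"
  have e: "e = ?e" if "e \<in> set tab" "?Q e" for e
  proof -
    from that(1) tab obtain y where y: "y \<in> trans M" "e = enc_entry y" by blast
    obtain q1 sy q2 as2 where "y = (q1, sy, q2, as2)" by (cases y)
    with y have "(q1, sy, q2, as2) \<in> trans M" and e: "e = enc_entry (q1, sy, q2, as2)" by simp_all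
    with that(2) have "(q, map (\<lambda>(T, h). T h) ts, q2, as2) \<in> trans M" by (auto simp: enc_entry_def hd)
    then have "(q2, as2) = (q', as)" using M(2) as(1) unfolding deterministic_def by blast
    then show ?thesis using e that(2) by (auto simp: enc_entry_def hd)
  qed
  have 1: "?e \<in> set tab" unfolding tab by (rule imageI[OF as(1)])
  have 2: "?Q ?e" by (simp add: enc_entry_def hd)
  have "zstep tab (q, zs) = (if \<exists>e\<in>set tab. ?Q e then ?G ?e else (q, zs))"
    unfolding zstep_def fst_conv snd_conv
    by (rule fold_overwrite, rule arg_cong[where f = ?G], rule e, assumption+)
  then have "zstep tab (q, zs) = ?G ?e" using 1 2 by meson
  moreover have "list_all2 (zrep Z (Suc i)) (map (\<lambda>p. zupd (fst p) (snd p)) (zip zs (map (\<lambda>a. (fst a, nat (snd a + 1))) as))) ts'"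
    unfolding as(2) using rep len
  proof (induction arbitrary: as rule: list_all2_induct)
    case (Cons z zs t ts)
    then obtain w d as' where a: "as = (w, d) # as'" by (cases as) auto
    obtain T h where t: "t = (T, h)" by (cases t)
    have "zrep Z (Suc i) (zupd z (w, nat (d + 1))) (T(h := w), h + d)"
      by (rule zrep_upd) (use Cons.hyps Cons.prems i a t in auto)
    then show ?case using Cons.IH[of as'] Cons.prems by (simp add: a t fun_upd_def)
  qed simp
  ultimately show ?thesis by (simp add: enc_entry_def)
qed

lemma zrun_steps:
  assumes M: "is_ntm m M" "deterministic M" and tab: "set tab = enc_entry ` trans M"
  shows "(step M ^^ k) (q, ts) (q', ts') \<Longrightarrow> list_all2 (zrep Z i) zs ts \<Longrightarrow> i + k \<le> Z \<Longrightarrow>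
    \<exists>zs'. (zstep tab ^^ k) (q, zs) = (q', zs') \<and> list_all2 (zrep Z (i + k)) zs' ts'"
proof (induction k arbitrary: q' ts')
  case (Suc k)
  then obtain q1 ts1 where 1: "(step M ^^ k) (q, ts) (q1, ts1)" "step M (q1, ts1) (q', ts')" by auto
  from Suc.IH[OF 1(1) Suc.prems(2)] Suc.prems(3) obtain zs1 where
    2: "(zstep tab ^^ k) (q, zs) = (q1, zs1)" "list_all2 (zrep Z (i + k)) zs1 ts1" by auto
  from zstep_step[OF M tab 1(2) 2(2)] Suc.prems(3) show ?case using 2(1) by auto
qed simp

text \<open>No entry starts in the accepting state, so the result is kept until the clock runs
  out.\<close>

lemma zstep_halt:
  assumes "is_ntm m M" "set tab = enc_entry ` trans M"
  shows "(zstep tab ^^ k) (1, zs) = (1, zs)"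
proof -
  have "fst e \<noteq> 1" if "e \<in> set tab" for e
    using that assms(2) ntm_entry(3)[OF assms(1)] by (auto simp: enc_entry_def)
  then have "zstep tab (1, zs) = (if \<exists>e\<in>set tab. fst e = 1 \<and> fst (snd e) = map (\<lambda>z. fst (snd z)) zs then undefined else (1, zs))"
    unfolding zstep_def fst_conv snd_conv by (intro fold_overwrite) blast
  then have "zstep tab (1, zs) = (1, zs)" using \<open>\<And>e. e \<in> set tab \<Longrightarrow> fst e \<noteq> 1\<close> by auto
  then show ?thesis by (induction k) auto
qed

lemma zrep_zinit: "zrep Z 0 (zinit Z x) (tape_of x, 0)"
proof -
  have "tape_of x (int j - int Z) = nth0 (replicate Z 0 @ map (\<lambda>b. if b then 2 else 1) x) j" for j
  proof (cases "j < Z")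
    case False
    then obtain i where "j = Z + i" using le_Suc_ex by (metis not_le)
    then show ?thesis by (simp add: tape_of_def nth0_def nth_append)
  qed (simp add: tape_of_def nth0_def nth_append)
  then show ?thesis by (simp add: zrep_def zinit_def nth0_hd0)
qed

lemma least_takeWhile:
  "map (\<lambda>i. nth0 D i = 2) [0..<(LEAST i. nth0 D i \<notin> {1, 2})] = map (\<lambda>s. s = 2) (takeWhile (\<lambda>s. s = 1 \<or> s = 2) D)"
proof -
  let ?W = "takeWhile (\<lambda>s. s = 1 \<or> s = 2) D"
  have "(LEAST i. nth0 D i \<notin> {1, 2}) = length ?W"
  proof (rule Least_equality)
    show "nth0 D (length ?W) \<notin> {1, 2}"
      using nth_length_takeWhile[of "\<lambda>s. s = 1 \<or> s = 2" D] by (auto simp: nth0_def)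
    fix i assume i: "nth0 D i \<notin> {1, 2}"
    show "length ?W \<le> i"
    proof (rule ccontr)
      assume "\<not> length ?W \<le> i"
      then have "i < length ?W" by simp
      moreover from this have "?W ! i = D ! i" "i < length D"
        using takeWhile_nth[of i "\<lambda>s. s = 1 \<or> s = 2" D] length_takeWhile_le[of "\<lambda>s. s = 1 \<or> s = 2" D] by auto
      ultimately show False using i nth_mem[of i ?W] set_takeWhileD[of "?W ! i" "\<lambda>s. s = 1 \<or> s = 2" D] by (auto simp: nth0_def)
    qed
  qed
  moreover have "map (\<lambda>i. nth0 D i = 2) [0..<length ?W] = map (\<lambda>s. s = 2) ?W"
  proof (rule nth_equalityI)
    fix i assume i: "i < length (map (\<lambda>i. nth0 D i = 2) [0..<length ?W])"
    then have "i < length D" using length_takeWhile_le[of "\<lambda>s. s = 1 \<or> s = 2" D] by simp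
    then show "map (\<lambda>i. nth0 D i = 2) [0..<length ?W] ! i = map (\<lambda>s. s = 2) ?W ! i"
      using i takeWhile_nth[of i "\<lambda>s. s = 1 \<or> s = 2" D] by (simp add: nth0_def)
  qed simp
  ultimately show ?thesis by (simp only:)
qed

lemma zrun_correct:
  assumes M: "description_method M" and tab: "set tab = enc_entry ` trans M"
    and p: "produces M [z, b] a t s" and t: "t \<le> N"
  shows "zrun tab (work_tapes M) N z b = a"
proof -
  have M': "is_ntm 2 M" "deterministic M" using M by (auto simp: description_method_def)
  obtain k q ts where k: "(step M ^^ k) (init_conf M [z, b]) (1, ts)" "k \<le> t" "out_string (1, ts) = a"
    using p unfolding produces_def by (metis prod.collapse)
  let ?i = "zinit N z # zinit N b # replicate (work_tapes M) (replicate N 0, 0, [])"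
  have e: "(replicate N 0, 0, []) = zinit N []" by (simp add: zinit_def hd0_def)
  have rep: "list_all2 (zrep N 0) (replicate k (zinit N [])) (replicate k (tape_of [], 0))" for k
    by (induction k) (auto simp: zrep_zinit)
  have "list_all2 (zrep N 0) ?i (map (\<lambda>x. (tape_of x, 0)) [z, b] @ replicate (work_tapes M) (tape_of [], 0))"
    by (simp add: zrep_zinit e rep)
  from zrun_steps[OF M' tab k(1)[unfolded init_conf_def] this] k(2) t obtain zs where
    zs: "(zstep tab ^^ k) (0, ?i) = (1, zs)" "list_all2 (zrep N k) zs ts" by auto
  have "(zstep tab ^^ N) (0, ?i) = (zstep tab ^^ (N - k)) ((zstep tab ^^ k) (0, ?i))"
    using k(2) t funpow_add[of "N - k" k "zstep tab"] by simp
  then have N: "(zstep tab ^^ N) (0, ?i) = (1, zs)" using zs(1) zstep_halt[OF M'(1) tab] by simp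
  have "length ts = length (snd (init_conf M [z, b]))"
  proof -
    have "(step M ^^ j) c c' \<Longrightarrow> length (snd c') = length (snd c)" for j c c'
    proof (induction j arbitrary: c')
      case (Suc j)
      then obtain c1 where 1: "(step M ^^ j) c c1" "step M c1 c'" by auto
      from 1(2) obtain as where as: "(fst c1, map (\<lambda>(T, h). T h) (snd c1), fst c', as) \<in> trans M"
        "snd c' = map2 (\<lambda>(T, h) (w, d). (T(h := w), h + d)) (snd c1) as" unfolding step_def by blast
      have "length (snd c') = length (snd c1)" using as(2) ntm_entry[OF M'(1) as(1)] by simp
      then show ?case using Suc.IH[OF 1(1)] by simp
    qed simp
    from this[OF k(1)] show ?thesis by simp
  qed
  then have ne: "ts \<noteq> []" by (auto simp: init_conf_def)
  then have zne: "zs \<noteq> []" using zs(2) by auto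
  have "zrep N k (last zs) (last ts)"
    using zs(2) ne zne by (auto simp: list_all2_conv_all_nth last_conv_nth)
  then have T: "fst (last ts) (int i) = nth0 (drop N (rev (fst (last zs)) @ fst (snd (last zs)) # snd (snd (last zs)))) i" for i
  proof -
    assume "zrep N k (last zs) (last ts)"
    then have "fst (last ts) (int (N + i) - int N) = nth0 (rev (fst (last zs)) @ fst (snd (last zs)) # snd (snd (last zs))) (N + i)"
      unfolding zrep_def by blast
    then show ?thesis by (simp only: nth0_drop) simp
  qed
  have rz: "rev zs = last zs # tl (rev zs)" using zne by (metis hd_rev list.collapse rev_is_Nil_conv)
  have "zout N zs = map (\<lambda>s. s = 2) (takeWhile (\<lambda>s. s = 1 \<or> s = 2) (drop N (rev (fst (last zs)) @ fst (snd (last zs)) # snd (snd (last zs)))))"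
    unfolding zout_def by (subst rz) simp
  also have "\<dots> = a" unfolding k(3)[symmetric] out_string_def Let_def snd_conv T by (rule least_takeWhile[symmetric])
  finally show ?thesis by (simp add: zrun_def N)
qed

lemma unp_pair: "unp (pair b p) = (b, p)"
proof -
  let ?F = "\<lambda>c st. if fst st then (True, [], fst (snd (snd st)), c # snd (snd (snd st)))
       else (case fst (snd st) of [] \<Rightarrow> (False, [c], snd (snd st))
         | d # _ \<Rightarrow> if d = c then (False, [], c # fst (snd (snd st)), snd (snd (snd st)))
            else (True, [], snd (snd st)))"
  have 1: "fold ?F (concat (map (\<lambda>b. [b, b]) b)) (False, [], acc, []) = (False, [], rev b @ acc, [])" for acc :: "bool list"
    by (induction b arbitrary: acc) auto
  have 2: "fold ?F p (True, [], acc, acc') = (True, [], acc, rev p @ acc')" for acc acc' :: "bool list"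
    by (induction p arbitrary: acc') auto
  show ?thesis unfolding unp_def pair_def by (simp add: 1 2 Let_def)
qed

section \<open>Certificates\<close>

definition BB :: "entry list \<Rightarrow> nat \<Rightarrow> nat \<Rightarrow> nat \<Rightarrow> nat \<Rightarrow> nat list list \<Rightarrow> nat \<Rightarrow> bool list \<Rightarrow> bool list set" where
  "BB tab w N s P Ss d b = {nw N s P Ss y u | y u. length u = d \<and>
     (\<exists>z. length z + d + 4 \<le> length Ss \<and> (y = z \<or> y = zrun tab w N z b))}"

lemma BB_I:
  "length u = d \<Longrightarrow> length z + d + 4 \<le> length Ss \<Longrightarrow> nw N s P Ss z u = v \<or> nw N s P Ss (zrun tab w N z b) u = v \<Longrightarrow>
   v \<in> BB tab w N s P Ss d b"
  unfolding BB_def by blast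

text \<open>There are fewer than \<open>2 ^ (k + 1)\<close> strings \<open>z\<close>, two readings
  of each and \<open>2 ^ d\<close> seeds, hence at most \<open>2 ^ (k + d + 2)\<close>
  outputs.\<close>

lemma card_BB:
  assumes "k + d + 4 = length Ss"
  shows "real (card (BB tab w N s P Ss d b)) \<le> 2 ^ length Ss / 4"
proof -
  let ?Z = "\<Union>i\<le>k. BL i"
  have Z: "card ?Z \<le> 2 ^ Suc k"
  proof -
    have "card ?Z \<le> (\<Sum>i\<le>k. card (BL i))" by (rule card_UN_le) simp
    also have "\<dots> < 2 ^ Suc k" by (induction k) auto
    finally show ?thesis by simp
  qed
  have finZ: "finite (?Z \<times> BL d)" by auto
  have "BB tab w N s P Ss d b \<subseteq> (\<lambda>(z, u). nw N s P Ss z u) ` (?Z \<times> BL d) \<union> (\<lambda>(z, u). nw N s P Ss (zrun tab w N z b) u) ` (?Z \<times> BL d)"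
  proof
    fix v assume "v \<in> BB tab w N s P Ss d b"
    then obtain y u z where v: "v = nw N s P Ss y u" "length u = d" "length z + d + 4 \<le> length Ss" "y = z \<or> y = zrun tab w N z b"
      unfolding BB_def by blast
    then have "(z, u) \<in> ?Z \<times> BL d" using assms by (auto simp: BL_def)
    then show "v \<in> (\<lambda>(z, u). nw N s P Ss z u) ` (?Z \<times> BL d) \<union> (\<lambda>(z, u). nw N s P Ss (zrun tab w N z b) u) ` (?Z \<times> BL d)"
      using v(1,4) by force
  qed
  then have "card (BB tab w N s P Ss d b) \<le> card ((\<lambda>(z, u). nw N s P Ss z u) ` (?Z \<times> BL d) \<union> (\<lambda>(z, u). nw N s P Ss (zrun tab w N z b) u) ` (?Z \<times> BL d))"
    by (rule card_mono[rotated]) (intro finite_UnI finite_imageI finZ)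
  also have "\<dots> \<le> card (?Z \<times> BL d) + card (?Z \<times> BL d)"
    by (rule order.trans[OF card_Un_le]) (intro add_mono card_image_le finZ)
  also have "\<dots> \<le> 2 ^ Suc k * 2 ^ d + 2 ^ Suc k * 2 ^ d"
    unfolding card_cartesian_product card_BL by (intro add_mono mult_right_mono Z) auto
  also have "\<dots> = 2 ^ (k + d + 2)" by (simp add: power_add)
  finally have "real (card (BB tab w N s P Ss d b)) \<le> real (2 ^ (k + d + 2))" by (simp only: of_nat_le_iff)
  also have "\<dots> = 2 ^ length Ss / 4" unfolding assms[symmetric] by (simp add: power_add)
  finally show ?thesis .
qed

text \<open>Merlin guesses a seed and a description; unflagged cells fill the certificate up to
  length \<open>C\<close>.\<close>

lemma sample_ok_iff:
  assumes C: "length (ad_Ss N ad) \<le> C" "length (ad_u ad) \<le> C"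
  shows "(\<exists>gc. length gc = C \<and> sample_ok tab w N ad b x rc gc) \<longleftrightarrow>
    target N (ad_s ad) (bn N (ad_P ad)) (ad_l ad) (ad_Ss N ad) (bn N (ad_I ad)) (ad_u ad) x rc
      \<in> BB tab w N (ad_s ad) (bn N (ad_P ad)) (ad_Ss N ad) (length (ad_u ad)) b" (is "?L \<longleftrightarrow> ?t \<in> _")
proof
  assume ?L
  then obtain gc where gc: "length gc = C" "sample_ok tab w N ad b x rc gc" by blast
  have "length (map snd (take (length (ad_u ad)) gc)) = length (ad_u ad)" using C gc(1) by simp
  then show "?t \<in> BB tab w N (ad_s ad) (bn N (ad_P ad)) (ad_Ss N ad) (length (ad_u ad)) b"
    by (rule BB_I) (use gc(2) in \<open>unfold sample_ok_def, blast+\<close>)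
next
  assume "?t \<in> BB tab w N (ad_s ad) (bn N (ad_P ad)) (ad_Ss N ad) (length (ad_u ad)) b"
  then obtain y u z where v: "?t = nw N (ad_s ad) (bn N (ad_P ad)) (ad_Ss N ad) y u" "length u = length (ad_u ad)"
    "length z + length (ad_u ad) + 4 \<le> length (ad_Ss N ad)" "y = z \<or> y = zrun tab w N z b"
    unfolding BB_def by blast
  define gc where "gc = map (Pair True) u @ map (Pair True) z @ replicate (C - (length u + length z)) (False, False)"
  have l: "length gc = C" using v C by (simp add: gc_def)
  have u: "map snd (take (length (ad_u ad)) gc) = u" using v(2) by (simp add: gc_def o_def)
  have z: "cert_z (length (ad_u ad)) gc = z" using v(2) by (simp add: cert_z_def gc_def filter_map o_def)
  have "sample_ok tab w N ad b x rc gc" unfolding sample_ok_def u z using v(3,4) by (auto simp: v(1))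
  then show ?L using l by blast
qed

lemma chunk_concat: "(\<And>i. length (g i) = C) \<Longrightarrow> i < T \<Longrightarrow> chunk C i (concat (map g [0..<T]) @ rest) = g i"
proof (induction T arbitrary: i g)
  case (Suc T)
  have e: "concat (map g [0..<Suc T]) @ rest = g 0 @ concat (map (g \<circ> Suc) [0..<T]) @ rest"
    by (simp add: upt_conv_Cons map_Suc_upt[symmetric] del: upt_Suc)
  show ?case
  proof (cases i)
    case 0
    then show ?thesis unfolding e using Suc.prems by (simp add: chunk_append)
  next
    case (Suc j)
    then show ?thesis unfolding e using Suc.prems Suc.IH[of "g \<circ> Suc" j] by (simp add: chunk_append o_def)
  qed
qed simp

text \<open>The certificates of different samples occupy disjoint chunks, so they can be chosen
  independently, and the best count is the number of samples that have a certificate at all.\<close>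

lemma ex_certificate_list:
  assumes N: "T * C \<le> N"
  shows "(\<exists>G. length G = N \<and> th \<le> length (filter (\<lambda>i. ok (chunk C i R) (chunk C i G)) [0..<T])) \<longleftrightarrow>
    th \<le> cnt T C (\<lambda>rc. \<exists>gc. length gc = C \<and> ok rc gc) R"
proof
  assume "\<exists>G. length G = N \<and> th \<le> length (filter (\<lambda>i. ok (chunk C i R) (chunk C i G)) [0..<T])"
  then obtain G where G: "length G = N" "th \<le> length (filter (\<lambda>i. ok (chunk C i R) (chunk C i G)) [0..<T])" by blast
  have len: "length (chunk C i G) = C" if "i < T" for i
  proof -
    have "Suc i * C \<le> T * C" using that by (intro mult_right_mono) auto
    then have "C \<le> N - i * C" using N by simp
    then show ?thesis using G(1) by (simp add: chunk_def)
  qed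
  have "card {i. i < T \<and> ok (chunk C i R) (chunk C i G)} \<le> card {i. i < T \<and> (\<exists>gc. length gc = C \<and> ok (chunk C i R) gc)}"
    by (rule card_mono) (use len in auto)
  then have "length (filter (\<lambda>i. ok (chunk C i R) (chunk C i G)) [0..<T]) \<le> length (filter (\<lambda>i. \<exists>gc. length gc = C \<and> ok (chunk C i R) gc) [0..<T])"
    by (simp add: length_filter_conv_card cong: conj_cong)
  then show "th \<le> cnt T C (\<lambda>rc. \<exists>gc. length gc = C \<and> ok rc gc) R" using G(2) by (simp add: cnt_def)
next
  assume th: "th \<le> cnt T C (\<lambda>rc. \<exists>gc. length gc = C \<and> ok rc gc) R"
  define g where "g i = (if \<exists>gc. length gc = C \<and> ok (chunk C i R) gc then SOME gc. length gc = C \<and> ok (chunk C i R) gc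
     else replicate C undefined)" for i
  have g: "length (g i) = C" "(\<exists>gc. length gc = C \<and> ok (chunk C i R) gc) \<Longrightarrow> ok (chunk C i R) (g i)" for i
    unfolding g_def using someI_ex[of "\<lambda>gc. length gc = C \<and> ok (chunk C i R) gc"] by auto
  define G where "G = concat (map g [0..<T]) @ replicate (N - T * C) undefined"
  have "length (concat (map g [0..<T])) = T * C" by (induction T) (auto simp: g)
  then have len: "length G = N" using N by (simp add: G_def)
  have "ok (chunk C i R) (chunk C i G)" if "i < T" "\<exists>gc. length gc = C \<and> ok (chunk C i R) gc" for i
    using g(2)[OF that(2)] chunk_concat[OF g(1) that(1)] unfolding G_def by simp
  then have "card {i. i < T \<and> (\<exists>gc. length gc = C \<and> ok (chunk C i R) gc)} \<le> card {i. i < T \<and> ok (chunk C i R) (chunk C i G)}"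
    by (intro card_mono) auto
  then have "length (filter (\<lambda>i. \<exists>gc. length gc = C \<and> ok (chunk C i R) gc) [0..<T]) \<le> length (filter (\<lambda>i. ok (chunk C i R) (chunk C i G)) [0..<T])"
    by (simp add: length_filter_conv_card cong: conj_cong)
  then show "\<exists>G. length G = N \<and> th \<le> length (filter (\<lambda>i. ok (chunk C i R) (chunk C i G)) [0..<T])"
    using th len by (intro exI[of _ G]) (simp add: cnt_def)
qed

lemma cnt_take:
  assumes "T * C \<le> N" shows "cnt T C G (take N r) = cnt T C G r"
proof -
  have "chunk C i (take N r) = chunk C i r" if "i < T" for i
  proof -
    have "Suc i * C \<le> T * C" using that by (intro mult_right_mono) auto
    then have "C \<le> N - i * C" using assms by simp
    then show ?thesis by (simp add: chunk_def drop_take min_absorb1)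
  qed
  then show ?thesis unfolding cnt_def by (intro arg_cong[of _ _ length] filter_cong) auto
qed

lemma bn_le: "bn N bs \<le> N"
  by (induction bs) (auto simp: bn_def)

text \<open>Eliminates Merlin: the existence of an accepting path becomes a statement about
  \<open>x\<close> and \<open>r\<close> alone, in the form treated by
  \<open>isolate\<close>.\<close>

lemma verify_iff:
  assumes T: "T = pw N (ad_t ad)" and C: "C = pw N (ad_c ad)" and N: "T * C \<le> N"
    and CC: "length (ad_Ss N ad) \<le> C" "length (ad_u ad) \<le> C" and r: "N \<le> length r"
  shows "(\<exists>t. length t = N \<and> map fst t = take N r \<and> verify tab w N ad (pair b p) t = [x]) \<longleftrightarrow>
    length x = bn N (ad_len ad) \<and> compr N ad x = p \<and>
    dig (length (ad_fp ad)) (rs (bn N (ad_P ad)) x (bn N (ad_pt ad))) = ad_fp ad \<and>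
    bn N (ad_th ad) \<le> cnt T C (\<lambda>rc. target N (ad_s ad) (bn N (ad_P ad)) (ad_l ad) (ad_Ss N ad) (bn N (ad_I ad)) (ad_u ad) x rc
      \<in> BB tab w N (ad_s ad) (bn N (ad_P ad)) (ad_Ss N ad) (length (ad_u ad)) b) r" (is "?L \<longleftrightarrow> ?R")
proof -
  let ?c = "cnt T C (\<lambda>rc. target N (ad_s ad) (bn N (ad_P ad)) (ad_l ad) (ad_Ss N ad) (bn N (ad_I ad)) (ad_u ad) x rc
      \<in> BB tab w N (ad_s ad) (bn N (ad_P ad)) (ad_Ss N ad) (length (ad_u ad)) b)"
  have ex: "(\<exists>G. length G = N \<and> bn N (ad_th ad) \<le> length (filter (\<lambda>i. sample_ok tab w N ad b x (chunk C i (take N r)) (chunk C i G)) [0..<T])) \<longleftrightarrow>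
    bn N (ad_th ad) \<le> ?c r"
    unfolding ex_certificate_list[OF N] sample_ok_iff[OF CC] cnt_take[OF N] ..
  show ?thesis
  proof
    assume ?L
    then obtain t where t: "length t = N" "map fst t = take N r" "verify tab w N ad (pair b p) t = [x]" by blast
    then have "accepts tab w N ad b p (guess_x t) (take N r) (map (\<lambda>q. fst (snd q)) t)" "guess_x t = x"
      by (auto simp: verify_def unp_pair split: if_splits)
    then have a: "accepts tab w N ad b p x (take N r) (map (\<lambda>q. fst (snd q)) t)" by simp
    moreover have "length (map (\<lambda>q. fst (snd q)) t) = N" using t by simp
    ultimately show ?R using ex unfolding accepts_def T[symmetric] C[symmetric] by blast
  next
    assume R: ?R
    then obtain G where G: "length G = N" "bn N (ad_th ad) \<le> length (filter (\<lambda>i. sample_ok tab w N ad b x (chunk C i (take N r)) (chunk C i G)) [0..<T])"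
      using ex by blast
    have x: "length x \<le> N" using R bn_le[of N "ad_len ad"] by simp
    define X where "X = map (Pair True) x @ replicate (N - length x) (False, False)"
    define t where "t = zip (take N r) (zip G X)"
    have lX: "length X = N" using x by (simp add: X_def)
    have gx: "map snd (filter fst X) = x" by (simp add: X_def filter_map o_def)
    have t: "length t = N" "map fst t = take N r" "map (\<lambda>q. fst (snd q)) t = G" "map (\<lambda>q. snd (snd q)) t = X"
    proof -
      show "length t = N" "map fst t = take N r" using G(1) lX r by (auto simp: t_def)
      have "map snd t = zip G X" using G(1) lX r by (simp add: t_def)
      then have "map fst (map snd t) = G" "map snd (map snd t) = X" using G(1) lX by auto
      then show "map (\<lambda>q. fst (snd q)) t = G" "map (\<lambda>q. snd (snd q)) t = X" by (auto simp: o_def)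
    qed
    have "guess_x t = x" unfolding guess_x_def t(4) by (rule gx)
    moreover have "accepts tab w N ad b p x (take N r) G" unfolding accepts_def T[symmetric] C[symmetric] using R G(2) by blast
    ultimately have "verify tab w N ad (pair b p) t = [x]" unfolding verify_def unp_pair t(2,3) by simp
    then show ?L using t by blast
  qed
qed

section \<open>Parameters\<close>

lemma sz_list_le: "(\<And>x. x \<in> set xs \<Longrightarrow> sz x \<le> c) \<Longrightarrow> sz xs \<le> (c + 1) * length xs + 1"
proof (induction xs)
  case (Cons x xs)
  then have "sz x \<le> c" "sz xs \<le> (c + 1) * length xs + 1" by auto
  then show ?case by simp
qed simp

lemma sz_bool_list: "sz (xs :: bool list) \<le> 4 * length xs + 1"
  using sz_list_le[of xs 3] by simp

lemma sz_LL: "set A \<subseteq> LL l k \<Longrightarrow> sz A \<le> ((4 * k + 2) * l + 2) * length A + 1"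
proof -
  assume A: "set A \<subseteq> LL l k"
  have "sz C \<le> (4 * k + 2) * l + 1" if "C \<in> set A" for C
  proof -
    have C: "length C = l" "\<And>v. v \<in> set C \<Longrightarrow> length v = k" using that A by (auto simp: LL_def BL_def)
    have "sz C \<le> (4 * k + 1 + 1) * length C + 1"
    proof (rule sz_list_le)
      fix v assume "v \<in> set C"
      then show "sz v \<le> 4 * k + 1" using sz_bool_list[of v] C(2) by simp
    qed
    then show ?thesis using C(1) by simp
  qed
  then show ?thesis using sz_list_le[of A "(4 * k + 2) * l + 1"] by simp
qed

lemma bn_dig: "x < 2 ^ w \<Longrightarrow> x \<le> N \<Longrightarrow> bn N (dig w x) = x"
  by (simp add: bn_eq bval_dig)

text \<open>Here \<open>L\<close> is the logarithm of \<open>n\<close> and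
  \<open>2 ^ (c * L)\<close> the clock. The values passed through \<open>bn\<close> and
  \<open>pw\<close> are at most \<open>2 ^ (259 * L)\<close>, so \<open>259 \<le> c\<close> keeps
  their cuts inactive. The constant \<open>200000000\<close> is a generous bound for the sum of all
  components.\<close>

lemma isolating_advice:
  fixes c L n k k' t :: nat
  assumes \<phi>: "description_method \<phi>" and tab: "set tab = enc_entry ` trans \<phi>"
    and c: "259 \<le> c" and L: "1 \<le> L" "n < 2 ^ L"
    and a: "length a \<le> n" and z: "length z \<le> k" "produces \<phi> [z, b] a N1 \<infinity>" "N1 \<le> 2 ^ (c * L)"
    and t: "2 ^ (c * L) \<le> t"
  shows "\<exists>ad :: advice. fst ad = c * L \<and> sz ad \<le> 2 * (c * L) + 200000000 * L ^ 3 \<and>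
    length (compr (2 ^ (c * L)) ad a) \<le> min k n + 200000000 * L ^ 3 \<and>
    3 * real (card {r \<in> BL t. \<not> (\<forall>x. (\<exists>u. length u = 2 ^ (c * L) \<and> map fst u = take (2 ^ (c * L)) r \<and>
       verify tab (work_tapes \<phi>) (2 ^ (c * L)) ad (pair b (compr (2 ^ (c * L)) ad a)) u = [x]) \<longleftrightarrow> x = a)}) < 2 ^ t"
proof -
  define N :: nat where "N = 2 ^ (c * L)"
  \<comment> \<open>Digits for the number \<open>m\<close> of outputs, which is below
    \<open>2 ^ (25 + 3 * L)\<close>.\<close>
  define \<mu> where "\<mu> = 40 * L"
  \<comment> \<open>Exactly \<open>2 ^ s = 8 * 2 ^ L * (2 * 2 ^ (2 * \<mu>))\<close>, the bound that
    the fingerprint and the inner products demand.\<close>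
  define s where "s = L + 2 * \<mu> + 4"
  define s' where "s' = 2 * s + 4"
  define l where "l = s + s'"
  \<comment> \<open>At least \<open>l\<close> cells per coordinate, as the design requires, and at
    most twice as many.\<close>
  define \<kappa> where "\<kappa> = floor_log l + 1"
  \<comment> \<open>Up to \<open>4 * \<mu>\<close> blocks of \<open>l\<close> coordinates with
    \<open>2 ^ \<kappa>\<close> cells each: three logarithmic factors.\<close>
  define d where "d = 4 * \<mu> * (l * 2 ^ \<kappa>)"
  \<comment> \<open>The cap at \<open>n\<close> bounds the compressed string, and with it the
    running time, independently of \<open>k\<close>.\<close>
  define k' where "k' = min k n"
  define m where "m = k' + d + 4"
  \<comment> \<open>The exponents of the factors \<open>64\<close>, \<open>4 * 2 ^ L\<close> and
    \<open>2 * 2 ^ (2 * \<mu>)\<close> add up to this; their product dominates the number of samples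
    required by \<open>isolate\<close>.\<close>
  define \<tau> where "\<tau> = L + 2 * \<mu> + 9"
  \<comment> \<open>A sample needs \<open>l + m\<close> bits, and neither summand exceeds
    \<open>2 ^ \<mu>\<close>.\<close>
  define \<rho> where "\<rho> = \<mu> + 1"
  \<comment> \<open>In fact \<open>l = 243 * L + 16\<close>, whence the constant
    \<open>259\<close>.\<close>
  have lL: "l \<le> 259 * L" "0 < l" using L(1) by (auto simp: l_def s'_def s_def \<mu>_def)
  have \<kappa>: "l \<le> 2 ^ \<kappa>" "2 ^ \<kappa> \<le> 2 * l"
    using floor_log_exp2_gt[of l] floor_log_exp2_le[of l] lL(2) by (auto simp: \<kappa>_def)
  have \<kappa>L: "2 ^ \<kappa> \<le> 518 * L" "\<kappa> \<le> 518 * L" using \<kappa>(2) lL(1) less_exp[of \<kappa>] by linarith+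
  have L3: "1 \<le> L ^ 3" "L \<le> L ^ 3" "L * L \<le> L ^ 3"
    using L(1) by (auto simp: power3_eq_cube intro: mult_le_mono)
  have dL: "d \<le> 21465920 * L ^ 3"
  proof -
    have "d \<le> 4 * (40 * L) * (259 * L * (518 * L))"
      unfolding d_def \<mu>_def by (intro mult_le_mono le_refl lL \<kappa>L)
    then show ?thesis by (simp add: power3_eq_cube)
  qed
  have m\<mu>: "m < 2 ^ \<mu>"
  proof -
    have "L ^ 3 \<le> (2 ^ L) ^ 3" using less_exp[of L] by (intro power_mono) auto
    moreover have "(2 :: nat) ^ L \<le> (2 ^ L) ^ 3" by (intro self_le_power) auto
    moreover have "(1 :: nat) \<le> (2 ^ L) ^ 3" by simp
    ultimately have "m \<le> 21465925 * (2 ^ L) ^ 3" using L(2) dL unfolding m_def k'_def by linarith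
    also have "\<dots> < 2 ^ 25 * (2 ^ L) ^ 3" by simp
    also have "\<dots> = 2 ^ (25 + L * 3)" by (simp only: power_add power_mult)
    also have "\<dots> \<le> 2 ^ \<mu>" using L(1) by (intro power_increasing) (auto simp: \<mu>_def)
    finally show ?thesis .
  qed
  have d\<mu>: "d \<le> m" "0 < m" by (auto simp: m_def)
  obtain p :: nat where p: "prime p" "2 ^ s < p" "p \<le> 2 ^ s'" using ex_prime_between unfolding s'_def by blast
  define P where "P = p - 1"
  have P: "Suc P = p" using p(2) by (simp add: P_def)
  obtain es where es: "okb es" "sum_list (map (\<lambda>e. 2 ^ e) es) = m" "length es \<le> 4 * \<mu>" "\<And>e. e \<in> set es \<Longrightarrow> e < \<mu>"
    using ex_blocks[OF m\<mu>] by blast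
  obtain A where A: "length A = \<mu>" "set A \<subseteq> LL l \<kappa>" "\<And>e. e \<le> \<mu> \<Longrightarrow>
      (\<Sum>j\<in>BL e - {replicate e False}. 2 ^ agr (cvec l \<kappa> A j) (zero_vec l \<kappa>)) \<le> 3 * (2 ^ e - 1 :: nat)"
    using design_columns[OF \<kappa>(1), of \<mu>] by blast
  have pN: "(2 :: nat) ^ e \<le> N" if "e \<le> 259 * L" for e
  proof -
    have "259 * L \<le> c * L" using c by (rule mult_right_mono) simp
    then show ?thesis unfolding N_def by (intro power_increasing order.trans[OF that]) auto
  qed
  have Nl: "2 ^ l \<le> N" by (rule pN[OF lL(1)])
  have ranges: "\<mu> \<le> 259 * L" "s \<le> 259 * L" "s' \<le> 259 * L" "\<tau> + \<rho> \<le> 259 * L" "\<tau> \<le> 259 * L" "\<rho> \<le> 259 * L" "L \<le> 259 * L"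
    using L(1) by (auto simp: s'_def s_def \<mu>_def \<tau>_def \<rho>_def)
  define Ss where "Ss = dsg l \<kappa> A 0 es"
  have lenS: "length Ss = m" by (simp add: Ss_def length_dsg es(2))
  have Ss: "design N l \<kappa> (2 ^ \<kappa>) es A = Ss"
    unfolding Ss_def
  proof (rule design_eq)
    show "\<forall>e\<in>set es. 2 ^ e \<le> N \<and> e \<le> length A"
    proof
      fix e assume "e \<in> set es"
      then have "e < \<mu>" by (rule es(4))
      then show "2 ^ e \<le> N \<and> e \<le> length A" using ranges(1) by (auto simp: A(1) intro: pN)
    qed
    show "2 ^ \<kappa> \<le> N"
    proof -
      have "2 * l \<le> 2 ^ l"
      proof -
        obtain j where j: "l = Suc j" using lL(2) gr0_implies_Suc by blast
        have "Suc j \<le> 2 ^ j" using less_exp[of j] by (rule Suc_leI)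
        then show ?thesis by (simp add: j)
      qed
      then show ?thesis using \<kappa>(2) Nl by linarith
    qed
  qed (rule A(2))
  have S: "length S = l \<and> distinct S \<and> set S \<subseteq> {..<d}" if "S \<in> set Ss" for S
  proof -
    from dsg_mem[OF that[unfolded Ss_def]] obtain \<gamma> e j where
      S: "S = Sf l \<kappa> A \<gamma> e j" "\<gamma> < length es" "e \<in> set es" by auto
    have e: "e \<le> length A" using es(4)[OF S(3)] A(1) by simp
    have "x < d" if "x \<in> set S" for x
    proof -
      have "x < Suc \<gamma> * (l * 2 ^ \<kappa>)" using Sf_range(2)[OF A(2) e] that unfolding S(1) by blast
      also have "\<dots> \<le> d" unfolding d_def using S(2) es(3) by (intro mult_right_mono) auto
      finally show ?thesis .
    qed
    then show ?thesis using Sf_len[OF A(2) e] Sf_distinct[OF A(2) e] S(1) by auto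
  qed
  define B where "B = BB tab (work_tapes \<phi>) N s P Ss d b"
  have Bm: "real (card (B \<inter> BL m)) \<le> 2 ^ m / 4"
  proof -
    have "B \<inter> BL m = B" by (auto simp: B_def BB_def BL_def nw_def lenS)
    then show ?thesis using card_BB[of k' d Ss tab "work_tapes \<phi>" N s P b] lenS by (simp add: B_def m_def)
  qed
  \<comment> \<open>If \<open>k \<le> n\<close>, the certificate is the given description
    \<open>z\<close>; otherwise it is \<open>a\<close> itself, read literally.\<close>
  have Ba: "nw N s P Ss a u \<in> B" if "length u = d" for u
  proof (cases "k \<le> n")
    case True
    have "zrun tab (work_tapes \<phi>) N z b = a" by (rule zrun_correct[OF \<phi> tab z(2)]) (use z(3) in \<open>simp add: N_def\<close>)
    then show ?thesis unfolding B_def using that z(1) True lenS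
      by (intro BB_I[where z = z]) (auto simp: m_def k'_def)
  next
    case False
    then show ?thesis unfolding B_def using that a lenS
      by (intro BB_I[where z = a]) (auto simp: m_def k'_def)
  qed
  have m2: "(4 * real m / 3)\<^sup>2 \<le> 2 * 2 ^ (2 * \<mu>)"
  proof -
    have "real m ^ 2 \<le> (2 ^ \<mu>) ^ 2" using m\<mu> by (intro power_mono) auto
    moreover have "0 \<le> ((2 :: real) ^ \<mu>) ^ 2" by simp
    ultimately have "16 / 9 * real m ^ 2 \<le> 2 * (2 ^ \<mu>) ^ 2" by linarith
    then show ?thesis by (simp add: power_divide power_mult_distrib power_mult[symmetric] mult.commute)
  qed
  have n1: "8 * real n * (4 * real m / 3)\<^sup>2 < 2 ^ s"
  proof -
    have "8 * real n * (4 * real m / 3)\<^sup>2 \<le> 8 * real n * (2 * 2 ^ (2 * \<mu>))" by (intro mult_left_mono m2) simp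
    also have "\<dots> < 8 * 2 ^ L * (2 * 2 ^ (2 * \<mu>))" using L(2) by simp
    also have "\<dots> = 2 ^ s" by (simp add: s_def power_add)
    finally show ?thesis .
  qed
  define T :: nat where "T = 2 ^ \<tau>"
  define C :: nat where "C = 2 ^ \<rho>"
  have T1: "64 * (real n + 3) * (4 * real m / 3)\<^sup>2 \<le> real T"
  proof -
    have nL: "real n + 3 \<le> 4 * 2 ^ L"
    proof -
      have "n + 3 \<le> 4 * 2 ^ L" using L(2) by (simp add: Suc_le_eq)
      then have "real (n + 3) \<le> real (4 * 2 ^ L)" by (simp only: of_nat_le_iff)
      then show ?thesis by simp
    qed
    have "64 * (real n + 3) * (4 * real m / 3)\<^sup>2 \<le> 64 * (4 * 2 ^ L) * (2 * 2 ^ (2 * \<mu>))"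
      by (intro mult_mono m2 nL) auto
    also have "\<dots> = real T" by (simp add: T_def \<tau>_def power_add)
    finally show ?thesis .
  qed
  have Cm: "l + m \<le> C"
  proof -
    have "L < 2 ^ L" by (rule less_exp)
    then have "l \<le> 2 ^ 9 * 2 ^ L" by (intro order.trans[OF lL(1)] mult_le_mono) auto
    also have "\<dots> = 2 ^ (9 + L)" by (simp only: power_add)
    also have "\<dots> \<le> 2 ^ \<mu>" using L(1) by (intro power_increasing) (auto simp: \<mu>_def)
    finally show ?thesis using m\<mu> by (simp add: C_def \<rho>_def)
  qed
  have TC: "T * C \<le> N" using pN[OF ranges(4)] by (simp add: T_def C_def power_add)
  \<comment> \<open>The random bits that are not sampled: \<open>t\<close> will be the time bound,
    which may be much larger than the clock.\<close>
  define R where "R = t - T * C"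
  have tR: "T * C + R = t" using TC t by (simp add: R_def N_def)
  have "\<exists>I u th e. I < m \<and> length u = d \<and> th \<le> T \<and> e < 2 ^ s \<and>
    3 * real (card {r \<in> BL (T * C + R). \<not> ((\<forall>x. length x = length a \<and> pf N s P l Ss I u x = pf N s P l Ss I u a \<and>
        rs P x e = rs P a e \<and> th \<le> cnt T C (\<lambda>rc. target N s P l Ss I u x rc \<in> B) r \<longrightarrow> x = a) \<and>
        th \<le> cnt T C (\<lambda>rc. target N s P l Ss I u a rc \<in> B) r)}) < 2 ^ (T * C + R)"
  proof (rule isolate[where c = "C - (l + m)" and s' = s'])
    show "prime (Suc P)" "2 ^ s \<le> Suc P" "Suc P \<le> 2 ^ s'" using p P by auto
    show "C = l + m + (C - (l + m))" using Cm by simp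
  qed (use Nl lenS d\<mu>(2) S Bm Ba a n1 T1 in \<open>auto simp: l_def\<close>)
  then obtain I u th e where I: "I < m" and u: "length u = d" and th: "th \<le> T" and e: "e < 2 ^ s" and
    iso: "3 * real (card {r \<in> BL t. \<not> ((\<forall>x. length x = length a \<and> pf N s P l Ss I u x = pf N s P l Ss I u a \<and>
        rs P x e = rs P a e \<and> th \<le> cnt T C (\<lambda>rc. target N s P l Ss I u x rc \<in> B) r \<longrightarrow> x = a) \<and>
        th \<le> cnt T C (\<lambda>rc. target N s P l Ss I u a rc \<in> B) r)}) < 2 ^ t"
    unfolding tR by blast
  define ad :: advice where "ad = (c * L, s, l, \<kappa>, 2 ^ \<kappa>, es, A, dig \<mu> I, u, dig s' P, dig L (length a), dig s e,
    dig s' (rs P a e), dig (Suc \<tau>) th, \<tau>, \<rho>)"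
  have bns: "bn N (dig \<mu> I) = I" "bn N (dig s' P) = P" "bn N (dig L (length a)) = length a" "bn N (dig s e) = e"
    "bn N (dig (Suc \<tau>) th) = th"
  proof -
    show "bn N (dig \<mu> I) = I" using I m\<mu> pN[OF ranges(1)] by (intro bn_dig) auto
    show "bn N (dig s' P) = P" using p P pN[OF ranges(3)] by (intro bn_dig) auto
    show "bn N (dig L (length a)) = length a" using a L(2) pN[OF ranges(7)] by (intro bn_dig) auto
    show "bn N (dig s e) = e" using e pN[OF ranges(2)] by (intro bn_dig) auto
    show "bn N (dig (Suc \<tau>) th) = th"
    proof (rule bn_dig)
      show "th < 2 ^ Suc \<tau>" using th unfolding T_def by (rule le_less_trans) simp
      show "th \<le> N" using th pN[OF ranges(5)] by (simp add: T_def)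
    qed
  qed
  have adSs: "ad_Ss N ad = Ss" by (simp add: ad_Ss_def ad_def Ss)
  have compr: "compr N ad x = pf N s P l Ss I u x" for x by (simp add: compr_def adSs) (simp add: ad_def bns)
  have pws: "T = pw N (ad_t ad)" "C = pw N (ad_c ad)"
    using pN[OF ranges(5)] pN[OF ranges(6)] by (simp_all add: ad_def pw_eq T_def C_def)
  let ?ver = "\<lambda>r x. \<exists>t. length t = N \<and> map fst t = take N r \<and>
       verify tab (work_tapes \<phi>) N ad (pair b (compr N ad a)) t = [x]"
  have ver: "?ver r x \<longleftrightarrow> length x = length a \<and> pf N s P l Ss I u x = pf N s P l Ss I u a \<and> rs P x e = rs P a e \<and>
      th \<le> cnt T C (\<lambda>rc. target N s P l Ss I u x rc \<in> B) r" if "length r = t" for r x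
  proof -
    have CC: "length (ad_Ss N ad) \<le> C" using Cm lenS by (simp add: adSs)
    have Cu: "length (ad_u ad) \<le> C" using Cm d\<mu>(1) u by (simp add: ad_def)
    have r: "N \<le> length r" using that t by (simp add: N_def)
    have dd: "dig s' (rs P x e) = dig s' (rs P a e) \<longleftrightarrow> rs P x e = rs P a e"
    proof -
      have "rs P y e < 2 ^ s'" for y using rs_less[of P y e] p(3) P by simp
      then show ?thesis by (metis bval_dig)
    qed
    show ?thesis
      unfolding verify_iff[OF pws TC CC Cu r] compr unfolding adSs unfolding ad_def B_def by (simp add: bns dd u)
  qed
  have "{r \<in> BL t. \<not> (\<forall>x. ?ver r x \<longleftrightarrow> x = a)} = {r \<in> BL t. \<not> ((\<forall>x. length x = length a \<and> pf N s P l Ss I u x = pf N s P l Ss I u a \<and>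
        rs P x e = rs P a e \<and> th \<le> cnt T C (\<lambda>rc. target N s P l Ss I u x rc \<in> B) r \<longrightarrow> x = a) \<and>
        th \<le> cnt T C (\<lambda>rc. target N s P l Ss I u a rc \<in> B) r)}"
    by (rule Collect_cong, rule conj_cong[OF refl]) (simp only: BL_def mem_Collect_eq ver, blast)
  with iso have good: "3 * real (card {r \<in> BL t. \<not> (\<forall>x. ?ver r x \<longleftrightarrow> x = a)}) < 2 ^ t" by (simp only:)
  have "(\<Sum>i<I. 2 ^ ov l (Ss ! i) (Ss ! I)) \<le> length Ss"
    unfolding Ss_def by (rule design_sum[OF A(2)]) (use A es I lenS in \<open>auto simp: Ss_def less_imp_le\<close>)
  then have len: "length (compr N ad a) \<le> min k n + 200000000 * L ^ 3"
    unfolding compr using length_pf[OF Nl _ _ , of I Ss u m s P a] I lenS S u dL L3(1) by (simp add: m_def k'_def)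
  have size: "sz ad \<le> 2 * (c * L) + 200000000 * L ^ 3"
  proof -
    have 1: "sz es \<le> 13120 * L ^ 3 + 1"
    proof -
      have "sz es \<le> (2 * \<mu> + 1 + 1) * length es + 1" by (rule sz_list_le) (auto dest: es(4))
      also have "\<dots> \<le> (82 * L) * (160 * L) + 1"
        by (intro add_mono mult_le_mono) (use L(1) es(3) in \<open>auto simp: \<mu>_def\<close>)
      also have "\<dots> = 13120 * (L * L) + 1" by simp
      also have "\<dots> \<le> 13120 * L ^ 3 + 1" by (intro add_mono mult_le_mono L3 le_refl)
      finally show ?thesis .
    qed
    have 2: "sz A \<le> 21486720 * L ^ 3 + 1"
    proof -
      have "sz A \<le> ((4 * \<kappa> + 2) * l + 2) * length A + 1" by (rule sz_LL[OF A(2)])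
      also have "\<dots> \<le> ((2074 * L) * (259 * L) + 2 * (L * L)) * (40 * L) + 1"
      proof -
        have f: "4 * \<kappa> + 2 \<le> 2074 * L" "2 \<le> 2 * (L * L)" "length A \<le> 40 * L"
          using L(1) \<kappa>L(2) A(1) by (simp_all add: \<mu>_def)
        show ?thesis by (intro add_mono mult_le_mono le_refl f lL(1))
      qed
      also have "\<dots> = 21486720 * L ^ 3 + 1" by (simp add: power3_eq_cube)
      finally show ?thesis .
    qed
    have 3: "sz (dig w x) \<le> 4 * w + 1" for w x using sz_bool_list[of "dig w x"] by simp
    have 4: "sz u \<le> 4 * d + 1" using sz_bool_list[of u] u by simp
    have "sz ad \<le> 15 + (2 * (c * L) + 1) + (2 * s + 1) + (2 * l + 1) + (2 * \<kappa> + 1) + (2 * 2 ^ \<kappa> + 1) + sz es + sz A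
       + (4 * \<mu> + 1) + sz u + (4 * s' + 1) + (4 * L + 1) + (4 * s + 1) + (4 * s' + 1) + (4 * (\<tau> + 1) + 1) + (2 * \<tau> + 1) + (2 * \<rho> + 1)"
      using 3[of \<mu> I] 3[of s' P] 3[of L "length a"] 3[of s e] 3[of s' "rs P a e"] 3[of "Suc \<tau>" th]
      unfolding ad_def by simp
    also have "\<dots> \<le> 2 * (c * L) + 200000000 * L ^ 3"
    proof -
      have "15 + (2 * Y + 1) + (2 * s + 1) + (2 * l + 1) + (2 * \<kappa> + 1) + (2 * q + 1) + E + F
          + (4 * \<mu> + 1) + G + (4 * s' + 1) + (4 * L + 1) + (4 * s + 1) + (4 * s' + 1) + (4 * (\<tau> + 1) + 1) + (2 * \<tau> + 1) + (2 * \<rho> + 1)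
          \<le> 2 * Y + 200000000 * X"
        if h: "E \<le> 13120 * X + 1" "F \<le> 21486720 * X + 1" "G \<le> 4 * d + 1" "d \<le> 21465920 * X" "1 \<le> X" "L \<le> X" "q \<le> 518 * L"
        for E F G X Y q :: nat
      proof -
        have "E + F + G \<le> 107363520 * X + 3" using h(1-4) by linarith
        then have e1: "E + F + G \<le> 107363523 * X" using h(5) by linarith
        have "2 * s + 2 * l + 2 * \<kappa> + 2 * q \<le> 3108 * L" using \<kappa>L(2) lL(1) ranges(2) h(7) by linarith
        then have e2: "2 * s + 2 * l + 2 * \<kappa> + 2 * q \<le> 3108 * X" using h(6) by linarith
        have "4 * \<mu> + 4 * s' + 4 * L + 4 * s + 4 * s' + 4 * \<tau> + 2 * \<tau> + 2 * \<rho> \<le> 6738 * L"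
          using ranges(1-3,5,6) by linarith
        then have e3: "4 * \<mu> + 4 * s' + 4 * L + 4 * s + 4 * s' + 4 * \<tau> + 2 * \<tau> + 2 * \<rho> \<le> 6738 * X" using h(6) by linarith
        have e4: "35 \<le> 35 * X" using h(5) by simp
        have "15 + (2 * Y + 1) + (2 * s + 1) + (2 * l + 1) + (2 * \<kappa> + 1) + (2 * q + 1) + E + F
          + (4 * \<mu> + 1) + G + (4 * s' + 1) + (4 * L + 1) + (4 * s + 1) + (4 * s' + 1) + (4 * (\<tau> + 1) + 1) + (2 * \<tau> + 1) + (2 * \<rho> + 1)
          = 2 * Y + ((E + F + G) + ((2 * s + 2 * l + 2 * \<kappa> + 2 * q)
            + ((4 * \<mu> + 4 * s' + 4 * L + 4 * s + 4 * s' + 4 * \<tau> + 2 * \<tau> + 2 * \<rho>) + 32)))" by simp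
        also have "\<dots> \<le> 2 * Y + (107363523 * X + (3108 * X + (6738 * X + 35 * X)))"
          using e4 by (intro add_mono le_refl e1 e2 e3) simp
        also have "\<dots> \<le> 2 * Y + 200000000 * X" by simp
        finally show ?thesis .
      qed
      from this[OF 1 2 4 dL L3(1,2) \<kappa>L(1)] show ?thesis .
    qed
    finally show ?thesis .
  qed
  show ?thesis
    using good len size unfolding N_def by (intro exI[of _ ad]) (simp add: ad_def)
qed

section \<open>Complexity measures, time bounds and the assembly of the theorem\<close>

lemma floor_log_succ: "n < 2 ^ (floor_log n + 1)" "2 ^ (floor_log n + 1) \<le> 2 * n + 2"
  using floor_log_exp2_gt[of n] floor_log_exp2_le[of n] by (cases "n = 0"; simp)+

text \<open>Coefficients may be negative or fractional, so they are replaced by their absolute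
  values rounded up, and all powers of \<open>n\<close> are dominated by the highest power of
  \<open>2 * n + 2\<close>.\<close>

lemma bound_pbd: "pbd (bound t)"
proof -
  have "\<bar>poly t (real n)\<bar> \<le> real ((\<Sum>i\<le>degree t. nat \<lceil>\<bar>coeff t i\<bar>\<rceil>) * (2 * n + 2) ^ degree t)" for n
  proof -
    have "\<bar>poly t (real n)\<bar> \<le> (\<Sum>i\<le>degree t. \<bar>coeff t i * real n ^ i\<bar>)" unfolding poly_altdef by (rule sum_abs)
    also have "\<dots> \<le> (\<Sum>i\<le>degree t. real (nat \<lceil>\<bar>coeff t i\<bar>\<rceil>) * real ((2 * n + 2) ^ degree t))"
    proof (rule sum_mono)
      fix i assume i: "i \<in> {..degree t}"
      have "real n ^ i \<le> real (2 * n + 2) ^ i" by (intro power_mono) auto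
      also have "\<dots> \<le> real (2 * n + 2) ^ degree t" using i by (intro power_increasing) auto
      finally have "real n ^ i \<le> real ((2 * n + 2) ^ degree t)" by simp
      moreover have "\<bar>coeff t i\<bar> \<le> real (nat \<lceil>\<bar>coeff t i\<bar>\<rceil>)" by linarith
      ultimately show "\<bar>coeff t i * real n ^ i\<bar> \<le> real (nat \<lceil>\<bar>coeff t i\<bar>\<rceil>) * real ((2 * n + 2) ^ degree t)"
        unfolding abs_mult by (intro mult_mono) auto
    qed
    finally show ?thesis by (simp add: sum_distrib_right)
  qed
  note abs_le = this
  have "bound t n \<le> (\<Sum>i\<le>degree t. nat \<lceil>\<bar>coeff t i\<bar>\<rceil>) * (sz n + 1) ^ degree t" for n
  proof -
    let ?v = "(\<Sum>i\<le>degree t. nat \<lceil>\<bar>coeff t i\<bar>\<rceil>) * (2 * n + 2) ^ degree t"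
    have "poly t (real n) \<le> real ?v" by (rule order.trans[OF abs_ge_self abs_le])
    then have "\<lfloor>poly t (real n)\<rfloor> \<le> \<lfloor>real ?v\<rfloor>" by (rule floor_mono)
    then have "\<lfloor>poly t (real n)\<rfloor> \<le> int ?v" by (simp only: floor_of_nat)
    then have "bound t n \<le> ?v" unfolding bound_def by (simp only: nat_le_iff)
    then show ?thesis by simp
  qed
  then show ?thesis by (rule pbd_mono[rotated]) (intro pbd_intros)
qed

lemma produces_mono: "produces M ins z t s \<Longrightarrow> t \<le> t' \<Longrightarrow> s \<le> s' \<Longrightarrow> produces M ins z t' s'"
  unfolding produces_def by (fastforce intro: order.trans)

lemma KC_mono: "t \<le> t' \<Longrightarrow> s \<le> s' \<Longrightarrow> KC \<phi> t' s' x y \<le> KC \<phi> t s x y"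
  unfolding KC_def by (rule Inf_superset_mono) (use produces_mono in blast)

text \<open>A finite infimum of extended naturals is attained: otherwise all members would be at
  least \<open>k + 1\<close>.\<close>

lemma KC_leE:
  assumes "KC \<phi> t s x y \<le> enat k" obtains z where "produces \<phi> [z, y] x t s" "length z \<le> k"
proof -
  have "\<exists>v \<in> {enat (length z) | z. produces \<phi> [z, y] x t s}. v \<le> enat k"
  proof (rule ccontr)
    assume "\<not> ?thesis"
    then have "\<forall>v \<in> {enat (length z) | z. produces \<phi> [z, y] x t s}. eSuc (enat k) \<le> v"
      by (meson ileI1 not_le)
    then have "eSuc (enat k) \<le> KC \<phi> t s x y" unfolding KC_def by (intro Inf_greatest) blast
    then have "eSuc (enat k) \<le> enat k" using assms by (rule order.trans)
    then show False by (simp add: eSuc_enat)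
  qed
  then show ?thesis using that by auto
qed

text \<open>From \<open>n = 2\<close> on the logarithm is at least \<open>1\<close>, so
  \<open>floor_log n + 1\<close> is at most twice as large; \<open>8 + 1\<close> gives the factor
  \<open>9\<close>.\<close>

lemma log_cubed_bigo: "(\<lambda>n. real (K * (floor_log n + 1) ^ 3 + K)) \<in> O(\<lambda>n. log 2 (real n) ^ 3)"
proof (rule bigoI[of _ "9 * real K"], rule eventually_sequentiallyI[of 2])
  fix n :: nat assume n: "2 \<le> n"
  have "real (2 ^ floor_log n) \<le> real n" using floor_log_exp2_le[of n] n by (simp only: of_nat_le_iff)
  then have f: "real (floor_log n) \<le> log 2 (real n)" using n by (simp add: le_log_iff powr_realpow)
  have l1: "1 \<le> log 2 (real n)" using n by (simp add: le_log_iff)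
  have "(real (floor_log n) + 1) ^ 3 \<le> (2 * log 2 (real n)) ^ 3" using f l1 by (intro power_mono) auto
  then have 1: "(real (floor_log n) + 1) ^ 3 \<le> 8 * log 2 (real n) ^ 3" by (simp add: power_mult_distrib)
  have "1 ^ 3 \<le> log 2 (real n) ^ 3" using l1 by (intro power_mono) auto
  then have "real K * ((real (floor_log n) + 1) ^ 3 + 1) \<le> real K * (9 * log 2 (real n) ^ 3)"
    using 1 by (intro mult_left_mono) auto
  then show "norm (real (K * (floor_log n + 1) ^ 3 + K)) \<le> 9 * real K * norm (log 2 (real n) ^ 3)"
    using l1 by (simp add: algebra_simps add.commute)
qed

text \<open>One polynomial and one error function serve for all three bounds. The same advice is the
  program in both complexities, up to the translations given by optimality and universality, so each
  costs its size O(log^3 n) plus a constant.\<close>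

theorem theorem7:
  fixes \<phi> U\<^sub>n :: ntm
  assumes "optimal \<phi>" and "universal U\<^sub>n"
  shows "\<forall>t\<^sub>1 :: real poly. \<exists>t\<^sub>2 :: real poly.
    \<exists>e\<^sub>1 e\<^sub>2 e\<^sub>3 :: nat \<Rightarrow> nat.
      (\<lambda>n. real (e\<^sub>1 n)) \<in> O(\<lambda>n. log 2 (real n) ^ 3) \<and>
      (\<lambda>n. real (e\<^sub>2 n)) \<in> O(\<lambda>n. log 2 (real n) ^ 3) \<and>
      (\<lambda>n. real (e\<^sub>3 n)) \<in> O(\<lambda>n. log 2 (real n) ^ 3) \<and>
      (\<forall>(n::nat) (k::nat) (a::bool list) (b::bool list).
         length a \<le> n \<longrightarrow> length b \<le> n \<longrightarrow>
         KC \<phi> (bound t\<^sub>1 n) \<infinity> a b \<le> enat k \<longrightarrow>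
         (\<exists>p::bool list. length p \<le> k + e\<^sub>1 n \<and>
            KC \<phi> (bound t\<^sub>2 n) \<infinity> p a \<le> enat (e\<^sub>2 n) \<and>
            CAM U\<^sub>n (bound t\<^sub>2 n) a (pair b p) \<le> enat (e\<^sub>3 n)))"
proof
  fix t\<^sub>1 :: "real poly"
  have \<phi>: "description_method \<phi>" using assms(1) by (simp add: optimal_def)
  then have "finite (enc_entry ` trans \<phi>)" by (simp add: description_method_def is_ntm_def)
  then obtain tab where tab: "set tab = enc_entry ` trans \<phi>" using finite_list by blast
  obtain \<psi> C\<^sub>1 where \<psi>: "description_method \<psi>" "\<And>ad x. produces \<psi> [code (tr ad), x] (compr (2 ^ fst ad) ad x)
      ((2 ^ fst ad + sz (ad, x)) ^ C\<^sub>1) \<infinity>" using compression_machine by blast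
  obtain c\<^sub>1 where c1: "\<And>t s x y. KC \<phi> (c\<^sub>1 * t * floor_log t + c\<^sub>1) (enat c\<^sub>1 * s + enat c\<^sub>1) x y \<le> KC \<psi> t s x y + enat c\<^sub>1"
    using assms(1) \<psi>(1) unfolding optimal_def by blast
  obtain M C\<^sub>2 where M: "is_ntm 3 M" "\<And>ad y r. 2 ^ fst ad \<le> length r \<Longrightarrow>
    results M [y, code (tr ad), r] = {x. \<exists>t. length t = 2 ^ fst ad \<and> map fst t = take (2 ^ fst ad) r \<and>
       verify tab (work_tapes \<phi>) (2 ^ fst ad) ad y t = [x]} \<and>
    halts_within M [y, code (tr ad), r] ((2 ^ fst ad + sz (ad, y)) ^ C\<^sub>2)"
    using verification_machine[of tab "work_tapes \<phi>"] by blast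
  obtain c\<^sub>2 where c2: "\<And>p. \<exists>q. length q \<le> length p + c\<^sub>2 \<and>
           (\<forall>y r. results U\<^sub>n [y, q, r] = results M [y, p, r] \<and>
              (\<forall>t. halts_within M [y, p, r] t \<longrightarrow> halts_within U\<^sub>n [y, q, r] (c\<^sub>2 * t * floor_log t + c\<^sub>2)))"
    using assms(2) M(1) unfolding universal_def by blast
  obtain D where D: "\<And>n :: nat. bound t\<^sub>1 n \<le> (sz n + 1) ^ D" using bound_pbd[of t\<^sub>1] unfolding pbd_def by blast
  \<comment> \<open>\<open>isolating_advice\<close> demands \<open>259\<close>; the summand
    \<open>2 * D\<close> lifts the clock above \<open>bound t\<^sub>1 n\<close>, since
    \<open>sz n + 1\<close> is at most \<open>2 ^ (2 * L n)\<close>.\<close>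
  define c where "c = 259 + 2 * D"
  define L where "L n = floor_log n + 1" for n
  have L: "1 \<le> L n" "n < 2 ^ L n" "2 ^ L n \<le> 2 * n + 2" for n
    using floor_log_succ[of n] by (auto simp: L_def)
  have bt1: "bound t\<^sub>1 n \<le> 2 ^ (c * L n)" for n
  proof -
    have "2 * n + 2 \<le> 2 ^ L n * 2" using L(2)[of n] by simp
    also have "\<dots> \<le> 2 ^ L n * 2 ^ L n" using L(1)[of n] by (intro mult_le_mono) (auto simp: self_le_power)
    finally have "sz n + 1 \<le> 2 ^ (2 * L n)" by (simp add: mult_2 power_add)
    then have "(sz n + 1) ^ D \<le> (2 ^ (2 * L n)) ^ D" by (rule power_mono) simp
    also have "\<dots> \<le> 2 ^ (c * L n)" unfolding power_mult[symmetric]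
      by (rule power_increasing) (auto simp: c_def algebra_simps)
    finally show ?thesis using D[of n] by linarith
  qed
  define S where "S n = 2 * (c * L n) + 200000000 * L n ^ 3" for n
  \<comment> \<open>The clock plus a bound on the input sizes of both machines. In
    \<open>3 * n + 2\<close> are the doubled bits of \<open>b\<close>, the delimiter and the part
    \<open>min k n\<close> of the length of \<open>p\<close>.\<close>
  define Z where "Z n = (2 :: nat) ^ (c * L n) + (1 + S n + (4 * (3 * n + 2 + 200000000 * L n ^ 3) + 1))" for n
  \<comment> \<open>In both overheads the logarithm of the time is bounded by the time itself. The
    last summand ensures that random strings as long as the time bound contain all bits the verifier
    reads.\<close>
  define G where "G n = (c\<^sub>1 * (Z n ^ C\<^sub>1) * (Z n ^ C\<^sub>1) + c\<^sub>1) + (c\<^sub>2 * (Z n ^ C\<^sub>2) * (Z n ^ C\<^sub>2) + c\<^sub>2) + 2 ^ (c * L n)" for n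
  have "pbd G"
  proof -
    have 0: "pbd (\<lambda>n :: nat. n)" by (rule pbd_mono[OF pbd_sz]) simp
    have p2: "pbd (\<lambda>n :: nat. 2 ^ L n)" by (rule pbd_mono[of "\<lambda>n. 2 * n + 2"]) (intro pbd_intros 0 | rule L(3))+
    have pL: "pbd L" by (rule pbd_mono[OF p2]) (use less_exp in \<open>auto intro: less_imp_le\<close>)
    have pc: "pbd (\<lambda>n :: nat. 2 ^ (c * L n))"
      using pbd_power[OF p2, of c] by (simp add: power_mult[symmetric] mult.commute)
    show ?thesis unfolding G_def Z_def S_def by (intro pbd_intros 0 pL pc)
  qed
  then obtain g where g: "\<And>n. G n \<le> (sz n + 1) ^ g" unfolding pbd_def by blast
  \<comment> \<open>At \<open>n\<close> this polynomial takes the value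
    \<open>(sz n + 1) ^ g\<close>.\<close>
  define t\<^sub>2 :: "real poly" where "t\<^sub>2 = [:2, 2:] ^ g"
  have bt2: "G n \<le> bound t\<^sub>2 n" for n
  proof -
    have "poly t\<^sub>2 (real n) = real ((sz n + 1) ^ g)" by (simp add: t\<^sub>2_def add.commute mult.commute)
    then have "bound t\<^sub>2 n = (sz n + 1) ^ g" unfolding bound_def by (simp only: floor_of_nat nat_int)
    then show ?thesis using g[of n] by simp
  qed
  define K where "K = 2 * c + 200000000 + c\<^sub>1 + c\<^sub>2"
  define E where "E n = K * (floor_log n + 1) ^ 3 + K" for n
  have SE: "S n + c\<^sub>1 \<le> E n" "S n + c\<^sub>2 \<le> E n" "200000000 * L n ^ 3 \<le> E n" for n
  proof -
    have "L n \<le> L n ^ 3" by (rule self_le_power) (use L(1) in auto)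
    then have "c * L n \<le> c * L n ^ 3" by (rule mult_left_mono) simp
    then have "S n + c\<^sub>1 + c\<^sub>2 \<le> (2 * c + 200000000) * L n ^ 3 + c\<^sub>1 + c\<^sub>2" by (simp add: S_def algebra_simps)
    also have "\<dots> \<le> K * L n ^ 3 + K" unfolding K_def by (simp add: algebra_simps)
    finally show "S n + c\<^sub>1 \<le> E n" "S n + c\<^sub>2 \<le> E n" by (auto simp: E_def L_def)
    have "200000000 * L n ^ 3 \<le> K * L n ^ 3" by (intro mult_right_mono) (auto simp: K_def)
    then show "200000000 * L n ^ 3 \<le> E n" unfolding E_def L_def by (rule trans_le_add1)
  qed
  have fl: "floor_log t \<le> t" for t
  proof (cases "t = 0")
    case False
    then show ?thesis using floor_log_exp2_le[of t] less_exp[of "floor_log t"] by linarith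
  qed simp
  have main: "\<exists>p. length p \<le> k + E n \<and> KC \<phi> (bound t\<^sub>2 n) \<infinity> p a \<le> enat (E n) \<and>
      CAM U\<^sub>n (bound t\<^sub>2 n) a (pair b p) \<le> enat (E n)"
    if a: "length a \<le> n" and b: "length b \<le> n" and kc: "KC \<phi> (bound t\<^sub>1 n) \<infinity> a b \<le> enat k" for n k a b
  proof -
    let ?t = "bound t\<^sub>2 n" and ?N = "2 ^ (c * L n) :: nat"
    obtain z where z: "produces \<phi> [z, b] a (bound t\<^sub>1 n) \<infinity>" "length z \<le> k" using KC_leE[OF kc] .
    have Nt: "?N \<le> ?t" using bt2[of n] by (simp add: G_def)
    have "259 \<le> c" by (simp add: c_def)
    from isolating_advice[OF \<phi> tab this L(1)[of n] L(2)[of n] a z(2,1) bt1[of n] Nt] obtain ad :: advice where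
      ad: "fst ad = c * L n" "sz ad \<le> S n" "length (compr ?N ad a) \<le> min k n + 200000000 * L n ^ 3" and
      iso: "3 * real (card {r \<in> BL ?t. \<not> (\<forall>x. (\<exists>u. length u = ?N \<and> map fst u = take ?N r \<and>
       verify tab (work_tapes \<phi>) ?N ad (pair b (compr ?N ad a)) u = [x]) \<longleftrightarrow> x = a)}) < 2 ^ ?t"
      unfolding S_def by (elim exE conjE)
    define p where "p = compr ?N ad a"
    have "length p \<le> k + E n" using ad(3) SE(3)[of n] unfolding p_def by linarith
    moreover have "KC \<phi> ?t \<infinity> p a \<le> enat (E n)"
    proof -
      define t where "t = (2 ^ fst ad + sz (ad, a)) ^ C\<^sub>1"
      have "2 ^ fst ad + sz (ad, a) \<le> Z n" using ad(1,2) a sz_bool_list[of a] unfolding Z_def by simp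
      then have tZ: "t \<le> Z n ^ C\<^sub>1" unfolding t_def by (rule power_mono) simp
      have "c\<^sub>1 * t * floor_log t + c\<^sub>1 \<le> c\<^sub>1 * (Z n ^ C\<^sub>1) * (Z n ^ C\<^sub>1) + c\<^sub>1"
        by (intro add_mono mult_le_mono le_refl tZ order.trans[OF fl tZ])
      also have "\<dots> \<le> ?t" using bt2[of n] by (simp add: G_def)
      finally have "KC \<phi> ?t \<infinity> p a \<le> KC \<phi> (c\<^sub>1 * t * floor_log t + c\<^sub>1) \<infinity> p a" by (rule KC_mono) simp
      also have "\<dots> \<le> KC \<phi> (c\<^sub>1 * t * floor_log t + c\<^sub>1) (enat c\<^sub>1 * \<infinity> + enat c\<^sub>1) p a"
        by (rule KC_mono) simp_all
      also have "\<dots> \<le> KC \<psi> t \<infinity> p a + enat c\<^sub>1" by (rule c1)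
      also have "KC \<psi> t \<infinity> p a \<le> enat (sz ad)"
        unfolding KC_def sz_def by (rule Inf_lower) (use \<psi>(2)[of ad a] ad(1) in \<open>auto simp: p_def t_def\<close>)
      finally have "KC \<phi> ?t \<infinity> p a \<le> enat (sz ad + c\<^sub>1)" by (simp add: add_mono)
      also have "\<dots> \<le> enat (E n)" using ad(2) SE(1)[of n] by simp
      finally show ?thesis .
    qed
    moreover have "CAM U\<^sub>n ?t a (pair b p) \<le> enat (E n)"
    proof -
      obtain q where q: "length q \<le> sz ad + c\<^sub>2" "\<And>y r. results U\<^sub>n [y, q, r] = results M [y, code (tr ad), r]"
        "\<And>y r t. halts_within M [y, code (tr ad), r] t \<Longrightarrow> halts_within U\<^sub>n [y, q, r] (c\<^sub>2 * t * floor_log t + c\<^sub>2)"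
        using c2[of "code (tr ad)"] unfolding sz_def by blast
      have Mr: "results M [pair b p, code (tr ad), r] = {x. \<exists>u. length u = ?N \<and> map fst u = take ?N r \<and>
          verify tab (work_tapes \<phi>) ?N ad (pair b p) u = [x]}"
        "halts_within M [pair b p, code (tr ad), r] ((?N + sz (ad, pair b p)) ^ C\<^sub>2)" if "length r = ?t" for r
        using M(2)[of ad r "pair b p"] that Nt unfolding ad(1) by auto
      have halt: "halts_within U\<^sub>n [pair b p, q, r] ?t" if r: "length r = ?t" for r
      proof -
        define t where "t = (?N + sz (ad, pair b p)) ^ C\<^sub>2"
        have "length (pair b p) = 2 * length b + 2 + length p"
        proof -
          have "length (concat (map (\<lambda>b. [b, b]) xs)) = 2 * length xs" for xs :: "bool list" by (induction xs) auto
          then show ?thesis by (simp add: pair_def)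
        qed
        then have "length (pair b p) \<le> 3 * n + 2 + 200000000 * L n ^ 3" using b ad(3) unfolding p_def by linarith
        then have "sz (pair b p) \<le> 4 * (3 * n + 2 + 200000000 * L n ^ 3) + 1"
          using sz_bool_list[of "pair b p"] by (meson add_mono le_refl mult_le_mono order.trans)
        then have "?N + sz (ad, pair b p) \<le> Z n" using ad(2) unfolding Z_def by simp
        then have tZ: "t \<le> Z n ^ C\<^sub>2" unfolding t_def by (rule power_mono) simp
        have "c\<^sub>2 * t * floor_log t + c\<^sub>2 \<le> c\<^sub>2 * (Z n ^ C\<^sub>2) * (Z n ^ C\<^sub>2) + c\<^sub>2"
          by (intro add_mono mult_le_mono le_refl tZ order.trans[OF fl tZ])
        also have "\<dots> \<le> ?t" using bt2[of n] by (simp add: G_def)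
        finally have "c\<^sub>2 * t * floor_log t + c\<^sub>2 \<le> ?t" .
        moreover have "halts_within U\<^sub>n [pair b p, q, r] (c\<^sub>2 * t * floor_log t + c\<^sub>2)"
          by (rule q(3)) (use Mr(2)[OF r] in \<open>simp add: t_def\<close>)
        ultimately show ?thesis unfolding halts_within_def by (meson order.trans)
      qed
      let ?bad = "{r \<in> BL ?t. \<not> (\<forall>x. (\<exists>u. length u = ?N \<and> map fst u = take ?N r \<and>
       verify tab (work_tapes \<phi>) ?N ad (pair b p) u = [x]) \<longleftrightarrow> x = a)}"
      let ?good = "{r. results U\<^sub>n [pair b p, q, r] \<noteq> {} \<and> (\<forall>z \<in> results U\<^sub>n [pair b p, q, r]. z = a)}"
      have "2 / 3 < measure_pmf.prob (pmf_of_set {r. length r = ?t}) ?good"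
      proof -
        have BL: "{r. length r = ?t} = BL ?t" by (simp add: BL_def)
        \<comment> \<open>Outside the bad set exactly \<open>a\<close> is returned, so an accepting
          path exists as well.\<close>
        have "BL ?t - ?bad \<subseteq> BL ?t \<inter> ?good"
        proof
          fix r assume r: "r \<in> BL ?t - ?bad"
          then have "length r = ?t" by (simp add: BL_def)
          from Mr(1)[OF this] have "results U\<^sub>n [pair b p, q, r] = {a}" unfolding q(2) using r by auto
          then show "r \<in> BL ?t \<inter> ?good" using r by simp
        qed
        then have "card (BL ?t - ?bad) \<le> card (BL ?t \<inter> ?good)" by (rule card_mono[rotated]) simp
        moreover have "card (BL ?t - ?bad) = card (BL ?t) - card ?bad" by (rule card_Diff_subset) auto
        moreover have "card ?bad \<le> card (BL ?t)" by (rule card_mono) auto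
        ultimately have "real (card (BL ?t)) - real (card ?bad) \<le> real (card (BL ?t \<inter> ?good))" by linarith
        moreover have "3 * real (card ?bad) < 2 ^ ?t" using iso unfolding p_def .
        ultimately have "2 / 3 * 2 ^ ?t < real (card (BL ?t \<inter> ?good))" by simp
        moreover have "BL ?t \<noteq> {}" using card_BL[of ?t] by (metis card.empty power_not_zero zero_neq_numeral)
        ultimately show ?thesis unfolding BL by (simp add: measure_pmf_of_set pos_less_divide_eq)
      qed
      then have "CAM U\<^sub>n ?t a (pair b p) \<le> enat (length q)"
        unfolding CAM_def using halt by (intro Inf_lower) blast
      also have "\<dots> \<le> enat (E n)" using q(1) ad(2) SE(2)[of n] by simp
      finally show ?thesis .
    qed
    ultimately show ?thesis by blast
  qed
  have O: "(\<lambda>n. real (E n)) \<in> O(\<lambda>n. log 2 (real n) ^ 3)" unfolding E_def by (rule log_cubed_bigo)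
  show "\<exists>t\<^sub>2 :: real poly. \<exists>e\<^sub>1 e\<^sub>2 e\<^sub>3 :: nat \<Rightarrow> nat.
      (\<lambda>n. real (e\<^sub>1 n)) \<in> O(\<lambda>n. log 2 (real n) ^ 3) \<and>
      (\<lambda>n. real (e\<^sub>2 n)) \<in> O(\<lambda>n. log 2 (real n) ^ 3) \<and>
      (\<lambda>n. real (e\<^sub>3 n)) \<in> O(\<lambda>n. log 2 (real n) ^ 3) \<and>
      (\<forall>(n::nat) (k::nat) (a::bool list) (b::bool list).
         length a \<le> n \<longrightarrow> length b \<le> n \<longrightarrow>
         KC \<phi> (bound t\<^sub>1 n) \<infinity> a b \<le> enat k \<longrightarrow>
         (\<exists>p::bool list. length p \<le> k + e\<^sub>1 n \<and>
            KC \<phi> (bound t\<^sub>2 n) \<infinity> p a \<le> enat (e\<^sub>2 n) \<and>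
            CAM U\<^sub>n (bound t\<^sub>2 n) a (pair b p) \<le> enat (e\<^sub>3 n)))"
    by (intro exI[of _ t\<^sub>2] exI[of _ E] conjI O allI impI main)
qed

end
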